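(* Let $T\in\,]0,\infty[$, $\Gamma=V^2$, $\sigma\equiv1$. Let $X=(X_t)_{t\in[0,T]}$ be a real continuous process whose window process $\mathbb X$ takes values in $V^2$, with $[X]_t=t$ for $t\in[0,T]$ and $X_0=0$. Let $G\colon C([-T,0])\to\mathbb R$ and $F\colon[0,T]\times C([-T,0])\times\mathbb R\times\mathbb R\to\mathbb R$ be continuous and let $h=G(\mathbb X_T)$. Let $u\in C^{1,2}([0,T[\times C([-T,0]))\cap C([0,T]\times C([-T,0]))$ be such that (i) $\int_{]-t,0]}D^\perp_{dx}u(t,\eta)\,d^-\eta(x)$, $t\in[0,T[$, $\Gamma$-strongly exists; (ii) $D^2u\colon[0,T[\times C([-T,0])\to\chi^0_{Diag}$ exists and is continuous. Suppose that $u$ solves the Kolmogorov path-dependent equation $$\begin{cases}\mathcal L\,u(t,\eta)+F(t,\eta,u(t,\eta),D^{\delta_0}u(t,\eta))=0,&\forall\,(t,\eta)\in[0,T[\times C([-T,0]),\\ u(T,\eta)=G(\eta),&\forall\,\eta\in C([-T,0]).\end{cases}$$ Then, with $$v:=D^{\delta_0}u,\qquad Y_0=u(0,\mathbb X_0),\qquad Z_s=D^{\delta_0}u(s,\mathbb X_s),$$ one has $$h=Y_0-\int_0^TF(s,\mathbb X_s,u(s,\mathbb X_s),v(s,\mathbb X_s))\,ds+\int_0^TZ_s\,d^-X_s ,$$ where $\int_0^TZ_s\,d^-X_s$ is the improper forward integral of $Z$ with respect to $X$ on $[0,T]$.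
   Context: $C([-T,0])$ is the Banach space of continuous functions $\eta\colon[-T,0]\to\mathbb R$ with the supremum norm; its dual is the space $\mathcal M([-T,0])$ of finite signed Borel measures. Paths are extended by $\eta(x)=\eta(-T)$ for $x<-T$ and $\eta(x)=\eta(0)$ for $x>0$. $V^2$ is the set of $\eta\in C([-T,0])$ such that $\lim_{\varepsilon\to0^+}\frac1\varepsilon\int_0^x(\eta(s+\varepsilon)-\eta(s))^2ds$ exists and is finite for every $x\in[-T,0]$. Extension and window process: $X_t=X_0$ for $t<0$ and $X_t=X_T$ for $t>T$; $\mathbb X_t=\{X_{t+x},\,x\in[-T,0]\}$. Quadratic variation: $[X]_t=\lim_{\varepsilon\to0^+}\frac1\varepsilon\int_0^t(X_{s+\varepsilon}-X_s)^2ds$ in probability for every $t\in[0,T]$. $C^{1,2}([0,T[\times C([-T,0]))$: $u$, the time derivative $\partial_tu$ and the first and second Fréchet derivatives $Du$, $D^2u$ in $\eta$ exist and are continuous on $[0,T[\times C([-T,0])$. For the measure $Du(t,\eta)=D_{dx}u(t,\eta)$ put $D^{\delta_0}u(t,\eta):=Du(t,\eta)(\{0\})$ and $D^\perp_{dx}u(t,\eta):=D_{dx}u(t,\eta)-D^{\delta_0}u(t,\eta)\delta_0(dx)$. $\chi^0_{Diag}$ is the space of measures $\mu$ on $[-T,0]^2$ of the form $$\mu(dx,dy)=g_1(x,y)dxdy+\lambda\,\delta_0(dx)\otimes\delta_0(dy)+g_2(x)dx\otimes\delta_0(dy)+\delta_0(dx)\otimes g_3(y)dy+g_4(x)\delta_y(dx)\otimes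 dy,$$ with $g_1\in L^2([-T,0]^2)$, $g_2,g_3\in L^2([-T,0])$, $g_4\in L^\infty([-T,0])$, $\lambda\in\mathbb R$, with the natural direct-sum norm. $D_{-t}:=\{(x,x)\colon x\in[-t,0]\}$, and $\int_{D_{-t}}\mu(dx,dy)=\lambda+\int_{-t}^0g_4(x)dx$. Deterministic forward integral: for $g\in\mathcal M([-T,0])$ and $\eta\in C([-T,0])$, $\int_{]-t,0]}g(dx)d^-\eta(x):=\lim_{\varepsilon\to0^+}\int_{[-t,0]}g(dx)\frac{\eta(x+\varepsilon)-\eta(x)}{\varepsilon}$, if the limit exists and is finite. $\Gamma$-strong existence: let $H\colon[0,T[\times C([-T,0])\to\mathcal M([-T,0])$ be weakly measurable and bounded, and for $\eta\in C([-T,0])$ let $K_\eta=\{\gamma\in C([-T,0])\colon\gamma(x)=\eta(x-\varepsilon),\,x\in[-T,0],\ \varepsilon\in[0,1]\}$. One says that $\int_{]-t,0]}H_{dx}(t,\eta)d^-\eta(x)$ $\Gamma$-strongly exists if for every $\eta\in\Gamma$: the integral exists for every $t\in[0,T[$; $K_\eta\subset\Gamma$; and there is a Lebesgue integrable $I_\eta\colon[0,T]\to\mathbb R$ with $\big|\int_{[-t,0]}H_{dx}(t,\gamma)\frac{\gamma(x+\varepsilon)-\gamma(x)}{\varepsilon}\big|\le I_\eta(t)$ for all $\varepsilon\in\,]0,1]$, $t\in[0,T[$, $\gamma\in K_\eta$. Operator (with $\sigma\equiv1$): $\mathcal L\,u(t,\eta)=\partial_tu(t,\eta)+\int_{]-t,0]}D^\perp_{dx}u(t,\eta)d^-\eta(x)+\frac12\int_{D_{-t}}D^2_{dx\,dy}u(t,\eta)$;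 the equation includes the requirement that the forward integral in it exists. Stochastic forward integral: let $X$ be a continuous process and $Y$ a process with $\int_0^T|Y_t|dt<\infty$ $\mathbb P$-a.s. Suppose there is a real continuous process $A=(A_t)_{t\in[0,T]}$ with $A_t=\lim_{\varepsilon\to0^+}\int_0^tY_s\frac{X_{s+\varepsilon}-X_s}{\varepsilon}ds$ in probability for every $t\in[0,T[$. Then $A$ is the forward integral process $\int_0^\cdot Y_s\,d^-X_s$ on $[0,T[$; if moreover $A_T=\lim_{t\to T^-}A_t$ holds $\mathbb P$-a.s., then $A_T$ is called the improper forward integral of $Y$ with respect to $X$ on $[0,T]$ and denoted $\int_0^TY_s\,d^-X_s$.
   Formalization: The formal statement additionally assumes that, almost surely, the integrals over [0,T] of |Z_s| and of |F(s,X_s,u(s,X_s),v(s,X_s))| are finite; the English hypotheses do not imply this, since v may blow up at T, and without it the integrals in the conclusion are undefined. *)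

theory Defs
  imports "HOL-Probability.Probability" "HOL-Probability.Essential_Supremum"
begin

section \<open>Path space\<close>

text \<open>
  The space \<open>C([-T,0])\<close> is the closed subspace \<open>C_space T\<close> of the Banach space of bounded
  continuous functions on the real line: the functions that are constant to the left of \<open>-T\<close>
  and to the right of \<open>0\<close>. Constant extension of paths is an isometric isomorphism onto it, so
  the convention for evaluating a path outside \<open>[-T,0]\<close> is built in.
\<close>

type_synonym path = "real \<Rightarrow>\<^sub>C real"

definition C_space :: "real \<Rightarrow> path set" where
  "C_space T = {\<eta>. \<forall>x. apply_bcontfun \<eta> x = apply_bcontfun \<eta> (clamp (-T) 0 x)}"

text \<open>For \<open>x < 0\<close> the integral \<open>LBINT s=0..x\<close> is the oriented one, i.e. minus the integral over
  \<open>[x,0]\<close>.\<close>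

definition V2 :: "real \<Rightarrow> path set" where
  "V2 T = {\<eta> \<in> C_space T. \<forall>x\<in>{-T..0}. \<exists>l.
     ((\<lambda>\<epsilon>. (1 / \<epsilon>) * (LBINT s=0..x. (apply_bcontfun \<eta> (s + \<epsilon>) - apply_bcontfun \<eta> s)\<^sup>2))
        \<longlongrightarrow> l) (at_right 0)}"


section \<open>Finite signed Borel measures on \<open>[-T,0]\<close>\<close>

text \<open>Such a measure is a countably additive real-valued set function on the Borel sets of the
  line that is carried by \<open>[-T,0]\<close>; its values on non-Borel sets are irrelevant.\<close>

definition signed_measure_on :: "real \<Rightarrow> (real set \<Rightarrow> real) \<Rightarrow> bool" where
  "signed_measure_on T \<mu> \<longleftrightarrow>
     (\<forall>A :: nat \<Rightarrow> real set. range A \<subseteq> sets borel \<longrightarrow> disjoint_family A \<longrightarrow>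
        (\<lambda>n. \<mu> (A n)) sums \<mu> (\<Union>n. A n)) \<and>
     (\<forall>A\<in>sets borel. \<mu> A = \<mu> (A \<inter> {-T..0}))"

text \<open>\<open>pos_variation \<mu>\<close> and \<open>pos_variation (-\<mu>)\<close> are the two parts of the Jordan decomposition
  of a signed measure; integrals are taken with respect to it.\<close>

definition pos_variation :: "(real set \<Rightarrow> real) \<Rightarrow> real set \<Rightarrow> real" where
  "pos_variation \<mu> A = (SUP B\<in>{B \<in> sets borel. B \<subseteq> A}. \<mu> B)"

definition pos_part_measure :: "(real set \<Rightarrow> real) \<Rightarrow> real measure" where
  "pos_part_measure \<mu> = measure_of UNIV (sets borel) (\<lambda>A. ennreal (pos_variation \<mu> A))"

definition signed_integral :: "(real set \<Rightarrow> real) \<Rightarrow> (real \<Rightarrow> real) \<Rightarrow> real" where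
  "signed_integral \<mu> f =
     (LINT x|pos_part_measure \<mu>. f x) - (LINT x|pos_part_measure (\<lambda>A. - \<mu> A). f x)"

definition total_variation :: "(real set \<Rightarrow> real) \<Rightarrow> real" where
  "total_variation \<mu> = pos_variation \<mu> UNIV + pos_variation (\<lambda>A. - \<mu> A) UNIV"

text \<open>
  The element of the dual of \<open>C([-T,0])\<close> given by a measure. Since the measure is carried by
  \<open>[-T,0]\<close>, the functional depends only on the restriction of its argument to \<open>[-T,0]\<close>; hence its
  norm on all bounded continuous functions equals its norm on \<open>C_space T\<close>, the total variation.
\<close>

definition dual_of :: "(real set \<Rightarrow> real) \<Rightarrow> path \<Rightarrow>\<^sub>L real" where
  "dual_of \<mu> = Blinfun (\<lambda>\<phi>. signed_integral \<mu> (apply_bcontfun \<phi>))"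

definition remove_atom0 :: "(real set \<Rightarrow> real) \<Rightarrow> (real set \<Rightarrow> real)" where
  "remove_atom0 \<mu> = (\<lambda>A. \<mu> A - \<mu> {0} * indicator A 0)"


section \<open>Deterministic forward integral\<close>

definition forward_quotient ::
  "real \<Rightarrow> (real set \<Rightarrow> real) \<Rightarrow> path \<Rightarrow> real \<Rightarrow> real" where
  "forward_quotient t g \<eta> \<epsilon> = signed_integral g
     (\<lambda>x. indicator {-t..0} x * ((apply_bcontfun \<eta> (x + \<epsilon>) - apply_bcontfun \<eta> x) / \<epsilon>))"

definition forward_integral_exists :: "real \<Rightarrow> (real set \<Rightarrow> real) \<Rightarrow> path \<Rightarrow> bool" where
  "forward_integral_exists t g \<eta> \<longleftrightarrow> (\<exists>l. (forward_quotient t g \<eta> \<longlongrightarrow> l) (at_right 0))"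

definition forward_integral :: "real \<Rightarrow> (real set \<Rightarrow> real) \<Rightarrow> path \<Rightarrow> real" where
  "forward_integral t g \<eta> = Lim (at_right 0) (forward_quotient t g \<eta>)"

definition K_set :: "real \<Rightarrow> path \<Rightarrow> path set" where
  "K_set T \<eta> = {\<gamma> \<in> C_space T. \<exists>\<epsilon>\<in>{0..1}. \<forall>x\<in>{-T..0}.
     apply_bcontfun \<gamma> x = apply_bcontfun \<eta> (x - \<epsilon>)}"

definition weakly_measurable ::
  "real \<Rightarrow> (real \<Rightarrow> path \<Rightarrow> real set \<Rightarrow> real) \<Rightarrow> bool" where
  "weakly_measurable T H \<longleftrightarrow> (\<forall>\<phi>\<in>C_space T.
     (\<lambda>(t, \<eta>). signed_integral (H t \<eta>) (apply_bcontfun \<phi>))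
       \<in> borel_measurable (restrict_space borel ({0..<T} \<times> C_space T)))"

definition strongly_exists ::
  "real \<Rightarrow> path set \<Rightarrow> (real \<Rightarrow> path \<Rightarrow> real set \<Rightarrow> real) \<Rightarrow> bool" where
  "strongly_exists T \<Gamma> H \<longleftrightarrow>
     (\<forall>t\<in>{0..<T}. \<forall>\<eta>\<in>C_space T. signed_measure_on T (H t \<eta>)) \<and>
     weakly_measurable T H \<and>
     (\<exists>B. \<forall>t\<in>{0..<T}. \<forall>\<eta>\<in>C_space T. total_variation (H t \<eta>) \<le> B) \<and>
     (\<forall>\<eta>\<in>\<Gamma>.
        (\<forall>t\<in>{0..<T}. forward_integral_exists t (H t \<eta>) \<eta>) \<and>
        K_set T \<eta> \<subseteq> \<Gamma> \<and>
        (\<exists>I. set_integrable lborel {0..T} I \<and>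
           (\<forall>\<epsilon>\<in>{0<..1}. \<forall>t\<in>{0..<T}. \<forall>\<gamma>\<in>K_set T \<eta>.
              \<bar>forward_quotient t (H t \<gamma>) \<gamma> \<epsilon>\<bar> \<le> I t)))"


section \<open>The class \<open>C\<^sup>1\<^sup>,\<^sup>2\<close>\<close>

text \<open>
  \<open>dtu\<close>, \<open>Du\<close>, \<open>D2u\<close> are the time derivative and the first and second Frechet derivatives of \<open>u\<close>
  on \<open>[0,T[ \<times> C([-T,0])\<close>. The first derivative is given as a measure, through the
  identification of the dual of \<open>C([-T,0])\<close> with the signed measures; the second one is the
  derivative of the map \<open>\<eta> \<mapsto> Du(t,\<eta>)\<close> into that dual. Differentiation is within the subspace
  \<open>C_space T\<close>, and is one-sided in time at \<open>t = 0\<close>.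
\<close>

definition C12 ::
  "real \<Rightarrow> (real \<Rightarrow> path \<Rightarrow> real) \<Rightarrow> (real \<Rightarrow> path \<Rightarrow> real) \<Rightarrow>
   (real \<Rightarrow> path \<Rightarrow> real set \<Rightarrow> real) \<Rightarrow>
   (real \<Rightarrow> path \<Rightarrow> path \<Rightarrow>\<^sub>L path \<Rightarrow>\<^sub>L real) \<Rightarrow> bool" where
  "C12 T u dtu Du D2u \<longleftrightarrow>
     (\<forall>t\<in>{0..<T}. \<forall>\<eta>\<in>C_space T.
        ((\<lambda>s. u s \<eta>) has_real_derivative dtu t \<eta>) (at t within {0..<T}) \<and>
        signed_measure_on T (Du t \<eta>) \<and>
        (u t has_derivative (\<lambda>\<phi>. signed_integral (Du t \<eta>) (apply_bcontfun \<phi>)))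
          (at \<eta> within C_space T) \<and>
        ((\<lambda>\<gamma>. dual_of (Du t \<gamma>)) has_derivative blinfun_apply (D2u t \<eta>))
          (at \<eta> within C_space T)) \<and>
     continuous_on ({0..<T} \<times> C_space T) (\<lambda>(t, \<eta>). u t \<eta>) \<and>
     continuous_on ({0..<T} \<times> C_space T) (\<lambda>(t, \<eta>). dtu t \<eta>) \<and>
     continuous_on ({0..<T} \<times> C_space T) (\<lambda>(t, \<eta>). dual_of (Du t \<eta>)) \<and>
     continuous_on ({0..<T} \<times> C_space T) (\<lambda>(t, \<eta>). D2u t \<eta>)"


section \<open>The space \<open>\<chi>\<^sup>0\<^sub>D\<^sub>i\<^sub>a\<^sub>g\<close>\<close>

text \<open>An element is represented by its components
  \<open>g\<^sub>1 dx dy + \<lambda> \<delta>\<^sub>0 \<otimes> \<delta>\<^sub>0 + g\<^sub>2 dx \<otimes> \<delta>\<^sub>0 + \<delta>\<^sub>0 \<otimes> g\<^sub>3 dy + g\<^sub>4 \<delta>\<^sub>y(dx) \<otimes> dy\<close>.\<close>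

datatype chi = Chi (chi_g1: "real \<times> real \<Rightarrow> real") (chi_lambda: real)
  (chi_g2: "real \<Rightarrow> real") (chi_g3: "real \<Rightarrow> real") (chi_g4: "real \<Rightarrow> real")

definition square_integrable_on :: "'a::euclidean_space set \<Rightarrow> ('a \<Rightarrow> real) \<Rightarrow> bool" where
  "square_integrable_on S f \<longleftrightarrow>
     set_borel_measurable lborel S f \<and> set_integrable lborel S (\<lambda>x. (f x)\<^sup>2)"

definition L2_norm_on :: "'a::euclidean_space set \<Rightarrow> ('a \<Rightarrow> real) \<Rightarrow> real" where
  "L2_norm_on S f = sqrt (LINT x:S|lborel. (f x)\<^sup>2)"

definition essentially_bounded_on :: "real set \<Rightarrow> (real \<Rightarrow> real) \<Rightarrow> bool" where
  "essentially_bounded_on S f \<longleftrightarrow> set_borel_measurable lborel S f \<and>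
     esssup (restrict_space lborel S) (\<lambda>x. ereal \<bar>f x\<bar>) < \<infinity>"

definition Linf_norm_on :: "real set \<Rightarrow> (real \<Rightarrow> real) \<Rightarrow> real" where
  "Linf_norm_on S f = real_of_ereal (esssup (restrict_space lborel S) (\<lambda>x. ereal \<bar>f x\<bar>))"

definition chi_space :: "real \<Rightarrow> chi set" where
  "chi_space T = {\<mu>.
     square_integrable_on ({-T..0} \<times> {-T..0}) (chi_g1 \<mu>) \<and>
     square_integrable_on {-T..0} (chi_g2 \<mu>) \<and>
     square_integrable_on {-T..0} (chi_g3 \<mu>) \<and>
     essentially_bounded_on {-T..0} (chi_g4 \<mu>)}"

definition chi_diff :: "chi \<Rightarrow> chi \<Rightarrow> chi" where
  "chi_diff \<mu> \<nu> = Chi (\<lambda>z. chi_g1 \<mu> z - chi_g1 \<nu> z) (chi_lambda \<mu> - chi_lambda \<nu>)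
     (\<lambda>x. chi_g2 \<mu> x - chi_g2 \<nu> x) (\<lambda>y. chi_g3 \<mu> y - chi_g3 \<nu> y)
     (\<lambda>x. chi_g4 \<mu> x - chi_g4 \<nu> x)"

definition chi_norm :: "real \<Rightarrow> chi \<Rightarrow> real" where
  "chi_norm T \<mu> = sqrt ((L2_norm_on ({-T..0} \<times> {-T..0}) (chi_g1 \<mu>))\<^sup>2 + (chi_lambda \<mu>)\<^sup>2 +
     (L2_norm_on {-T..0} (chi_g2 \<mu>))\<^sup>2 + (L2_norm_on {-T..0} (chi_g3 \<mu>))\<^sup>2 +
     (Linf_norm_on {-T..0} (chi_g4 \<mu>))\<^sup>2)"

definition chi_integral :: "real \<Rightarrow> chi \<Rightarrow> (real \<times> real \<Rightarrow> real) \<Rightarrow> real" where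
  "chi_integral T \<mu> f =
     (LINT z:{-T..0} \<times> {-T..0}|lborel. chi_g1 \<mu> z * f z) + chi_lambda \<mu> * f (0, 0) +
     (LBINT x=-T..0. chi_g2 \<mu> x * f (x, 0)) + (LBINT y=-T..0. chi_g3 \<mu> y * f (0, y)) +
     (LBINT y=-T..0. chi_g4 \<mu> y * f (y, y))"

text \<open>The integral over the diagonal of \<open>[-t,0]\<^sup>2\<close>: only the \<open>\<lambda>\<close> and \<open>g\<^sub>4\<close> parts charge it.\<close>

definition chi_diagonal :: "real \<Rightarrow> chi \<Rightarrow> real" where
  "chi_diagonal t \<mu> = chi_lambda \<mu> + (LBINT x=-t..0. chi_g4 \<mu> x)"

text \<open>\<open>D2chi\<close> is \<open>D2u\<close> as a continuous map with values in \<open>\<chi>\<^sup>0\<^sub>D\<^sub>i\<^sub>a\<^sub>g\<close>. The integrals only see the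
  restrictions of \<open>\<phi>, \<psi>\<close> to \<open>[-T,0]\<close>; as \<open>\<phi>, \<psi>\<close> range over all bounded continuous functions, the
  identity also fixes the values of \<open>D2u t \<eta>\<close> outside \<open>C_space T\<close>, which the derivative within
  \<open>C_space T\<close> leaves open, so that no spurious information enters its operator norm.\<close>

definition continuous_into_chi ::
  "real \<Rightarrow> (real \<Rightarrow> path \<Rightarrow> path \<Rightarrow>\<^sub>L path \<Rightarrow>\<^sub>L real) \<Rightarrow> (real \<Rightarrow> path \<Rightarrow> chi) \<Rightarrow> bool" where
  "continuous_into_chi T D2u D2chi \<longleftrightarrow>
     (\<forall>t\<in>{0..<T}. \<forall>\<eta>\<in>C_space T.
        D2chi t \<eta> \<in> chi_space T \<and>
        (\<forall>\<phi> \<psi>. blinfun_apply (blinfun_apply (D2u t \<eta>) \<phi>) \<psi> =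
           chi_integral T (D2chi t \<eta>) (\<lambda>(x, y). apply_bcontfun \<phi> x * apply_bcontfun \<psi> y)) \<and>
        ((\<lambda>(s, \<gamma>). chi_norm T (chi_diff (D2chi s \<gamma>) (D2chi t \<eta>))) \<longlongrightarrow> 0)
          (at (t, \<eta>) within {0..<T} \<times> C_space T))"


section \<open>The path-dependent equation\<close>

definition L_operator ::
  "(real \<Rightarrow> path \<Rightarrow> real) \<Rightarrow> (real \<Rightarrow> path \<Rightarrow> real set \<Rightarrow> real) \<Rightarrow> (real \<Rightarrow> path \<Rightarrow> chi) \<Rightarrow>
   real \<Rightarrow> path \<Rightarrow> real" where
  "L_operator dtu Du D2chi t \<eta> =
     dtu t \<eta> + forward_integral t (remove_atom0 (Du t \<eta>)) \<eta> + 1 / 2 * chi_diagonal t (D2chi t \<eta>)"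

definition solves_kolmogorov ::
  "real \<Rightarrow> (real \<Rightarrow> path \<Rightarrow> real \<Rightarrow> real \<Rightarrow> real) \<Rightarrow> (path \<Rightarrow> real) \<Rightarrow>
   (real \<Rightarrow> path \<Rightarrow> real) \<Rightarrow> (real \<Rightarrow> path \<Rightarrow> real) \<Rightarrow> (real \<Rightarrow> path \<Rightarrow> real set \<Rightarrow> real) \<Rightarrow>
   (real \<Rightarrow> path \<Rightarrow> chi) \<Rightarrow> bool" where
  "solves_kolmogorov T F G u dtu Du D2chi \<longleftrightarrow>
     (\<forall>t\<in>{0..<T}. \<forall>\<eta>\<in>C_space T.
        forward_integral_exists t (remove_atom0 (Du t \<eta>)) \<eta> \<and>
        L_operator dtu Du D2chi t \<eta> + F t \<eta> (u t \<eta>) (Du t \<eta> {0}) = 0) \<and>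
     (\<forall>\<eta>\<in>C_space T. u T \<eta> = G \<eta>)"


section \<open>Processes\<close>

definition continuous_process ::
  "'w measure \<Rightarrow> real \<Rightarrow> (real \<Rightarrow> 'w \<Rightarrow> real) \<Rightarrow> bool" where
  "continuous_process M T X \<longleftrightarrow> (\<forall>t\<in>{0..T}. X t \<in> borel_measurable M) \<and>
     (\<forall>\<omega>\<in>space M. continuous_on {0..T} (\<lambda>t. X t \<omega>))"

definition extend_process :: "real \<Rightarrow> (real \<Rightarrow> 'w \<Rightarrow> real) \<Rightarrow> real \<Rightarrow> 'w \<Rightarrow> real" where
  "extend_process T X t = X (clamp 0 T t)"

definition window :: "real \<Rightarrow> (real \<Rightarrow> 'w \<Rightarrow> real) \<Rightarrow> real \<Rightarrow> 'w \<Rightarrow> path" where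
  "window T X t \<omega> = Bcontfun (\<lambda>x. extend_process T X (t + clamp (-T) 0 x) \<omega>)"

text \<open>Measurability is part of convergence in probability, so that \<open>measure\<close> is not applied to
  non-measurable sets (where it would be \<open>0\<close>).\<close>

definition tendsto_in_probability ::
  "'w measure \<Rightarrow> ('i \<Rightarrow> 'w \<Rightarrow> real) \<Rightarrow> ('w \<Rightarrow> real) \<Rightarrow> 'i filter \<Rightarrow> bool" where
  "tendsto_in_probability M Z Z0 \<F> \<longleftrightarrow>
     (\<forall>\<^sub>F i in \<F>. Z i \<in> borel_measurable M) \<and> Z0 \<in> borel_measurable M \<and>
     (\<forall>\<delta>>0. ((\<lambda>i. measure M {\<omega> \<in> space M. \<delta> < \<bar>Z i \<omega> - Z0 \<omega>\<bar>}) \<longlongrightarrow> 0) \<F>)"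

definition has_quadratic_variation ::
  "'w measure \<Rightarrow> real \<Rightarrow> (real \<Rightarrow> 'w \<Rightarrow> real) \<Rightarrow> (real \<Rightarrow> 'w \<Rightarrow> real) \<Rightarrow> bool" where
  "has_quadratic_variation M T X Q \<longleftrightarrow> (\<forall>t\<in>{0..T}. tendsto_in_probability M
     (\<lambda>\<epsilon> \<omega>. (1 / \<epsilon>) * (LBINT s=0..t. (extend_process T X (s + \<epsilon>) \<omega> - extend_process T X s \<omega>)\<^sup>2))
     (Q t) (at_right 0))"

definition is_forward_integral_process ::
  "'w measure \<Rightarrow> real \<Rightarrow> (real \<Rightarrow> 'w \<Rightarrow> real) \<Rightarrow> (real \<Rightarrow> 'w \<Rightarrow> real) \<Rightarrow>
   (real \<Rightarrow> 'w \<Rightarrow> real) \<Rightarrow> bool" where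
  "is_forward_integral_process M T Y X A \<longleftrightarrow>
     (\<forall>t\<in>{0..<T}. Y t \<in> borel_measurable M) \<and>
     (AE \<omega> in M. interval_lebesgue_integrable lborel 0 T (\<lambda>t. Y t \<omega>)) \<and>
     continuous_process M T A \<and>
     (\<forall>t\<in>{0..<T}. tendsto_in_probability M
        (\<lambda>\<epsilon> \<omega>. LBINT s=0..t.
           Y s \<omega> * ((extend_process T X (s + \<epsilon>) \<omega> - extend_process T X s \<omega>) / \<epsilon>))
        (A t) (at_right 0))"

definition has_improper_forward_integral ::
  "'w measure \<Rightarrow> real \<Rightarrow> (real \<Rightarrow> 'w \<Rightarrow> real) \<Rightarrow> (real \<Rightarrow> 'w \<Rightarrow> real) \<Rightarrow> ('w \<Rightarrow> real) \<Rightarrow> bool" where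
  "has_improper_forward_integral M T Y X I \<longleftrightarrow>
     (\<exists>A. is_forward_integral_process M T Y X A \<and>
        (AE \<omega> in M. ((\<lambda>t. A t \<omega>) \<longlongrightarrow> A T \<omega>) (at_left T)) \<and> I = A T)"

end

theory Submission
  imports Defs
begin

text \<open>
  A trajectory \<open>x\<close> is replaced by a \<open>C\<^sup>1\<close> path \<open>x\<^sup>\<epsilon>\<close> with derivative \<open>(x(s+\<epsilon>) - x(s)) / \<epsilon>\<close> away from
  \<open>0\<close>, modified near \<open>0\<close> so that it vanishes to the left of \<open>0\<close>. Along the windows of \<open>x\<^sup>\<epsilon>\<close> the
  ordinary chain rule applies to \<open>u\<close>, and there \<open>D\<^sup>\<bottom>u\<close> acts by the deterministic forward integral,
  which the equation expresses through \<open>\<partial>\<^sub>tu\<close>, \<open>F\<close> and the diagonal integral of \<open>D\<^sup>2u\<close>. What remains is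
  to evaluate \<open>D\<^sup>\<delta>u\<close> at the windows of \<open>x\<close> instead of those of \<open>x\<^sup>\<epsilon>\<close>: to first order the difference
  is \<open>D\<^sup>2u\<close> applied to \<open>x\<^sup>\<epsilon> - x\<close>, and by \<open>[X]\<^sub>t = t\<close> its integral against \<open>(x(s+\<epsilon>) - x(s)) / \<epsilon>\<close>
  converges to half the integral of the \<open>\<lambda>\<close>-component of \<open>D\<^sup>2u\<close>, the other components being negligible.

  This cancels the second-order term of the equation because the \<open>g\<^sub>4\<close>-component does not contribute
  to the diagonal integral: as the forward integral exists for all paths and is continuous in the
  path, its second differences in the direction of fast oscillations of amplitude \<open>\<surd>\<epsilon>\<close> vanish in the
  limit, while those of the forward quotients, which converge almost uniformly on a ball by Baire's
  theorem, yield the integral of \<open>g\<^sub>4\<close>.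

  All limits are taken along subsequences for which the quadratic variation converges almost surely
  at countably many times; the energy \<open>\<integral> (x(s+\<epsilon>p) - x(s))\<^sup>2 ds\<close> is then of order \<open>\<epsilon>\<close> uniformly in
  \<open>p \<in> [0,1]\<close>, by a subadditivity argument.
\<close>

section \<open>Integration against finite signed measures\<close>

text \<open>The gap between the smoothed path and \<open>x\<close> tends to 0 uniformly, but without
  a rate, and it is multiplied by quotients of size \<open>1 / \<epsilon>\<close>. Two finer
  estimates replace the rate. The gap is essentially an average of the increments
  \<open>x (r + \<epsilon> * p) - x r\<close> over \<open>p\<close> in \<open>[0,1]\<close>, so its
  L2 norm is of order \<open>sqrt \<epsilon>\<close> once the energy is controlled for all these
  shifts; and its integral over any interval is of order \<open>\<epsilon>\<close>. Forms in chi see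
  a path only through its value at 0 and its L2 norm, so the first estimate bounds all errors, while
  the second removes the \<open>g2\<close> component by a Riemann-Lebesgue argument. The factor one
  half arises because the gap times the quotient is half the squared increment over
  \<open>\<epsilon>\<close> up to an exact derivative of something small. Forward quotients vanish
  at 0, since paths are extended constantly; this is why the atom is separated from the forward
  integral and reappears, times the speed, in the chain rule. The continuity of the forward integral
  in the path, on which the Baire argument rests, is read off from the equation itself.\<close>

lemma signed_measure_sums:
  assumes "signed_measure_on T \<mu>" "range A \<subseteq> sets borel" "disjoint_family A"
  shows "(\<lambda>n. \<mu> (A n)) sums \<mu> (\<Union>n. A n)"
  using assms unfolding signed_measure_on_def by blast

lemma signed_measure_carrier:
  assumes "signed_measure_on T \<mu>" "A \<in> sets borel"
  shows "\<mu> A = \<mu> (A \<inter> {-T..0})"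
  using assms unfolding signed_measure_on_def by blast

lemma signed_measure_empty:
  assumes "signed_measure_on T \<mu>"
  shows "\<mu> {} = 0"
proof -
  have "(\<lambda>n::nat. \<mu> {}) sums \<mu> (\<Union>n::nat. {})"
    by (rule signed_measure_sums[OF assms]) (auto simp: disjoint_family_on_def)
  then have "(\<lambda>n::nat. \<mu> {}) \<longlonglongrightarrow> 0"
    by (intro summable_LIMSEQ_zero) (auto simp: sums_iff)
  then show ?thesis by (simp add: LIMSEQ_const_iff)
qed

lemma signed_measure_Un:
  assumes "signed_measure_on T \<mu>" "A \<in> sets borel" "B \<in> sets borel" "A \<inter> B = {}"
  shows "\<mu> (A \<union> B) = \<mu> A + \<mu> B"
proof -
  have "(\<lambda>n. \<mu> (binaryset A B n)) sums \<mu> (\<Union>n. binaryset A B n)"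
    using assms by (intro signed_measure_sums[OF assms(1)])
      (auto simp: range_binaryset_eq disjoint_family_on_def binaryset_def)
  moreover have "(\<lambda>n. \<mu> (binaryset A B n)) sums (\<mu> A + \<mu> B)"
    by (rule binaryset_sums) (rule signed_measure_empty[OF assms(1)])
  ultimately show ?thesis by (simp add: UN_binaryset_eq sums_unique2)
qed

lemma signed_measure_Diff:
  assumes "signed_measure_on T \<mu>" "A \<in> sets borel" "B \<in> sets borel" "B \<subseteq> A"
  shows "\<mu> (A - B) = \<mu> A - \<mu> B"
proof -
  have "\<mu> ((A - B) \<union> B) = \<mu> (A - B) + \<mu> B"
    using assms by (intro signed_measure_Un[OF assms(1)]) auto
  moreover have "(A - B) \<union> B = A" using assms by auto
  ultimately show ?thesis by simp
qed

lemma signed_measure_uminus: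
  assumes "signed_measure_on T \<mu>"
  shows "signed_measure_on T (\<lambda>A. - \<mu> A)"
proof -
  have "(\<lambda>n. - \<mu> (A n)) sums - \<mu> (\<Union>n. A n)"
    if "range A \<subseteq> sets borel" "disjoint_family A" for A :: "nat \<Rightarrow> real set"
    using signed_measure_sums[OF assms that] by (rule sums_minus)
  moreover have "- \<mu> A = - \<mu> (A \<inter> {-T..0})" if "A \<in> sets borel" for A
    using signed_measure_carrier[OF assms that] by (rule arg_cong[of _ _ uminus])
  ultimately show ?thesis unfolding signed_measure_on_def by blast
qed

text \<open>If the values on subsets of \<open>A\<close> were unbounded, one could split off sets of mass at least
  one from \<open>A\<close> for ever.\<close>

lemma signed_measure_bounded:
  assumes \<mu>: "signed_measure_on T \<mu>"
  shows "\<exists>C. \<forall>A\<in>sets borel. \<bar>\<mu> A\<bar> \<le> C"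
proof (rule ccontr)
  define U where "U A \<longleftrightarrow> (\<forall>C. \<exists>B\<in>sets borel. B \<subseteq> A \<and> C < \<bar>\<mu> B\<bar>)" for A :: "real set"
  assume "\<nexists>C. \<forall>A\<in>sets borel. \<bar>\<mu> A\<bar> \<le> C"
  then have U0: "U UNIV" unfolding U_def by (auto simp: not_le)
  have split: "U B \<or> U (A - B)" if "U A" "B \<subseteq> A" "A \<in> sets borel" "B \<in> sets borel" for A B
  proof (rule ccontr)
    assume "\<not> (U B \<or> U (A - B))"
    then have nU: "\<not> U B" "\<not> U (A - B)" by simp_all
    obtain C where C: "\<And>E. E \<in> sets borel \<Longrightarrow> E \<subseteq> B \<Longrightarrow> \<bar>\<mu> E\<bar> \<le> C"
      using nU(1) unfolding U_def by (meson not_less)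
    obtain D where D: "\<And>E. E \<in> sets borel \<Longrightarrow> E \<subseteq> A - B \<Longrightarrow> \<bar>\<mu> E\<bar> \<le> D"
      using nU(2) unfolding U_def by (meson not_less)
    have "\<exists>E\<in>sets borel. E \<subseteq> A \<and> C + D < \<bar>\<mu> E\<bar>"
      using \<open>U A\<close> unfolding U_def by simp
    then obtain E where E: "E \<in> sets borel" "E \<subseteq> A" "C + D < \<bar>\<mu> E\<bar>"
      by auto
    have "\<mu> ((E \<inter> B) \<union> (E - B)) = \<mu> (E \<inter> B) + \<mu> (E - B)"
      using E that by (intro signed_measure_Un[OF \<mu>]) auto
    moreover have "(E \<inter> B) \<union> (E - B) = E" by blast
    moreover have "\<bar>\<mu> (E \<inter> B)\<bar> \<le> C" using E that by (intro C) auto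
    moreover have "\<bar>\<mu> (E - B)\<bar> \<le> D" using E that by (intro D) auto
    ultimately show False using E(3) by (smt (verit))
  qed
  have step: "\<exists>A'. (A' \<in> sets borel \<and> U A') \<and> (A' \<subseteq> A \<and> 1 \<le> \<bar>\<mu> (A - A')\<bar>)"
    if "A \<in> sets borel \<and> U A" for A
  proof -
    \<comment> \<open>The margin over \<open>\<bar>\<mu> A\<bar>\<close> gives both \<open>B\<close>
      and \<open>A - B\<close> mass at least 1, so whichever of the two still has unbounded values
      can be kept while the other is split off.\<close>
    have "\<exists>B\<in>sets borel. B \<subseteq> A \<and> \<bar>\<mu> A\<bar> + 1 < \<bar>\<mu> B\<bar>"
      using that unfolding U_def by simp
    then obtain B where B: "B \<in> sets borel" "B \<subseteq> A" "\<bar>\<mu> A\<bar> + 1 < \<bar>\<mu> B\<bar>"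
      by auto
    have d: "\<mu> (A - B) = \<mu> A - \<mu> B" using B that by (intro signed_measure_Diff[OF \<mu>]) auto
    have dd: "A - (A - B) = B" using B by auto
    show ?thesis
    proof (cases "U B")
      case True
      moreover have "1 \<le> \<bar>\<mu> (A - B)\<bar>" using B(3) d by linarith
      ultimately show ?thesis using B(1,2) by blast
    next
      case False
      then have "U (A - B)" using split[of A B] B that by auto
      moreover have "1 \<le> \<bar>\<mu> (A - (A - B))\<bar>" using B(3) dd by simp
      moreover have "A - B \<in> sets borel" using B that by auto
      ultimately show ?thesis by blast
    qed
  qed
  have "\<exists>A. \<forall>n. (A n \<in> sets borel \<and> U (A n)) \<and> (A (Suc n) \<subseteq> A n \<and> 1 \<le> \<bar>\<mu> (A n - A (Suc n))\<bar>)"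
    proof (rule dependent_nat_choice[where P="\<lambda>_ A. A \<in> sets borel \<and> U A"
        and Q="\<lambda>_ A A'. A' \<subseteq> A \<and> 1 \<le> \<bar>\<mu> (A - A')\<bar>"])
    show "\<exists>A. A \<in> sets borel \<and> U A" using U0 by (intro exI[of _ UNIV]) simp
  qed (rule step)
  then obtain A where A0: "\<forall>n::nat. (A n \<in> sets borel \<and> U (A n))
      \<and> (A (Suc n) \<subseteq> A n \<and> 1 \<le> \<bar>\<mu> (A n - A (Suc n))\<bar>)" ..
  have A: "A n \<in> sets borel" and A': "A (Suc n) \<subseteq> A n" "1 \<le> \<bar>\<mu> (A n - A (Suc n))\<bar>" for n
    using A0 by simp_all
  have dec: "A n \<subseteq> A m" if "m \<le> n" for m n using lift_Suc_antimono_le[of A, OF A'(1) that] .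
  have "disjoint_family (\<lambda>n. A n - A (Suc n))"
    unfolding disjoint_family_on_def
  proof (intro ballI impI)
    fix m n :: nat assume "m \<noteq> n"
    then consider "Suc m \<le> n" | "Suc n \<le> m" by linarith
    then show "(A m - A (Suc m)) \<inter> (A n - A (Suc n)) = {}"
      by cases (use dec in blast)+
  qed
  moreover have "range (\<lambda>n. A n - A (Suc n)) \<subseteq> sets borel" using A by auto
  ultimately have "(\<lambda>n. \<mu> (A n - A (Suc n))) \<longlonglongrightarrow> 0"
    using signed_measure_sums[OF \<mu>] by (meson sums_iff summable_LIMSEQ_zero)
  then have "eventually (\<lambda>n. \<bar>\<mu> (A n - A (Suc n))\<bar> < 1) sequentially"
    by (auto dest!: tendstoD[of _ _ _ 1] simp: dist_real_def)
  then obtain n where "\<bar>\<mu> (A n - A (Suc n))\<bar> < 1"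
    by (auto simp: eventually_sequentially)
  then show False using A'(2)[of n] by simp
qed

section \<open>The positive variation is a finite measure\<close>

lemma pos_variation_bdd:
  assumes "signed_measure_on T \<mu>"
  shows "bdd_above (\<mu> ` {B \<in> sets borel. B \<subseteq> A})"
proof -
  obtain C where "\<forall>A\<in>sets borel. \<bar>\<mu> A\<bar> \<le> C" using signed_measure_bounded[OF assms] ..
  then have "\<mu> B \<le> C" if "B \<in> sets borel" for B using that by (meson abs_le_D1)
  then show ?thesis by (intro bdd_aboveI2[where M=C]) simp
qed

lemma pos_variation_upper:
  assumes "signed_measure_on T \<mu>" "B \<in> sets borel" "B \<subseteq> A"
  shows "\<mu> B \<le> pos_variation \<mu> A"
  unfolding pos_variation_def using assms by (intro cSUP_upper pos_variation_bdd) auto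

lemma pos_variation_least:
  assumes "\<And>B. B \<in> sets borel \<Longrightarrow> B \<subseteq> A \<Longrightarrow> \<mu> B \<le> c"
  shows "pos_variation \<mu> A \<le> c"
  unfolding pos_variation_def using assms by (intro cSUP_least) auto

lemma pos_variation_nonneg:
  assumes "signed_measure_on T \<mu>"
  shows "0 \<le> pos_variation \<mu> A"
  using pos_variation_upper[OF assms, of "{}" A] signed_measure_empty[OF assms] by simp

text \<open>Passing from \<open>B\<close> to \<open>A - B\<close> exchanges large values of
  \<open>\<mu>\<close> for small ones, since \<open>\<mu> B = \<mu> A - \<mu> (A - B)\<close>; hence
  the two suprema differ by \<open>\<mu> A\<close>. No Hahn decomposition is involved.\<close>

lemma jordan_decomposition:
  assumes "signed_measure_on T \<mu>" "A \<in> sets borel"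
  shows "pos_variation \<mu> A - pos_variation (\<lambda>A. - \<mu> A) A = \<mu> A"
proof -
  note \<mu>' = signed_measure_uminus[OF assms(1)]
  have "pos_variation \<mu> A \<le> \<mu> A + pos_variation (\<lambda>A. - \<mu> A) A"
  proof (rule pos_variation_least)
    fix B :: "real set" assume B: "B \<in> sets borel" "B \<subseteq> A"
    have "- \<mu> (A - B) \<le> pos_variation (\<lambda>A. - \<mu> A) A"
      using B assms by (intro pos_variation_upper[OF \<mu>']) auto
    then show "\<mu> B \<le> \<mu> A + pos_variation (\<lambda>A. - \<mu> A) A"
      using signed_measure_Diff[OF assms(1,2) B] by simp
  qed
  moreover have "pos_variation (\<lambda>A. - \<mu> A) A \<le> pos_variation \<mu> A - \<mu> A"
  proof (rule pos_variation_least)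
    fix B :: "real set" assume B: "B \<in> sets borel" "B \<subseteq> A"
    have "\<mu> (A - B) \<le> pos_variation \<mu> A"
      using B assms by (intro pos_variation_upper[OF assms(1)]) auto
    then show "- \<mu> B \<le> pos_variation \<mu> A - \<mu> A"
      using signed_measure_Diff[OF assms(1,2) B] by simp
  qed
  ultimately show ?thesis by simp
qed

text \<open>Subsets of disjoint sets can be chosen independently and united, so the suprema add up.
  Taking the supremum over one piece at a time avoids nearly optimal choices.\<close>

lemma pos_variation_sum_le:
  assumes \<mu>: "signed_measure_on T \<mu>" and A: "\<And>i::nat. A i \<in> sets borel" "disjoint_family A"
  shows "(\<Sum>i<n. pos_variation \<mu> (A i)) \<le> pos_variation \<mu> (\<Union>i<n. A i)"
proof (induction n)
  case 0 then show ?case using pos_variation_nonneg[OF \<mu>] by simp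
next
  case (Suc n)
  define P where "P = (\<Union>i<n. A i)"
  have disj: "P \<inter> A n = {}" 
  proof -
    have "A i \<inter> A n = {}" if "i < n" for i
      using that by (intro disjoint_family_onD[OF A(2)]) simp_all
    then show ?thesis unfolding P_def by blast
  qed
  have un: "(\<Union>i<Suc n. A i) = P \<union> A n" unfolding P_def by (simp add: lessThan_Suc Un_commute)
  have PA: "P \<in> sets borel" "A n \<in> sets borel" unfolding P_def using A(1) by simp_all
  have "pos_variation \<mu> P \<le> pos_variation \<mu> (P \<union> A n) - pos_variation \<mu> (A n)"
  proof (rule pos_variation_least)
    fix B :: "real set" assume B: "B \<in> sets borel" "B \<subseteq> P"
    have "pos_variation \<mu> (A n) \<le> pos_variation \<mu> (P \<union> A n) - \<mu> B"
    proof (rule pos_variation_least)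
      fix E :: "real set" assume E: "E \<in> sets borel" "E \<subseteq> A n"
      have "\<mu> B + \<mu> E = \<mu> (B \<union> E)"
        using B E disj by (intro signed_measure_Un[OF \<mu>, symmetric]) auto
      also have "\<dots> \<le> pos_variation \<mu> (P \<union> A n)"
        using B E by (intro pos_variation_upper[OF \<mu>]) auto
      finally show "\<mu> E \<le> pos_variation \<mu> (P \<union> A n) - \<mu> B" by simp
    qed
    then show "\<mu> B \<le> pos_variation \<mu> (P \<union> A n) - pos_variation \<mu> (A n)" by simp
  qed
  then show ?case using Suc unfolding un P_def[symmetric] by simp
qed

lemma pos_variation_mono:
  assumes "signed_measure_on T \<mu>" "A \<subseteq> B"
  shows "pos_variation \<mu> A \<le> pos_variation \<mu> B"
  by (rule pos_variation_least) (use assms in \<open>auto intro!: pos_variation_upper\<close>)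

text \<open>A subset of the union is cut along the \<open>A n\<close>, which bounds its measure by
  the sum of the variations; the other inequality is the finite superadditivity above.\<close>

lemma pos_variation_sums:
  assumes \<mu>: "signed_measure_on T \<mu>" and A: "range A \<subseteq> sets borel" "disjoint_family A"
  shows "(\<lambda>n. pos_variation \<mu> (A n)) sums pos_variation \<mu> (\<Union>n. A n)"
proof -
  have Ai: "A i \<in> sets borel" for i using A(1) by blast
  have part: "(\<Sum>i<n. pos_variation \<mu> (A i)) \<le> pos_variation \<mu> (\<Union>i. A i)" for n
    using pos_variation_sum_le[OF \<mu> Ai A(2), of n]
      pos_variation_mono[OF \<mu>, of "\<Union>i<n. A i" "\<Union>i. A i"] by force
  have sm: "summable (\<lambda>n. pos_variation \<mu> (A n))"
    by (rule summableI_nonneg_bounded[OF _ part]) (rule pos_variation_nonneg[OF \<mu>])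
  have "(\<Sum>n. pos_variation \<mu> (A n)) = pos_variation \<mu> (\<Union>n. A n)"
  proof (rule antisym)
    show "(\<Sum>n. pos_variation \<mu> (A n)) \<le> pos_variation \<mu> (\<Union>n. A n)"
      by (rule suminf_le_const[OF sm part])
    show "pos_variation \<mu> (\<Union>n. A n) \<le> (\<Sum>n. pos_variation \<mu> (A n))"
    proof (rule pos_variation_least)
      fix B :: "real set" assume B: "B \<in> sets borel" "B \<subseteq> (\<Union>n. A n)"
      have "(\<lambda>n. \<mu> (B \<inter> A n)) sums \<mu> (\<Union>n. B \<inter> A n)"
      proof (rule signed_measure_sums[OF \<mu>])
        show "range (\<lambda>n. B \<inter> A n) \<subseteq> sets borel"
          by (intro image_subsetI sets.Int B(1) Ai)
        show "disjoint_family (\<lambda>n. B \<inter> A n)"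
          by (rule disjoint_family_subset[OF A(2)]) simp
      qed
      moreover have "(\<Union>n. B \<inter> A n) = B" using B(2) by blast
      ultimately have s: "(\<lambda>n. \<mu> (B \<inter> A n)) sums \<mu> B" by simp
      have "(\<Sum>n. \<mu> (B \<inter> A n)) \<le> (\<Sum>n. pos_variation \<mu> (A n))"
      proof (rule suminf_le[OF _ _ sm])
        show "\<mu> (B \<inter> A n) \<le> pos_variation \<mu> (A n)" for n
          by (intro pos_variation_upper[OF \<mu>] sets.Int B(1) Ai Int_lower2)
      qed (use s in \<open>simp add: sums_iff\<close>)
      then show "\<mu> B \<le> (\<Sum>n. pos_variation \<mu> (A n))" using s by (simp add: sums_iff)
    qed
  qed
  then show ?thesis using sm by (simp add: sums_iff)
qed

lemma sets_pos_part_measure[simp, measurable_cong]: "sets (pos_part_measure \<mu>) = sets borel"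
  unfolding pos_part_measure_def by (metis sets.sets_measure_of_eq space_borel)

lemma space_pos_part_measure[simp]: "space (pos_part_measure \<mu>) = UNIV"
  unfolding pos_part_measure_def by (metis sets.space_measure_of_eq space_borel)

lemma emeasure_pos_part_measure:
  assumes \<mu>: "signed_measure_on T \<mu>" and A: "A \<in> sets borel"
  shows "emeasure (pos_part_measure \<mu>) A = ennreal (pos_variation \<mu> A)"
proof (rule emeasure_measure_of[OF pos_part_measure_def])
  show "positive (sets (pos_part_measure \<mu>)) (\<lambda>A. ennreal (pos_variation \<mu> A))"
    by (auto simp: positive_def pos_variation_def signed_measure_empty[OF \<mu>])
  show "countably_additive (sets (pos_part_measure \<mu>)) (\<lambda>A. ennreal (pos_variation \<mu> A))"
    unfolding countably_additive_def
  proof (intro allI impI)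
    fix B :: "nat \<Rightarrow> real set"
    assume "range B \<subseteq> sets (pos_part_measure \<mu>)" "disjoint_family B"
    then have "(\<lambda>n. pos_variation \<mu> (B n)) sums pos_variation \<mu> (\<Union>n. B n)"
      by (intro pos_variation_sums[OF \<mu>]) simp_all
    then show "(\<Sum>i. ennreal (pos_variation \<mu> (B i))) = ennreal (pos_variation \<mu> (\<Union>i. B i))"
      by (intro suminf_ennreal_eq pos_variation_nonneg[OF \<mu>])
  qed
qed (simp_all add: A)

lemma finite_measure_pos_part:
  assumes "signed_measure_on T \<mu>"
  shows "finite_measure (pos_part_measure \<mu>)"
  by standard (simp add: emeasure_pos_part_measure[OF assms])

lemma pos_part_integrable:
  fixes f :: "real \<Rightarrow> real"
  assumes "signed_measure_on T \<mu>" "f \<in> borel_measurable borel" "\<And>x. \<bar>f x\<bar> \<le> C"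
  shows "integrable (pos_part_measure \<mu>) f"
proof -
  interpret finite_measure "pos_part_measure \<mu>" by (rule finite_measure_pos_part[OF assms(1)])
  show ?thesis using assms(2,3) by (intro integrable_const_bound[where B=C]) auto
qed

section \<open>Linearity, limits and bounds of integrals against signed measures\<close>

lemma signed_integral_add:
  assumes "signed_measure_on T \<mu>" "f \<in> borel_measurable borel" "\<And>x. \<bar>f x\<bar> \<le> C"
    "g \<in> borel_measurable borel" "\<And>x. \<bar>g x\<bar> \<le> D"
  shows "signed_integral \<mu> (\<lambda>x. f x + g x) = signed_integral \<mu> f + signed_integral \<mu> g"
  using pos_part_integrable[OF assms(1-3)] pos_part_integrable[OF assms(1,4,5)]
    pos_part_integrable[OF signed_measure_uminus[OF assms(1)] assms(2,3)]
    pos_part_integrable[OF signed_measure_uminus[OF assms(1)] assms(4,5)]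
  unfolding signed_integral_def by simp

lemma signed_integral_cmult:
  "signed_integral \<mu> (\<lambda>x. c * f x) = c * signed_integral \<mu> f"
  unfolding signed_integral_def by (simp add: algebra_simps)

lemma signed_integral_diff:
  assumes "signed_measure_on T \<mu>" "f \<in> borel_measurable borel" "\<And>x. \<bar>f x\<bar> \<le> C"
    "g \<in> borel_measurable borel" "\<And>x. \<bar>g x\<bar> \<le> D"
  shows "signed_integral \<mu> (\<lambda>x. f x - g x) = signed_integral \<mu> f - signed_integral \<mu> g"
  using pos_part_integrable[OF assms(1-3)] pos_part_integrable[OF assms(1,4,5)]
    pos_part_integrable[OF signed_measure_uminus[OF assms(1)] assms(2,3)]
    pos_part_integrable[OF signed_measure_uminus[OF assms(1)] assms(4,5)]
  unfolding signed_integral_def by simp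

lemma signed_integral_indicator:
  assumes "signed_measure_on T \<mu>" "A \<in> sets borel"
  shows "signed_integral \<mu> (indicator A) = \<mu> A"
  unfolding signed_integral_def
  using assms signed_measure_uminus[OF assms(1)]
  by (simp add: measure_def emeasure_pos_part_measure[of T] pos_variation_nonneg[of T]
      jordan_decomposition)

lemma signed_integral_dominated:
  assumes \<mu>: "signed_measure_on T \<mu>" and f: "\<And>n. f n \<in> borel_measurable borel"
    and C: "\<And>n x. \<bar>f n x\<bar> \<le> C" and lim: "\<And>x. (\<lambda>n. f n x) \<longlonglongrightarrow> g x"
  shows "(\<lambda>n. signed_integral \<mu> (f n)) \<longlonglongrightarrow> signed_integral \<mu> g"
proof -
  have g: "g \<in> borel_measurable borel" by (rule borel_measurable_LIMSEQ_real[OF lim f])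
  have "(\<lambda>n. LINT x|pos_part_measure \<nu>. f n x) \<longlonglongrightarrow> (LINT x|pos_part_measure \<nu>. g x)"
    if "signed_measure_on T \<nu>" for \<nu>
    by (rule integral_dominated_convergence[where w="\<lambda>_. C"])
      (use f g C lim pos_part_integrable[OF that, of "\<lambda>_. C" "\<bar>C\<bar>"] in auto)
  from this[OF \<mu>] this[OF signed_measure_uminus[OF \<mu>]] show ?thesis
    unfolding signed_integral_def by (rule tendsto_diff)
qed

lemma signed_integral_sum:
  assumes \<mu>: "signed_measure_on T \<mu>" and f: "\<And>i. i \<in> I \<Longrightarrow> f i \<in> borel_measurable borel"
    and C: "\<And>i x. i \<in> I \<Longrightarrow> \<bar>f i x\<bar> \<le> C i"
  shows "signed_integral \<mu> (\<lambda>x. \<Sum>i\<in>I. f i x) = (\<Sum>i\<in>I. signed_integral \<mu> (f i))"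
proof -
  have "(LINT x|pos_part_measure \<nu>. (\<Sum>i\<in>I. f i x)) = (\<Sum>i\<in>I. LINT x|pos_part_measure \<nu>. f i x)"
    if "signed_measure_on T \<nu>" for \<nu>
    by (rule Bochner_Integration.integral_sum) (use f C in \<open>blast intro: pos_part_integrable[OF that]\<close>)
  from this[OF \<mu>] this[OF signed_measure_uminus[OF \<mu>]] show ?thesis
    unfolding signed_integral_def by (simp add: sum_subtractf)
qed

text \<open>The variations of \<open>remove_atom0 \<mu>\<close> are not expressed through those of
  \<open>\<mu>\<close>. Instead, integrals of simple functions are written with the values of the
  signed measures themselves, where the identity is the definition of \<open>remove_atom0\<close>;
  bounded convergence then carries it to \<open>f\<close>.\<close>

lemma signed_integral_remove_atom0:
  assumes \<mu>: "signed_measure_on T \<mu>" and T: "0 \<le> T"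
    and f: "f \<in> borel_measurable borel" "\<And>x. \<bar>f x\<bar> \<le> C"
  shows "signed_measure_on T (remove_atom0 \<mu>)"
    and "signed_integral (remove_atom0 \<mu>) f = signed_integral \<mu> f - \<mu> {0} * f 0"
proof -
  show \<nu>: "signed_measure_on T (remove_atom0 \<mu>)"
    unfolding signed_measure_on_def
  proof (intro conjI allI impI ballI)
    fix A :: "nat \<Rightarrow> real set" assume A: "range A \<subseteq> sets borel" "disjoint_family A"
    have "(\<lambda>n. indicat_real (A n) 0) sums indicat_real (\<Union>n. A n) 0"
      by (rule indicator_sums) (use A in \<open>auto simp: disjoint_family_on_def\<close>)
    from sums_diff[OF signed_measure_sums[OF \<mu> A] sums_mult[OF this, of "\<mu> {0}"]]
    show "(\<lambda>n. remove_atom0 \<mu> (A n)) sums remove_atom0 \<mu> (\<Union>n. A n)"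
      unfolding remove_atom0_def .
  next
    fix A :: "real set" assume "A \<in> sets borel"
    then show "remove_atom0 \<mu> A = remove_atom0 \<mu> (A \<inter> {- T..0})"
      using signed_measure_carrier[OF \<mu>, of A] T unfolding remove_atom0_def
      by (auto simp: indicator_def)
  qed
  define P where "P f \<longleftrightarrow> signed_integral (remove_atom0 \<mu>) f = signed_integral \<mu> f - \<mu> {0} * f 0" for f
  have ind: "P (indicator A)" if "A \<in> sets borel" for A
    unfolding P_def using signed_integral_indicator[OF \<nu> that] signed_integral_indicator[OF \<mu> that]
    by (simp add: remove_atom0_def)
  obtain s where s: "\<And>i. simple_function borel (s i)" "\<And>x. (\<lambda>i. s i x) \<longlonglongrightarrow> f x"
    "\<And>i x. norm (s i x) \<le> 2 * norm (f x)"
    using borel_measurable_implies_sequence_metric[OF f(1), of 0]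
    by (auto simp: dist_real_def)
  have sb: "\<bar>s i x\<bar> \<le> 2 * C" for i x using s(3)[of i x] f(2)[of x] by simp
  have sm: "s i \<in> borel_measurable borel" for i using s(1) by (rule borel_measurable_simple_function)
  have Ps: "P (s i)" for i
  proof -
    have fin: "finite (range (s i))" using s(1)[of i] by (auto simp: simple_function_def)
    have vm: "s i -` {y} \<in> sets borel" for y
      using measurable_sets[OF sm[of i], of "{y}"] by simp
    have rep: "s i = (\<lambda>x. \<Sum>y\<in>range (s i). y * indicator (s i -` {y}) x)"
    proof
      fix x
      have "(\<Sum>y\<in>range (s i). y * indicator (s i -` {y}) x) = (\<Sum>y\<in>range (s i). if y = s i x then s i x else 0)"
        by (rule sum.cong) (auto simp: indicator_def)
      then show "s i x = (\<Sum>y\<in>range (s i). y * indicator (s i -` {y}) x)" using fin by simp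
    qed
    have "signed_integral \<rho> (s i) = (\<Sum>y\<in>range (s i). y * \<rho> (s i -` {y}))"
      if \<rho>: "signed_measure_on T \<rho>" for \<rho>
    proof -
      have "signed_integral \<rho> (\<lambda>x. \<Sum>y\<in>range (s i). y * indicator (s i -` {y}) x)
          = (\<Sum>y\<in>range (s i). signed_integral \<rho> (\<lambda>x. y * indicator (s i -` {y}) x))"
      proof (rule signed_integral_sum[OF \<rho>, where C="\<lambda>y. \<bar>y\<bar>"])
        show "(\<lambda>x. y * indicator (s i -` {y}) x) \<in> borel_measurable borel" for y
          by (intro borel_measurable_times borel_measurable_const borel_measurable_indicator vm)
        show "\<bar>y * indicat_real (s i -` {y}) x\<bar> \<le> \<bar>y\<bar>" for x y
          by (simp add: indicator_def)
      qed
      also have "\<dots> = (\<Sum>y\<in>range (s i). y * \<rho> (s i -` {y}))"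
        by (simp add: signed_integral_cmult signed_integral_indicator[OF \<rho> vm])
      finally show ?thesis using rep by simp
    qed
    from this[OF \<nu>] this[OF \<mu>]
    have "signed_integral (remove_atom0 \<mu>) (s i) = signed_integral \<mu> (s i)
        - \<mu> {0} * (\<Sum>y\<in>range (s i). y * indicator (s i -` {y}) 0)"
      by (simp add: remove_atom0_def right_diff_distrib sum_subtractf sum_distrib_left mult_ac)
    moreover have "(\<Sum>y\<in>range (s i). y * indicator (s i -` {y}) 0) = s i 0"
      using rep by metis
    ultimately show ?thesis unfolding P_def by simp
  qed
  have "(\<lambda>i. signed_integral (remove_atom0 \<mu>) (s i)) \<longlonglongrightarrow> signed_integral (remove_atom0 \<mu>) f"
    by (rule signed_integral_dominated[OF \<nu> sm sb s(2)])
  moreover have "(\<lambda>i. signed_integral \<mu> (s i) - \<mu> {0} * s i 0) \<longlonglongrightarrow> signed_integral \<mu> f - \<mu> {0} * f 0"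
    by (intro tendsto_intros signed_integral_dominated[OF \<mu> sm sb s(2)] s(2))
  ultimately show "signed_integral (remove_atom0 \<mu>) f = signed_integral \<mu> f - \<mu> {0} * f 0"
    using Ps unfolding P_def by (simp add: LIMSEQ_unique)
qed

text \<open>By the carrier condition every Borel set outside \<open>[-T,0]\<close> has measure 0, so
  both variations vanish on the complement of that interval.\<close>

lemma signed_integral_cong_carrier:
  assumes \<mu>: "signed_measure_on T \<mu>" and "\<And>x. x \<in> {-T..0} \<Longrightarrow> f x = g x"
    and "f \<in> borel_measurable borel" "g \<in> borel_measurable borel"
  shows "signed_integral \<mu> f = signed_integral \<mu> g"
proof -
  have "(LINT x|pos_part_measure \<nu>. f x) = (LINT x|pos_part_measure \<nu>. g x)"
    if \<nu>: "signed_measure_on T \<nu>" for \<nu>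
  proof (rule integral_cong_AE)
    have "pos_variation \<nu> (- {-T..0}) \<le> 0"
    proof (rule pos_variation_least)
      fix B :: "real set" assume "B \<in> sets borel" "B \<subseteq> - {-T..0}"
      then show "\<nu> B \<le> 0"
        using signed_measure_carrier[OF \<nu>, of B] signed_measure_empty[OF \<nu>]
        by (metis disjoint_eq_subset_Compl order_refl)
    qed
    then have "emeasure (pos_part_measure \<nu>) (- {-T..0}) = 0"
      by (simp add: emeasure_pos_part_measure[OF \<nu>] ennreal_neg borel_comp)
    then show "AE x in pos_part_measure \<nu>. f x = g x"
      by (intro AE_I[where N="- {-T..0}"]) (use assms in \<open>auto simp: borel_comp\<close>)
  qed (use assms in simp_all)
  from this[OF \<mu>] this[OF signed_measure_uminus[OF \<mu>]] show ?thesis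
    unfolding signed_integral_def by simp
qed

lemma signed_integral_abs_le:
  assumes \<mu>: "signed_measure_on T \<mu>" and f: "f \<in> borel_measurable borel" "\<And>x. \<bar>f x\<bar> \<le> C"
  shows "\<bar>signed_integral \<mu> f\<bar> \<le> total_variation \<mu> * C"
proof -
  have "\<bar>LINT x|pos_part_measure \<nu>. f x\<bar> \<le> pos_variation \<nu> UNIV * C" if \<nu>: "signed_measure_on T \<nu>" for \<nu>
  proof -
    interpret finite_measure "pos_part_measure \<nu>" by (rule finite_measure_pos_part[OF \<nu>])
    have "\<bar>LINT x|pos_part_measure \<nu>. f x\<bar> \<le> (LINT x|pos_part_measure \<nu>. \<bar>f x\<bar>)"
      by simp
    also have "\<dots> \<le> (LINT x|pos_part_measure \<nu>. C)"
      using pos_part_integrable[OF \<nu> f] f by (intro integral_mono) auto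
    also have "\<dots> = pos_variation \<nu> UNIV * C"
      by (simp add: measure_def emeasure_pos_part_measure[OF \<nu>] pos_variation_nonneg[OF \<nu>])
    finally show ?thesis .
  qed
  from this[OF \<mu>] this[OF signed_measure_uminus[OF \<mu>]] show ?thesis
    unfolding signed_integral_def total_variation_def distrib_right by linarith
qed

lemma abs_apply_bcontfun_le: "\<bar>apply_bcontfun \<phi> x\<bar> \<le> norm \<phi>" for \<phi> :: path
  using norm_bounded[of \<phi> x] by simp

lemma borel_measurable_apply_bcontfun[measurable]:
  "apply_bcontfun \<phi> \<in> borel_measurable borel" for \<phi> :: path
  by (rule borel_measurable_continuous_onI) simp

lemma dual_of_apply:
  assumes \<mu>: "signed_measure_on T \<mu>"
  shows "blinfun_apply (dual_of \<mu>) \<phi> = signed_integral \<mu> (apply_bcontfun \<phi>)"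
proof -
  have "bounded_linear (\<lambda>\<phi>. signed_integral \<mu> (apply_bcontfun \<phi>))"
  proof (rule bounded_linear_intro[where K="total_variation \<mu>"])
    fix \<phi> \<psi> :: path and r :: real
    show "signed_integral \<mu> (apply_bcontfun (\<phi> + \<psi>))
        = signed_integral \<mu> (apply_bcontfun \<phi>) + signed_integral \<mu> (apply_bcontfun \<psi>)"
      using signed_integral_add[OF \<mu> borel_measurable_apply_bcontfun[of \<phi>] abs_apply_bcontfun_le
          borel_measurable_apply_bcontfun[of \<psi>] abs_apply_bcontfun_le]
      by (simp add: plus_bcontfun.rep_eq)
    show "signed_integral \<mu> (apply_bcontfun (r *\<^sub>R \<phi>)) = r *\<^sub>R signed_integral \<mu> (apply_bcontfun \<phi>)"
      by (simp add: scaleR_bcontfun.rep_eq signed_integral_cmult)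
    show "norm (signed_integral \<mu> (apply_bcontfun \<phi>)) \<le> norm \<phi> * total_variation \<mu>"
      using signed_integral_abs_le[OF \<mu> borel_measurable_apply_bcontfun[of \<phi>] abs_apply_bcontfun_le]
      by (simp add: mult.commute)
  qed
  then show ?thesis unfolding dual_of_def by (simp add: bounded_linear_Blinfun_apply)
qed

text \<open>The norm of \<open>dual_of\<close> also controls integrals of bounded pointwise limits of continuous
  functions; this replaces the identification of that norm with the total variation.\<close>

lemma signed_integral_diff_le_dual:
  fixes f :: "nat \<Rightarrow> path"
  assumes \<mu>: "signed_measure_on T \<mu>" and \<nu>: "signed_measure_on T \<nu>"
    and C: "\<And>n. norm (f n) \<le> C" and lim: "\<And>x. (\<lambda>n. apply_bcontfun (f n) x) \<longlonglongrightarrow> g x"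
  shows "\<bar>signed_integral \<mu> g - signed_integral \<nu> g\<bar> \<le> norm (dual_of \<mu> - dual_of \<nu>) * C"
proof -
  have C': "\<bar>apply_bcontfun (f n) x\<bar> \<le> C" for n x
    using abs_apply_bcontfun_le[of "f n" x] C[of n] by linarith
  have "(\<lambda>n. signed_integral \<mu> (apply_bcontfun (f n)) - signed_integral \<nu> (apply_bcontfun (f n)))
      \<longlonglongrightarrow> signed_integral \<mu> g - signed_integral \<nu> g"
    using signed_integral_dominated[OF \<mu> borel_measurable_apply_bcontfun C' lim]
      signed_integral_dominated[OF \<nu> borel_measurable_apply_bcontfun C' lim]
    by (rule tendsto_diff)
  then have "(\<lambda>n. \<bar>blinfun_apply (dual_of \<mu> - dual_of \<nu>) (f n)\<bar>)
      \<longlonglongrightarrow> \<bar>signed_integral \<mu> g - signed_integral \<nu> g\<bar>"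
    by (intro tendsto_rabs) (simp add: blinfun.diff_left dual_of_apply[OF \<mu>] dual_of_apply[OF \<nu>])
  moreover have "\<bar>blinfun_apply (dual_of \<mu> - dual_of \<nu>) (f n)\<bar> \<le> norm (dual_of \<mu> - dual_of \<nu>) * C" for n
    using norm_blinfun[of "dual_of \<mu> - dual_of \<nu>" "f n"]
      mult_left_mono[OF C norm_ge_zero, of "dual_of \<mu> - dual_of \<nu>" n] by simp
  ultimately show ?thesis by (intro LIMSEQ_le_const2) auto
qed

section \<open>Path space\<close>

lemma clamp_real_def:
  fixes a b x :: real
  assumes "a \<le> b"
  shows "clamp a b x = max a (min b x)"
proof -
  have "clamp a b x = (if x < a then a else if x \<le> b then x else b)"
    using assms unfolding clamp_def Basis_real_def by simp
  then show ?thesis using assms by (simp add: max_def min_def)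
qed

text \<open>The counterpart of \<open>window\<close> for a single function on the line. It is
  applied to trajectories, to their smoothings and to the derivatives of these, so that the velocity
  of a window is again a window.\<close>

definition path_of :: "real \<Rightarrow> (real \<Rightarrow> real) \<Rightarrow> real \<Rightarrow> path" where
  "path_of T y t = Bcontfun (\<lambda>x. y (t + clamp (-T) 0 x))"

lemma apply_path_of:
  assumes "continuous_on UNIV y" "0 \<le> T"
  shows "apply_bcontfun (path_of T y t) x = y (t + clamp (-T) 0 x)"
proof -
  have "continuous_on (cbox (- T) 0) (\<lambda>x. y (t + x))"
    by (intro continuous_intros continuous_on_compose2[OF assms(1)]) auto
  from continuous_on_cbox_bcontfunE[OF this] obtain g :: path
    where "\<And>x. x \<in> cbox (- T) 0 \<Longrightarrow> apply_bcontfun g x = y (t + x)"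
      "\<And>x. apply_bcontfun g x = y (t + clamp (- T) 0 x)" by metis
  then have "(\<lambda>x. y (t + clamp (- T) 0 x)) = apply_bcontfun g" by auto
  then have "(\<lambda>x. y (t + clamp (- T) 0 x)) \<in> bcontfun" by (metis apply_bcontfun)
  then show ?thesis unfolding path_of_def by (simp add: Bcontfun_inverse)
qed

lemma path_of_in_C_space:
  assumes "continuous_on UNIV y" "0 \<le> T"
  shows "path_of T y t \<in> C_space T"
  using assms by (simp add: C_space_def apply_path_of clamp_real_def)

lemma norm_path_of_diff_le:
  assumes "continuous_on UNIV y" "continuous_on UNIV z" "0 \<le> T"
    and "\<And>x. x \<in> {-T..0} \<Longrightarrow> \<bar>y (t + x) - z (s + x)\<bar> \<le> c"
  shows "norm (path_of T y t - path_of T z s) \<le> c"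
  using assms by (intro norm_bound) (simp add: apply_path_of clamp_real_def)

lemma C_space_add: "\<eta> \<in> C_space T \<Longrightarrow> \<gamma> \<in> C_space T \<Longrightarrow> \<eta> + \<gamma> \<in> C_space T"
  and C_space_diff: "\<eta> \<in> C_space T \<Longrightarrow> \<gamma> \<in> C_space T \<Longrightarrow> \<eta> - \<gamma> \<in> C_space T"
  and C_space_scaleR: "\<eta> \<in> C_space T \<Longrightarrow> c *\<^sub>R \<eta> \<in> C_space T"
  unfolding C_space_def mem_Collect_eq plus_bcontfun.rep_eq minus_bcontfun.rep_eq
    scaleR_bcontfun.rep_eq by metis+

lemma C_space_const_left: "\<eta> \<in> C_space T \<Longrightarrow> 0 \<le> T \<Longrightarrow> 0 \<le> x \<Longrightarrow> apply_bcontfun \<eta> x = apply_bcontfun \<eta> 0"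
  unfolding C_space_def using clamp_real_def[of "-T" 0 x] by (simp add: min_def) metis

lemma apply_bcontfun_tendsto:
  fixes f :: "'a \<Rightarrow> path"
  assumes "(f \<longlongrightarrow> g) F"
  shows "((\<lambda>i. apply_bcontfun (f i) x) \<longlongrightarrow> apply_bcontfun g x) F"
proof (rule tendstoI)
  fix e :: real assume "0 < e"
  from tendstoD[OF assms this]
  show "\<forall>\<^sub>F i in F. dist (apply_bcontfun (f i) x) (apply_bcontfun g x) < e"
    by eventually_elim (meson dist_fun_lt_imp_dist_val_lt)
qed

text \<open>Closedness makes the path space completely metrizable, as Baire's theorem
  requires.\<close>

lemma closed_C_space: "closed (C_space T)"
  unfolding closed_sequential_limits
proof (intro allI impI)
  fix f and l :: path assume "(\<forall>n. f n \<in> C_space T) \<and> f \<longlonglongrightarrow> l"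
  then have f: "\<And>n. f n \<in> C_space T" and lim: "f \<longlonglongrightarrow> l" by auto
  show "l \<in> C_space T"
    unfolding C_space_def mem_Collect_eq
  proof
    fix x
    have "(\<lambda>n. apply_bcontfun (f n) x) \<longlonglongrightarrow> apply_bcontfun l (clamp (- T) 0 x)"
    proof -
      have "apply_bcontfun (f n) (clamp (- T) 0 x) = apply_bcontfun (f n) x" for n
        using f[of n] unfolding C_space_def mem_Collect_eq by metis
      then show ?thesis using apply_bcontfun_tendsto[OF lim, of "clamp (- T) 0 x"] by simp
    qed
    then show "apply_bcontfun l x = apply_bcontfun l (clamp (- T) 0 x)"
      using apply_bcontfun_tendsto[OF lim] LIMSEQ_unique by blast
  qed
qed

text \<open>Continuous functions of norm at most 1 converging pointwise to the indicator of
  \<open>{0}\<close>: tested on them, an element of the dual reveals the atom at 0 of its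
  measure.\<close>

definition tent :: "nat \<Rightarrow> path" where
  "tent n = Bcontfun (\<lambda>x. max 0 (1 - real (Suc n) * \<bar>x\<bar>))"

lemma apply_tent: "apply_bcontfun (tent n) x = max 0 (1 - real (Suc n) * \<bar>x\<bar>)"
proof -
  have "(\<lambda>x. max 0 (1 - real (Suc n) * \<bar>x\<bar>)) \<in> bcontfun"
    by (rule bcontfun_normI[where b=1]) (auto intro!: continuous_intros simp del: of_nat_Suc)
  then show ?thesis unfolding tent_def by (simp add: Bcontfun_inverse)
qed

lemma norm_tent_le: "norm (tent n) \<le> 1"
  by (rule norm_bound) (simp add: apply_tent)

lemma tent_tendsto: "(\<lambda>n. apply_bcontfun (tent n) x) \<longlonglongrightarrow> indicator {0} x"
proof (cases "x = 0")
  case True then show ?thesis by (simp add: apply_tent)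
next
  case False
  obtain N :: nat where N: "1 / \<bar>x\<bar> < real N" using reals_Archimedean2 by blast
  have "\<forall>\<^sub>F n in sequentially. apply_bcontfun (tent n) x = 0"
    using eventually_ge_at_top[of N]
  proof eventually_elim
    case (elim n)
    have "1 \<le> real N * \<bar>x\<bar>" using N False by (simp add: field_simps)
    also have "\<dots> \<le> real (Suc n) * \<bar>x\<bar>" using elim by (intro mult_right_mono) auto
    finally show ?case by (simp add: apply_tent)
  qed
  then show ?thesis using False by (simp add: tendsto_eventually)
qed

lemma dual_of_tent_tendsto:
  assumes "signed_measure_on T \<mu>"
  shows "(\<lambda>n. blinfun_apply (dual_of \<mu>) (tent n)) \<longlonglongrightarrow> \<mu> {0}"
proof -
  have "\<bar>apply_bcontfun (tent n) x\<bar> \<le> 1" for n x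
    using abs_apply_bcontfun_le[of "tent n" x] norm_tent_le[of n] by linarith
  from signed_integral_dominated[OF assms borel_measurable_apply_bcontfun this tent_tendsto]
  show ?thesis by (simp add: dual_of_apply[OF assms] signed_integral_indicator[OF assms])
qed

text \<open>The tents have norm at most 1, so the atom is a contraction of the dual norm. The
  continuity of \<open>Du\<close> in that norm thus passes to its atom.\<close>

lemma atom_diff_le_dual:
  assumes "signed_measure_on T \<mu>" "signed_measure_on T \<nu>"
  shows "\<bar>\<mu> {0} - \<nu> {0}\<bar> \<le> norm (dual_of \<mu> - dual_of \<nu>)"
  using signed_integral_diff_le_dual[OF assms norm_tent_le tent_tendsto]
  by (simp add: signed_integral_indicator[OF assms(1)] signed_integral_indicator[OF assms(2)])

section \<open>Bilinear forms given by elements of \<open>\<chi>\<^sup>0\<^sub>D\<^sub>i\<^sub>a\<^sub>g\<close>\<close>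

lemma Cauchy_Schwarz_integral:
  fixes f g :: "'a \<Rightarrow> real"
  assumes [measurable]: "f \<in> borel_measurable M" "g \<in> borel_measurable M"
    and f: "integrable M (\<lambda>x. (f x)\<^sup>2)" and g: "integrable M (\<lambda>x. (g x)\<^sup>2)"
  shows "integrable M (\<lambda>x. f x * g x)"
    and "\<bar>LINT x|M. f x * g x\<bar> \<le> sqrt (LINT x|M. (f x)\<^sup>2) * sqrt (LINT x|M. (g x)\<^sup>2)"
proof -
  have le: "\<bar>f x * g x\<bar> \<le> (f x)\<^sup>2 + (g x)\<^sup>2" for x
  proof -
    have "0 \<le> (\<bar>f x\<bar> - \<bar>g x\<bar>)\<^sup>2" by simp
    then have "2 * \<bar>f x * g x\<bar> \<le> (f x)\<^sup>2 + (g x)\<^sup>2"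
      by (simp add: power2_diff abs_mult algebra_simps)
    then show ?thesis by linarith
  qed
  show fg: "integrable M (\<lambda>x. f x * g x)"
    by (rule Bochner_Integration.integrable_bound[OF Bochner_Integration.integrable_add[OF f g]])
      (use le in \<open>auto intro!: AE_I2\<close>)
  define a b c where "a = (LINT x|M. (f x)\<^sup>2)" and "b = (LINT x|M. (g x)\<^sup>2)"
    and "c = (LINT x|M. f x * g x)"
  have "0 \<le> a" "0 \<le> b" unfolding a_def b_def by simp_all
  have q: "0 \<le> a + 2 * s * c + s\<^sup>2 * b" for s
  proof -
    have "0 \<le> (LINT x|M. (f x + s * g x)\<^sup>2)" by simp
    also have "\<dots> = (LINT x|M. (f x)\<^sup>2 + 2 * s * (f x * g x) + s\<^sup>2 * (g x)\<^sup>2)"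
      by (simp add: power2_eq_square algebra_simps)
    also have "\<dots> = a + 2 * s * c + s\<^sup>2 * b"
      unfolding a_def b_def c_def using f g fg by simp
    finally show ?thesis .
  qed
  have "c\<^sup>2 \<le> a * b"
  proof (cases "b = 0")
    case True
    have "c = 0"
    proof (rule ccontr)
      assume "c \<noteq> 0"
      \<comment> \<open>If \<open>b = 0\<close>, the nonnegative quadratic of \<open>q\<close> is
        affine in \<open>s\<close>; this \<open>s\<close> is the point where it takes the value
        -1.\<close>
      then have "a + 2 * (- (a + 1) / (2 * c)) * c + (- (a + 1) / (2 * c))\<^sup>2 * b = - 1"
        using True by (simp add: field_simps)
      then show False using q[of "- (a + 1) / (2 * c)"] by simp
    qed
    then show ?thesis using True by simp
  next
    case False
    then have "b > 0" using \<open>0 \<le> b\<close> by simp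
    then have "0 \<le> a - c\<^sup>2 / b" using q[of "- c / b"] by (simp add: power2_eq_square field_simps)
    then show ?thesis using \<open>b > 0\<close> by (simp add: field_simps)
  qed
  then have "sqrt (c\<^sup>2) \<le> sqrt (a * b)" by (rule real_sqrt_le_mono)
  then show "\<bar>LINT x|M. f x * g x\<bar> \<le> sqrt (LINT x|M. (f x)\<^sup>2) * sqrt (LINT x|M. (g x)\<^sup>2)"
    unfolding a_def[symmetric] b_def[symmetric] c_def[symmetric] by (simp add: real_sqrt_mult)
qed

lemma indicator_mult_power2: "(indicator A x * (c::real))\<^sup>2 = indicator A x * c\<^sup>2"
  by (simp add: indicator_def)

lemma square_integrable_onD:
  assumes "square_integrable_on S f"
  shows "(\<lambda>x. indicator S x * f x) \<in> borel_measurable lborel"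
    and "integrable lborel (\<lambda>x. (indicator S x * f x)\<^sup>2)"
  using assms unfolding square_integrable_on_def set_borel_measurable_def set_integrable_def
  by (simp_all add: indicator_mult_power2)

lemma L2_Cauchy_Schwarz:
  assumes f: "square_integrable_on S f" and g: "square_integrable_on S g"
  shows "set_integrable lborel S (\<lambda>x. f x * g x)"
    and "\<bar>LINT x:S|lborel. f x * g x\<bar> \<le> L2_norm_on S f * L2_norm_on S g"
proof -
  have eq: "indicator S x * f x * (indicator S x * g x) = indicator S x * (f x * g x)" for x
    by (simp add: indicator_def)
  note cs = Cauchy_Schwarz_integral[OF square_integrable_onD(1)[OF f] square_integrable_onD(1)[OF g]
      square_integrable_onD(2)[OF f] square_integrable_onD(2)[OF g], unfolded eq]
  show "set_integrable lborel S (\<lambda>x. f x * g x)"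
    using cs(1) unfolding set_integrable_def by simp
  show "\<bar>LINT x:S|lborel. f x * g x\<bar> \<le> L2_norm_on S f * L2_norm_on S g"
    using cs(2) unfolding L2_norm_on_def set_lebesgue_integral_def
    by (simp add: indicator_mult_power2)
qed

lemma square_integrable_on_diff:
  assumes f: "square_integrable_on S f" and g: "square_integrable_on S g"
  shows "square_integrable_on S (\<lambda>x. f x - g x)"
proof -
  have "integrable lborel (\<lambda>x. indicator S x * (f x)\<^sup>2 + indicator S x * (g x)\<^sup>2
      - 2 * (indicator S x * (f x * g x)))"
    using f g L2_Cauchy_Schwarz(1)[OF f g] unfolding square_integrable_on_def set_integrable_def
    by (intro Bochner_Integration.integrable_diff Bochner_Integration.integrable_add
        integrable_mult_right) simp_all
  then have "integrable lborel (\<lambda>x. indicator S x * (f x - g x)\<^sup>2)"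
    by (simp add: power2_eq_square algebra_simps)
  moreover have "(\<lambda>x. indicator S x * f x - indicator S x * g x) \<in> borel_measurable lborel"
    by (intro borel_measurable_diff square_integrable_onD f g)
  ultimately show ?thesis
    unfolding square_integrable_on_def set_borel_measurable_def set_integrable_def
    by (simp add: right_diff_distrib)
qed

lemma L2_norm_on_nonneg: "0 \<le> L2_norm_on S f"
  unfolding L2_norm_on_def set_lebesgue_integral_def by simp

lemma square_integrable_on_bounded:
  assumes f: "f \<in> borel_measurable borel" and C: "\<And>x. x \<in> S \<Longrightarrow> \<bar>f x\<bar> \<le> C"
    and S: "S \<in> sets borel" "emeasure lborel S < \<infinity>"
  shows "square_integrable_on S f" and "L2_norm_on S f \<le> sqrt (measure lborel S) * \<bar>C\<bar>"
proof -
  have [measurable]: "f \<in> borel_measurable lborel" "S \<in> sets lborel" using f S by auto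
  have le: "indicator S x * (f x)\<^sup>2 \<le> C\<^sup>2 * indicator S x" for x
    using C[of x] by (auto simp: indicator_def abs_le_square_iff[symmetric])
  have iS: "integrable lborel (\<lambda>x. C\<^sup>2 * indicator S x :: real)"
    using S by (intro integrable_mult_right integrable_real_indicator) auto
  have int: "integrable lborel (\<lambda>x. indicator S x * (f x)\<^sup>2)"
    by (rule Bochner_Integration.integrable_bound[OF iS]) (use le in auto)
  then show "square_integrable_on S f"
    unfolding square_integrable_on_def set_borel_measurable_def set_integrable_def by simp
  have "(LINT x|lborel. indicator S x * (f x)\<^sup>2) \<le> (LINT x|lborel. C\<^sup>2 * indicator S x)"
    by (rule integral_mono[OF int iS le])
  also have "\<dots> = C\<^sup>2 * measure lborel S" by simp
  finally have "sqrt (LINT x|lborel. indicator S x * (f x)\<^sup>2) \<le> sqrt (C\<^sup>2 * measure lborel S)"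
    by (rule real_sqrt_le_mono)
  then show "L2_norm_on S f \<le> sqrt (measure lborel S) * \<bar>C\<bar>"
    unfolding L2_norm_on_def set_lebesgue_integral_def
    by (simp add: real_sqrt_mult mult.commute)
qed

lemma square_integrable_on_path:
  fixes T :: real
  shows "square_integrable_on {-T..0} (apply_bcontfun \<phi>)"
  by (intro square_integrable_on_bounded(1)[OF borel_measurable_apply_bcontfun abs_apply_bcontfun_le])
    (auto simp: emeasure_lborel_Icc_eq)

lemma square_integrable_on_tensor:
  fixes f g :: "real \<Rightarrow> real"
  assumes f: "square_integrable_on A f" and g: "square_integrable_on B g"
  shows "square_integrable_on (A \<times> B) (\<lambda>(x, y). f x * g y)"
    and "L2_norm_on (A \<times> B) (\<lambda>(x, y). f x * g y) = L2_norm_on A f * L2_norm_on B g"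
proof -
  define F G where "F = (\<lambda>x. indicator A x * f x)" and "G = (\<lambda>x. indicator B x * g x)"
  have Fm[measurable]: "F \<in> borel_measurable lborel" "G \<in> borel_measurable lborel"
    and F2: "integrable lborel (\<lambda>x. (F x)\<^sup>2)" and G2: "integrable lborel (\<lambda>x. (G x)\<^sup>2)"
    unfolding F_def G_def using square_integrable_onD[OF f] square_integrable_onD[OF g] by simp_all
  have eq: "indicator (A \<times> B) z * (case z of (x, y) \<Rightarrow> f x * g y) = F (fst z) * G (snd z)" for z
    unfolding F_def G_def by (cases z) (simp add: indicator_times)
  have m: "(\<lambda>z. F (fst z) * G (snd z)) \<in> borel_measurable lborel"
    unfolding lborel_prod[symmetric] by measurable
  have i: "integrable (lborel \<Otimes>\<^sub>M lborel) (\<lambda>(x, y). (F x)\<^sup>2 * (G y)\<^sup>2)"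
    by (rule lborel_pair.Fubini_integrable) (use F2 G2 in auto)
  have eq2: "(F (fst z) * G (snd z))\<^sup>2 = (case z of (x, y) \<Rightarrow> (F x)\<^sup>2 * (G y)\<^sup>2)" for z
    by (cases z) (simp add: power_mult_distrib)
  have sq: "integrable lborel (\<lambda>z. (F (fst z) * G (snd z))\<^sup>2)"
    using i unfolding lborel_prod eq2 .
  show "square_integrable_on (A \<times> B) (\<lambda>(x, y). f x * g y)"
    using m sq unfolding square_integrable_on_def set_borel_measurable_def set_integrable_def
      real_scaleR_def indicator_mult_power2[symmetric] eq by simp
  have "(LINT z|lborel. (F (fst z) * G (snd z))\<^sup>2) = integral\<^sup>L (lborel \<Otimes>\<^sub>M lborel) (\<lambda>(x, y). (F x)\<^sup>2 * (G y)\<^sup>2)"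
    unfolding lborel_prod eq2 by simp
  also have "\<dots> = (LINT x|lborel. LINT y|lborel. (F x)\<^sup>2 * (G y)\<^sup>2)"
    using lborel_pair.integral_fst'[OF i] by simp
  also have "\<dots> = (LINT x|lborel. (F x)\<^sup>2) * (LINT y|lborel. (G y)\<^sup>2)" by simp
  finally show "L2_norm_on (A \<times> B) (\<lambda>(x, y). f x * g y) = L2_norm_on A f * L2_norm_on B g"
    unfolding L2_norm_on_def set_lebesgue_integral_def real_scaleR_def
      indicator_mult_power2[symmetric] eq
    by (simp add: real_sqrt_mult F_def G_def)
qed

section \<open>Essentially bounded densities\<close>

lemma set_borel_measurable_iff_restrict:
  fixes f :: "real \<Rightarrow> real"
  assumes "S \<in> sets borel"
  shows "set_borel_measurable lborel S f \<longleftrightarrow> f \<in> borel_measurable (restrict_space lborel S)"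
  unfolding set_borel_measurable_def
  using assms by (subst borel_measurable_restrict_space_iff) (auto simp: mult.commute)

text \<open>The absolute value around \<open>Linf_norm_on\<close> spares a proof that it is
  nonnegative; the essential supremum over a null set is minus infinity, which becomes 0 as a real
  number.\<close>

lemma essentially_bounded_onD:
  assumes "essentially_bounded_on S f" "S \<in> sets borel"
  shows "AE x in lborel. x \<in> S \<longrightarrow> \<bar>f x\<bar> \<le> \<bar>Linf_norm_on S f\<bar>"
proof -
  define E where "E = esssup (restrict_space lborel S) (\<lambda>x. ereal \<bar>f x\<bar>)"
  have "AE x in restrict_space lborel S. ereal \<bar>f x\<bar> \<le> E" unfolding E_def by (rule esssup_AE)
  moreover have "E < \<infinity>" using assms unfolding E_def essentially_bounded_on_def by simp
  moreover have "\<bar>r\<bar> \<le> \<bar>real_of_ereal E\<bar>" if "ereal \<bar>r\<bar> \<le> E" "E < \<infinity>" for r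
    using that by (cases E) auto
  ultimately have "AE x in restrict_space lborel S. \<bar>f x\<bar> \<le> \<bar>real_of_ereal E\<bar>" by auto
  then show ?thesis
    using assms(2) unfolding Linf_norm_on_def E_def by (subst (asm) AE_restrict_space_iff) auto
qed

lemma essentially_bounded_on_diff:
  assumes f: "essentially_bounded_on S f" and g: "essentially_bounded_on S g" and S: "S \<in> sets borel"
  shows "essentially_bounded_on S (\<lambda>x. f x - g x)"
proof -
  have m: "set_borel_measurable lborel S (\<lambda>x. f x - g x)"
    using f g unfolding essentially_bounded_on_def set_borel_measurable_iff_restrict[OF S]
    by (intro borel_measurable_diff) simp_all
  define C where "C = \<bar>Linf_norm_on S f\<bar> + \<bar>Linf_norm_on S g\<bar>"
  have "AE x in lborel. x \<in> S \<longrightarrow> \<bar>f x - g x\<bar> \<le> C"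
    using essentially_bounded_onD[OF f S] essentially_bounded_onD[OF g S]
    unfolding C_def by eventually_elim auto
  then have "AE x in restrict_space lborel S. ereal \<bar>f x - g x\<bar> \<le> ereal C"
    using S by (subst AE_restrict_space_iff) auto
  then have "esssup (restrict_space lborel S) (\<lambda>x. ereal \<bar>f x - g x\<bar>) \<le> ereal C"
    using m unfolding set_borel_measurable_iff_restrict[OF S] by (intro esssup_I) auto
  then show ?thesis using m unfolding essentially_bounded_on_def
    by (metis ereal_infty_less(1) less_ereal.simps(4) order_le_less_trans)
qed

lemma Linf_integral_le:
  assumes f: "essentially_bounded_on S f" and S: "S \<in> sets borel"
    and g: "set_integrable lborel S g"
  shows "set_integrable lborel S (\<lambda>x. f x * g x)"
    and "\<bar>LINT x:S|lborel. f x * g x\<bar> \<le> \<bar>Linf_norm_on S f\<bar> * (LINT x:S|lborel. \<bar>g x\<bar>)"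
proof -
  define C where "C = \<bar>Linf_norm_on S f\<bar>"
  have fm: "(\<lambda>x. indicator S x * f x) \<in> borel_measurable lborel"
    using f unfolding essentially_bounded_on_def set_borel_measurable_def by simp
  have gi: "integrable lborel (\<lambda>x. indicator S x * g x)" using g unfolding set_integrable_def by simp
  have eq: "indicator S x * f x * (indicator S x * g x) = indicator S x * (f x * g x)" for x
    by (simp add: indicator_def)
  have ae: "AE x in lborel. \<bar>indicator S x * (f x * g x)\<bar> \<le> C * (indicator S x * \<bar>g x\<bar>)"
    using essentially_bounded_onD[OF f S]
    by eventually_elim (auto simp: indicator_def C_def abs_mult intro!: mult_right_mono)
  have ga: "integrable lborel (\<lambda>x. C * (indicator S x * \<bar>g x\<bar>))"
    using integrable_abs[OF gi] by (intro integrable_mult_right) (simp add: abs_mult)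
  have m: "(\<lambda>x. indicator S x * (f x * g x)) \<in> borel_measurable lborel"
    using borel_measurable_times[OF fm borel_measurable_integrable[OF gi]] unfolding eq .
  have C0: "0 \<le> C" unfolding C_def by simp
  have int: "integrable lborel (\<lambda>x. indicator S x * (f x * g x))"
    by (rule Bochner_Integration.integrable_bound[OF ga m]) (use ae C0 in \<open>auto simp: abs_mult\<close>)
  then show "set_integrable lborel S (\<lambda>x. f x * g x)" unfolding set_integrable_def by simp
  have "\<bar>LINT x|lborel. indicator S x * (f x * g x)\<bar> \<le> (LINT x|lborel. \<bar>indicator S x * (f x * g x)\<bar>)"
    by simp
  also have "\<dots> \<le> (LINT x|lborel. C * (indicator S x * \<bar>g x\<bar>))"
    by (rule integral_mono_AE[OF integrable_abs[OF int] ga ae])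
  finally show "\<bar>LINT x:S|lborel. f x * g x\<bar> \<le> \<bar>Linf_norm_on S f\<bar> * (LINT x:S|lborel. \<bar>g x\<bar>)"
    unfolding set_lebesgue_integral_def C_def by simp
qed

text \<open>The size of a path as seen by an element of chi. It is much weaker than the supremum
  norm: for the gap of the smoothed path the L2 part has the rate \<open>sqrt \<epsilon>\<close>,
  which the supremum lacks.\<close>

definition path_weight :: "real \<Rightarrow> path \<Rightarrow> real" where
  "path_weight T \<phi> = \<bar>apply_bcontfun \<phi> 0\<bar> + L2_norm_on {-T..0} (apply_bcontfun \<phi>)"

lemma path_weight_nonneg: "0 \<le> path_weight T \<phi>"
  unfolding path_weight_def by (intro add_nonneg_nonneg L2_norm_on_nonneg) simp

text \<open>The factor that the component \<open>g\<^sub>2 dx \<otimes> \<delta>\<^sub>0\<close>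
  contributes in front of the value at 0 of the second argument.\<close>

definition chi_row :: "real \<Rightarrow> chi \<Rightarrow> path \<Rightarrow> real" where
  "chi_row T \<mu> \<phi> = (LINT x:{-T..0}|lborel. chi_g2 \<mu> x * apply_bcontfun \<phi> x)"

abbreviation chi_form :: "real \<Rightarrow> chi \<Rightarrow> path \<Rightarrow> path \<Rightarrow> real" where
  "chi_form T \<mu> \<phi> \<psi> \<equiv> chi_integral T \<mu> (\<lambda>(x, y). apply_bcontfun \<phi> x * apply_bcontfun \<psi> y)"

lemma chi_form_eq:
  assumes "0 \<le> T"
  shows "chi_form T \<mu> \<phi> \<psi> =
    (LINT z:{-T..0} \<times> {-T..0}|lborel. chi_g1 \<mu> z * (\<lambda>(x, y). apply_bcontfun \<phi> x * apply_bcontfun \<psi> y) z)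
    + chi_lambda \<mu> * (apply_bcontfun \<phi> 0 * apply_bcontfun \<psi> 0)
    + chi_row T \<mu> \<phi> * apply_bcontfun \<psi> 0
    + apply_bcontfun \<phi> 0 * (LINT y:{-T..0}|lborel. chi_g3 \<mu> y * apply_bcontfun \<psi> y)
    + (LINT y:{-T..0}|lborel. chi_g4 \<mu> y * (apply_bcontfun \<phi> y * apply_bcontfun \<psi> y))"
proof -
  have I: "(LBINT x=-T..0. f x) = (LINT x:{-T..0}|lborel. f x)" for f :: "real \<Rightarrow> real"
    using interval_integral_Icc[of "-T" 0 f] assms by (simp add: zero_ereal_def)
  have 2: "(LINT x:{-T..0}|lborel. chi_g2 \<mu> x * (apply_bcontfun \<phi> x * apply_bcontfun \<psi> 0))
      = chi_row T \<mu> \<phi> * apply_bcontfun \<psi> 0"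
    unfolding chi_row_def mult.assoc[symmetric] by (rule set_integral_mult_left)
  have 3: "(LINT y:{-T..0}|lborel. chi_g3 \<mu> y * (apply_bcontfun \<phi> 0 * apply_bcontfun \<psi> y))
      = apply_bcontfun \<phi> 0 * (LINT y:{-T..0}|lborel. chi_g3 \<mu> y * apply_bcontfun \<psi> y)"
    unfolding mult.left_commute[of _ "apply_bcontfun \<phi> 0"] by (rule set_integral_mult_right)
  show ?thesis unfolding chi_integral_def I by (simp add: 2 3)
qed

lemma chi_components_le:
  shows "L2_norm_on ({-T..0} \<times> {-T..0}) (chi_g1 \<mu>) \<le> chi_norm T \<mu>" (is "?a \<le> _")
    and "\<bar>chi_lambda \<mu>\<bar> \<le> chi_norm T \<mu>" (is "\<bar>?l\<bar> \<le> _")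
    and "L2_norm_on {-T..0} (chi_g2 \<mu>) \<le> chi_norm T \<mu>" (is "?b \<le> _")
    and "L2_norm_on {-T..0} (chi_g3 \<mu>) \<le> chi_norm T \<mu>" (is "?c \<le> _")
    and "\<bar>Linf_norm_on {-T..0} (chi_g4 \<mu>)\<bar> \<le> chi_norm T \<mu>" (is "\<bar>?d\<bar> \<le> _")
  unfolding chi_norm_def
  by (intro real_le_rsqrt, simp)+

lemma L2_norm_on_path_le:
  assumes "0 \<le> T"
  shows "L2_norm_on {-T..0} (apply_bcontfun \<phi>) \<le> sqrt T * norm \<phi>"
  using square_integrable_on_bounded(2)[OF borel_measurable_apply_bcontfun abs_apply_bcontfun_le,
      of "{-T..0}" \<phi>] assms by (simp add: emeasure_lborel_Icc_eq)

text \<open>Only the part of the form involving the first row survives if the second argument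
  concentrates at \<open>0\<close>.\<close>

lemma chi_form_parts_le:
  assumes T: "0 \<le> T" and \<mu>: "\<mu> \<in> chi_space T"
  shows "\<bar>chi_form T \<mu> \<phi> \<psi> - (chi_lambda \<mu> * apply_bcontfun \<phi> 0 + chi_row T \<mu> \<phi>) * apply_bcontfun \<psi> 0\<bar>
      \<le> 3 * chi_norm T \<mu> * path_weight T \<phi> * L2_norm_on {-T..0} (apply_bcontfun \<psi>)"
    and "\<bar>chi_row T \<mu> \<phi>\<bar> \<le> chi_norm T \<mu> * L2_norm_on {-T..0} (apply_bcontfun \<phi>)"
proof -
  define n a b where "n = chi_norm T \<mu>" and "a = L2_norm_on {-T..0} (apply_bcontfun \<phi>)"
    and "b = L2_norm_on {-T..0} (apply_bcontfun \<psi>)"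
  have g: "square_integrable_on ({-T..0} \<times> {-T..0}) (chi_g1 \<mu>)"
    "square_integrable_on {-T..0} (chi_g2 \<mu>)" "square_integrable_on {-T..0} (chi_g3 \<mu>)"
    "essentially_bounded_on {-T..0} (chi_g4 \<mu>)"
    using \<mu> unfolding chi_space_def by auto
  note sq = square_integrable_on_path
  note comp = chi_components_le[where T=T and \<mu>=\<mu>, folded n_def]
  have pos: "0 \<le> a" "0 \<le> b" "0 \<le> n" "a \<le> path_weight T \<phi>" "\<bar>apply_bcontfun \<phi> 0\<bar> \<le> path_weight T \<phi>"
    using comp(2) L2_norm_on_nonneg unfolding a_def b_def path_weight_def by auto
  have 1: "\<bar>LINT z:{-T..0} \<times> {-T..0}|lborel. chi_g1 \<mu> z * (\<lambda>(x, y). apply_bcontfun \<phi> x * apply_bcontfun \<psi> y) z\<bar>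
      \<le> n * path_weight T \<phi> * b"
  proof -
    have "\<bar>LINT z:{-T..0} \<times> {-T..0}|lborel. chi_g1 \<mu> z * (\<lambda>(x, y). apply_bcontfun \<phi> x * apply_bcontfun \<psi> y) z\<bar>
      \<le> L2_norm_on ({-T..0} \<times> {-T..0}) (chi_g1 \<mu>) * (a * b)"
      using L2_Cauchy_Schwarz(2)[OF g(1) square_integrable_on_tensor(1)[OF sq sq], of \<phi> \<psi>]
      unfolding square_integrable_on_tensor(2)[OF sq sq] a_def b_def .
    also have "\<dots> \<le> n * (path_weight T \<phi> * b)"
      using pos comp(1) path_weight_nonneg by (intro mult_mono) auto
    finally show ?thesis by (simp add: mult.assoc)
  qed
  have "\<bar>LINT y:{-T..0}|lborel. chi_g3 \<mu> y * apply_bcontfun \<psi> y\<bar> \<le> L2_norm_on {-T..0} (chi_g3 \<mu>) * b"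
    unfolding b_def by (rule L2_Cauchy_Schwarz(2)[OF g(3) sq])
  also have "\<dots> \<le> n * b" using comp(4) pos by (intro mult_right_mono)
  finally have "\<bar>apply_bcontfun \<phi> 0\<bar> * \<bar>LINT y:{-T..0}|lborel. chi_g3 \<mu> y * apply_bcontfun \<psi> y\<bar>
      \<le> path_weight T \<phi> * (n * b)"
    using pos path_weight_nonneg by (intro mult_mono) auto
  then have 3: "\<bar>apply_bcontfun \<phi> 0 * (LINT y:{-T..0}|lborel. chi_g3 \<mu> y * apply_bcontfun \<psi> y)\<bar>
      \<le> n * path_weight T \<phi> * b" by (simp add: abs_mult mult_ac)
  have "\<bar>LINT y:{-T..0}|lborel. chi_g4 \<mu> y * (apply_bcontfun \<phi> y * apply_bcontfun \<psi> y)\<bar>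
      \<le> \<bar>Linf_norm_on {-T..0} (chi_g4 \<mu>)\<bar> * (LINT y:{-T..0}|lborel. \<bar>apply_bcontfun \<phi> y * apply_bcontfun \<psi> y\<bar>)"
    by (rule Linf_integral_le(2)[OF g(4)]) (auto intro: L2_Cauchy_Schwarz(1)[OF sq sq])
  also have "(LINT y:{-T..0}|lborel. \<bar>apply_bcontfun \<phi> y * apply_bcontfun \<psi> y\<bar>) \<le> a * b"
  proof -
    have s: "square_integrable_on {-T..0} (\<lambda>y. \<bar>apply_bcontfun \<theta> y\<bar>)" for \<theta>
      using square_integrable_on_bounded(1)[of "\<lambda>y. \<bar>apply_bcontfun \<theta> y\<bar>" "{-T..0}" "norm \<theta>"]
        abs_apply_bcontfun_le[of \<theta>] by (simp add: emeasure_lborel_Icc_eq)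
    have n: "L2_norm_on S (\<lambda>y. \<bar>f y\<bar>) = L2_norm_on S f" for S :: "real set" and f unfolding L2_norm_on_def by simp
    show ?thesis using L2_Cauchy_Schwarz(2)[OF s s, of \<phi> \<psi>] unfolding n a_def b_def abs_mult by linarith
  qed
  finally have "\<bar>LINT y:{-T..0}|lborel. chi_g4 \<mu> y * (apply_bcontfun \<phi> y * apply_bcontfun \<psi> y)\<bar>
      \<le> \<bar>Linf_norm_on {-T..0} (chi_g4 \<mu>)\<bar> * (a * b)"
    by (simp add: mult_left_mono)
  also have "\<dots> \<le> n * (path_weight T \<phi> * b)"
    using pos comp(5) path_weight_nonneg by (intro mult_mono) auto
  finally have 4: "\<bar>LINT y:{-T..0}|lborel. chi_g4 \<mu> y * (apply_bcontfun \<phi> y * apply_bcontfun \<psi> y)\<bar>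
      \<le> n * path_weight T \<phi> * b" by (simp add: mult.assoc)
  \<comment> \<open>The factor 3 counts the components \<open>g\<^sub>1\<close>,
    \<open>g\<^sub>3\<close> and \<open>g\<^sub>4\<close>, each bounded by the same product; the
    contributions of \<open>\<lambda>\<close> and \<open>g\<^sub>2\<close> are exactly what is
    subtracted.\<close>
  show "\<bar>chi_form T \<mu> \<phi> \<psi> - (chi_lambda \<mu> * apply_bcontfun \<phi> 0 + chi_row T \<mu> \<phi>) * apply_bcontfun \<psi> 0\<bar>
      \<le> 3 * chi_norm T \<mu> * path_weight T \<phi> * L2_norm_on {-T..0} (apply_bcontfun \<psi>)"
  proof -
    define t1 t3 t4 where
      "t1 = (LINT z:{-T..0} \<times> {-T..0}|lborel. chi_g1 \<mu> z * (\<lambda>(x, y). apply_bcontfun \<phi> x * apply_bcontfun \<psi> y) z)"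
      and "t3 = apply_bcontfun \<phi> 0 * (LINT y:{-T..0}|lborel. chi_g3 \<mu> y * apply_bcontfun \<psi> y)"
      and "t4 = (LINT y:{-T..0}|lborel. chi_g4 \<mu> y * (apply_bcontfun \<phi> y * apply_bcontfun \<psi> y))"
    have "chi_form T \<mu> \<phi> \<psi> - (chi_lambda \<mu> * apply_bcontfun \<phi> 0 + chi_row T \<mu> \<phi>) * apply_bcontfun \<psi> 0
        = t1 + t3 + t4"
      unfolding chi_form_eq[OF T] t1_def[symmetric] t3_def[symmetric] t4_def[symmetric]
      by (simp only: algebra_simps)
    moreover have "\<bar>t1 + t3 + t4\<bar> \<le> 3 * (n * path_weight T \<phi> * b)"
      using 1 3 4 unfolding t1_def[symmetric] t3_def[symmetric] t4_def[symmetric] by linarith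
    ultimately show ?thesis unfolding n_def[symmetric] b_def[symmetric] by (simp only: mult.assoc)
  qed
  have "\<bar>chi_row T \<mu> \<phi>\<bar> \<le> L2_norm_on {-T..0} (chi_g2 \<mu>) * a"
    unfolding chi_row_def a_def by (rule L2_Cauchy_Schwarz(2)[OF g(2) sq])
  also have "\<dots> \<le> n * a" using comp(3) pos by (intro mult_right_mono)
  finally show "\<bar>chi_row T \<mu> \<phi>\<bar> \<le> chi_norm T \<mu> * L2_norm_on {-T..0} (apply_bcontfun \<phi>)"
    unfolding n_def a_def .
qed

text \<open>Only the values at 0 and the L2 norms of the arguments enter the bound. The constant 5
  is convenient, not sharp.\<close>

lemma chi_form_le:
  assumes T: "0 \<le> T" and \<mu>: "\<mu> \<in> chi_space T"
  shows "\<bar>chi_form T \<mu> \<phi> \<psi>\<bar> \<le> 5 * chi_norm T \<mu> * path_weight T \<phi> * path_weight T \<psi>"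
proof -
  define n a where "n = chi_norm T \<mu>" and "a = path_weight T \<phi>"
  define p b where "p = \<bar>apply_bcontfun \<psi> 0\<bar>" and "b = L2_norm_on {-T..0} (apply_bcontfun \<psi>)"
  have pos: "0 \<le> a" "0 \<le> n" "0 \<le> b" "0 \<le> p"
    using chi_components_le(2)[of \<mu> T] path_weight_nonneg[of T \<phi>] L2_norm_on_nonneg
    unfolding n_def a_def b_def p_def by auto
  have "\<bar>chi_lambda \<mu> * apply_bcontfun \<phi> 0\<bar> \<le> n * \<bar>apply_bcontfun \<phi> 0\<bar>"
    unfolding abs_mult n_def by (intro mult_right_mono chi_components_le) auto
  moreover have "\<bar>chi_row T \<mu> \<phi>\<bar> \<le> n * L2_norm_on {-T..0} (apply_bcontfun \<phi>)"
    unfolding n_def by (rule chi_form_parts_le(2)[OF T \<mu>])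
  ultimately have "\<bar>chi_lambda \<mu> * apply_bcontfun \<phi> 0 + chi_row T \<mu> \<phi>\<bar> \<le> n * a"
    unfolding a_def path_weight_def distrib_left by linarith
  then have "\<bar>(chi_lambda \<mu> * apply_bcontfun \<phi> 0 + chi_row T \<mu> \<phi>) * apply_bcontfun \<psi> 0\<bar> \<le> n * a * p"
    unfolding abs_mult[of _ "apply_bcontfun \<psi> 0"] p_def by (intro mult_right_mono) auto
  then have "\<bar>chi_form T \<mu> \<phi> \<psi>\<bar> \<le> n * a * p + 3 * n * a * b"
    using chi_form_parts_le(1)[OF T \<mu>, of \<phi> \<psi>] unfolding n_def[symmetric] a_def[symmetric] b_def[symmetric]
    by linarith
  also have "\<dots> \<le> 5 * n * a * (p + b)"
    using mult_nonneg_nonneg[OF mult_nonneg_nonneg[OF pos(2,1)] pos(3)]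
      mult_nonneg_nonneg[OF mult_nonneg_nonneg[OF pos(2,1)] pos(4)]
    by (simp add: algebra_simps)
  finally show ?thesis unfolding n_def a_def b_def p_def path_weight_def[of T \<psi>] .
qed

lemma chi_diff_in_chi_space:
  assumes "\<mu> \<in> chi_space T" "\<nu> \<in> chi_space T"
  shows "chi_diff \<mu> \<nu> \<in> chi_space T"
  using assms unfolding chi_space_def chi_diff_def mem_Collect_eq chi.sel
  by (intro conjI square_integrable_on_diff essentially_bounded_on_diff) simp_all

lemma chi_diff_linear:
  assumes T: "0 \<le> T" and \<mu>: "\<mu> \<in> chi_space T" and \<nu>: "\<nu> \<in> chi_space T"
  shows "chi_form T (chi_diff \<mu> \<nu>) \<phi> \<psi> = chi_form T \<mu> \<phi> \<psi> - chi_form T \<nu> \<phi> \<psi>"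
    and "chi_row T (chi_diff \<mu> \<nu>) \<phi> = chi_row T \<mu> \<phi> - chi_row T \<nu> \<phi>"
proof -
  have g: "square_integrable_on ({-T..0} \<times> {-T..0}) (chi_g1 \<rho>)"
    "square_integrable_on {-T..0} (chi_g2 \<rho>)" "square_integrable_on {-T..0} (chi_g3 \<rho>)"
    "essentially_bounded_on {-T..0} (chi_g4 \<rho>)" if "\<rho> \<in> chi_space T" for \<rho>
    using that unfolding chi_space_def by auto
  note sq = square_integrable_on_path
  have d: "(LINT z:S|lborel. (f z - g z) * h z) = (LINT z:S|lborel. f z * h z) - (LINT z:S|lborel. g z * h z)"
    if "set_integrable lborel S (\<lambda>z. f z * h z)" "set_integrable lborel S (\<lambda>z. g z * h z)"
    for S and f g h :: "'e::euclidean_space \<Rightarrow> real"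
    unfolding left_diff_distrib by (rule set_integral_diff(2)[OF that])
  note t = square_integrable_on_tensor(1)[OF sq sq]
  have 1: "(LINT z:{-T..0} \<times> {-T..0}|lborel. chi_g1 (chi_diff \<mu> \<nu>) z * k z)
      = (LINT z:{-T..0} \<times> {-T..0}|lborel. chi_g1 \<mu> z * k z) - (LINT z:{-T..0} \<times> {-T..0}|lborel. chi_g1 \<nu> z * k z)"
    if "square_integrable_on ({-T..0} \<times> {-T..0}) k" for k
    unfolding chi_diff_def chi.sel
    by (rule d) (rule L2_Cauchy_Schwarz(1)[OF g(1) that], rule \<mu> \<nu>)+
  have 2: "chi_row T (chi_diff \<mu> \<nu>) \<phi> = chi_row T \<mu> \<phi> - chi_row T \<nu> \<phi>"
    unfolding chi_row_def chi_diff_def chi.sel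
    by (rule d) (rule L2_Cauchy_Schwarz(1)[OF g(2) sq], rule \<mu> \<nu>)+
  have 3: "(LINT y:{-T..0}|lborel. chi_g3 (chi_diff \<mu> \<nu>) y * apply_bcontfun \<psi> y) =
     (LINT y:{-T..0}|lborel. chi_g3 \<mu> y * apply_bcontfun \<psi> y) - (LINT y:{-T..0}|lborel. chi_g3 \<nu> y * apply_bcontfun \<psi> y)"
    unfolding chi_diff_def chi.sel
    by (rule d) (rule L2_Cauchy_Schwarz(1)[OF g(3) sq], rule \<mu> \<nu>)+
  have 4: "(LINT y:{-T..0}|lborel. chi_g4 (chi_diff \<mu> \<nu>) y * (apply_bcontfun \<phi> y * apply_bcontfun \<psi> y)) =
     (LINT y:{-T..0}|lborel. chi_g4 \<mu> y * (apply_bcontfun \<phi> y * apply_bcontfun \<psi> y))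
     - (LINT y:{-T..0}|lborel. chi_g4 \<nu> y * (apply_bcontfun \<phi> y * apply_bcontfun \<psi> y))"
    unfolding chi_diff_def chi.sel
    by (rule d) (rule Linf_integral_le(1)[OF g(4) _ L2_Cauchy_Schwarz(1)[OF sq sq]], rule \<mu> \<nu>, simp)+
  have l: "chi_lambda (chi_diff \<mu> \<nu>) = chi_lambda \<mu> - chi_lambda \<nu>" by (simp add: chi_diff_def)
  show "chi_form T (chi_diff \<mu> \<nu>) \<phi> \<psi> = chi_form T \<mu> \<phi> \<psi> - chi_form T \<nu> \<phi> \<psi>"
    unfolding chi_form_eq[OF T] 1[OF t] 2 3 4 l by (simp add: algebra_simps)
  show "chi_row T (chi_diff \<mu> \<nu>) \<phi> = chi_row T \<mu> \<phi> - chi_row T \<nu> \<phi>" by (rule 2)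
qed

lemma L2_norm_tent_tendsto:
  fixes T :: real
  shows "(\<lambda>n. L2_norm_on {-T..0} (apply_bcontfun (tent n))) \<longlonglongrightarrow> 0"
proof -
  have "(\<lambda>n. LINT x|lborel. indicator {-T..0} x * (apply_bcontfun (tent n) x)\<^sup>2) \<longlonglongrightarrow> (LINT x|lborel. indicator {-T..0} x * (indicator {0} x)\<^sup>2 :: real)"
  proof (rule integral_dominated_convergence[where w="indicator {-T..0}"])
    show "AE x in lborel. (\<lambda>n. indicator {-T..0} x * (apply_bcontfun (tent n) x)\<^sup>2) \<longlonglongrightarrow> indicator {-T..0} x * (indicator {0} x)\<^sup>2"
      by (intro AE_I2 tendsto_intros tent_tendsto)
    show "AE x in lborel. norm (indicator {-T..0} x * (apply_bcontfun (tent n) x)\<^sup>2) \<le> indicat_real {-T..0} x" for n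
    proof (rule AE_I2)
      fix x
      have "\<bar>apply_bcontfun (tent n) x\<bar> \<le> 1"
        using abs_apply_bcontfun_le[of "tent n" x] norm_tent_le[of n] by linarith
      then have "(apply_bcontfun (tent n) x)\<^sup>2 \<le> 1" by (simp add: abs_square_le_1)
      then show "norm (indicator {-T..0} x * (apply_bcontfun (tent n) x)\<^sup>2) \<le> indicat_real {-T..0} x"
        by (simp add: indicator_def)
    qed
  qed (auto simp: emeasure_lborel_Icc_eq intro!: integrable_real_indicator)
  moreover have "(LINT x|lborel. indicator {-T..0} x * (indicator {0} x)\<^sup>2 :: real) = 0"
  proof (rule integral_eq_zero_AE)
    show "AE x in lborel. indicator {-T..0} x * (indicator {0} x)\<^sup>2 = (0::real)"
      using AE_lborel_singleton[of "0::real"] by eventually_elim simp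
  qed
  ultimately have "(\<lambda>n. LINT x|lborel. indicator {-T..0} x * (apply_bcontfun (tent n) x)\<^sup>2) \<longlonglongrightarrow> 0" by simp
  from tendsto_real_sqrt[OF this] show ?thesis
    unfolding L2_norm_on_def set_lebesgue_integral_def by simp
qed

text \<open>The L2 norm of the tents vanishes while their value at 0 stays 1. Applied to
  \<open>D2u\<close>, the limit is the derivative of the atom of \<open>Du\<close> in the direction
  \<open>\<phi>\<close>.\<close>

lemma chi_form_tent_tendsto:
  assumes T: "0 \<le> T" and \<mu>: "\<mu> \<in> chi_space T"
  shows "(\<lambda>n. chi_form T \<mu> \<phi> (tent n)) \<longlonglongrightarrow> chi_lambda \<mu> * apply_bcontfun \<phi> 0 + chi_row T \<mu> \<phi>"
proof -
  have lim: "(\<lambda>n. 3 * chi_norm T \<mu> * path_weight T \<phi> * L2_norm_on {-T..0} (apply_bcontfun (tent n))) \<longlonglongrightarrow> 0"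
    by (intro tendsto_mult_right_zero L2_norm_tent_tendsto)
  have le: "norm (chi_form T \<mu> \<phi> (tent n) - (chi_lambda \<mu> * apply_bcontfun \<phi> 0 + chi_row T \<mu> \<phi>))
      \<le> 3 * chi_norm T \<mu> * path_weight T \<phi> * L2_norm_on {-T..0} (apply_bcontfun (tent n))" for n
    using chi_form_parts_le(1)[OF T \<mu>, of \<phi> "tent n"] by (simp add: apply_tent)
  have "(\<lambda>n. chi_form T \<mu> \<phi> (tent n) - (chi_lambda \<mu> * apply_bcontfun \<phi> 0 + chi_row T \<mu> \<phi>)) \<longlonglongrightarrow> 0"
    by (rule Lim_null_comparison[OF _ lim]) (rule always_eventually, rule allI, rule le)
  then show ?thesis by (simp add: LIM_zero_iff)
qed

lemma path_weight_tent_tendsto: "(\<lambda>n. path_weight T (tent n)) \<longlonglongrightarrow> 1"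
  using tendsto_add[OF tendsto_const[of 1] L2_norm_tent_tendsto[of T]]
  unfolding path_weight_def by (simp add: apply_tent)

section \<open>Oscillating kernels and compactness\<close>

text \<open>Induction over the Borel sets from intervals. For a countable disjoint union the limit
  and the sum are exchanged by Tannery's theorem, the terms being dominated by \<open>C\<close>
  times the measure of \<open>F i \<inter> {a..b}\<close>.\<close>

lemma weakly_null_set:
  fixes k :: "nat \<Rightarrow> real \<Rightarrow> real"
  assumes k[measurable]: "\<And>n. k n \<in> borel_measurable borel" and C: "\<And>n x. \<bar>k n x\<bar> \<le> C"
    and null: "\<And>c d. a \<le> c \<Longrightarrow> c \<le> d \<Longrightarrow> d \<le> b \<Longrightarrow> (\<lambda>n. LINT x:{c..d}|lborel. k n x) \<longlonglongrightarrow> 0"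
    and A: "A \<in> sets borel"
  shows "(\<lambda>n. LINT x:A|lborel. indicator {a..b} x * k n x) \<longlonglongrightarrow> 0"
proof -
  have C0: "0 \<le> C" using C[of 0 0] by linarith
  have int: "integrable lborel (\<lambda>x. indicator {a..b} x * k n x)" for n
  proof (rule Bochner_Integration.integrable_bound)
    show "integrable lborel (\<lambda>x. C * indicat_real {a..b} x)"
      by (intro integrable_mult_right integrable_real_indicator) (auto simp: emeasure_lborel_Icc_eq)
    show "AE x in lborel. norm (indicator {a..b} x * k n x) \<le> norm (C * indicat_real {a..b} x)"
      using C C0 by (intro AE_I2) (auto simp: indicator_def)
  qed simp
  have sint: "set_integrable lborel B (\<lambda>x. indicator {a..b} x * k n x)" if "B \<in> sets borel" for B n
    unfolding set_integrable_def real_scaleR_def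
    using integrable_mult_indicator[OF _ int, of B n] that by simp
  show ?thesis
    using A
  proof (induction A rule: borel_set_induct)
    case empty
    then show ?case by (simp add: set_lebesgue_integral_def)
  next
    case (interval c d)
    show ?case
    proof (cases "max a c \<le> min b d")
      case True
      have "indicator {c..d} x * (indicator {a..b} x * k n x) = indicator {max a c..min b d} x * k n x" for n x
        by (auto simp: indicator_def)
      then have "(LINT x:{c..d}|lborel. indicator {a..b} x * k n x) = (LINT x:{max a c..min b d}|lborel. k n x)" for n
        unfolding set_lebesgue_integral_def real_scaleR_def by (intro Bochner_Integration.integral_cong refl)
      then show ?thesis using null[OF _ True] by simp
    next
      case False
      have "(\<lambda>x. indicator {c..d} x * (indicator {a..b} x * k n x)) = (\<lambda>x. 0)" for n
        by (rule ext) (use False in \<open>auto simp: indicator_def\<close>)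
      then show ?thesis unfolding set_lebesgue_integral_def real_scaleR_def by simp
    qed
  next
    case (compl A)
    have "(\<lambda>n. LINT x:UNIV|lborel. indicator {a..b} x * k n x) \<longlonglongrightarrow> 0"
    proof (cases "a \<le> b")
      case True
      then show ?thesis using null[of a b] by (simp add: set_lebesgue_integral_def)
    qed (simp add: set_lebesgue_integral_def)
    from tendsto_diff[OF this compl(2)]
    have "(\<lambda>n. (LINT x:UNIV|lborel. indicator {a..b} x * k n x) - (LINT x:A|lborel. indicator {a..b} x * k n x)) \<longlonglongrightarrow> 0"
      by simp
    moreover have "(LINT x:UNIV|lborel. indicator {a..b} x * k n x) - (LINT x:A|lborel. indicator {a..b} x * k n x)
        = (LINT x:-A|lborel. indicator {a..b} x * k n x)" for n
      using set_integral_Un[OF _ sint sint, of A "- A" n] compl(1) by simp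
    ultimately show ?case by simp
  next
    case (union F)
    define m where "m i = measure lborel (F i \<inter> {a..b})" for i
    have fin: "emeasure lborel (B \<inter> {a..b}) \<noteq> \<infinity>" if "B \<in> sets borel" for B
    proof -
      have "emeasure lborel (B \<inter> {a..b}) \<le> emeasure lborel {a..b}" by (rule emeasure_mono) auto
      also have "\<dots> < \<infinity>" by (simp add: emeasure_lborel_Icc_eq)
      finally show ?thesis by simp
    qed
    have "(\<lambda>i. measure lborel (F i \<inter> {a..b})) sums measure lborel (\<Union>i. F i \<inter> {a..b})"
    proof (rule measure_UNION)
      show "disjoint_family (\<lambda>i. F i \<inter> {a..b})"
        by (rule disjoint_family_subset[OF union(1)]) simp
      show "range (\<lambda>i. F i \<inter> {a..b}) \<subseteq> sets lborel"
        using union(2) by (intro image_subsetI) simp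
      have eq: "(\<Union>i. F i \<inter> {a..b}) = (\<Union>i. F i) \<inter> {a..b}" by blast
      have "(\<Union>i. F i) \<in> sets borel" by (rule sets.countable_UN) (use union(2) in blast)
      then show "emeasure lborel (\<Union>i. F i \<inter> {a..b}) \<noteq> \<infinity>"
        unfolding eq by (rule fin)
    qed
    then have sm: "summable (\<lambda>i. C * m i)" unfolding m_def by (intro summable_mult sums_summable)
    have le: "norm (LINT x:F i|lborel. indicator {a..b} x * k n x) \<le> C * m i" for i n
    proof -
      have "norm (LINT x:F i|lborel. indicator {a..b} x * k n x)
          \<le> (LINT x|lborel. norm (indicator (F i) x *\<^sub>R (indicator {a..b} x * k n x)))"
        unfolding set_lebesgue_integral_def by (rule integral_norm_bound)
      also have "\<dots> \<le> (LINT x|lborel. C * indicator (F i \<inter> {a..b}) x)"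
      proof (rule integral_mono)
        show "integrable lborel (\<lambda>x. norm (indicator (F i) x *\<^sub>R (indicator {a..b} x * k n x)))"
          using sint[OF union(2), of i n] unfolding set_integrable_def by (rule integrable_norm)
        show "integrable lborel (\<lambda>x. C * indicat_real (F i \<inter> {a..b}) x)"
          using fin[OF union(2)] union(2)
          by (intro integrable_mult_right integrable_real_indicator) (auto simp: less_top)
        show "norm (indicator (F i) x *\<^sub>R (indicator {a..b} x * k n x)) \<le> C * indicat_real (F i \<inter> {a..b}) x" for x
          using C C0 by (auto simp: indicator_def)
      qed
      also have "\<dots> = C * m i" unfolding m_def by simp
      finally show ?thesis .
    qed
    have "(\<lambda>n. \<Sum>i. LINT x:F i|lborel. indicator {a..b} x * k n x) \<longlonglongrightarrow> (\<Sum>i. 0)"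
      proof -
      have "eventually (\<lambda>(i, n). norm (LINT x:F i|lborel. indicator {a..b} x * k n x) \<le> C * m i)
          (at_top \<times>\<^sub>F sequentially)"
        using le by (intro always_eventually) (simp add: split_beta)
      from tannerys_theorem[OF union(3) this sm] show ?thesis by simp
    qed
    moreover have "(LINT x:(\<Union>i. F i)|lborel. indicator {a..b} x * k n x) = (\<Sum>i. LINT x:F i|lborel. indicator {a..b} x * k n x)" for n
    proof (rule lebesgue_integral_countable_add)
      show "F i \<inter> F j = {}" if "i \<noteq> j" for i j
        using union(1) that by (simp add: disjoint_family_on_def)
      show "set_integrable lborel (\<Union>i. F i) (\<lambda>x. indicator {a..b} x * k n x)"
        by (rule sint, rule sets.countable_UN) (use union(2) in blast)
    qed (use union(2) in simp)
    ultimately show ?case by simp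
  qed
qed

text \<open>An abstract Riemann-Lebesgue lemma: for uniformly bounded kernels, vanishing averages
  over intervals suffice, because simple functions are dense in L1. It serves for sines and cosines
  at scale \<open>\<epsilon>\<close> and again for the correlations of the gap with the
  increments.\<close>

lemma weakly_null_integral:
  fixes k :: "nat \<Rightarrow> real \<Rightarrow> real"
  assumes k[measurable]: "\<And>n. k n \<in> borel_measurable borel" and C: "\<And>n x. \<bar>k n x\<bar> \<le> C"
    and null: "\<And>c d. a \<le> c \<Longrightarrow> c \<le> d \<Longrightarrow> d \<le> b \<Longrightarrow> (\<lambda>n. LINT x:{c..d}|lborel. k n x) \<longlonglongrightarrow> 0"
    and f: "set_integrable lborel {a..b} f"
  shows "(\<lambda>n. LINT x:{a..b}|lborel. f x * k n x) \<longlonglongrightarrow> 0"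
proof -
  define g where "g x = indicator {a..b} x * f x" for x
  have C0: "0 \<le> C" using C[of 0 0] by linarith
  define kk where "kk n x = indicator {a..b} x * k n x" for n x
  have kkm[measurable]: "kk n \<in> borel_measurable lborel" for n unfolding kk_def by measurable
  have kkC: "\<bar>kk n x\<bar> \<le> C" for n x using C[of n x] C0 unfolding kk_def by (auto simp: indicator_def)
  have prod: "integrable lborel (\<lambda>x. h x * kk n x)" if "integrable lborel h" for h n
    by (rule Bochner_Integration.integrable_bound[OF integrable_mult_right[OF that, of C]])
      (use that kkC C0 in \<open>auto simp: abs_mult mult.commute[of C] intro!: mult_left_mono AE_I2\<close>)
  have "integrable lborel g" using f unfolding set_integrable_def g_def by simp
  then have "(\<lambda>n. LINT x|lborel. g x * kk n x) \<longlonglongrightarrow> 0"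
  proof (induction rule: integrable_induct)
    case (base A c)
    have "(\<lambda>n. c * (LINT x:A|lborel. indicator {a..b} x * k n x)) \<longlonglongrightarrow> c * 0"
      by (intro tendsto_intros weakly_null_set[OF k C null]) (use base in auto)
    then show ?case unfolding set_lebesgue_integral_def kk_def by (simp add: mult_ac)
  next
    case (add f g)
    have "(LINT x|lborel. (f x + g x) * kk n x) = (LINT x|lborel. f x * kk n x) + (LINT x|lborel. g x * kk n x)" for n
      using prod[OF add.hyps(1)] prod[OF add.hyps(2)] by (simp add: distrib_right)
    then show ?case using tendsto_add[OF add.IH] by simp
  next
    case (lim f s)
    have "(\<lambda>i. LINT x|lborel. \<bar>s i x - f x\<bar>) \<longlonglongrightarrow> (LINT x|(lborel :: real measure). 0)"
    proof (rule integral_dominated_convergence[where w="\<lambda>x. 3 * \<bar>f x\<bar>"])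
      show "AE x in lborel. (\<lambda>i. \<bar>s i x - f x\<bar>) \<longlonglongrightarrow> 0"
        using lim.hyps(2) by (intro AE_I2 tendsto_rabs_zero) (simp add: LIM_zero)
      show "AE x in lborel. norm \<bar>s i x - f x\<bar> \<le> 3 * \<bar>f x\<bar>" for i
      proof (rule AE_I2)
        fix x show "norm \<bar>s i x - f x\<bar> \<le> 3 * \<bar>f x\<bar>" using lim.hyps(3)[of x i] by simp
      qed
    qed (use lim.hyps(1,4) in auto)
    then have l1: "(\<lambda>i. LINT x|lborel. \<bar>s i x - f x\<bar>) \<longlonglongrightarrow> 0" by simp
    show ?case
    proof (rule LIMSEQ_I)
      fix e :: real assume "0 < e"
      \<comment> \<open>Adding 1 to \<open>C\<close> keeps the denominator positive when
        \<open>C = 0\<close>.\<close>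
      obtain i where i: "(LINT x|lborel. \<bar>s i x - f x\<bar>) < e / (2 * (C + 1))"
        using LIMSEQ_D[OF l1, of "e / (2 * (C + 1))"] \<open>0 < e\<close> C0 by auto
      obtain N where N: "\<And>n. n \<ge> N \<Longrightarrow> \<bar>LINT x|lborel. s i x * kk n x\<bar> < e / 2"
        using LIMSEQ_D[OF lim.IH, of "e / 2" i] \<open>0 < e\<close> by auto
      have "norm ((LINT x|lborel. f x * kk n x) - 0) < e" if "N \<le> n" for n
      proof -
        have d: "(LINT x|lborel. s i x * kk n x) - (LINT x|lborel. f x * kk n x) = (LINT x|lborel. (s i x - f x) * kk n x)"
          using prod[OF lim.hyps(1)] prod[OF lim.hyps(4)] by (simp add: left_diff_distrib)
        have dif: "integrable lborel (\<lambda>x. s i x - f x)" using lim.hyps(1,4) by auto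
        have "\<bar>LINT x|lborel. (s i x - f x) * kk n x\<bar> \<le> (LINT x|lborel. \<bar>(s i x - f x) * kk n x\<bar>)"
          by simp
        also have "\<dots> \<le> (LINT x|lborel. C * \<bar>s i x - f x\<bar>)"
        proof (rule integral_mono)
          show "integrable lborel (\<lambda>x. \<bar>(s i x - f x) * kk n x\<bar>)"
            by (rule integrable_abs[OF prod[OF dif]])
          show "integrable lborel (\<lambda>x. C * \<bar>s i x - f x\<bar>)"
            by (rule integrable_mult_right[OF integrable_abs[OF dif]])
          show "\<bar>(s i x - f x) * kk n x\<bar> \<le> C * \<bar>s i x - f x\<bar>" for x
            unfolding abs_mult using mult_left_mono[OF kkC[of n x], of "\<bar>s i x - f x\<bar>"]
            by (simp add: mult.commute)
        qed
        also have "\<dots> \<le> C * (e / (2 * (C + 1)))" using mult_left_mono[OF less_imp_le[OF i] C0] by simp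
        also have "\<dots> < e / 2" using C0 \<open>0 < e\<close> by (simp add: field_simps)
        finally have "\<bar>LINT x|lborel. (s i x - f x) * kk n x\<bar> < e / 2" .
        then show ?thesis using N[OF that] d unfolding real_norm_def by (smt (verit) field_sum_of_halves)
      qed
      then show "\<exists>no. \<forall>n\<ge>no. norm ((LINT x|lborel. f x * kk n x) - 0) < e" by blast
    qed
  qed
  moreover have "(LINT x|lborel. g x * kk n x) = (LINT x:{a..b}|lborel. f x * k n x)" for n
    unfolding g_def kk_def set_lebesgue_integral_def
    by (rule Bochner_Integration.integral_cong) (auto simp: indicator_def)
  ultimately show ?thesis by simp
qed

text \<open>Lebesgue's number lemma for a binary relation. A relation is used, rather than a
  continuous map, because the type \<open>chi\<close> carries no topology; moreover \<open>q\<close>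
  and \<open>r\<close> may lie outside \<open>K\<close>.\<close>

lemma compact_uniform_neighbourhood:
  fixes K :: "'a::metric_space set"
  assumes K: "compact K"
    and loc: "\<And>p. p \<in> K \<Longrightarrow> \<exists>d>0. \<forall>q\<in>ball p d. \<forall>r\<in>ball p d. P q r"
  shows "\<exists>d>0. \<forall>p\<in>K. \<forall>q r. dist p q < d \<longrightarrow> dist p r < d \<longrightarrow> P q r"
proof -
  define \<G> where "\<G> = {ball p d | p d. p \<in> K \<and> 0 < d \<and> (\<forall>q\<in>ball p d. \<forall>r\<in>ball p d. P q r)}"
  have sub: "K \<subseteq> \<Union>\<G>"
  proof
    fix p assume "p \<in> K"
    with loc[OF this] obtain d where "0 < d" "\<forall>q\<in>ball p d. \<forall>r\<in>ball p d. P q r" by blast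
    then have "ball p d \<in> \<G>" "p \<in> ball p d" using \<open>p \<in> K\<close> unfolding \<G>_def by auto
    then show "p \<in> \<Union>\<G>" by blast
  qed
  have op: "open G" if "G \<in> \<G>" for G using that unfolding \<G>_def by auto
  obtain d where d: "0 < d" "\<And>p. p \<in> K \<Longrightarrow> \<exists>G\<in>\<G>. ball p d \<subseteq> G"
    by (rule Heine_Borel_lemma[OF K sub op]) auto
  show ?thesis
  proof (intro exI[of _ d] conjI d(1) ballI allI impI)
    fix p q r assume *: "p \<in> K" "dist p q < d" "dist p r < d"
    then obtain G where "G \<in> \<G>" "ball p d \<subseteq> G" using d(2) by blast
    moreover have "q \<in> G" "r \<in> G" using * \<open>ball p d \<subseteq> G\<close> by (auto simp: subset_iff)
    ultimately show "P q r" unfolding \<G>_def by blast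
  qed
qed

text \<open>Uniformity holds for pairs with only one point in \<open>K\<close>. This is what the
  smoothed windows require: they lie near the compact graph of the true windows, but off it, in a
  space that is not locally compact.\<close>

lemma compact_uniform_continuity:
  fixes f :: "'a::metric_space \<Rightarrow> 'b::metric_space"
  assumes K: "compact K" "K \<subseteq> D" and f: "continuous_on D f" and e: "0 < e"
  obtains d where "0 < d" "\<And>p q. p \<in> K \<Longrightarrow> q \<in> D \<Longrightarrow> dist p q < d \<Longrightarrow> dist (f q) (f p) < e"
proof -
  have "\<exists>d>0. \<forall>q\<in>ball p d. \<forall>r\<in>ball p d. q \<in> D \<longrightarrow> r \<in> D \<longrightarrow> dist (f q) (f r) < e" if "p \<in> K" for p
  proof -
    obtain d where d: "0 < d" "\<And>q. q \<in> D \<Longrightarrow> dist q p < d \<Longrightarrow> dist (f q) (f p) < e / 2"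
    proof (atomize_elim)
      have "p \<in> D" "0 < e / 2" using K(2) \<open>p \<in> K\<close> e by auto
      with f have "\<exists>d>0. \<forall>q\<in>D. dist q p < d \<longrightarrow> dist (f q) (f p) < e / 2"
        unfolding continuous_on_iff by blast
      then show "\<exists>d>0. \<forall>q. q \<in> D \<longrightarrow> dist q p < d \<longrightarrow> dist (f q) (f p) < e / 2" by blast
    qed
    have "dist (f q) (f r) < e" if "q \<in> ball p d" "r \<in> ball p d" "q \<in> D" "r \<in> D" for q r
      using d(2)[of q] d(2)[of r] that dist_triangle_half_l[of "f q" "f p" e "f r"]
      by (simp add: dist_commute)
    then show ?thesis using d(1) by blast
  qed
  from compact_uniform_neighbourhood[OF K(1) this] obtain d where d: "0 < d"
    "\<forall>p\<in>K. \<forall>q r. dist p q < d \<longrightarrow> dist p r < d \<longrightarrow> q \<in> D \<longrightarrow> r \<in> D \<longrightarrow> dist (f q) (f r) < e"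
    by blast
  show ?thesis
  proof (rule that[OF d(1)])
    fix p q assume "p \<in> K" "q \<in> D" "dist p q < d"
    then show "dist (f q) (f p) < e" using d K(2) by auto
  qed
qed

section \<open>Smoothing a path\<close>

text \<open>For \<open>r < 0\<close> the integral over \<open>{0..r}\<close> is over an empty set,
  hence 0; since \<open>f\<close> vanishes there, this agrees with the true primitive, and the
  derivative exists at 0 and to its left as well.\<close>

lemma primitive_has_derivative:
  fixes f :: "real \<Rightarrow> real"
  assumes f: "continuous_on UNIV f" and f0: "\<And>r. r \<le> 0 \<Longrightarrow> f r = 0"
  shows "((\<lambda>r. integral {0..r} f) has_real_derivative f r) (at r)"
proof -
  define A where "A = \<bar>r\<bar> + 1"
  have cf: "continuous_on S f" for S using f continuous_on_subset by blast
  have eq: "integral {0..s} f = integral {-A..s} f" if "s > -A" for s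
  proof (cases "0 \<le> s")
    case True
    have "integral {-A..0} f = integral {-A..0} (\<lambda>_. 0)"
      by (rule integral_cong) (use f0 in auto)
    then have "integral {-A..0} f = 0" by simp
    moreover have "integral {-A..0} f + integral {0..s} f = integral {-A..s} f"
      using True A_def by (intro Henstock_Kurzweil_Integration.integral_combine
          integrable_continuous_real cf) auto
    ultimately show ?thesis by simp
  next
    case False
    have "integral {-A..s} f = integral {-A..s} (\<lambda>_. 0)"
      by (rule integral_cong) (use f0 False in auto)
    then show ?thesis using False by simp
  qed
  have r: "-A < r" "r < A" unfolding A_def by auto
  have "((\<lambda>s. integral {-A..s} f) has_vector_derivative f r) (at r within {-A..A})"
    by (rule integral_has_vector_derivative[OF cf]) (use r in auto)
  then have "((\<lambda>s. integral {-A..s} f) has_real_derivative f r) (at r)"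
    using r by (simp add: has_real_derivative_iff_has_vector_derivative at_within_Icc_at)
  then show ?thesis
  proof (rule DERIV_cong_ev[OF refl _ refl, THEN iffD1, rotated])
    show "\<forall>\<^sub>F s in nhds r. integral {-A..s} f = integral {0..s} f"
      using eventually_nhds_in_open[of "{-A<..}" r] r by (auto elim!: eventually_mono simp: eq)
  qed
qed

text \<open>One trajectory of the extended process. Vanishing on the left encodes
  \<open>X 0 = 0\<close> together with the extension convention.\<close>

locale driving_path =
  fixes T :: real and x :: "real \<Rightarrow> real"
  assumes T: "0 < T" and x_cont: "continuous_on UNIV x"
    and x_left: "\<And>r. r \<le> 0 \<Longrightarrow> x r = 0" and x_right: "\<And>r. T \<le> r \<Longrightarrow> x r = x T"
begin

text \<open>The modulus of continuity of \<open>x\<close>; every error that is only known to be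
  small is measured by it.\<close>

definition osc :: "real \<Rightarrow> real" where
  "osc \<epsilon> = (SUP p\<in>{(r, s). \<bar>r - s\<bar> \<le> \<epsilon>}. \<bar>x (fst p) - x (snd p)\<bar>)"

lemma x_cont': "continuous_on S x"
  using x_cont continuous_on_subset by blast

lemma x_clamp: "x r = x (max 0 (min T r))"
  using x_left[of r] x_left[of 0] x_right[of r] T by (auto simp: max_def min_def)

lemma x_bounded: "\<exists>B\<ge>0. \<forall>r. \<bar>x r\<bar> \<le> B"
proof -
  have "compact (x ` {0..T})" by (intro compact_continuous_image x_cont') simp
  then obtain B where B: "\<And>r. r \<in> {0..T} \<Longrightarrow> \<bar>x r\<bar> \<le> B"
    by (meson bounded_real compact_imp_bounded imageI)
  have "\<bar>x r\<bar> \<le> B" for r unfolding x_clamp[of r] by (rule B) (use T in auto)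
  then show ?thesis by (meson abs_ge_zero order_trans)
qed

lemma x_uniform:
  assumes "0 < e"
  shows "\<exists>d>0. \<forall>r s. \<bar>r - s\<bar> \<le> d \<longrightarrow> \<bar>x r - x s\<bar> \<le> e"
proof -
  have "uniformly_continuous_on {0..T} x"
    by (intro compact_uniformly_continuous x_cont') simp
  then obtain d where d: "0 < d" "\<And>r s. r \<in> {0..T} \<Longrightarrow> s \<in> {0..T} \<Longrightarrow> \<bar>s - r\<bar> < d \<Longrightarrow> \<bar>x s - x r\<bar> < e"
    unfolding uniformly_continuous_on_def dist_real_def using assms by metis
  have "\<bar>x r - x s\<bar> \<le> e" if "\<bar>r - s\<bar> \<le> d / 2" for r s
    unfolding x_clamp[of r] x_clamp[of s]
    by (rule less_imp_le, rule d(2)) (use T d(1) that in \<open>auto simp: max_def min_def\<close>)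
  then show ?thesis using d(1) by (intro exI[of _ "d / 2"]) auto
qed

lemma osc_bound:
  assumes "\<bar>r - s\<bar> \<le> \<epsilon>"
  shows "\<bar>x r - x s\<bar> \<le> osc \<epsilon>"
proof -
  obtain B where B: "\<And>r. \<bar>x r\<bar> \<le> B" using x_bounded by blast
  have "\<bar>x r - x s\<bar> \<le> 2 * B" for r s using B[of r] B[of s] by linarith
  then have "bdd_above ((\<lambda>p. \<bar>x (fst p) - x (snd p)\<bar>) ` {(r, s). \<bar>r - s\<bar> \<le> \<epsilon>})"
    by (intro bdd_aboveI2[where M="2 * B"]) auto
  from cSUP_upper[OF _ this, of "(r, s)"] assms show ?thesis unfolding osc_def by simp
qed

lemma osc_nonneg: "0 \<le> \<epsilon> \<Longrightarrow> 0 \<le> osc \<epsilon>"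
  using osc_bound[of 0 0 \<epsilon>] by simp

lemma osc_tendsto: "(osc \<longlongrightarrow> 0) (at_right 0)"
proof (rule tendstoI)
  fix e :: real assume e: "0 < e"
  obtain d where d: "0 < d" "\<And>r s. \<bar>r - s\<bar> \<le> d \<Longrightarrow> \<bar>x r - x s\<bar> \<le> e / 2"
    using x_uniform[of "e / 2"] e by auto
  have "dist (osc \<epsilon>) 0 < e" if \<epsilon>: "0 < \<epsilon>" "\<epsilon> < d" for \<epsilon>
  proof -
    have "{(r, s). \<bar>r - s\<bar> \<le> \<epsilon>} \<noteq> {}" proof -
      have "(0, 0) \<in> {(r, s). \<bar>r - s\<bar> \<le> \<epsilon>}" using \<epsilon> by simp
      then show ?thesis by blast
    qed
    then have "osc \<epsilon> \<le> e / 2" unfolding osc_def by (rule cSUP_least) (use d \<epsilon> in auto)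
    then show ?thesis using osc_nonneg[of \<epsilon>] \<epsilon> e by simp
  qed
  then show "\<forall>\<^sub>F \<epsilon> in at_right 0. dist (osc \<epsilon>) 0 < e"
    using d(1) by (auto simp: eventually_at_right_field)
qed

text \<open>The integral is over the whole line, so it is invariant under translations; it is finite
  because \<open>x\<close> is constant outside \<open>[0,T]\<close>. Translation invariance is what
  makes the energy nearly subadditive in the shift.\<close>

definition energy :: "real \<Rightarrow> real" where
  "energy r = (LINT s|lborel. (x (s + r) - x s)\<^sup>2)"

lemma integrable_increment:
  "integrable lborel (\<lambda>s. (x (s + r) - x (s + r'))\<^sup>2)"
proof -
  define A where "A = \<bar>r\<bar> + \<bar>r'\<bar> + T"
  have "integrable lborel (\<lambda>s. indicator {-A..A} s *\<^sub>R (x (s + r) - x (s + r'))\<^sup>2)"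
    by (intro borel_integrable_compact continuous_intros continuous_on_compose2[OF x_cont]) auto
  moreover have "(\<lambda>s. indicator {-A..A} s *\<^sub>R (x (s + r) - x (s + r'))\<^sup>2) = (\<lambda>s. (x (s + r) - x (s + r'))\<^sup>2)"
  proof (rule ext)
    fix s
    show "indicator {-A..A} s *\<^sub>R (x (s + r) - x (s + r'))\<^sup>2 = (x (s + r) - x (s + r'))\<^sup>2"
  proof (cases "s \<in> {-A..A}")
    case False
    then have "s < - A \<or> A < s" by auto
    then have "(s + r \<le> 0 \<and> s + r' \<le> 0) \<or> (T \<le> s + r \<and> T \<le> s + r')"
      using T unfolding A_def by (smt (verit))
    then have "x (s + r) = x (s + r')"
      using x_left[of "s + r"] x_left[of "s + r'"] x_right[of "s + r"] x_right[of "s + r'"] by auto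
    then show ?thesis by simp
  qed simp
  qed
  ultimately show ?thesis by simp
qed

lemma energy_nonneg: "0 \<le> energy r"
  unfolding energy_def by simp

lemma energy_shift: "(LINT s|lborel. (x (s + r) - x (s + r'))\<^sup>2) = energy \<bar>r - r'\<bar>"
proof -
  have 1: "(LINT s|lborel. (x (s + r) - x (s + r'))\<^sup>2) = energy (r - r')"
    using lborel_integral_real_affine[of 1 "\<lambda>s. (x (s + r) - x (s + r'))\<^sup>2" "- r'"]
    unfolding energy_def by (simp add: algebra_simps)
  have "(LINT s|lborel. (x (s + r) - x (s + r'))\<^sup>2) = (LINT s|lborel. (x (s + r') - x (s + r))\<^sup>2)"
    by (simp add: power2_commute)
  also have "\<dots> = energy (r' - r)"
    using lborel_integral_real_affine[of 1 "\<lambda>s. (x (s + r') - x (s + r))\<^sup>2" "- r"]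
    unfolding energy_def by (simp add: algebra_simps)
  finally show ?thesis using 1 by (simp add: abs_if)
qed

lemma energy_subadditive: "energy r \<le> 2 * energy r' + 2 * energy \<bar>r - r'\<bar>"
proof -
  have "energy r \<le> (LINT s|lborel. 2 * (x (s + r') - x (s + 0))\<^sup>2 + 2 * (x (s + r) - x (s + r'))\<^sup>2)"
    unfolding energy_def
  proof (rule integral_mono)
    show "integrable lborel (\<lambda>s. (x (s + r) - x s)\<^sup>2)" using integrable_increment[of r 0] by simp
    show "integrable lborel (\<lambda>s. 2 * (x (s + r') - x (s + 0))\<^sup>2 + 2 * (x (s + r) - x (s + r'))\<^sup>2)"
      by (intro Bochner_Integration.integrable_add integrable_mult_right integrable_increment)
    fix s
    have "0 \<le> ((x (s + r') - x s) - (x (s + r) - x (s + r')))\<^sup>2" by simp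
    then show "(x (s + r) - x s)\<^sup>2 \<le> 2 * (x (s + r') - x (s + 0))\<^sup>2 + 2 * (x (s + r) - x (s + r'))\<^sup>2"
      by (simp add: power2_eq_square algebra_simps)
  qed
  also have "\<dots> = 2 * energy r' + 2 * energy \<bar>r - r'\<bar>"
    using energy_shift[of r' 0] energy_shift[of r r'] integrable_increment[of r' 0]
      integrable_increment[of r r'] by (simp add: energy_def)
  finally show ?thesis .
qed

lemma energy_measurable[measurable]: "energy \<in> borel_measurable borel"
proof -
  have "(\<lambda>p. (x (snd p + fst p) - x (snd p))\<^sup>2) \<in> borel_measurable (borel \<Otimes>\<^sub>M lborel)"
  proof -
    have [measurable]: "x \<in> borel_measurable borel" by (rule borel_measurable_continuous_onI[OF x_cont])
    show ?thesis by measurable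
  qed
  then have "(\<lambda>r. LINT s|lborel. (x (s + r) - x s)\<^sup>2) \<in> borel_measurable borel"
    by (intro lborel.borel_measurable_lebesgue_integral) (simp add: case_prod_unfold)
  then show ?thesis unfolding energy_def[abs_def] .
qed

text \<open>A large value of the energy forces it to be large for a quarter of the shorter shifts.\<close>

lemma energy_le:
  assumes B: "B \<in> sets borel" "measure lborel B < 1 / 4" "B \<subseteq> {0..1}"
    and K: "\<And>r. r \<in> {0..1} \<Longrightarrow> r \<notin> B \<Longrightarrow> energy (\<epsilon> * r) \<le> K" and \<epsilon>: "0 \<le> \<epsilon>" and r0: "r0 \<in> {0..1}"
  shows "energy (\<epsilon> * r0) \<le> 4 * K"
proof -
  have "emeasure lborel B \<le> emeasure lborel {0..1::real}" by (rule emeasure_mono[OF B(3)]) simp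
  then have fB: "emeasure lborel B < \<infinity>" 
    by (metis emeasure_lborel_Icc diff_zero ennreal_1 ennreal_less_top infinity_ennreal_def
        order_le_less_trans zero_le_one)
  define b where "b r = indicat_real B r" for r
  have bi: "integrable lborel b" "(LINT r|lborel. b r) = measure lborel B"
    unfolding b_def using B fB by (auto intro!: integrable_real_indicator)
  have b1: "integrable lborel (\<lambda>r. b (r0 + (-1) * r))" "(LINT r|lborel. b (r0 + (-1) * r)) = measure lborel B"
    using lborel_integrable_real_affine[OF bi(1), of "-1" r0] lborel_integral_real_affine[of "-1" b r0] bi(2) by simp_all
  have b2: "integrable lborel (\<lambda>r. b (-r0 + 1 * r))" "(LINT r|lborel. b (-r0 + 1 * r)) = measure lborel B"
    using lborel_integrable_real_affine[OF bi(1), of "1" "-r0"] lborel_integral_real_affine[of 1 b "-r0"] bi(2) by simp_all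
  \<comment> \<open>The set \<open>B\<close>, its reflection \<open>r0 - B\<close> and its translate
    \<open>r0 + B\<close> together have measure below 3/4, so some \<open>r\<close> in the unit
    interval avoids all three. Then both \<open>r\<close> and \<open>\<bar>r0 - r\<bar>\<close> are
    good shifts, and \<open>2 * K + 2 * K\<close> bounds the energy at \<open>r0\<close>.\<close>
  have "\<exists>r\<in>{0..1}. r \<notin> B \<and> r0 - r \<notin> B \<and> r - r0 \<notin> B"
  proof (rule ccontr)
    assume "\<not> ?thesis"
    then have le: "indicat_real {0..1} r \<le> b r + b (r0 + (-1) * r) + b (-r0 + 1 * r)" for r
      unfolding b_def by (auto simp: indicator_def)
    have "(LINT r|lborel. indicat_real {0..1::real} r) \<le> (LINT r|lborel. b r + b (r0 + (-1) * r) + b (-r0 + 1 * r))"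
    proof (rule integral_mono[OF _ _ le])
      show "integrable lborel (indicat_real {0..1::real})"
        by (rule integrable_real_indicator) (simp_all add: emeasure_lborel_Icc_eq)
      show "integrable lborel (\<lambda>r. b r + b (r0 + (-1) * r) + b (-r0 + 1 * r))"
        by (intro Bochner_Integration.integrable_add bi b1 b2)
    qed
    also have "\<dots> = 3 * measure lborel B" using bi b1 b2 by simp
    finally show False using B(2) by simp
  qed
  then obtain r where r: "r \<in> {0..1}" "r \<notin> B" "r0 - r \<notin> B" "r - r0 \<notin> B" by blast
  have "\<bar>r0 - r\<bar> \<in> {0..1}" "\<bar>r0 - r\<bar> \<notin> B" using r r0 by (auto simp: abs_if)
  from K[OF this] have "energy \<bar>\<epsilon> * r0 - \<epsilon> * r\<bar> \<le> K"
    using \<epsilon> by (simp add: right_diff_distrib[symmetric] abs_mult)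
  with energy_subadditive[of "\<epsilon> * r0" "\<epsilon> * r"] K[OF r(1,2)] show ?thesis by simp
qed

end

lemma integral_derivative:
  fixes F f :: "real \<Rightarrow> real"
  assumes "a \<le> b" "\<And>r. a \<le> r \<Longrightarrow> r \<le> b \<Longrightarrow> (F has_real_derivative f r) (at r within {a..b})"
  shows "integral {a..b} f = F b - F a"
  using fundamental_theorem_of_calculus[OF assms(1), of F f] assms(2)
  by (intro integral_unique) (auto simp: has_real_derivative_iff_has_vector_derivative)

lemma integral_abs_le_const:
  fixes f :: "real \<Rightarrow> real"
  assumes "a \<le> b" "continuous_on {a..b} f" "\<And>r. a \<le> r \<Longrightarrow> r \<le> b \<Longrightarrow> \<bar>f r\<bar> \<le> c"
  shows "\<bar>integral {a..b} f\<bar> \<le> c * (b - a)"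
  using integral_bound[OF assms(1,2), of c] assms(3) by simp

text \<open>Made for errors living on \<open>[0,\<epsilon>]\<close>, namely those caused by
  modifying the smoothed path near 0.\<close>

lemma integral_abs_le_const_prefix:
  fixes f :: "real \<Rightarrow> real"
  assumes cf: "continuous_on {0..\<tau>} f" and "0 \<le> \<tau>" "0 \<le> \<epsilon>" "0 \<le> c"
    and le: "\<And>r. 0 \<le> r \<Longrightarrow> r \<le> \<epsilon> \<Longrightarrow> r \<le> \<tau> \<Longrightarrow> \<bar>f r\<bar> \<le> c" and z: "\<And>r. \<epsilon> \<le> r \<Longrightarrow> f r = 0"
  shows "\<bar>integral {0..\<tau>} f\<bar> \<le> c * \<epsilon>"
proof (cases "\<tau> \<le> \<epsilon>")
  case True
  have "\<bar>integral {0..\<tau>} f\<bar> \<le> c * (\<tau> - 0)"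
    by (rule integral_abs_le_const) (use assms True in auto)
  also have "\<dots> \<le> c * \<epsilon>" using True assms by (simp add: mult_left_mono)
  finally show ?thesis .
next
  case False
  have "integral {\<epsilon>..\<tau>} f = integral {\<epsilon>..\<tau>} (\<lambda>_. 0)"
    by (rule integral_cong) (use z in auto)
  then have "integral {\<epsilon>..\<tau>} f = 0" by simp
  moreover have "integral {0..\<epsilon>} f + integral {\<epsilon>..\<tau>} f = integral {0..\<tau>} f"
    using False assms by (intro Henstock_Kurzweil_Integration.integral_combine integrable_continuous_real) auto
  moreover have "\<bar>integral {0..\<epsilon>} f\<bar> \<le> c * (\<epsilon> - 0)"
    by (rule integral_abs_le_const) (use assms False in \<open>auto intro: continuous_on_subset\<close>)
  ultimately show ?thesis by simp
qed

context driving_path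
begin

section \<open>The smoothed path\<close>

definition incr :: "real \<Rightarrow> real \<Rightarrow> real" where
  "incr \<epsilon> r = x (r + \<epsilon>) - x r"

definition prim :: "real \<Rightarrow> real" where
  "prim r = integral {0..r} x"

text \<open>The Steklov mean of \<open>x\<close> over \<open>[r, r + \<epsilon>]\<close>, which is
  continuously differentiable with derivative \<open>incr \<epsilon> r / \<epsilon>\<close>.\<close>

definition avg :: "real \<Rightarrow> real \<Rightarrow> real" where
  "avg \<epsilon> r = (prim (r + \<epsilon>) - prim r) / \<epsilon>"

text \<open>Chosen such that \<open>speed \<epsilon>\<close> below is continuous at \<open>0\<close> and has, over \<open>[0,\<epsilon>]\<close>, the integral
  \<open>avg \<epsilon> \<epsilon>\<close>.\<close>

definition ramp :: "real \<Rightarrow> real \<Rightarrow> real" where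
  "ramp \<epsilon> r = max 0 (1 - r / \<epsilon>) * (- x \<epsilon> + (6 * avg \<epsilon> 0 + 3 * x \<epsilon>) * (r / \<epsilon>)) / \<epsilon>"

text \<open>Replacing \<open>r\<close> by \<open>max r 0\<close> freezes the value at 0, where the
  ramp cancels the increment; so the speed is continuous and vanishes on the left.\<close>

definition speed :: "real \<Rightarrow> real \<Rightarrow> real" where
  "speed \<epsilon> r = incr \<epsilon> (max r 0) / \<epsilon> + ramp \<epsilon> (max r 0)"

definition smooth :: "real \<Rightarrow> real \<Rightarrow> real" where
  "smooth \<epsilon> r = integral {0..r} (speed \<epsilon>)"

text \<open>The error of the smoothing, later the value at 0 of the perturbation of the
  window.\<close>

definition gap :: "real \<Rightarrow> real \<Rightarrow> real" where
  "gap \<epsilon> r = smooth \<epsilon> r - x r"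

lemma incr_cont[continuous_intros]: "continuous_on S (incr \<epsilon>)"
  unfolding incr_def[abs_def]
  by (intro continuous_intros x_cont' continuous_on_compose2[OF x_cont]) auto

lemma prim_deriv: "(prim has_real_derivative x r) (at r)"
  unfolding prim_def[abs_def] by (rule primitive_has_derivative[OF x_cont x_left])

lemma avg_deriv: "(avg \<epsilon> has_real_derivative incr \<epsilon> r / \<epsilon>) (at r)"
proof -
  have "((\<lambda>r. prim (r + \<epsilon>)) has_real_derivative x (r + \<epsilon>) * 1) (at r)"
    by (rule DERIV_chain2[OF prim_deriv]) (auto intro!: derivative_eq_intros)
  from DERIV_cdivide[OF DERIV_diff[OF this prim_deriv], of \<epsilon>]
  show ?thesis unfolding avg_def[abs_def] incr_def by simp
qed

lemma avg_cont[continuous_intros]: "continuous_on S (avg \<epsilon>)"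
  by (intro DERIV_continuous_on[of _ "avg \<epsilon>" "\<lambda>r. incr \<epsilon> r / \<epsilon>"] has_field_derivative_at_within[OF avg_deriv])

lemma prim_cont: "continuous_on S prim"
  by (intro DERIV_continuous_on[of _ prim x] has_field_derivative_at_within[OF prim_deriv])

lemma ramp_cont[continuous_intros]: "continuous_on S (ramp \<epsilon>)"
proof (cases "\<epsilon> = 0")
  case False then show ?thesis unfolding ramp_def[abs_def] by (intro continuous_intros) auto
next
  case True then show ?thesis unfolding ramp_def[abs_def] by simp
qed

lemma speed_cont: "continuous_on S (speed \<epsilon>)"
proof (cases "\<epsilon> = 0")
  case False
  then show ?thesis
    unfolding speed_def[abs_def]
    by (intro continuous_intros continuous_on_compose2[OF incr_cont[of UNIV]]
        continuous_on_compose2[OF ramp_cont[of UNIV]]) auto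
next
  case True
  then show ?thesis unfolding speed_def[abs_def] ramp_def incr_def by simp
qed

lemma speed_left: "0 < \<epsilon> \<Longrightarrow> r \<le> 0 \<Longrightarrow> speed \<epsilon> r = 0"
  unfolding speed_def incr_def ramp_def using x_left[of 0] by (simp add: max_def)

lemma smooth_deriv: "0 < \<epsilon> \<Longrightarrow> (smooth \<epsilon> has_real_derivative speed \<epsilon> r) (at r)"
  unfolding smooth_def[abs_def] by (rule primitive_has_derivative[OF speed_cont speed_left])

lemma smooth_cont: "0 < \<epsilon> \<Longrightarrow> continuous_on S (smooth \<epsilon>)"
  by (intro DERIV_continuous_on[of _ "smooth \<epsilon>" "speed \<epsilon>"] has_field_derivative_at_within[OF smooth_deriv])

lemma gap_cont: "0 < \<epsilon> \<Longrightarrow> continuous_on S (gap \<epsilon>)"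
  unfolding gap_def[abs_def] by (intro continuous_intros smooth_cont x_cont')

lemma smooth_left: "r \<le> 0 \<Longrightarrow> smooth \<epsilon> r = 0"
  unfolding smooth_def by (cases "r = 0") auto

lemma avg_between:
  assumes "0 < \<epsilon>"
  shows "\<exists>p. r < p \<and> p < r + \<epsilon> \<and> avg \<epsilon> r = x p"
proof -
  obtain p where "r < p" "p < r + \<epsilon>" "prim (r + \<epsilon>) - prim r = (r + \<epsilon> - r) * x p"
    using MVT2[of r "r + \<epsilon>" prim x] prim_deriv assms by auto
  then show ?thesis using assms unfolding avg_def by (intro exI[of _ p]) auto
qed

lemma avg_osc: "0 < \<epsilon> \<Longrightarrow> \<bar>avg \<epsilon> r - x r\<bar> \<le> osc \<epsilon>"
  using avg_between[of \<epsilon> r] osc_bound[of _ r \<epsilon>] by force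

lemma ramp_le:
  assumes \<epsilon>: "0 < \<epsilon>" and r: "0 \<le> r"
  shows "\<bar>ramp \<epsilon> r\<bar> \<le> 10 * osc \<epsilon> / \<epsilon>"
proof (cases "r \<le> \<epsilon>")
  case True
  define q where "q = r / \<epsilon>"
  have q: "0 \<le> q" "q \<le> 1" using \<epsilon> r True unfolding q_def by auto
  have x\<epsilon>: "\<bar>x \<epsilon>\<bar> \<le> osc \<epsilon>" using osc_bound[of \<epsilon> 0 \<epsilon>] x_left[of 0] \<epsilon> by simp
  have c: "\<bar>avg \<epsilon> 0\<bar> \<le> osc \<epsilon>" using avg_osc[OF \<epsilon>, of 0] x_left[of 0] by simp
  \<comment> \<open>Both \<open>avg \<epsilon> 0\<close> and \<open>x \<epsilon>\<close> are bounded
    by \<open>osc \<epsilon>\<close> because \<open>x\<close> vanishes at 0: 9 comes from the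
    coefficients 6 and 3, and the remaining term \<open>- x \<epsilon>\<close> raises it to
    10.\<close>
  have "\<bar>(6 * avg \<epsilon> 0 + 3 * x \<epsilon>) * q\<bar> \<le> (9 * osc \<epsilon>) * 1"
    unfolding abs_mult using x\<epsilon> c q by (intro mult_mono) auto
  then have "\<bar>- x \<epsilon> + (6 * avg \<epsilon> 0 + 3 * x \<epsilon>) * q\<bar> \<le> 10 * osc \<epsilon>" using x\<epsilon> by linarith
  then have "\<bar>max 0 (1 - q)\<bar> * \<bar>- x \<epsilon> + (6 * avg \<epsilon> 0 + 3 * x \<epsilon>) * q\<bar> \<le> 1 * (10 * osc \<epsilon>)"
    using q by (intro mult_mono) auto
  then have "\<bar>max 0 (1 - q) * (- x \<epsilon> + (6 * avg \<epsilon> 0 + 3 * x \<epsilon>) * q)\<bar> / \<epsilon> \<le> 10 * osc \<epsilon> / \<epsilon>"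
    unfolding abs_mult using \<epsilon> by (intro divide_right_mono) auto
  then show ?thesis unfolding ramp_def q_def[symmetric] using \<epsilon> by (simp add: abs_divide)
next
  case False
  then have "1 - r / \<epsilon> \<le> 0" using \<epsilon> by simp
  then show ?thesis unfolding ramp_def using osc_nonneg[of \<epsilon>] \<epsilon> by simp
qed

lemma ramp_zero: "0 < \<epsilon> \<Longrightarrow> \<epsilon> \<le> r \<Longrightarrow> ramp \<epsilon> r = 0"
  unfolding ramp_def by (simp add: max_def)

text \<open>With \<open>q = r / \<epsilon>\<close>, the integral of
  \<open>(1 - q) * (- a + b * q)\<close> over the unit interval is \<open>- a / 2 + b / 6\<close>.
  Requiring the value \<open>avg \<epsilon> 0\<close> for \<open>a = x \<epsilon>\<close> forces
  \<open>b = 6 * avg \<epsilon> 0 + 3 * x \<epsilon>\<close>, which explains the coefficients in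
  \<open>ramp\<close>.\<close>

lemma integral_ramp:
  assumes \<epsilon>: "0 < \<epsilon>"
  shows "integral {0..\<epsilon>} (ramp \<epsilon>) = avg \<epsilon> 0"
proof -
  define a b where "a = x \<epsilon>" and "b = 6 * avg \<epsilon> 0 + 3 * x \<epsilon>"
  define F where "F r = - a * (r / \<epsilon> - (r / \<epsilon>)\<^sup>2 / 2) + b * ((r / \<epsilon>)\<^sup>2 / 2 - (r / \<epsilon>)^3 / 3)" for r
  have "integral {0..\<epsilon>} (ramp \<epsilon>) = F \<epsilon> - F 0"
  proof (rule integral_derivative)
    fix r assume r: "0 \<le> r" "r \<le> \<epsilon>"
    have "ramp \<epsilon> r = (1 - r / \<epsilon>) * (- a + b * (r / \<epsilon>)) / \<epsilon>"
      using r \<epsilon> unfolding ramp_def a_def b_def by (simp add: max_def)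
    also have "\<dots> = - a * (1 / \<epsilon> - 2 * (r / \<epsilon>) * (1 / \<epsilon>) / 2) + b * (2 * (r / \<epsilon>) * (1 / \<epsilon>) / 2 - 3 * (r / \<epsilon>)\<^sup>2 * (1 / \<epsilon>) / 3)"
      using \<epsilon> by (simp add: field_simps power2_eq_square)
    finally have eq: "ramp \<epsilon> r = \<dots>" .
    have "(F has_real_derivative ramp \<epsilon> r) (at r)"
      unfolding F_def[abs_def] eq
      by (rule derivative_eq_intros refl | use \<epsilon> in simp)+
    then show "(F has_real_derivative ramp \<epsilon> r) (at r within {0..\<epsilon>})"
      by (rule has_field_derivative_at_within)
  qed (use \<epsilon> in simp)
  also have "\<dots> = avg \<epsilon> 0" unfolding F_def a_def b_def using \<epsilon> by (simp add: field_simps)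
  finally show ?thesis .
qed

lemma smooth_eq:
  assumes \<epsilon>: "0 < \<epsilon>" and r: "0 \<le> r"
  shows "smooth \<epsilon> r = avg \<epsilon> r - avg \<epsilon> 0 + integral {0..r} (ramp \<epsilon>)"
proof -
  have "smooth \<epsilon> r = integral {0..r} (\<lambda>s. incr \<epsilon> s / \<epsilon> + ramp \<epsilon> s)"
    unfolding smooth_def speed_def by (rule integral_cong) (simp add: max_absorb1)
  also have "\<dots> = integral {0..r} (\<lambda>s. incr \<epsilon> s / \<epsilon>) + integral {0..r} (ramp \<epsilon>)"
    by (intro Henstock_Kurzweil_Integration.integral_add integrable_continuous_real continuous_intros) (use \<epsilon> in auto)
  also have "integral {0..r} (\<lambda>s. incr \<epsilon> s / \<epsilon>) = avg \<epsilon> r - avg \<epsilon> 0"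
    by (rule integral_derivative[OF r has_field_derivative_at_within[OF avg_deriv]])
  finally show ?thesis by simp
qed

text \<open>Starting from 0 instead of \<open>avg \<epsilon> 0\<close> costs exactly
  \<open>avg \<epsilon> 0\<close>, and the ramp has paid this back by time
  \<open>\<epsilon>\<close>.\<close>

lemma smooth_eq_avg:
  assumes \<epsilon>: "0 < \<epsilon>" and r: "\<epsilon> \<le> r"
  shows "smooth \<epsilon> r = avg \<epsilon> r"
proof -
  have "integral {0..\<epsilon>} (ramp \<epsilon>) + integral {\<epsilon>..r} (ramp \<epsilon>) = integral {0..r} (ramp \<epsilon>)"
    using \<epsilon> r by (intro Henstock_Kurzweil_Integration.integral_combine integrable_continuous_real ramp_cont) auto
  moreover have "integral {\<epsilon>..r} (ramp \<epsilon>) = integral {\<epsilon>..r} (\<lambda>_. 0)"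
    by (rule integral_cong) (use ramp_zero \<epsilon> in auto)
  ultimately show ?thesis using smooth_eq[OF \<epsilon>, of r] integral_ramp[OF \<epsilon>] \<epsilon> r by simp
qed

lemma smooth_avg_le:
  assumes \<epsilon>: "0 < \<epsilon>" and r: "0 \<le> r"
  shows "\<bar>smooth \<epsilon> r - avg \<epsilon> r\<bar> \<le> 11 * osc \<epsilon>"
proof -
  have "\<bar>integral {0..r} (ramp \<epsilon>)\<bar> \<le> 10 * osc \<epsilon> / \<epsilon> * \<epsilon>"
    by (rule integral_abs_le_const_prefix[OF ramp_cont])
      (use assms ramp_le ramp_zero osc_nonneg[of \<epsilon>] in auto)
  moreover have "\<bar>avg \<epsilon> 0\<bar> \<le> osc \<epsilon>" using avg_osc[OF \<epsilon>, of 0] x_left[of 0] by simp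
  ultimately show ?thesis using smooth_eq[OF assms] \<epsilon> by simp
qed

section \<open>Size, energy and integrals of the gap\<close>

lemma gap_left: "r \<le> 0 \<Longrightarrow> gap \<epsilon> r = 0"
  unfolding gap_def using smooth_left x_left by simp

text \<open>Beyond \<open>T\<close> the mean runs over a stretch where \<open>x\<close> is constant,
  and \<open>\<epsilon> \<le> T\<close> ensures that the ramp is over. With \<open>gap_left\<close>
  this gives the gap compact support.\<close>

lemma gap_right: "0 < \<epsilon> \<Longrightarrow> \<epsilon> \<le> T \<Longrightarrow> T \<le> r \<Longrightarrow> gap \<epsilon> r = 0"
proof -
  assume \<epsilon>: "0 < \<epsilon>" "\<epsilon> \<le> T" and r: "T \<le> r"
  obtain p where p: "r < p" "avg \<epsilon> r = x p" using avg_between[OF \<epsilon>(1)] by blast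
  then show "gap \<epsilon> r = 0"
    unfolding gap_def using smooth_eq_avg[of \<epsilon> r] \<epsilon> r x_right[of p] x_right[of r] by simp
qed

lemma gap_le:
  assumes \<epsilon>: "0 < \<epsilon>"
  shows "\<bar>gap \<epsilon> r\<bar> \<le> 12 * osc \<epsilon>"
proof (cases "r \<le> 0")
  case True then show ?thesis using gap_left osc_nonneg[of \<epsilon>] \<epsilon> by simp
next
  case False
  then show ?thesis unfolding gap_def using smooth_avg_le[OF \<epsilon>, of r] avg_osc[OF \<epsilon>, of r] by linarith
qed

text \<open>Substitution writes \<open>avg \<epsilon> r - x r\<close> as the mean over
  \<open>p\<close> in \<open>[0,1]\<close> of \<open>x (r + \<epsilon> * p) - x r\<close>; the
  Cauchy-Schwarz inequality against the constant 1 then plays the part of Jensen's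
  inequality.\<close>

lemma avg_square_le:
  assumes \<epsilon>: "0 < \<epsilon>"
  shows "(avg \<epsilon> r - x r)\<^sup>2 \<le> (LINT p:{0..1}|lborel. (x (r + \<epsilon> * p) - x r)\<^sup>2)"
proof -
  have c: "continuous_on S (\<lambda>p. x (r + \<epsilon> * p) - x r)" for S
    by (intro continuous_intros continuous_on_compose2[OF x_cont]) auto
  have "integral {0..1} (\<lambda>p. x (r + \<epsilon> * p) - x r) = (prim (r + \<epsilon> * 1) / \<epsilon> - x r * 1) - (prim (r + \<epsilon> * 0) / \<epsilon> - x r * 0)"
  proof (rule integral_derivative)
    fix p
    have "((\<lambda>p. prim (r + \<epsilon> * p)) has_real_derivative x (r + \<epsilon> * p) * \<epsilon>) (at p)"
      by (rule DERIV_chain2[OF prim_deriv]) (auto intro!: derivative_eq_intros)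
    then have "((\<lambda>p. prim (r + \<epsilon> * p) / \<epsilon> - x r * p) has_real_derivative x (r + \<epsilon> * p) - x r) (at p)"
      using \<epsilon> by (auto intro!: derivative_eq_intros)
    then show "((\<lambda>p. prim (r + \<epsilon> * p) / \<epsilon> - x r * p) has_real_derivative x (r + \<epsilon> * p) - x r) (at p within {0..1})"
      by (rule has_field_derivative_at_within)
  qed simp
  also have "\<dots> = avg \<epsilon> r - x r" unfolding avg_def by (simp add: diff_divide_distrib)
  finally have i: "(LINT p:{0..1}|lborel. (x (r + \<epsilon> * p) - x r)) = avg \<epsilon> r - x r"
    using set_borel_integral_eq_integral(2)[OF borel_integrable_atLeastAtMost'[OF c[of "{0..1}"]]] by simp
  have bm: "(\<lambda>p. x (r + \<epsilon> * p) - x r) \<in> borel_measurable borel"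
    by (rule borel_measurable_continuous_onI[OF c])
  obtain B where B: "\<And>r. \<bar>x r\<bar> \<le> B" using x_bounded by blast
  have sq: "square_integrable_on {0..1} (\<lambda>p. x (r + \<epsilon> * p) - x r)"
  proof (rule square_integrable_on_bounded(1)[OF bm])
    show "\<bar>x (r + \<epsilon> * p) - x r\<bar> \<le> 2 * B" for p using B[of "r + \<epsilon> * p"] B[of r] by linarith
  qed (simp_all add: emeasure_lborel_Icc_eq)
  have one: "square_integrable_on {0..1::real} (\<lambda>_. 1)"
    by (rule square_integrable_on_bounded(1)[where C=1]) (simp_all add: emeasure_lborel_Icc_eq)
  have L1: "L2_norm_on {0..1::real} (\<lambda>_. 1) = 1"
    unfolding L2_norm_on_def set_lebesgue_integral_def by simp
  have "\<bar>avg \<epsilon> r - x r\<bar> \<le> L2_norm_on {0..1} (\<lambda>p. x (r + \<epsilon> * p) - x r)"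
    using L2_Cauchy_Schwarz(2)[OF sq one] unfolding L1 by (simp add: i)
  then have "\<bar>avg \<epsilon> r - x r\<bar>\<^sup>2 \<le> (L2_norm_on {0..1} (\<lambda>p. x (r + \<epsilon> * p) - x r))\<^sup>2"
    by (intro power_mono) auto
  also have "\<dots> = (LINT p:{0..1}|lborel. (x (r + \<epsilon> * p) - x r)\<^sup>2)"
    unfolding L2_norm_on_def by (simp add: set_lebesgue_integral_def)
  finally show ?thesis by simp
qed

text \<open>Integrating \<open>avg_square_le\<close> over \<open>r\<close> and exchanging the
  integrals bounds the gap by the energies of all shifts \<open>\<epsilon> * p\<close>, which is why
  these must be controlled uniformly in \<open>p\<close>. On \<open>[0,\<epsilon>]\<close>, where
  the smoothed path is not the mean, the square of \<open>12 * osc \<epsilon>\<close> is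
  used.\<close>

lemma gap_energy:
  assumes \<epsilon>: "0 < \<epsilon>" "\<epsilon> \<le> T" and K: "\<And>p. p \<in> {0..1} \<Longrightarrow> energy (\<epsilon> * p) \<le> K"
  shows "integrable lborel (\<lambda>r. (gap \<epsilon> r)\<^sup>2)"
    and "(LINT r|lborel. (gap \<epsilon> r)\<^sup>2) \<le> 144 * (osc \<epsilon>)\<^sup>2 * \<epsilon> + K"
proof -
  have xm[measurable]: "x \<in> borel_measurable borel" by (rule borel_measurable_continuous_onI[OF x_cont])
  have gm[measurable]: "gap \<epsilon> \<in> borel_measurable borel" by (rule borel_measurable_continuous_onI[OF gap_cont[OF \<epsilon>(1)]])
  have am[measurable]: "avg \<epsilon> \<in> borel_measurable borel" by (rule borel_measurable_continuous_onI[OF avg_cont])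
  have K0: "0 \<le> K" using K[of 0] energy_nonneg[of 0] by simp
  have "integrable lborel (\<lambda>r. indicator {0..T} r *\<^sub>R (gap \<epsilon> r)\<^sup>2)"
    by (intro borel_integrable_compact continuous_intros gap_cont[OF \<epsilon>(1)]) auto
  moreover have "(\<lambda>r. indicator {0..T} r *\<^sub>R (gap \<epsilon> r)\<^sup>2) = (\<lambda>r. (gap \<epsilon> r)\<^sup>2)"
  proof (rule ext)
    fix r
    show "indicator {0..T} r *\<^sub>R (gap \<epsilon> r)\<^sup>2 = (gap \<epsilon> r)\<^sup>2"
      using gap_left[of r \<epsilon>] gap_right[OF \<epsilon>, of r] by (cases "r \<le> 0"; cases "T \<le> r") auto
  qed
  ultimately show int: "integrable lborel (\<lambda>r. (gap \<epsilon> r)\<^sup>2)" by simp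
  have pt: "(gap \<epsilon> r)\<^sup>2 \<le> 144 * (osc \<epsilon>)\<^sup>2 * indicator {0..\<epsilon>} r + (LINT p:{0..1}|lborel. (x (r + \<epsilon> * p) - x r)\<^sup>2)" for r
  proof -
    have nn: "0 \<le> (LINT p:{0..1}|lborel. (x (r + \<epsilon> * p) - x r)\<^sup>2)"
      unfolding set_lebesgue_integral_def by simp
    consider "r < 0" | "0 \<le> r" "r \<le> \<epsilon>" | "\<epsilon> < r" by linarith
    then show ?thesis
    proof cases
      case 1 then show ?thesis using nn gap_left[of r \<epsilon>] by simp
    next
      case 2
      have "(gap \<epsilon> r)\<^sup>2 \<le> (12 * osc \<epsilon>)\<^sup>2"
        using gap_le[OF \<epsilon>(1), of r] by (metis abs_ge_zero power2_abs power_mono)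
      then show ?thesis using 2 nn by (simp add: power_mult_distrib)
    next
      case 3
      then have "gap \<epsilon> r = avg \<epsilon> r - x r" unfolding gap_def using smooth_eq_avg[OF \<epsilon>(1), of r] by simp
      then show ?thesis using avg_square_le[OF \<epsilon>(1), of r] 3 by simp
    qed
  qed
  have m2: "(\<lambda>(r, p). ennreal (indicator {0..1} p * (x (r + \<epsilon> * p) - x r)\<^sup>2)) \<in> borel_measurable (lborel \<Otimes>\<^sub>M lborel)"
    by measurable
  have inner: "ennreal (LINT p:{0..1}|lborel. (x (r + \<epsilon> * p) - x r)\<^sup>2)
      = (\<integral>\<^sup>+p. ennreal (indicator {0..1} p * (x (r + \<epsilon> * p) - x r)\<^sup>2) \<partial>lborel)" for r
  proof -
    have "set_integrable lborel {0..1} (\<lambda>p. (x (r + \<epsilon> * p) - x r)\<^sup>2)"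
      by (intro borel_integrable_atLeastAtMost' continuous_intros continuous_on_compose2[OF x_cont]) auto
    then show ?thesis unfolding set_integrable_def set_lebesgue_integral_def real_scaleR_def
      by (intro nn_integral_eq_integral[symmetric]) simp_all
  qed
  have "ennreal (LINT r|lborel. (gap \<epsilon> r)\<^sup>2) = (\<integral>\<^sup>+r. ennreal ((gap \<epsilon> r)\<^sup>2) \<partial>lborel)"
    by (rule nn_integral_eq_integral[symmetric, OF int]) simp
  also have "\<dots> \<le> (\<integral>\<^sup>+r. ennreal (144 * (osc \<epsilon>)\<^sup>2 * indicator {0..\<epsilon>} r)
      + (\<integral>\<^sup>+p. ennreal (indicator {0..1} p * (x (r + \<epsilon> * p) - x r)\<^sup>2) \<partial>lborel) \<partial>lborel)"
  proof (rule nn_integral_mono)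
    fix r
    have "ennreal ((gap \<epsilon> r)\<^sup>2) \<le> ennreal (144 * (osc \<epsilon>)\<^sup>2 * indicator {0..\<epsilon>} r + (LINT p:{0..1}|lborel. (x (r + \<epsilon> * p) - x r)\<^sup>2))"
      using pt[of r] by (rule ennreal_leI)
    also have "\<dots> = ennreal (144 * (osc \<epsilon>)\<^sup>2 * indicator {0..\<epsilon>} r) + ennreal (LINT p:{0..1}|lborel. (x (r + \<epsilon> * p) - x r)\<^sup>2)"
      by (rule ennreal_plus) (auto simp: set_lebesgue_integral_def)
    finally show "ennreal ((gap \<epsilon> r)\<^sup>2) \<le> ennreal (144 * (osc \<epsilon>)\<^sup>2 * indicator {0..\<epsilon>} r)
      + (\<integral>\<^sup>+p. ennreal (indicator {0..1} p * (x (r + \<epsilon> * p) - x r)\<^sup>2) \<partial>lborel)" unfolding inner .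
  qed
  also have "\<dots> = (\<integral>\<^sup>+r. ennreal (144 * (osc \<epsilon>)\<^sup>2 * indicator {0..\<epsilon>} r) \<partial>lborel)
      + (\<integral>\<^sup>+r. (\<integral>\<^sup>+p. ennreal (indicator {0..1} p * (x (r + \<epsilon> * p) - x r)\<^sup>2) \<partial>lborel) \<partial>lborel)"
    by (rule nn_integral_add) (use lborel.borel_measurable_nn_integral[OF m2] in simp_all)
  also have "(\<integral>\<^sup>+r. ennreal (144 * (osc \<epsilon>)\<^sup>2 * indicator {0..\<epsilon>} r) \<partial>lborel) = ennreal (144 * (osc \<epsilon>)\<^sup>2 * \<epsilon>)"
  proof -
    have "(\<integral>\<^sup>+r. ennreal (144 * (osc \<epsilon>)\<^sup>2 * indicator {0..\<epsilon>} r) \<partial>lborel) = ennreal (LINT r|lborel. 144 * (osc \<epsilon>)\<^sup>2 * indicator {0..\<epsilon>} r)"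
      by (rule nn_integral_eq_integral) (auto intro!: integrable_mult_right integrable_real_indicator simp: emeasure_lborel_Icc_eq)
    then show ?thesis using \<epsilon> by simp
  qed
  also have "(\<integral>\<^sup>+r. (\<integral>\<^sup>+p. ennreal (indicator {0..1} p * (x (r + \<epsilon> * p) - x r)\<^sup>2) \<partial>lborel) \<partial>lborel)
      = (\<integral>\<^sup>+p. (\<integral>\<^sup>+r. ennreal (indicator {0..1} p * (x (r + \<epsilon> * p) - x r)\<^sup>2) \<partial>lborel) \<partial>lborel)"
    using lborel_pair.Fubini'[OF m2] by simp
  also have "\<dots> \<le> (\<integral>\<^sup>+p. ennreal K * indicator {0..1} (p :: real) \<partial>lborel)"
  proof (rule nn_integral_mono)
    fix p :: real
    have "(\<integral>\<^sup>+r. ennreal ((x (r + \<epsilon> * p) - x r)\<^sup>2) \<partial>lborel) = ennreal (energy (\<epsilon> * p))"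
      unfolding energy_def using integrable_increment[of "\<epsilon> * p" 0] by (intro nn_integral_eq_integral) simp_all
    then show "(\<integral>\<^sup>+r. ennreal (indicator {0..1} p * (x (r + \<epsilon> * p) - x r)\<^sup>2) \<partial>lborel) \<le> ennreal K * indicator {0..1} p"
      using K[of p] by (cases "p \<in> {0..1}") (auto intro: ennreal_leI)
  qed
  also have "\<dots> = ennreal K" by (simp add: nn_integral_cmult_indicator emeasure_lborel_Icc_eq)
  also have "ennreal (144 * (osc \<epsilon>)\<^sup>2 * \<epsilon>) + ennreal K = ennreal (144 * (osc \<epsilon>)\<^sup>2 * \<epsilon> + K)"
    using \<epsilon> K0 by (intro ennreal_plus[symmetric]) auto
  finally have "ennreal (LINT r|lborel. (gap \<epsilon> r)\<^sup>2) \<le> ennreal (144 * (osc \<epsilon>)\<^sup>2 * \<epsilon> + K)"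
    by (simp add: add_left_mono del: ennreal_plus)
  then show "(LINT r|lborel. (gap \<epsilon> r)\<^sup>2) \<le> 144 * (osc \<epsilon>)\<^sup>2 * \<epsilon> + K"
    using \<epsilon> K0 by (subst (asm) ennreal_le_iff) auto
qed

text \<open>The correction term of the change of variables formula: half of the quadratic variation.\<close>

lemma gap_incr_integral:
  assumes \<epsilon>: "0 < \<epsilon>" and B: "\<And>r. \<bar>x r\<bar> \<le> B" and \<tau>: "0 \<le> \<tau>"
  shows "\<bar>integral {0..\<tau>} (\<lambda>s. gap \<epsilon> s * incr \<epsilon> s / \<epsilon>) - integral {0..\<tau>} (\<lambda>s. (incr \<epsilon> s)\<^sup>2) / (2 * \<epsilon>)\<bar>
    \<le> 2 * B * osc \<epsilon> + 11 * (osc \<epsilon>)\<^sup>2"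
proof -
  have B0: "0 \<le> B" using B[of 0] by linarith
  have o0: "0 \<le> osc \<epsilon>" using osc_nonneg \<epsilon> by simp
  define P2 where "P2 r = integral {0..r} (\<lambda>s. (x s)\<^sup>2)" for r
  have P2: "(P2 has_real_derivative (x r)\<^sup>2) (at r)" for r
    unfolding P2_def[abs_def] by (rule primitive_has_derivative) (auto intro!: continuous_intros x_cont' simp: x_left)
  \<comment> \<open>Half of the squared mean minus half of the mean of the square. Its derivative is
    the integrand up to the squared increment, and it is small since both halves are close to
    \<open>(x s)\<^sup>2 / 2\<close>.\<close>
  define F where "F s = (avg \<epsilon> s)\<^sup>2 / 2 - (P2 (s + \<epsilon>) - P2 s) / (2 * \<epsilon>)" for s
  have F': "(F has_real_derivative (avg \<epsilon> s - x s) * incr \<epsilon> s / \<epsilon> - (incr \<epsilon> s)\<^sup>2 / (2 * \<epsilon>)) (at s)" for s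
  proof -
    have "((\<lambda>s. P2 (s + \<epsilon>)) has_real_derivative (x (s + \<epsilon>))\<^sup>2 * 1) (at s)"
      by (rule DERIV_chain2[OF P2]) (auto intro!: derivative_eq_intros)
    then have "(F has_real_derivative (2 * avg \<epsilon> s * (incr \<epsilon> s / \<epsilon>)) / 2 - ((x (s + \<epsilon>))\<^sup>2 - (x s)\<^sup>2) / (2 * \<epsilon>)) (at s)"
      unfolding F_def[abs_def] using \<epsilon>
      by (auto intro!: derivative_eq_intros avg_deriv P2 simp: power2_eq_square) (simp add: field_simps)
    moreover have "(2 * avg \<epsilon> s * (incr \<epsilon> s / \<epsilon>)) / 2 - ((x (s + \<epsilon>))\<^sup>2 - (x s)\<^sup>2) / (2 * \<epsilon>)
        = (avg \<epsilon> s - x s) * incr \<epsilon> s / \<epsilon> - (incr \<epsilon> s)\<^sup>2 / (2 * \<epsilon>)"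
      unfolding incr_def using \<epsilon> by (simp add: field_simps power2_eq_square)
    ultimately show ?thesis by simp
  qed
  have Fle: "\<bar>F s\<bar> \<le> B * osc \<epsilon>" for s
  proof -
    obtain p where p: "s < p" "p < s + \<epsilon>" "avg \<epsilon> s = x p" using avg_between[OF \<epsilon>] by blast
    obtain q where q: "s < q" "q < s + \<epsilon>" "P2 (s + \<epsilon>) - P2 s = (s + \<epsilon> - s) * (x q)\<^sup>2"
      using MVT2[of s "s + \<epsilon>" P2 "\<lambda>r. (x r)\<^sup>2"] P2 \<epsilon> by auto
    have "F s = ((x p)\<^sup>2 - (x q)\<^sup>2) / 2" unfolding F_def p(3) q(3) using \<epsilon> by (simp add: field_simps)
    also have "\<dots> = (x p + x q) * (x p - x q) / 2" by (simp add: power2_eq_square algebra_simps)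
    finally have "\<bar>F s\<bar> = \<bar>(x p + x q) * (x p - x q) / 2\<bar>" by simp
    also have "\<dots> = \<bar>x p + x q\<bar> * \<bar>x p - x q\<bar> / 2" by (simp add: abs_mult)
    also have "\<dots> \<le> (2 * B) * osc \<epsilon> / 2"
      using B[of p] B[of q] p q B0 by (intro divide_right_mono mult_mono osc_bound) auto
    finally show ?thesis by simp
  qed
  have i1: "integral {0..\<tau>} (\<lambda>s. (avg \<epsilon> s - x s) * incr \<epsilon> s / \<epsilon> - (incr \<epsilon> s)\<^sup>2 / (2 * \<epsilon>)) = F \<tau> - F 0"
    by (rule integral_derivative[OF \<tau> has_field_derivative_at_within[OF F']])
  have i2: "\<bar>integral {0..\<tau>} (\<lambda>s. (smooth \<epsilon> s - avg \<epsilon> s) * incr \<epsilon> s / \<epsilon>)\<bar> \<le> 11 * (osc \<epsilon>)\<^sup>2 / \<epsilon> * \<epsilon>"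
  proof (rule integral_abs_le_const_prefix)
    show "continuous_on {0..\<tau>} (\<lambda>s. (smooth \<epsilon> s - avg \<epsilon> s) * incr \<epsilon> s / \<epsilon>)"
      by (intro continuous_intros smooth_cont[OF \<epsilon>]) (use \<epsilon> in auto)
    fix r :: real assume r: "0 \<le> r"
    have "\<bar>(smooth \<epsilon> r - avg \<epsilon> r) * incr \<epsilon> r\<bar> \<le> (11 * osc \<epsilon>) * osc \<epsilon>"
      unfolding abs_mult incr_def using smooth_avg_le[OF \<epsilon> r] osc_bound[of "r + \<epsilon>" r \<epsilon>] o0 \<epsilon>
      by (intro mult_mono) auto
    then show "\<bar>(smooth \<epsilon> r - avg \<epsilon> r) * incr \<epsilon> r / \<epsilon>\<bar> \<le> 11 * (osc \<epsilon>)\<^sup>2 / \<epsilon>"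
      using \<epsilon> by (simp add: abs_divide divide_right_mono power2_eq_square mult.assoc)
  qed (use \<epsilon> \<tau> smooth_eq_avg[OF \<epsilon>] in auto)
  have "integral {0..\<tau>} (\<lambda>s. gap \<epsilon> s * incr \<epsilon> s / \<epsilon>) - integral {0..\<tau>} (\<lambda>s. (incr \<epsilon> s)\<^sup>2 / (2 * \<epsilon>))
      = integral {0..\<tau>} (\<lambda>s. gap \<epsilon> s * incr \<epsilon> s / \<epsilon> - (incr \<epsilon> s)\<^sup>2 / (2 * \<epsilon>))"
    by (intro Henstock_Kurzweil_Integration.integral_diff[symmetric] integrable_continuous_real continuous_intros gap_cont[OF \<epsilon>])
      (use \<epsilon> in auto)
  also have "\<dots> = integral {0..\<tau>} (\<lambda>s. ((avg \<epsilon> s - x s) * incr \<epsilon> s / \<epsilon> - (incr \<epsilon> s)\<^sup>2 / (2 * \<epsilon>)) + (smooth \<epsilon> s - avg \<epsilon> s) * incr \<epsilon> s / \<epsilon>)"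
    using \<epsilon> by (intro integral_cong) (simp add: gap_def field_simps)
  also have "\<dots> = (F \<tau> - F 0) + integral {0..\<tau>} (\<lambda>s. (smooth \<epsilon> s - avg \<epsilon> s) * incr \<epsilon> s / \<epsilon>)"
    unfolding i1[symmetric]
    by (intro Henstock_Kurzweil_Integration.integral_add integrable_continuous_real continuous_intros smooth_cont[OF \<epsilon>] x_cont')
      (use \<epsilon> in auto)
  finally have "\<bar>integral {0..\<tau>} (\<lambda>s. gap \<epsilon> s * incr \<epsilon> s / \<epsilon>) - integral {0..\<tau>} (\<lambda>s. (incr \<epsilon> s)\<^sup>2 / (2 * \<epsilon>))\<bar>
      \<le> 2 * B * osc \<epsilon> + 11 * (osc \<epsilon>)\<^sup>2"
  proof -
    assume eq: "integral {0..\<tau>} (\<lambda>s. gap \<epsilon> s * incr \<epsilon> s / \<epsilon>) - integral {0..\<tau>} (\<lambda>s. (incr \<epsilon> s)\<^sup>2 / (2 * \<epsilon>))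
      = F \<tau> - F 0 + integral {0..\<tau>} (\<lambda>s. (smooth \<epsilon> s - avg \<epsilon> s) * incr \<epsilon> s / \<epsilon>)"
    have d: "integral {0..\<tau>} (\<lambda>s. (incr \<epsilon> s)\<^sup>2 / (2 * \<epsilon>)) = integral {0..\<tau>} (\<lambda>s. (incr \<epsilon> s)\<^sup>2) / (2 * \<epsilon>)"
      by simp
    have "\<bar>integral {0..\<tau>} (\<lambda>s. (smooth \<epsilon> s - avg \<epsilon> s) * incr \<epsilon> s / \<epsilon>)\<bar> \<le> 11 * (osc \<epsilon>)\<^sup>2"
      using i2 \<epsilon> by simp
    then show ?thesis using eq Fle[of \<tau>] Fle[of 0] unfolding d by linarith
  qed
  then show ?thesis by simp
qed

text \<open>Away from \<open>[0,\<epsilon>]\<close> the gap is the derivative of the Steklov mean of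
  \<open>prim\<close> minus \<open>prim\<close>, a function of size \<open>B * \<epsilon>\<close>.
  This gain over the mere smallness of the gap compensates a factor \<open>1 / \<epsilon>\<close>
  later. An integral over \<open>{c..d}\<close> is a difference of two integrals from 0, hence the
  doubled constants.\<close>

lemma gap_integral_le:
  assumes \<epsilon>: "0 < \<epsilon>" and B: "\<And>r. \<bar>x r\<bar> \<le> B" and cd: "c \<le> d"
  shows "\<bar>integral {c..d} (gap \<epsilon>)\<bar> \<le> (4 * B + 22 * osc \<epsilon>) * \<epsilon>"
proof -
  have o0: "0 \<le> osc \<epsilon>" using osc_nonneg \<epsilon> by simp
  define PP where "PP r = integral {0..r} prim" for r
  have PP: "(PP has_real_derivative prim r) (at r)" for r
    unfolding PP_def[abs_def] 
  proof (rule primitive_has_derivative[OF prim_cont])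
    show "prim r = 0" if "r \<le> 0" for r using that unfolding prim_def by (cases "r = 0") auto
  qed
  define F where "F s = (PP (s + \<epsilon>) - PP s) / \<epsilon> - prim s" for s
  have F': "(F has_real_derivative avg \<epsilon> s - x s) (at s)" for s
  proof -
    have "((\<lambda>s. PP (s + \<epsilon>)) has_real_derivative prim (s + \<epsilon>) * 1) (at s)"
      by (rule DERIV_chain2[OF PP]) (auto intro!: derivative_eq_intros)
    from DERIV_diff[OF DERIV_cdivide[OF DERIV_diff[OF this PP], of \<epsilon>] prim_deriv]
    show ?thesis unfolding F_def[abs_def] avg_def by simp
  qed
  have Fle: "\<bar>F s\<bar> \<le> B * \<epsilon>" for s
  proof -
    obtain p where p: "s < p" "p < s + \<epsilon>" "PP (s + \<epsilon>) - PP s = (s + \<epsilon> - s) * prim p"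
      using MVT2[of s "s + \<epsilon>" PP prim] PP \<epsilon> by auto
    obtain q where q: "prim p - prim s = (p - s) * x q"
      using MVT2[of s p prim x] prim_deriv p(1) by auto
    have "F s = (p - s) * x q" unfolding F_def p(3) q[symmetric] using \<epsilon> by simp
    then have "\<bar>F s\<bar> \<le> \<epsilon> * B" unfolding abs_mult using p B[of q] by (simp add: abs_mult mult_mono)
    then show ?thesis by (simp add: mult.commute)
  qed
  have pre: "\<bar>integral {0..\<tau>} (gap \<epsilon>)\<bar> \<le> (2 * B + 11 * osc \<epsilon>) * \<epsilon>" if \<tau>: "0 \<le> \<tau>" for \<tau>
  proof -
    have "integral {0..\<tau>} (gap \<epsilon>) = integral {0..\<tau>} (\<lambda>s. (avg \<epsilon> s - x s) + (smooth \<epsilon> s - avg \<epsilon> s))"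
      by (rule integral_cong) (simp add: gap_def)
    also have "\<dots> = integral {0..\<tau>} (\<lambda>s. avg \<epsilon> s - x s) + integral {0..\<tau>} (\<lambda>s. smooth \<epsilon> s - avg \<epsilon> s)"
      by (intro Henstock_Kurzweil_Integration.integral_add integrable_continuous_real continuous_intros smooth_cont[OF \<epsilon>] x_cont')
    also have "integral {0..\<tau>} (\<lambda>s. avg \<epsilon> s - x s) = F \<tau> - F 0"
      by (rule integral_derivative[OF \<tau> has_field_derivative_at_within[OF F']])
    finally have eq: "integral {0..\<tau>} (gap \<epsilon>) = F \<tau> - F 0 + integral {0..\<tau>} (\<lambda>s. smooth \<epsilon> s - avg \<epsilon> s)" .
    have "\<bar>integral {0..\<tau>} (\<lambda>s. smooth \<epsilon> s - avg \<epsilon> s)\<bar> \<le> (11 * osc \<epsilon>) * \<epsilon>"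
      by (rule integral_abs_le_const_prefix)
        (use \<epsilon> \<tau> o0 smooth_eq_avg[OF \<epsilon>] smooth_avg_le[OF \<epsilon>] in \<open>auto intro!: continuous_intros smooth_cont[OF \<epsilon>]\<close>)
    then show ?thesis using eq Fle[of \<tau>] Fle[of 0] by (simp add: algebra_simps)
  qed
  have left: "integral {c..d} (gap \<epsilon>) = integral {max 0 c..max 0 d} (gap \<epsilon>)"
  proof -
    have z: "integral {a..b} (gap \<epsilon>) = 0" if "b \<le> 0" for a b
    proof -
      have "integral {a..b} (gap \<epsilon>) = integral {a..b} (\<lambda>_. 0)"
        by (rule integral_cong) (use that gap_left in auto)
      then show ?thesis by simp
    qed
    consider "0 \<le> c" | "d \<le> 0" | "c < 0" "0 < d" by linarith
    then show ?thesis
    proof cases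
      case 3
      have "integral {c..0} (gap \<epsilon>) + integral {0..d} (gap \<epsilon>) = integral {c..d} (gap \<epsilon>)"
        using 3 by (intro Henstock_Kurzweil_Integration.integral_combine integrable_continuous_real gap_cont[OF \<epsilon>]) auto
      then show ?thesis using z[of 0 c] 3 by simp
    qed (use cd z in auto)
  qed
  have "integral {0..max 0 c} (gap \<epsilon>) + integral {max 0 c..max 0 d} (gap \<epsilon>) = integral {0..max 0 d} (gap \<epsilon>)"
    using cd by (intro Henstock_Kurzweil_Integration.integral_combine integrable_continuous_real gap_cont[OF \<epsilon>]) auto
  then show ?thesis 
    using left pre[of "max 0 c", OF max.cobounded1] pre[of "max 0 d", OF max.cobounded1]
    unfolding distrib_right by linarith
qed

end

section \<open>Functionals with differentiable density on path space\<close>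

text \<open>A path is constant to the right of 0, so its forward quotient vanishes at 0 and an atom
  there is not seen: \<open>Du\<close> and its part without the atom have the same
  quotients.\<close>

lemma forward_quotient_remove_atom0:
  assumes \<mu>: "signed_measure_on T \<mu>" and T: "0 \<le> T" and \<eta>: "\<eta> \<in> C_space T" and \<epsilon>: "0 < \<epsilon>"
  shows "forward_quotient t (remove_atom0 \<mu>) \<eta> \<epsilon> = signed_integral \<mu>
     (\<lambda>x. indicator {-t..0} x * ((apply_bcontfun \<eta> (x + \<epsilon>) - apply_bcontfun \<eta> x) / \<epsilon>))"
proof -
  define f where "f x = indicator {-t..0} x * ((apply_bcontfun \<eta> (x + \<epsilon>) - apply_bcontfun \<eta> x) / \<epsilon>)" for x
  have f: "f \<in> borel_measurable borel" unfolding f_def[abs_def] by measurable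
  have "\<bar>f x\<bar> \<le> 2 * norm \<eta> / \<epsilon>" for x
  proof -
    have "\<bar>(apply_bcontfun \<eta> (x + \<epsilon>) - apply_bcontfun \<eta> x) / \<epsilon>\<bar> \<le> 2 * norm \<eta> / \<epsilon>"
      unfolding abs_divide using \<epsilon> abs_apply_bcontfun_le[of \<eta> "x + \<epsilon>"] abs_apply_bcontfun_le[of \<eta> x]
      by (intro frac_le) auto
    moreover have "0 \<le> 2 * norm \<eta> / \<epsilon>" using \<epsilon> by simp
    ultimately show ?thesis unfolding f_def by (cases "x \<in> {-t..0}") simp_all
  qed
  from signed_integral_remove_atom0(2)[OF \<mu> T f this]
  have "signed_integral (remove_atom0 \<mu>) f = signed_integral \<mu> f - \<mu> {0} * f 0" .
  moreover have "f 0 = 0" unfolding f_def using C_space_const_left[OF \<eta> T, of \<epsilon>] \<epsilon> by simp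
  ultimately show ?thesis unfolding forward_quotient_def f_def[abs_def] by simp
qed

lemma bounded_on_interval:
  fixes f :: "real \<Rightarrow> real"
  assumes "continuous_on UNIV f"
  shows "\<exists>C\<ge>0. \<forall>r\<in>{a..b}. \<bar>f r\<bar> \<le> C"
proof -
  have "compact (f ` {a..b})"
    by (intro compact_continuous_image continuous_on_subset[OF assms]) auto
  then obtain C where "\<forall>z\<in>f ` {a..b}. \<bar>z\<bar> \<le> C" by (meson bounded_real compact_imp_bounded)
  then show ?thesis by (intro exI[of _ "\<bar>C\<bar>"]) force
qed

text \<open>The quotients are bounded and converge to \<open>y' (s + x)\<close> for
  \<open>x < 0\<close>, but to 0 at \<open>x = 0\<close>, where the path stops; the lost value there
  is the subtracted atom term. As \<open>y'\<close> vanishes to the left of 0, truncating at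
  \<open>-s\<close> loses nothing.\<close>

lemma forward_integral_C1:
  fixes y y' :: "real \<Rightarrow> real"
  assumes \<mu>: "signed_measure_on T \<mu>" and s: "0 \<le> s" "s < T"
    and y: "\<And>r. (y has_real_derivative y' r) (at r)" and y': "continuous_on UNIV y'"
    and left: "\<And>r. r \<le> 0 \<Longrightarrow> y' r = 0"
  shows "forward_integral s (remove_atom0 \<mu>) (path_of T y s)
    = signed_integral \<mu> (apply_bcontfun (path_of T y' s)) - \<mu> {0} * y' s"
proof -
  have T: "0 \<le> T" using s by simp
  have yc: "continuous_on UNIV y" using y by (meson DERIV_continuous_on UNIV_I has_field_derivative_at_within)
  define h where "h = apply_bcontfun (path_of T y s)"
  have h: "h x = y (s + max (- T) (min 0 x))" for x
    unfolding h_def using apply_path_of[OF yc T] clamp_real_def[of "-T" 0] T by simp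
  have hC: "path_of T y s \<in> C_space T" by (rule path_of_in_C_space[OF yc T])
  obtain C where C: "0 \<le> C" "\<And>r. r \<in> {-T..T} \<Longrightarrow> \<bar>y' r\<bar> \<le> C" using bounded_on_interval[OF y'] by blast
  have lip: "\<bar>y a - y b\<bar> \<le> C * \<bar>a - b\<bar>" if "a \<in> {-T..T}" "b \<in> {-T..T}" for a b
    using field_differentiable_bound[of "{-T..T}" y y' C a b] that C y
    by (auto intro: has_field_derivative_at_within)
  define q where "q e x = indicator {-s..0} x * ((h (x + e) - h x) / e)" for e x
  \<comment> \<open>The half-open interval leaves out 0, where every quotient is 0.\<close>
  define g where "g x = indicator {-s..<0} x * y' (s + x)" for x
  have qm: "q e \<in> borel_measurable borel" for e unfolding q_def[abs_def] h_def by measurable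
  have qb: "\<bar>q e x\<bar> \<le> C" if "0 < e" for e x
  proof -
    have "\<bar>h (x + e) - h x\<bar> \<le> C * \<bar>(s + max (- T) (min 0 (x + e))) - (s + max (- T) (min 0 x))\<bar>"
      unfolding h by (rule lip) (use s in auto)
    also have "\<dots> \<le> C * e" using that C(1) by (intro mult_left_mono) auto
    finally have "\<bar>(h (x + e) - h x) / e\<bar> \<le> C" using that by (simp add: abs_divide divide_le_eq)
    then show ?thesis using C(1) unfolding q_def by (cases "x \<in> {-s..0}") simp_all
  qed
  have lim: "(forward_quotient s (remove_atom0 \<mu>) (path_of T y s) \<longlongrightarrow> signed_integral \<mu> g) (at_right 0)"
    unfolding tendsto_at_iff_sequentially
  proof (intro allI impI)
    fix E :: "nat \<Rightarrow> real" assume E: "\<forall>i. E i \<in> {0<..} - {0}" and E0: "E \<longlonglongrightarrow> 0"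
    have Epos: "0 < E i" for i using E by auto
    have "(\<lambda>n. signed_integral \<mu> (q (E n))) \<longlonglongrightarrow> signed_integral \<mu> g"
    proof (rule signed_integral_dominated[OF \<mu> qm qb[OF Epos]])
      fix x
      consider "x \<notin> {-s..0}" | "x = 0" | "-s \<le> x" "x < 0" by fastforce
      then show "(\<lambda>n. q (E n) x) \<longlonglongrightarrow> g x"
      proof cases
        case 1 then show ?thesis unfolding q_def g_def by (auto simp: indicator_def)
      next
        case 2
        have "q (E n) x = 0" for n unfolding q_def h 2 using Epos[of n] T by (simp add: min_def)
        then show ?thesis unfolding g_def 2 by simp
      next
        case 3
        have "((\<lambda>e. (y (s + x + e) - y (s + x)) / e) \<longlongrightarrow> y' (s + x)) (at 0)"
          using y[of "s + x"] by (simp add: DERIV_def)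
        moreover have "filterlim E (at 0) sequentially"
          using E0 Epos by (intro filterlim_atI) (auto simp: less_imp_neq[symmetric])
        ultimately have l: "(\<lambda>n. (y (s + x + E n) - y (s + x)) / E n) \<longlonglongrightarrow> y' (s + x)"
          by (rule filterlim_compose)
        have "\<forall>\<^sub>F n in sequentially. E n < - x" using order_tendstoD(2)[OF E0, of "- x"] 3 by simp
        then have "\<forall>\<^sub>F n in sequentially. (y (s + x + E n) - y (s + x)) / E n = q (E n) x"
        proof eventually_elim
          case (elim n)
          have "max (- T) (min 0 (x + E n)) = x + E n" "max (- T) (min 0 x) = x"
            using elim 3 s Epos[of n] by auto
          then show ?case unfolding q_def h using 3 by (simp add: add.assoc)
        qed
        from Lim_transform_eventually[OF l this] show ?thesis unfolding g_def using 3 by simp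
      qed
    qed
    moreover have "(forward_quotient s (remove_atom0 \<mu>) (path_of T y s) \<circ> E) n = signed_integral \<mu> (q (E n))" for n
      unfolding o_def forward_quotient_remove_atom0[OF \<mu> T hC Epos] q_def[abs_def] h_def ..
    ultimately show "(forward_quotient s (remove_atom0 \<mu>) (path_of T y s) \<circ> E) \<longlonglongrightarrow> signed_integral \<mu> g"
      by (simp add: o_def)
  qed
  have "forward_integral s (remove_atom0 \<mu>) (path_of T y s) = signed_integral \<mu> g"
    unfolding forward_integral_def using lim by (intro tendsto_Lim) auto
  also have "\<dots> = signed_integral \<mu> (\<lambda>x. apply_bcontfun (path_of T y' s) x - y' s * indicator {0} x)"
  proof (rule signed_integral_cong_carrier[OF \<mu>])
    fix x assume x: "x \<in> {-T..0}"
    have "apply_bcontfun (path_of T y' s) x = y' (s + x)"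
      using apply_path_of[OF y' T] clamp_real_def[of "-T" 0 x] T x by (simp add: min_def)
    then show "g x = apply_bcontfun (path_of T y' s) x - y' s * indicator {0} x"
      unfolding g_def using left[of "s + x"] x by (auto simp: indicator_def)
  next
    have [measurable]: "y' \<in> borel_measurable borel" by (rule borel_measurable_continuous_onI[OF y'])
    show "g \<in> borel_measurable borel" unfolding g_def[abs_def] by measurable
  qed measurable
  also have "\<dots> = signed_integral \<mu> (apply_bcontfun (path_of T y' s)) - signed_integral \<mu> (\<lambda>x. y' s * indicator {0} x)"
    by (rule signed_integral_diff[OF \<mu> borel_measurable_apply_bcontfun abs_apply_bcontfun_le, where D="\<bar>y' s\<bar>"])
      (auto simp: indicator_def)
  finally show ?thesis
    using signed_integral_indicator[OF \<mu>, of "{0}"] by (simp add: signed_integral_cmult mult.commute)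
qed

text \<open>Differentiability in the supremum norm needs the difference quotients of
  \<open>y\<close> to converge uniformly over the window; this follows from the mean value
  inequality and the uniform continuity of \<open>y'\<close> on an interval containing all windows
  at times within 1 of \<open>s\<close>.\<close>

lemma path_of_has_vector_derivative:
  fixes y y' :: "real \<Rightarrow> real"
  assumes T: "0 \<le> T" and y: "\<And>r. (y has_real_derivative y' r) (at r)" and y': "continuous_on UNIV y'"
  shows "(path_of T y has_vector_derivative path_of T y' s) (at s)"
  unfolding has_vector_derivative_def has_derivative_iff_norm
proof (intro conjI bounded_linear_scaleR_left)
  have yc: "continuous_on UNIV y" using y by (meson DERIV_continuous_on UNIV_I has_field_derivative_at_within)
  show "((\<lambda>r. norm (path_of T y r - path_of T y s - (r - s) *\<^sub>R path_of T y' s) / norm (r - s)) \<longlongrightarrow> 0) (at s)"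
  proof (rule tendstoI)
    fix e :: real assume e: "0 < e"
    have "uniformly_continuous_on {s - T - 1..s + 1} y'"
      by (intro compact_uniformly_continuous continuous_on_subset[OF y']) auto
    then obtain d where d: "0 < d" "\<And>a b. a \<in> {s - T - 1..s + 1} \<Longrightarrow> b \<in> {s - T - 1..s + 1} \<Longrightarrow> \<bar>b - a\<bar> < d \<Longrightarrow> \<bar>y' b - y' a\<bar> < e / 2"
      unfolding uniformly_continuous_on_def dist_real_def using e by (metis half_gt_zero)
    have main: "dist (norm (path_of T y r - path_of T y s - (r - s) *\<^sub>R path_of T y' s) / norm (r - s)) 0 < e"
      if r: "r \<noteq> s" "\<bar>r - s\<bar> < min d 1" for r
    proof -
      have "norm (path_of T y r - path_of T y s - (r - s) *\<^sub>R path_of T y' s) \<le> e / 2 * \<bar>r - s\<bar>"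
      proof (rule norm_bound)
        fix x
        define c where "c = clamp (-T) 0 x"
        have c: "- T \<le> c" "c \<le> 0" unfolding c_def using clamp_real_def[of "-T" 0 x] T by auto
        define k where "k a = y a - a * y' (s + c)" for a
        have "\<bar>k (r + c) - k (s + c)\<bar> \<le> e / 2 * \<bar>(r + c) - (s + c)\<bar>"
        proof -
          have kd: "(k has_real_derivative (y' a - y' (s + c))) (at a within S)" for a S
            unfolding k_def[abs_def]
            by (auto intro!: derivative_eq_intros has_field_derivative_at_within[OF y])
          have "norm (k (r + c) - k (s + c)) \<le> e / 2 * norm ((r + c) - (s + c))"
          proof (rule field_differentiable_bound[where S="closed_segment (s + c) (r + c)" and f'="\<lambda>a. y' a - y' (s + c)"])
            fix a assume a: "a \<in> closed_segment (s + c) (r + c)"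
            then have "\<bar>a - (s + c)\<bar> \<le> \<bar>r - s\<bar>"
              by (auto simp: closed_segment_eq_real_ivl split: if_splits)
            then show "norm (y' a - y' (s + c)) \<le> e / 2"
            proof -
              assume *: "\<bar>a - (s + c)\<bar> \<le> \<bar>r - s\<bar>"
              have r1: "\<bar>r - s\<bar> < 1" "\<bar>r - s\<bar> < d" using r(2) by auto
              have "\<bar>y' a - y' (s + c)\<bar> < e / 2"
                by (rule d(2)) (use * r1 c in \<open>simp_all, linarith+\<close>)
              then show ?thesis by simp
            qed
          qed (auto intro: kd)
          then show ?thesis by simp
        qed
        moreover have "k (r + c) - k (s + c) = apply_bcontfun (path_of T y r - path_of T y s - (r - s) *\<^sub>R path_of T y' s) x"
          unfolding k_def c_def by (simp add: apply_path_of[OF yc T] apply_path_of[OF y' T] algebra_simps)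
        ultimately show "norm (apply_bcontfun (path_of T y r - path_of T y s - (r - s) *\<^sub>R path_of T y' s) x) \<le> e / 2 * \<bar>r - s\<bar>"
          by simp
      qed
      then have "norm (path_of T y r - path_of T y s - (r - s) *\<^sub>R path_of T y' s) / \<bar>r - s\<bar> \<le> e / 2"
        using r by (simp add: divide_le_eq)
      then have "norm (path_of T y r - path_of T y s - (r - s) *\<^sub>R path_of T y' s) / \<bar>r - s\<bar> < e"
        using e by linarith
      then show ?thesis by simp
    qed
    show "\<forall>\<^sub>F r in at s. dist (norm (path_of T y r - path_of T y s - (r - s) *\<^sub>R path_of T y' s) / norm (r - s)) 0 < e"
      unfolding eventually_at using main d(1) by (intro exI[of _ "min d 1"]) (auto simp: dist_real_def)
  qed
qed

lemma path_of_time_cont: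
  assumes "continuous_on UNIV y" "0 \<le> T"
  shows "continuous_on {a..b} (path_of T y)"
  unfolding continuous_on_iff
proof (intro ballI allI impI)
  fix s e :: real assume s: "s \<in> {a..b}" and e: "0 < e"
  have "uniformly_continuous_on {a - T..b} y"
    by (intro compact_uniformly_continuous continuous_on_subset[OF assms(1)]) auto
  then obtain d where d: "0 < d" "\<And>p q. p \<in> {a - T..b} \<Longrightarrow> q \<in> {a - T..b} \<Longrightarrow> \<bar>q - p\<bar> < d \<Longrightarrow> \<bar>y q - y p\<bar> < e / 2"
    unfolding uniformly_continuous_on_def dist_real_def using e by (metis half_gt_zero)
  have "dist (path_of T y r) (path_of T y s) < e" if "r \<in> {a..b}" "dist r s < d" for r
  proof -
    have "norm (path_of T y r - path_of T y s) \<le> e / 2"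
      by (rule norm_path_of_diff_le[OF assms(1,1,2)], rule less_imp_le, rule d(2))
        (use that s in \<open>auto simp: dist_real_def\<close>)
    then show ?thesis using e by (simp add: dist_norm)
  qed
  then show "\<exists>d>0. \<forall>r\<in>{a..b}. dist r s < d \<longrightarrow> dist (path_of T y r) (path_of T y s) < e"
    using d(1) by blast
qed

locale smooth_functional =
  fixes T :: real and u dtu :: "real \<Rightarrow> path \<Rightarrow> real" and Du :: "real \<Rightarrow> path \<Rightarrow> real set \<Rightarrow> real"
    and D2u :: "real \<Rightarrow> path \<Rightarrow> path \<Rightarrow>\<^sub>L path \<Rightarrow>\<^sub>L real" and D2chi :: "real \<Rightarrow> path \<Rightarrow> chi"
  assumes T: "0 < T" and C12: "C12 T u dtu Du D2u" and chi: "continuous_into_chi T D2u D2chi"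
begin

abbreviation dom :: "(real \<times> path) set" where
  "dom \<equiv> {0..<T} \<times> C_space T"

lemma Du_signed: "t \<in> {0..<T} \<Longrightarrow> \<eta> \<in> C_space T \<Longrightarrow> signed_measure_on T (Du t \<eta>)"
  using C12 unfolding C12_def by blast

lemma u_time_deriv: "t \<in> {0..<T} \<Longrightarrow> \<eta> \<in> C_space T \<Longrightarrow>
    ((\<lambda>s. u s \<eta>) has_real_derivative dtu t \<eta>) (at t within {0..<T})"
  using C12 unfolding C12_def by blast

lemma u_deriv: "t \<in> {0..<T} \<Longrightarrow> \<eta> \<in> C_space T \<Longrightarrow>
    (u t has_derivative (\<lambda>\<phi>. signed_integral (Du t \<eta>) (apply_bcontfun \<phi>))) (at \<eta> within C_space T)"
  using C12 unfolding C12_def by blast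

lemma Du_deriv: "t \<in> {0..<T} \<Longrightarrow> \<eta> \<in> C_space T \<Longrightarrow>
    ((\<lambda>\<gamma>. dual_of (Du t \<gamma>)) has_derivative blinfun_apply (D2u t \<eta>)) (at \<eta> within C_space T)"
  using C12 unfolding C12_def by blast

lemma dtu_cont: "continuous_on dom (\<lambda>(t, \<eta>). dtu t \<eta>)"
  and dual_cont: "continuous_on dom (\<lambda>(t, \<eta>). dual_of (Du t \<eta>))"
  using C12 unfolding C12_def by blast+

lemma D2chi_space: "t \<in> {0..<T} \<Longrightarrow> \<eta> \<in> C_space T \<Longrightarrow> D2chi t \<eta> \<in> chi_space T"
  using chi unfolding continuous_into_chi_def by blast

lemma D2u_eq: "t \<in> {0..<T} \<Longrightarrow> \<eta> \<in> C_space T \<Longrightarrow>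
    blinfun_apply (blinfun_apply (D2u t \<eta>) \<phi>) \<psi> = chi_form T (D2chi t \<eta>) \<phi> \<psi>"
  using chi unfolding continuous_into_chi_def by blast

abbreviation atom :: "real \<Rightarrow> path \<Rightarrow> real" where
  "atom t \<eta> \<equiv> Du t \<eta> {0}"

lemma atom_cont: "continuous_on dom (\<lambda>(t, \<eta>). atom t \<eta>)"
  unfolding continuous_on_iff
proof (intro ballI allI impI)
  fix p and e :: real assume p: "p \<in> dom" and e: "0 < e"
  from dual_cont[unfolded continuous_on_iff, rule_format, OF p e]
  obtain d where d: "0 < d" "\<And>q. q \<in> dom \<Longrightarrow> dist q p < d \<Longrightarrow>
      dist (case q of (t, \<eta>) \<Rightarrow> dual_of (Du t \<eta>)) (case p of (t, \<eta>) \<Rightarrow> dual_of (Du t \<eta>)) < e"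
    by blast
  have "dist (case q of (t, \<eta>) \<Rightarrow> atom t \<eta>) (case p of (t, \<eta>) \<Rightarrow> atom t \<eta>) < e"
    if q: "q \<in> dom" "dist q p < d" for q
  proof -
    obtain t \<eta> s \<gamma> where qp: "q = (t, \<eta>)" "p = (s, \<gamma>)" by (meson surj_pair)
    show ?thesis
      using atom_diff_le_dual[OF Du_signed[of t \<eta>] Du_signed[of s \<gamma>]] d(2)[OF q] p q(1)
      unfolding qp by (simp add: dist_norm dist_real_def)
  qed
  then show "\<exists>d>0. \<forall>q\<in>dom. dist q p < d \<longrightarrow> dist (case q of (t, \<eta>) \<Rightarrow> atom t \<eta>) (case p of (t, \<eta>) \<Rightarrow> atom t \<eta>) < e"
    using d(1) by blast
qed

text \<open>Since \<open>chi\<close> is not a metric type, a small distance between two second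
  derivatives is recorded by its three consequences used below. As a relation between points of
  \<open>dom\<close> it fits \<open>compact_uniform_neighbourhood\<close>.\<close>

definition chi_close :: "real \<Rightarrow> real \<times> path \<Rightarrow> real \<times> path \<Rightarrow> bool" where
  "chi_close e p q \<longleftrightarrow>
    (\<forall>\<phi> \<psi>. \<bar>chi_form T (case_prod D2chi p) \<phi> \<psi> - chi_form T (case_prod D2chi q) \<phi> \<psi>\<bar> \<le> e * path_weight T \<phi> * path_weight T \<psi>) \<and>
    \<bar>chi_lambda (case_prod D2chi p) - chi_lambda (case_prod D2chi q)\<bar> \<le> e \<and>
    (\<forall>\<phi>. \<bar>chi_row T (case_prod D2chi p) \<phi> - chi_row T (case_prod D2chi q) \<phi>\<bar> \<le> e * L2_norm_on {-T..0} (apply_bcontfun \<phi>))"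

lemma chi_close_nbhd:
  assumes p: "p \<in> dom" and e: "0 < e"
  shows "\<exists>d>0. \<forall>q\<in>ball p d. \<forall>r\<in>ball p d. q \<in> dom \<longrightarrow> r \<in> dom \<longrightarrow> chi_close e q r"
proof -
  define D where "D = case_prod D2chi"
  obtain t \<eta> where tp: "p = (t, \<eta>)" by (meson surj_pair)
  have Ds: "D q \<in> chi_space T" if "q \<in> dom" for q
    using that D2chi_space unfolding D_def by (cases q) auto
  have "((\<lambda>(s, \<gamma>). chi_norm T (chi_diff (D2chi s \<gamma>) (D2chi t \<eta>))) \<longlongrightarrow> 0) (at (t, \<eta>) within dom)"
    using chi p unfolding continuous_into_chi_def tp by blast
  \<comment> \<open>The factor 5 of \<open>chi_form_le\<close> turns \<open>e / 10\<close> into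
    \<open>e / 2\<close>, leaving room for the comparison of two points through
    \<open>p\<close>.\<close>
  from tendstoD[OF this, of "e / 10"] e obtain d where d0: "0 < d"
    and dd: "\<forall>q\<in>dom. q \<noteq> p \<and> dist q p < d \<longrightarrow>
      dist ((\<lambda>(s, \<gamma>). chi_norm T (chi_diff (D2chi s \<gamma>) (D2chi t \<eta>))) q) 0 < e / 10"
    unfolding eventually_at tp by auto
  have "chi_norm T (chi_diff (D q) (D p)) < e / 10" if "q \<in> dom" "q \<noteq> p" "dist q p < d" for q
  proof -
    have "dist ((\<lambda>(s, \<gamma>). chi_norm T (chi_diff (D2chi s \<gamma>) (D2chi t \<eta>))) q) 0 < e / 10"
      using dd that by blast
    then show ?thesis unfolding D_def tp dist_real_def by (simp add: split_beta abs_less_iff)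
  qed
  note d = d0 this
  have T0: "0 \<le> T" using T by simp
  have one: "\<bar>chi_form T (D q) \<phi> \<psi> - chi_form T (D p) \<phi> \<psi>\<bar> \<le> e / 2 * path_weight T \<phi> * path_weight T \<psi>"
    "\<bar>chi_lambda (D q) - chi_lambda (D p)\<bar> \<le> e / 2"
    "\<bar>chi_row T (D q) \<phi> - chi_row T (D p) \<phi>\<bar> \<le> e / 2 * L2_norm_on {-T..0} (apply_bcontfun \<phi>)"
    if q: "q \<in> dom" "q \<in> ball p d" for q \<phi> \<psi>
  proof -
    have "\<bar>chi_form T (D q) \<phi> \<psi> - chi_form T (D p) \<phi> \<psi>\<bar> \<le> e / 2 * path_weight T \<phi> * path_weight T \<psi>
      \<and> \<bar>chi_lambda (D q) - chi_lambda (D p)\<bar> \<le> e / 2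
      \<and> \<bar>chi_row T (D q) \<phi> - chi_row T (D p) \<phi>\<bar> \<le> e / 2 * L2_norm_on {-T..0} (apply_bcontfun \<phi>)"
    \<comment> \<open>The punctured limit in \<open>continuous_into_chi\<close> says nothing at
      \<open>p\<close> itself, where the three differences are trivially 0.\<close>
    proof (cases "q = p")
      case True
      have "0 \<le> e * L2_norm_on {-T..0} (apply_bcontfun \<phi>)"
        using e L2_norm_on_nonneg by (intro mult_nonneg_nonneg) auto
      then show ?thesis using True e path_weight_nonneg by simp
    next
      case False
      define n where "n = chi_norm T (chi_diff (D q) (D p))"
      have n: "n < e / 10" using d(2)[of q] q False unfolding n_def by (simp add: dist_commute)
      have sp: "chi_diff (D q) (D p) \<in> chi_space T" by (intro chi_diff_in_chi_space Ds q p)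
      have "\<bar>chi_form T (chi_diff (D q) (D p)) \<phi> \<psi>\<bar> \<le> 5 * n * path_weight T \<phi> * path_weight T \<psi>"
        unfolding n_def by (rule chi_form_le[OF T0 sp])
      also have "\<dots> \<le> e / 2 * path_weight T \<phi> * path_weight T \<psi>"
        using n path_weight_nonneg by (intro mult_right_mono) auto
      finally have 1: "\<bar>chi_form T (chi_diff (D q) (D p)) \<phi> \<psi>\<bar> \<le> e / 2 * path_weight T \<phi> * path_weight T \<psi>" .
      have 2: "\<bar>chi_lambda (chi_diff (D q) (D p))\<bar> \<le> e / 2"
        using chi_components_le(2)[of "chi_diff (D q) (D p)" T] n e unfolding n_def by linarith
      have "\<bar>chi_row T (chi_diff (D q) (D p)) \<phi>\<bar> \<le> n * L2_norm_on {-T..0} (apply_bcontfun \<phi>)"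
        unfolding n_def by (rule chi_form_parts_le(2)[OF T0 sp])
      also have "\<dots> \<le> e / 2 * L2_norm_on {-T..0} (apply_bcontfun \<phi>)"
        using n e L2_norm_on_nonneg by (intro mult_right_mono) auto
      finally have 3: "\<bar>chi_row T (chi_diff (D q) (D p)) \<phi>\<bar> \<le> e / 2 * L2_norm_on {-T..0} (apply_bcontfun \<phi>)" .
      show ?thesis using 1 2 3 unfolding chi_diff_linear[OF T0 Ds[OF q(1)] Ds[OF p]]
        by (simp add: chi_diff_def)
    qed
    then show "\<bar>chi_form T (D q) \<phi> \<psi> - chi_form T (D p) \<phi> \<psi>\<bar> \<le> e / 2 * path_weight T \<phi> * path_weight T \<psi>"
      "\<bar>chi_lambda (D q) - chi_lambda (D p)\<bar> \<le> e / 2"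
      "\<bar>chi_row T (D q) \<phi> - chi_row T (D p) \<phi>\<bar> \<le> e / 2 * L2_norm_on {-T..0} (apply_bcontfun \<phi>)" by blast+
  qed
  have "chi_close e q r" if q: "q \<in> dom" "q \<in> ball p d" and r: "r \<in> dom" "r \<in> ball p d" for q r
    unfolding chi_close_def D_def[symmetric]
  proof (intro conjI allI)
    fix \<phi> \<psi>
    have half: "a \<le> e / 2 * c \<Longrightarrow> b \<le> e / 2 * c \<Longrightarrow> a + b \<le> e * c" for a b c :: real by linarith
    show "\<bar>chi_form T (D q) \<phi> \<psi> - chi_form T (D r) \<phi> \<psi>\<bar> \<le> e * path_weight T \<phi> * path_weight T \<psi>"
      using half[OF one(1)[OF q, of \<phi> \<psi>, unfolded mult.assoc] one(1)[OF r, of \<phi> \<psi>, unfolded mult.assoc]]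
      unfolding mult.assoc by linarith
    show "\<bar>chi_lambda (D q) - chi_lambda (D r)\<bar> \<le> e" using one(2)[OF q] one(2)[OF r] by linarith
    show "\<bar>chi_row T (D q) \<phi> - chi_row T (D r) \<phi>\<bar> \<le> e * L2_norm_on {-T..0} (apply_bcontfun \<phi>)"
      using half[OF one(3)[OF q, of \<phi>] one(3)[OF r, of \<phi>]] by linarith
  qed
  then show ?thesis using d(1) by blast
qed

lemma lambda_cont: "continuous_on dom (\<lambda>(t, \<eta>). chi_lambda (D2chi t \<eta>))"
  unfolding continuous_on_iff
proof (intro ballI allI impI)
  fix p and e :: real assume p: "p \<in> dom" and e: "0 < e"
  obtain d where d: "0 < d" "\<And>q r. q \<in> ball p d \<Longrightarrow> r \<in> ball p d \<Longrightarrow> q \<in> dom \<Longrightarrow> r \<in> dom \<Longrightarrow> chi_close (e / 2) q r"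
    using chi_close_nbhd[OF p, of "e / 2"] e by auto
  have "dist (case q of (t, \<eta>) \<Rightarrow> chi_lambda (D2chi t \<eta>)) (case p of (t, \<eta>) \<Rightarrow> chi_lambda (D2chi t \<eta>)) < e"
    if "q \<in> dom" "dist q p < d" for q
  proof -
    have "chi_close (e / 2) q p" using d(2)[of q p] that p d(1) by (simp add: dist_commute)
    then have "\<bar>chi_lambda (case_prod D2chi q) - chi_lambda (case_prod D2chi p)\<bar> \<le> e / 2"
      unfolding chi_close_def by blast
    then show ?thesis using e by (simp add: dist_real_def split_beta)
  qed
  then show "\<exists>d>0. \<forall>q\<in>dom. dist q p < d \<longrightarrow>
      dist (case q of (t, \<eta>) \<Rightarrow> chi_lambda (D2chi t \<eta>)) (case p of (t, \<eta>) \<Rightarrow> chi_lambda (D2chi t \<eta>)) < e"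
    using d(1) by blast
qed

text \<open>The derivative exists only within \<open>C_space T\<close>, but a segment between its
  elements stays inside, so the parameter has a full neighbourhood and the mean value theorem on the
  line becomes available.\<close>

lemma segment_deriv:
  assumes t: "t \<in> {0..<T}" and \<eta>: "\<eta> \<in> C_space T" and \<phi>: "\<phi> \<in> C_space T"
  shows "((\<lambda>\<theta>. blinfun_apply (dual_of (Du t (\<eta> + \<theta> *\<^sub>R \<phi>))) \<psi>) has_real_derivative
    chi_form T (D2chi t (\<eta> + \<theta> *\<^sub>R \<phi>)) \<phi> \<psi>) (at \<theta>)"
proof -
  have mem: "\<eta> + \<theta> *\<^sub>R \<phi> \<in> C_space T" for \<theta> by (intro C_space_add C_space_scaleR \<eta> \<phi>)
  have "((\<lambda>\<theta>. \<eta> + \<theta> *\<^sub>R \<phi>) has_derivative (\<lambda>h. h *\<^sub>R \<phi>)) (at \<theta>)"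
    by (auto intro!: derivative_eq_intros)
  moreover have "((\<lambda>\<gamma>. dual_of (Du t \<gamma>)) has_derivative blinfun_apply (D2u t (\<eta> + \<theta> *\<^sub>R \<phi>)))
      (at (\<eta> + \<theta> *\<^sub>R \<phi>) within range (\<lambda>\<theta>. \<eta> + \<theta> *\<^sub>R \<phi>))"
    by (rule has_derivative_subset[OF Du_deriv[OF t mem]]) (use mem in auto)
  ultimately have "((\<lambda>\<theta>. dual_of (Du t (\<eta> + \<theta> *\<^sub>R \<phi>))) has_derivative
      (\<lambda>h. blinfun_apply (D2u t (\<eta> + \<theta> *\<^sub>R \<phi>)) (h *\<^sub>R \<phi>))) (at \<theta>)"
    by (rule has_derivative_in_compose)
  from bounded_linear.has_derivative[OF blinfun.bounded_linear_left[of \<psi>] this]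
  have "((\<lambda>\<theta>. blinfun_apply (dual_of (Du t (\<eta> + \<theta> *\<^sub>R \<phi>))) \<psi>) has_derivative
      (\<lambda>h. blinfun_apply (blinfun_apply (D2u t (\<eta> + \<theta> *\<^sub>R \<phi>)) (h *\<^sub>R \<phi>)) \<psi>)) (at \<theta>)" .
  then show ?thesis
    unfolding has_field_derivative_def
    by (simp add: blinfun.scaleR_right blinfun.scaleR_left D2u_eq[OF t mem] mult.commute[of _ "chi_form T (D2chi t (\<eta> + \<theta> *\<^sub>R \<phi>)) \<phi> \<psi>"])
qed

lemma segment_mvt:
  assumes t: "t \<in> {0..<T}" and \<eta>: "\<eta> \<in> C_space T" and \<phi>: "\<phi> \<in> C_space T" and ab: "a < b"
  shows "\<exists>\<theta>. a < \<theta> \<and> \<theta> < b \<and>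
    blinfun_apply (dual_of (Du t (\<eta> + b *\<^sub>R \<phi>))) \<psi> - blinfun_apply (dual_of (Du t (\<eta> + a *\<^sub>R \<phi>))) \<psi>
      = (b - a) * chi_form T (D2chi t (\<eta> + \<theta> *\<^sub>R \<phi>)) \<phi> \<psi>"
  using MVT2[OF ab, of "\<lambda>\<theta>. blinfun_apply (dual_of (Du t (\<eta> + \<theta> *\<^sub>R \<phi>))) \<psi>"
      "\<lambda>\<theta>. chi_form T (D2chi t (\<eta> + \<theta> *\<^sub>R \<phi>)) \<phi> \<psi>"] segment_deriv[OF t \<eta> \<phi>] by simp

text \<open>The atom is a limit of evaluations on tents, each of which obeys the mean value theorem.
  The intermediate parameter depends on the tent, so closeness to \<open>p\<close> is required along
  the whole segment; it then survives the limit.\<close>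

lemma atom_expansion:
  assumes t: "t \<in> {0..<T}" and \<eta>: "\<eta> \<in> C_space T" and \<phi>: "\<phi> \<in> C_space T"
    and close: "\<And>\<theta>. 0 < \<theta> \<Longrightarrow> \<theta> < 1 \<Longrightarrow> chi_close e (t, \<eta> + \<theta> *\<^sub>R \<phi>) p" and p: "p \<in> dom"
  shows "\<bar>atom t (\<eta> + \<phi>) - atom t \<eta> -
      (chi_lambda (case_prod D2chi p) * apply_bcontfun \<phi> 0 + chi_row T (case_prod D2chi p) \<phi>)\<bar> \<le> e * path_weight T \<phi>"
proof -
  have T0: "0 \<le> T" using T by simp
  have ps: "case_prod D2chi p \<in> chi_space T" using p D2chi_space by (cases p) auto
  define f where "f n = blinfun_apply (dual_of (Du t (\<eta> + \<phi>))) (tent n) - blinfun_apply (dual_of (Du t \<eta>)) (tent n)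
    - chi_form T (case_prod D2chi p) \<phi> (tent n)" for n
  have le: "\<bar>f n\<bar> \<le> e * path_weight T \<phi> * path_weight T (tent n)" for n
  proof -
    obtain \<theta> where \<theta>: "0 < \<theta>" "\<theta> < 1" and eq: "blinfun_apply (dual_of (Du t (\<eta> + \<phi>))) (tent n)
        - blinfun_apply (dual_of (Du t \<eta>)) (tent n) = chi_form T (D2chi t (\<eta> + \<theta> *\<^sub>R \<phi>)) \<phi> (tent n)"
      using segment_mvt[OF t \<eta> \<phi>, of 0 1 "tent n"] by auto
    show ?thesis unfolding f_def eq using close[OF \<theta>] unfolding chi_close_def by simp
  qed
  have "f \<longlonglongrightarrow> atom t (\<eta> + \<phi>) - atom t \<eta> -
      (chi_lambda (case_prod D2chi p) * apply_bcontfun \<phi> 0 + chi_row T (case_prod D2chi p) \<phi>)"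
    unfolding f_def[abs_def]
    by (intro tendsto_diff dual_of_tent_tendsto[OF Du_signed] chi_form_tent_tendsto T0 ps t \<eta> C_space_add \<phi>)
  moreover have "(\<lambda>n. e * path_weight T \<phi> * path_weight T (tent n)) \<longlonglongrightarrow> e * path_weight T \<phi> * 1"
    by (intro tendsto_intros path_weight_tent_tendsto)
  ultimately show ?thesis
    using le by (intro tendsto_le[OF _ _ tendsto_rabs]) (auto intro!: always_eventually)
qed

text \<open>The first-order part of \<open>L_operator\<close>, that is, everything except the
  diagonal integral of the second derivative.\<close>

definition drift :: "real \<Rightarrow> path \<Rightarrow> real" where
  "drift t \<eta> = dtu t \<eta> + forward_integral t (remove_atom0 (Du t \<eta>)) \<eta>"

text \<open>Applying \<open>Du\<close> to the velocity of the window gives, by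
  \<open>forward_integral_C1\<close>, the forward integral against the measure without its atom plus
  the atom times the current speed.\<close>

lemma u_along_C1_path:
  fixes y y' :: "real \<Rightarrow> real"
  assumes y: "\<And>r. (y has_real_derivative y' r) (at r)" and y': "continuous_on UNIV y'"
    and left: "\<And>r. r \<le> 0 \<Longrightarrow> y' r = 0" and t: "0 \<le> t" "t < T"
  shows "u t (path_of T y t) - u 0 (path_of T y 0)
    = integral {0..t} (\<lambda>s. drift s (path_of T y s) + atom s (path_of T y s) * y' s)"
proof -
  have T0: "0 \<le> T" using T by simp
  have yc: "continuous_on UNIV y" using y by (meson DERIV_continuous_on UNIV_I has_field_derivative_at_within)
  define h where "h = path_of T y"
  have hC: "h s \<in> C_space T" for s unfolding h_def by (rule path_of_in_C_space[OF yc T0])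
  have hd: "(h has_vector_derivative path_of T y' s) (at s within S)" for s S
    unfolding h_def by (rule has_vector_derivative_at_within[OF path_of_has_vector_derivative[OF T0 y y']])
  have "((\<lambda>s. u s (h s)) has_real_derivative drift s (h s) + atom s (h s) * y' s) (at s within {0..t})"
    if s: "0 \<le> s" "s \<le> t" for s
  proof -
    have sT: "s \<in> {0..<T}" using s t by simp
    have A: "(h has_derivative (\<lambda>k. k *\<^sub>R path_of T y' s)) (at s within {0..t})"
      using hd unfolding has_vector_derivative_def .
    have B: "(u s has_derivative (\<lambda>\<phi>. signed_integral (Du s (h s)) (apply_bcontfun \<phi>))) (at (h s) within h ` {0..t})"
      by (rule has_derivative_subset[OF u_deriv[OF sT hC]]) (use hC in auto)
    have "((\<lambda>r. u s (h r)) has_derivative (\<lambda>k. signed_integral (Du s (h s)) (apply_bcontfun (k *\<^sub>R path_of T y' s)))) (at s within {0..t})"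
      by (rule has_derivative_in_compose[OF A B])
    moreover have "signed_integral (Du s (h s)) (apply_bcontfun (k *\<^sub>R path_of T y' s))
        = signed_integral (Du s (h s)) (apply_bcontfun (path_of T y' s)) * k" for k
      by (simp add: scaleR_bcontfun.rep_eq signed_integral_cmult)
    ultimately have g2: "((\<lambda>r. u s (h r)) has_real_derivative signed_integral (Du s (h s)) (apply_bcontfun (path_of T y' s))) (at s within {0..t})"
      unfolding has_field_derivative_def by simp
    \<comment> \<open>Joint differentiability is not at hand, so the increment of \<open>u\<close>
      is split. The path increment at fixed time is handled by the Frechet derivative; this time
      increment at the moving path \<open>h r\<close> uses the mean value theorem and the joint
      continuity of \<open>dtu\<close>.\<close>
    have g1: "((\<lambda>r. u r (h r) - u s (h r)) has_real_derivative dtu s (h s)) (at s within {0..t})"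
      unfolding has_field_derivative_iff
    proof (rule tendstoI)
      fix e :: real assume e: "0 < e"
      have sp: "(s, h s) \<in> dom" using sT hC by simp
      obtain d where d: "0 < d" "\<And>q. q \<in> dom \<Longrightarrow> dist q (s, h s) < d \<Longrightarrow> dist (case_prod dtu q) (dtu s (h s)) < e"
        using dtu_cont[unfolded continuous_on_iff, rule_format, OF sp e] by auto
      have hc: "continuous (at s within {0..t}) h"
        using has_vector_derivative_continuous[OF hd] .
      have "0 < d / 2" using d(1) by simp
      from hc[unfolded continuous_within_eps_delta, rule_format, OF this]
      obtain d' where d': "0 < d'" "\<And>r. r \<in> {0..t} \<Longrightarrow> dist r s < d' \<Longrightarrow> dist (h r) (h s) < d / 2"
        by auto
      have main: "dist ((u r (h r) - u s (h r) - (u s (h s) - u s (h s))) / (r - s)) (dtu s (h s)) < e"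
        if r: "r \<in> {0..t}" "r \<noteq> s" "dist r s < min d' (d / 2)" for r
      proof -
        have td: "((\<lambda>\<tau>. u \<tau> (h r)) has_real_derivative dtu \<tau> (h r)) (at \<tau> within {min r s..max r s})"
          if "\<tau> \<in> {min r s..max r s}" for \<tau>
          by (rule DERIV_subset[OF u_time_deriv[OF _ hC]]) (use that r s t in auto)
        have "\<exists>\<xi>\<in>{min r s<..<max r s}. u (max r s) (h r) - u (min r s) (h r) = (\<lambda>k. k * dtu \<xi> (h r)) (max r s - min r s)"
          by (rule mvt_simple) (use r td in \<open>auto simp: has_field_derivative_def mult.commute[of _ "dtu _ _"]\<close>)
        then obtain \<xi> where \<xi>: "min r s < \<xi>" "\<xi> < max r s"
          "u (max r s) (h r) - u (min r s) (h r) = (max r s - min r s) * dtu \<xi> (h r)" by auto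
        then have eq: "(u r (h r) - u s (h r)) / (r - s) = dtu \<xi> (h r)"
          using r(2) by (cases "r < s") (auto simp: field_simps min_def max_def)
        have "dist (\<xi>, h r) (s, h s) \<le> dist \<xi> s + dist (h r) (h s)"
          unfolding dist_Pair_Pair by (rule sqrt_sum_squares_le_sum) auto
        moreover have "dist \<xi> s < d / 2" using \<xi>(1,2) r(3) by (cases "r < s") (simp_all add: dist_real_def)
        ultimately have "dist (\<xi>, h r) (s, h s) < d" using d'(2)[OF r(1)] r(3) by simp
        moreover have "(\<xi>, h r) \<in> dom" using \<xi>(1,2) r s t hC by auto
        ultimately show ?thesis using d(2)[of "(\<xi>, h r)"] eq by simp
      qed
      show "\<forall>\<^sub>F r in at s within {0..t}. dist ((u r (h r) - u s (h r) - (u s (h s) - u s (h s))) / (r - s)) (dtu s (h s)) < e"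
        unfolding eventually_at using main d(1) d'(1) by (intro exI[of _ "min d' (d / 2)"]) auto
    qed
    have "forward_integral s (remove_atom0 (Du s (h s))) (h s)
        = signed_integral (Du s (h s)) (apply_bcontfun (path_of T y' s)) - atom s (h s) * y' s"
      unfolding h_def by (rule forward_integral_C1[OF Du_signed[OF sT hC[unfolded h_def]] s(1) _ y y' left]) (use sT in auto)
    then have D: "dtu s (h s) + signed_integral (Du s (h s)) (apply_bcontfun (path_of T y' s))
        = drift s (h s) + atom s (h s) * y' s" unfolding drift_def by simp
    from DERIV_add[OF g1 g2] show ?thesis unfolding D by simp
  qed
  from integral_derivative[OF t(1) this] show ?thesis unfolding h_def by simp
qed

end

section \<open>The diagonal density vanishes\<close>

lemma integrable_mult_bounded:
  fixes f g :: "'a \<Rightarrow> real"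
  assumes f: "integrable M f" and g: "g \<in> borel_measurable M" and C: "\<And>x. \<bar>g x\<bar> \<le> C"
  shows "integrable M (\<lambda>x. f x * g x)"
proof (rule Bochner_Integration.integrable_bound[OF integrable_mult_right[OF integrable_abs[OF f], of C]])
  show "(\<lambda>x. f x * g x) \<in> borel_measurable M" using f g by simp
  show "AE x in M. norm (f x * g x) \<le> norm (C * \<bar>f x\<bar>)"
  proof (rule AE_I2)
    fix x
    have "0 \<le> C" using C[of x] by linarith
    then show "norm (f x * g x) \<le> norm (C * \<bar>f x\<bar>)"
      using mult_right_mono[OF C[of x], of "\<bar>f x\<bar>"] by (simp add: abs_mult mult.commute)
  qed
qed

text \<open>\<open>E n * F (x / E n)\<close> is a primitive of the oscillating function, and it is
  of size \<open>E n\<close>.\<close>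

lemma oscillation_null:
  fixes E :: "nat \<Rightarrow> real" and F f :: "real \<Rightarrow> real"
  assumes E: "\<And>n. 0 < E n" "E \<longlonglongrightarrow> 0" and cd: "c \<le> d"
    and F: "\<And>x. (F has_real_derivative f x) (at x)" "\<And>x. \<bar>F x\<bar> \<le> 1" and f: "continuous_on UNIV f"
  shows "(\<lambda>n. LINT x:{c..d}|lborel. f (x / E n)) \<longlonglongrightarrow> 0"
proof -
  have eq: "(LINT x:{c..d}|lborel. f (x / E n)) = E n * F (d / E n) - E n * F (c / E n)" for n
  proof -
    have "((\<lambda>x. E n * F (x / E n)) has_real_derivative f (x / E n)) (at x within {c..d})" for x
    proof -
      have "((\<lambda>x. F (x / E n)) has_real_derivative f (x / E n) * (1 / E n)) (at x)"
        by (rule DERIV_chain2[OF F(1)]) (rule DERIV_cdivide[OF DERIV_ident])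
      from DERIV_cmult[OF this, of "E n"] show ?thesis using E(1)[of n]
        by (simp add: has_field_derivative_at_within)
    qed
    from integral_derivative[OF cd this]
    have "integral {c..d} (\<lambda>x. f (x / E n)) = E n * F (d / E n) - E n * F (c / E n)" .
    moreover have "set_integrable lborel {c..d} (\<lambda>x. f (x / E n))"
      by (intro borel_integrable_atLeastAtMost' continuous_on_compose2[OF f] continuous_intros) (use E(1)[of n] in auto)
    ultimately show ?thesis by (simp add: set_borel_integral_eq_integral(2))
  qed
  have "\<bar>E n * F (d / E n) - E n * F (c / E n)\<bar> \<le> 2 * E n" for n
  proof -
    have "\<bar>E n * F (a / E n)\<bar> \<le> E n * 1" for a
      unfolding abs_mult using E(1)[of n] F(2)[of "a / E n"] by (intro mult_mono) auto
    from this[of d] this[of c] show ?thesis by linarith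
  qed
  then have "\<forall>\<^sub>F n in sequentially. norm (LINT x:{c..d}|lborel. f (x / E n)) \<le> 2 * E n"
    unfolding eq by simp
  moreover have "(\<lambda>n. 2 * E n) \<longlonglongrightarrow> 0" using tendsto_mult_right_zero[OF E(2), of 2] by simp
  ultimately show ?thesis by (rule Lim_null_comparison)
qed

text \<open>Both paths vanish at 0, which removes \<open>\<lambda>\<close>, \<open>g\<^sub>2\<close>
  and \<open>g\<^sub>3\<close>. Replacing \<open>c (x + E n)\<close> by \<open>c x\<close> costs
  \<open>k * E n\<close>; then the product on the diagonal is \<open>- 2 * (c x)\<^sup>2\<close>
  times a squared sine, whose weak limit is one half. Off the diagonal the two sines are independent
  and average out against \<open>g\<^sub>1\<close>.\<close>

lemma chi_form_oscillation:
  fixes \<phi> \<psi> :: "nat \<Rightarrow> path"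
  assumes T: "0 \<le> T" and \<mu>: "\<mu> \<in> chi_space T" and E: "\<And>n. 0 < E n" "E \<longlonglongrightarrow> 0"
    and c: "\<And>x. 0 \<le> c x" "\<And>x. c x \<le> (1::real)" and k: "\<And>x y. \<bar>c x - c y\<bar> \<le> k * \<bar>x - y\<bar>"
    and cm: "continuous_on UNIV c"
    and \<phi>: "\<And>n x. apply_bcontfun (\<phi> n) x = sqrt (E n) * c x * sin (pi * (x / E n))"
    and \<psi>: "\<And>n x. apply_bcontfun (\<psi> n) x = - (c (x + E n) + c x) * sin (pi * (x / E n)) / sqrt (E n)"
  shows "(\<lambda>n. chi_form T \<mu> (\<phi> n) (\<psi> n)) \<longlonglongrightarrow> - (LINT x:{-T..0}|lborel. chi_g4 \<mu> x * (c x)\<^sup>2)"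
proof -
  have g: "square_integrable_on ({-T..0} \<times> {-T..0}) (chi_g1 \<mu>)" "essentially_bounded_on {-T..0} (chi_g4 \<mu>)"
    using \<mu> unfolding chi_space_def by auto
  have [measurable]: "c \<in> borel_measurable borel" by (rule borel_measurable_continuous_onI[OF cm])
  define s where "s n x = sin (pi * (x / E n))" for n x
  have sm[measurable]: "s n \<in> borel_measurable borel" for n unfolding s_def[abs_def] by measurable
  have s1: "\<bar>s n x\<bar> \<le> 1" for n x unfolding s_def by simp
  have k0: "0 \<le> k" using k[of 0 1] by simp
  define r where "r n x = c (x + E n) - c x" for n x
  have rm[measurable]: "r n \<in> borel_measurable borel" for n unfolding r_def[abs_def] by measurable
  have rk: "\<bar>r n x\<bar> \<le> k * E n" for n x using k[of "x + E n" x] E(1)[of n] unfolding r_def by simp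
  have prod: "apply_bcontfun (\<phi> n) x * apply_bcontfun (\<psi> n) y
      = - (2 * (c x * s n x) * (c y * s n y)) - (c x * s n x) * (r n y * s n y)" for n x y
  proof -
    have "sqrt (E n) \<noteq> 0" using E(1)[of n] by simp
    then show ?thesis unfolding \<phi> \<psi> s_def[symmetric] r_def by (simp add: field_simps)
  qed
  have z: "apply_bcontfun (\<phi> n) 0 = 0" "apply_bcontfun (\<psi> n) 0 = 0" for n unfolding \<phi> \<psi> by simp_all
  have cs: "\<bar>c x * s n x\<bar> \<le> 1" for n x
    unfolding abs_mult using c[of x] s1[of n x] by (intro mult_le_one) auto
  have rs: "\<bar>r n x * s n x\<bar> \<le> k * E n" for n x
    unfolding abs_mult using mult_mono[OF rk[of n x] s1[of n x]] k0 E(1)[of n] by simp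
  have null_sin: "(\<lambda>n. LINT x:{-T..0}|lborel. f x * s n x) \<longlonglongrightarrow> 0" if "set_integrable lborel {-T..0} f" for f
  proof (rule weakly_null_integral[where C=1])
    fix a b :: real assume "a \<le> b"
    have "((\<lambda>x. - cos (pi * x) / pi) has_real_derivative sin (pi * x)) (at x)" for x
      by (auto intro!: derivative_eq_intros)
    moreover have "\<bar>- cos (pi * x) / pi\<bar> \<le> 1" for x :: real
    proof -
      have "1 \<le> pi" using pi_gt3 by simp
      then show ?thesis using order_trans[OF abs_cos_le_one[of "pi * x"]] by (simp add: abs_divide divide_le_eq)
    qed
    ultimately show "(\<lambda>n. LINT x:{a..b}|lborel. s n x) \<longlonglongrightarrow> 0"
      unfolding s_def by (intro oscillation_null[OF E \<open>a \<le> b\<close>, of "\<lambda>x. - cos (pi * x) / pi" "\<lambda>x. sin (pi * x)"] continuous_intros) auto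
  qed (use s1 that in auto)
  have null_cos: "(\<lambda>n. LINT x:{-T..0}|lborel. f x * cos (2 * pi * (x / E n))) \<longlonglongrightarrow> 0" if "set_integrable lborel {-T..0} f" for f
  proof (rule weakly_null_integral[where C=1])
    fix a b :: real assume "a \<le> b"
    have "((\<lambda>x. sin (2 * pi * x) / (2 * pi)) has_real_derivative cos (2 * pi * x)) (at x)" for x
      by (auto intro!: derivative_eq_intros)
    moreover have "\<bar>sin (2 * pi * x) / (2 * pi)\<bar> \<le> 1" for x :: real
    proof -
      have "1 \<le> 2 * pi" using pi_gt3 by simp
      then show ?thesis using order_trans[OF abs_sin_le_one[of "2 * pi * x"]] by (simp add: abs_divide divide_le_eq)
    qed
    ultimately show "(\<lambda>n. LINT x:{a..b}|lborel. cos (2 * pi * (x / E n))) \<longlonglongrightarrow> 0"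
      by (intro oscillation_null[OF E \<open>a \<le> b\<close>, of "\<lambda>x. sin (2 * pi * x) / (2 * pi)" "\<lambda>x. cos (2 * pi * x)"] continuous_intros) auto
  qed (use that in auto)
  have kE: "(\<lambda>n. C * (k * E n)) \<longlonglongrightarrow> 0" for C
    using tendsto_mult_right_zero[OF E(2), of "C * k"] by (simp add: mult.assoc)
  define G where "G z = indicator ({-T..0} \<times> {-T..0}) z * chi_g1 \<mu> z" for z
  have Gi: "integrable lborel G"
  proof -
    have "square_integrable_on ({-T..0} \<times> {-T..0}) (\<lambda>z::real \<times> real. 1)"
      using square_integrable_on_tensor(1)[of "{-T..0}" "\<lambda>_. 1" "{-T..0}" "\<lambda>_. 1"]
        square_integrable_on_bounded(1)[of "\<lambda>_. 1" "{-T..0}" 1]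
      by (simp add: emeasure_lborel_Icc_eq case_prod_unfold)
    from L2_Cauchy_Schwarz(1)[OF g(1) this] show ?thesis unfolding set_integrable_def G_def[abs_def] by simp
  qed
  have G2: "integrable (lborel \<Otimes>\<^sub>M lborel) G" using Gi unfolding lborel_prod .
  define A where "A n = (LINT z|lborel. G z * ((c (fst z) * s n (fst z)) * (c (snd z) * s n (snd z))))" for n
  define R where "R n = (LINT z|lborel. G z * ((c (fst z) * s n (fst z)) * (r n (snd z) * s n (snd z))))" for n
  have mA: "(\<lambda>z. (c (fst z) * s n (fst z)) * (c (snd z) * s n (snd z))) \<in> borel_measurable (lborel :: (real \<times> real) measure)"
    and mR: "(\<lambda>z. (c (fst z) * s n (fst z)) * (r n (snd z) * s n (snd z))) \<in> borel_measurable (lborel :: (real \<times> real) measure)" for n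
    unfolding lborel_prod[symmetric] by measurable
  have bA: "\<bar>(c a * s n a) * (c b * s n b)\<bar> \<le> 1" for n a b
    unfolding abs_mult[of "c a * s n a"] using cs by (intro mult_le_one) auto
  have bR: "\<bar>(c a * s n a) * (r n b * s n b)\<bar> \<le> k * E n" for n a b
    unfolding abs_mult[of "c a * s n a"] using mult_mono[OF cs[of a n] rs[of n b]] by simp
  have iA: "integrable lborel (\<lambda>z. G z * ((c (fst z) * s n (fst z)) * (c (snd z) * s n (snd z))))" for n
    by (rule integrable_mult_bounded[OF Gi mA bA])
  have iR: "integrable lborel (\<lambda>z. G z * ((c (fst z) * s n (fst z)) * (r n (snd z) * s n (snd z))))" for n
    by (rule integrable_mult_bounded[OF Gi mR bR])
  have g1: "(LINT z:{-T..0} \<times> {-T..0}|lborel. chi_g1 \<mu> z * (\<lambda>(x, y). apply_bcontfun (\<phi> n) x * apply_bcontfun (\<psi> n) y) z)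
      = - 2 * A n - R n" for n
  proof -
    have "(LINT z:{-T..0} \<times> {-T..0}|lborel. chi_g1 \<mu> z * (\<lambda>(x, y). apply_bcontfun (\<phi> n) x * apply_bcontfun (\<psi> n) y) z)
      = (LINT z|lborel. - 2 * (G z * ((c (fst z) * s n (fst z)) * (c (snd z) * s n (snd z))))
          - G z * ((c (fst z) * s n (fst z)) * (r n (snd z) * s n (snd z))))"
      unfolding set_lebesgue_integral_def
      by (rule Bochner_Integration.integral_cong) (auto simp: G_def prod split_beta algebra_simps)
    also have "\<dots> = - 2 * A n - R n" unfolding A_def R_def using iA[of n] iR[of n] by simp
    finally show ?thesis .
  qed
  have R0: "R \<longlonglongrightarrow> 0"
  proof (rule Lim_null_comparison[OF always_eventually kE])
    show "\<forall>n. norm (R n) \<le> (LINT z|lborel. \<bar>G z\<bar>) * (k * E n)"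
    proof
      fix n
      have "norm (R n) \<le> (LINT z|lborel. norm (G z * ((c (fst z) * s n (fst z)) * (r n (snd z) * s n (snd z)))))"
        unfolding R_def by (rule integral_norm_bound)
      also have "\<dots> \<le> (LINT z|lborel. \<bar>G z\<bar> * (k * E n))"
      proof (rule integral_mono)
        show "norm (G z * ((c (fst z) * s n (fst z)) * (r n (snd z) * s n (snd z)))) \<le> \<bar>G z\<bar> * (k * E n)" for z
          unfolding real_norm_def abs_mult[of "G z"] by (intro mult_left_mono bR) simp
      qed (use iR Gi in auto)
      finally show "norm (R n) \<le> (LINT z|lborel. \<bar>G z\<bar>) * (k * E n)" by simp
    qed
  qed
  \<comment> \<open>For almost every \<open>x\<close> the section \<open>G (x, y)\<close> is
    integrable in \<open>y\<close>, so oscillation in this one variable makes the inner integral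
    vanish; the integrals of \<open>\<bar>G (x, y)\<bar>\<close> over \<open>y\<close>
    dominate.\<close>
  have A0: "A \<longlonglongrightarrow> 0"
  proof -
    define H where "H n x = (LINT y|lborel. G (x, y) * ((c x * s n x) * (c y * s n y)))" for n x
    have AH: "A n = (LINT x|lborel. H n x)" for n
      using lborel_pair.integral_fst'[of "\<lambda>z. G z * ((c (fst z) * s n (fst z)) * (c (snd z) * s n (snd z)))"] iA[of n]
      unfolding A_def H_def lborel_prod by simp
    have "(\<lambda>n. LINT x|lborel. H n x) \<longlonglongrightarrow> (LINT x|(lborel :: real measure). 0)"
    proof (rule integral_dominated_convergence[where w="\<lambda>x. LINT y|lborel. \<bar>G (x, y)\<bar>"])
      show "integrable lborel (\<lambda>x. LINT y|lborel. \<bar>G (x, y)\<bar>)"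
        using lborel_pair.integrable_fst'[OF integrable_abs[OF G2]] by simp
      show "H n \<in> borel_measurable lborel" for n
        using lborel_pair.integrable_fst'[of "\<lambda>z. G z * ((c (fst z) * s n (fst z)) * (c (snd z) * s n (snd z)))"] iA[of n]
        unfolding H_def[abs_def] lborel_prod by simp
      show "AE x in lborel. (\<lambda>n. H n x) \<longlonglongrightarrow> 0"
        using lborel_pair.AE_integrable_fst'[OF G2]
      proof eventually_elim
        case (elim x)
        have i: "integrable lborel (\<lambda>y. G (x, y) * c y)"
          by (rule integrable_mult_bounded[OF elim, where C=1]) (use c in \<open>auto simp: abs_le_iff intro: order_trans[of _ 0]\<close>)
        have ind: "indicator {-T..0} y * (G (x, y) * c y) = G (x, y) * c y" for y
          unfolding G_def by (auto simp: indicator_def)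
        have "set_integrable lborel {-T..0} (\<lambda>y. G (x, y) * c y)"
          unfolding set_integrable_def using i by (simp add: ind)
        from null_sin[OF this]
        have l: "(\<lambda>n. LINT y|lborel. G (x, y) * c y * s n y) \<longlonglongrightarrow> 0"
          unfolding set_lebesgue_integral_def real_scaleR_def mult.assoc[symmetric]
          by (simp add: ind[unfolded mult.assoc[symmetric]])
        have "H n x = (c x * s n x) * (LINT y|lborel. G (x, y) * c y * s n y)" for n
          unfolding H_def integral_mult_right_zero[symmetric] by (simp add: mult_ac)
        then have "norm (H n x) \<le> norm (LINT y|lborel. G (x, y) * c y * s n y)" for n
          using mult_right_mono[OF cs[of x n], of "\<bar>LINT y|lborel. G (x, y) * c y * s n y\<bar>"] by (simp add: abs_mult)
        then show ?case
          by (intro Lim_null_comparison[OF always_eventually tendsto_norm_zero[OF l]]) auto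
      qed
      show "AE x in lborel. norm (H n x) \<le> (LINT y|lborel. \<bar>G (x, y)\<bar>)" for n
        using lborel_pair.AE_integrable_fst'[OF G2]
      proof eventually_elim
        case (elim x)
        have m: "(\<lambda>y. (c x * s n x) * (c y * s n y)) \<in> borel_measurable lborel" by measurable
        have "norm (H n x) \<le> (LINT y|lborel. norm (G (x, y) * ((c x * s n x) * (c y * s n y))))"
          unfolding H_def by (rule integral_norm_bound)
        also have "\<dots> \<le> (LINT y|lborel. \<bar>G (x, y)\<bar>)"
        proof (rule integral_mono)
          show "integrable lborel (\<lambda>y. norm (G (x, y) * ((c x * s n x) * (c y * s n y))))"
            by (rule integrable_norm[OF integrable_mult_bounded[OF elim m bA]])
          show "norm (G (x, y) * ((c x * s n x) * (c y * s n y))) \<le> \<bar>G (x, y)\<bar>" for y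
            using mult_left_mono[OF bA[of x n y], of "\<bar>G (x, y)\<bar>"] by (simp add: abs_mult)
        qed (use elim in auto)
        finally show ?case .
      qed
    qed simp
    then show ?thesis unfolding AH by simp
  qed
  have g4i: "set_integrable lborel {-T..0} (\<lambda>x. chi_g4 \<mu> x * f x)"
    if fm: "f \<in> borel_measurable borel" and fC: "\<And>x. \<bar>f x\<bar> \<le> C" for f :: "real \<Rightarrow> real" and C
  proof (rule Linf_integral_le(1)[OF g(2)])
    have "integrable lborel (\<lambda>x. indicator {-T..0} x * f x)"
      by (rule integrable_mult_bounded[where C=C]) (use fm fC in \<open>auto intro!: integrable_real_indicator simp: emeasure_lborel_Icc_eq\<close>)
    then show "set_integrable lborel {-T..0} f" unfolding set_integrable_def by simp
  qed simp
  have c2: "\<bar>(c x)\<^sup>2\<bar> \<le> 1" for x using c[of x] by (simp add: abs_le_iff power_le_one order_trans[of _ 0])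
  have icc: "set_integrable lborel {-T..0} (\<lambda>x. chi_g4 \<mu> x * (c x)\<^sup>2)" by (rule g4i[OF _ c2]) measurable
  have b3: "\<bar>(c x)\<^sup>2 * cos (2 * pi * (x / E n))\<bar> \<le> 1" for n x
    unfolding abs_mult using c2[of x] by (intro mult_le_one) auto
  have b4: "\<bar>(c x * s n x) * (r n x * s n x)\<bar> \<le> k * E n" for n x by (rule bR)
  have i3: "set_integrable lborel {-T..0} (\<lambda>x. chi_g4 \<mu> x * ((c x)\<^sup>2 * cos (2 * pi * (x / E n))))" for n
    by (rule g4i[OF _ b3]) measurable
  have i4: "set_integrable lborel {-T..0} (\<lambda>x. chi_g4 \<mu> x * ((c x * s n x) * (r n x * s n x)))" for n
    by (rule g4i[OF _ b4]) measurable
  define R4 where "R4 n = (LINT x:{-T..0}|lborel. chi_g4 \<mu> x * ((c x * s n x) * (r n x * s n x)))" for n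
  have g4: "(LINT y:{-T..0}|lborel. chi_g4 \<mu> y * (apply_bcontfun (\<phi> n) y * apply_bcontfun (\<psi> n) y))
      = - (LINT x:{-T..0}|lborel. chi_g4 \<mu> x * (c x)\<^sup>2) + (LINT x:{-T..0}|lborel. chi_g4 \<mu> x * ((c x)\<^sup>2 * cos (2 * pi * (x / E n)))) - R4 n" for n
  proof -
    have "chi_g4 \<mu> y * (apply_bcontfun (\<phi> n) y * apply_bcontfun (\<psi> n) y)
      = (chi_g4 \<mu> y * ((c y)\<^sup>2 * cos (2 * pi * (y / E n))) - chi_g4 \<mu> y * (c y)\<^sup>2) - chi_g4 \<mu> y * ((c y * s n y) * (r n y * s n y))" for y
    proof -
      have "cos (2 * (pi * (y / E n))) = 1 - 2 * (s n y)\<^sup>2" unfolding s_def by (rule cos_double_sin)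
      then have cc: "cos (2 * pi * (y / E n)) = 1 - 2 * (s n y)\<^sup>2" by (simp only: mult.assoc)
      show ?thesis unfolding prod cc by (simp add: power2_eq_square algebra_simps)
    qed
    then show ?thesis
      unfolding R4_def using set_integral_diff[OF set_integral_diff(1)[OF i3 icc] i4, of n n] set_integral_diff(2)[OF i3 icc, of n]
      by simp
  qed
  have R40: "R4 \<longlonglongrightarrow> 0"
  proof (rule Lim_null_comparison[OF always_eventually kE])
    show "\<forall>n. norm (R4 n) \<le> (\<bar>Linf_norm_on {-T..0} (chi_g4 \<mu>)\<bar> * T) * (k * E n)"
    proof
      fix n
      have si: "set_integrable lborel {-T..0} (\<lambda>x. (c x * s n x) * (r n x * s n x))"
        unfolding set_integrable_def real_scaleR_def
        by (rule integrable_mult_bounded[OF _ _ b4]) (auto intro!: integrable_real_indicator simp: emeasure_lborel_Icc_eq)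
      have "norm (R4 n) \<le> \<bar>Linf_norm_on {-T..0} (chi_g4 \<mu>)\<bar> * (LINT x:{-T..0}|lborel. \<bar>(c x * s n x) * (r n x * s n x)\<bar>)"
        unfolding R4_def real_norm_def by (rule Linf_integral_le(2)[OF g(2) _ si]) simp
      also have "(LINT x:{-T..0}|lborel. \<bar>(c x * s n x) * (r n x * s n x)\<bar>) \<le> (LINT x:{-T..0}|lborel. k * E n)"
      proof (rule set_integral_mono[OF set_integrable_abs[OF si]])
        show "set_integrable lborel {-T..0} (\<lambda>x. k * E n)"
          by (intro borel_integrable_atLeastAtMost' continuous_intros)
      qed (use b4 in blast)
      also have "(LINT x:{-T..0}|lborel. k * E n) = T * (k * E n)"
        unfolding set_lebesgue_integral_def using T by simp
      finally show "norm (R4 n) \<le> (\<bar>Linf_norm_on {-T..0} (chi_g4 \<mu>)\<bar> * T) * (k * E n)"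
        by (simp add: mult_left_mono mult.assoc)
    qed
  qed
  have "chi_form T \<mu> (\<phi> n) (\<psi> n) = (- 2 * A n - R n)
      + (- (LINT x:{-T..0}|lborel. chi_g4 \<mu> x * (c x)\<^sup>2) + (LINT x:{-T..0}|lborel. chi_g4 \<mu> x * (c x)\<^sup>2 * cos (2 * pi * (x / E n))) - R4 n)" for n
    unfolding chi_form_eq[OF T] g1 g4 z by (simp add: mult.assoc)
  moreover have "(\<lambda>n. (- 2 * A n - R n)
      + (- (LINT x:{-T..0}|lborel. chi_g4 \<mu> x * (c x)\<^sup>2) + (LINT x:{-T..0}|lborel. chi_g4 \<mu> x * (c x)\<^sup>2 * cos (2 * pi * (x / E n))) - R4 n))
      \<longlonglongrightarrow> (- 2 * 0 - 0) + (- (LINT x:{-T..0}|lborel. chi_g4 \<mu> x * (c x)\<^sup>2) + 0 - 0)"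
    by (intro tendsto_intros A0 R0 R40 null_cos icc)
  ultimately show ?thesis by simp
qed

text \<open>A polynomial close to the path, restricted to \<open>[-T,0]\<close> and extended
  constantly. Lipschitz paths are wanted because their forward quotients stay bounded as the step
  tends to 0.\<close>

lemma lipschitz_paths_dense:
  assumes T: "0 \<le> T" and \<eta>: "\<eta> \<in> C_space T" and e: "0 < e"
  shows "\<exists>\<gamma>\<in>C_space T. dist \<gamma> \<eta> < e \<and> (\<exists>L\<ge>0. \<forall>x y. \<bar>apply_bcontfun \<gamma> x - apply_bcontfun \<gamma> y\<bar> \<le> L * \<bar>x - y\<bar>)"
proof -
  obtain p where p: "real_polynomial_function p" "\<And>x. x \<in> {-T..0} \<Longrightarrow> \<bar>apply_bcontfun \<eta> x - p x\<bar> < e / 2"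
    using Stone_Weierstrass_real_polynomial_function[of "{-T..0}" "apply_bcontfun \<eta>" "e / 2"] e by auto
  obtain p' where p': "real_polynomial_function p'" "\<And>x. (p has_real_derivative p' x) (at x)"
    using has_real_derivative_polynomial_function[OF p(1)] by blast
  have pc: "continuous_on UNIV p" "continuous_on UNIV p'"
    using p(1) p'(1) by (auto intro: continuous_on_polymonial_function simp: real_polynomial_function_eq)
  obtain L where L: "0 \<le> L" "\<And>x. x \<in> {-T..0} \<Longrightarrow> \<bar>p' x\<bar> \<le> L" using bounded_on_interval[OF pc(2)] by blast
  define \<gamma> where "\<gamma> = path_of T p 0"
  have ap: "apply_bcontfun \<gamma> x = p (max (-T) (min 0 x))" for x
    unfolding \<gamma>_def using apply_path_of[OF pc(1) T, of 0 x] clamp_real_def[of "-T" 0 x] T by simp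
  have "norm (\<gamma> - \<eta>) \<le> e / 2"
  proof (rule norm_bound)
    fix x
    define m where "m = clamp (- T) 0 x"
    have m: "m = max (-T) (min 0 x)" unfolding m_def using clamp_real_def[of "-T" 0 x] T by simp
    have "apply_bcontfun \<eta> x = apply_bcontfun \<eta> m"
      using \<eta> unfolding C_space_def m_def by blast
    then have "apply_bcontfun (\<gamma> - \<eta>) x = p m - apply_bcontfun \<eta> m"
      unfolding minus_bcontfun.rep_eq ap m[symmetric] by (rule arg_cong)
    moreover have "\<bar>apply_bcontfun \<eta> m - p m\<bar> < e / 2" by (rule p(2)) (use T in \<open>auto simp: m\<close>)
    ultimately show "norm (apply_bcontfun (\<gamma> - \<eta>) x) \<le> e / 2"
      unfolding real_norm_def by linarith
  qed
  then have "dist \<gamma> \<eta> < e" using e by (simp add: dist_norm)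
  moreover have "\<bar>apply_bcontfun \<gamma> x - apply_bcontfun \<gamma> y\<bar> \<le> L * \<bar>x - y\<bar>" for x y
  proof -
    have "norm (p (max (-T) (min 0 x)) - p (max (-T) (min 0 y))) \<le> L * norm (max (-T) (min 0 x) - max (-T) (min 0 y))"
      by (rule field_differentiable_bound[where S="{-T..0}" and f'=p'])
        (use L T p'(2) in \<open>auto intro: has_field_derivative_at_within\<close>)
    also have "\<dots> \<le> L * \<bar>x - y\<bar>" using L(1) by (intro mult_left_mono) auto
    finally show ?thesis by (simp add: ap)
  qed
  moreover have "\<gamma> \<in> C_space T" unfolding \<gamma>_def by (rule path_of_in_C_space[OF pc(1) T])
  ultimately show ?thesis using L(1) by blast
qed

text \<open>A shifted path is in general no longer constant to the left of \<open>-T\<close>, so it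
  may leave \<open>C_space T\<close>; the measures act on all bounded continuous functions, so they
  can still be applied to it.\<close>

definition shift_path :: "real \<Rightarrow> path \<Rightarrow> path" where
  "shift_path \<epsilon> \<eta> = Bcontfun (\<lambda>x. apply_bcontfun \<eta> (x + \<epsilon>))"

lemma apply_shift_path: "apply_bcontfun (shift_path \<epsilon> \<eta>) x = apply_bcontfun \<eta> (x + \<epsilon>)"
proof -
  have "(\<lambda>x. apply_bcontfun \<eta> (x + \<epsilon>)) \<in> bcontfun"
    by (rule bcontfun_normI[where b="norm \<eta>"])
      (auto intro!: continuous_on_compose2[OF continuous_on_apply_bcontfun[of UNIV \<eta>]] continuous_intros
        simp: abs_apply_bcontfun_le)
  then show ?thesis unfolding shift_path_def by (simp add: Bcontfun_inverse)
qed

definition diff_path :: "real \<Rightarrow> path \<Rightarrow> path" where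
  "diff_path \<epsilon> \<eta> = (1 / \<epsilon>) *\<^sub>R (shift_path \<epsilon> \<eta> - \<eta>)"

lemma apply_diff_path: "apply_bcontfun (diff_path \<epsilon> \<eta>) x = (apply_bcontfun \<eta> (x + \<epsilon>) - apply_bcontfun \<eta> x) / \<epsilon>"
  unfolding diff_path_def by (simp add: apply_shift_path)

lemma diff_path_diff: "diff_path \<epsilon> (\<eta> - \<gamma>) = diff_path \<epsilon> \<eta> - diff_path \<epsilon> \<gamma>"
  and diff_path_add: "diff_path \<epsilon> (\<eta> + \<gamma>) = diff_path \<epsilon> \<eta> + diff_path \<epsilon> \<gamma>"
  by (rule bcontfun_eqI, simp add: apply_diff_path diff_divide_distrib add_divide_distrib)+

lemma norm_diff_path_le: "0 < \<epsilon> \<Longrightarrow> norm (diff_path \<epsilon> \<eta>) \<le> 2 * norm \<eta> / \<epsilon>"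
proof (rule norm_bound)
  fix x assume "0 < \<epsilon>"
  then show "norm (apply_bcontfun (diff_path \<epsilon> \<eta>) x) \<le> 2 * norm \<eta> / \<epsilon>"
    unfolding apply_diff_path using abs_apply_bcontfun_le[of \<eta> "x + \<epsilon>"] abs_apply_bcontfun_le[of \<eta> x]
    by (simp add: abs_divide divide_right_mono)
qed

definition truncated_integral :: "real \<Rightarrow> (real set \<Rightarrow> real) \<Rightarrow> path \<Rightarrow> real" where
  "truncated_integral t \<mu> \<phi> = signed_integral \<mu> (\<lambda>x. indicator {-t..0} x * apply_bcontfun \<phi> x)"

text \<open>The indicator of \<open>{-t..0}\<close> is not continuous, so the dual norm does not
  bound the truncated integrals directly; the indicator is reached as a bounded pointwise limit of
  continuous cut-off functions.\<close>

lemma truncated_integral_diff_le: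
  assumes \<mu>: "signed_measure_on T \<mu>" and \<nu>: "signed_measure_on T \<nu>" and t: "0 \<le> t"
  shows "\<bar>truncated_integral t \<mu> \<phi> - truncated_integral t \<nu> \<phi>\<bar> \<le> norm (dual_of \<mu> - dual_of \<nu>) * norm \<phi>"
proof -
  \<comment> \<open>The distance of \<open>x\<close> from \<open>[-t,0]\<close>.\<close>
  define d where "d x = max 0 (max (- t - x) x)" for x :: real
  define w where "w n x = max 0 (1 - real n * d x)" for n x
  have w01: "0 \<le> w n x" "w n x \<le> 1" for n x unfolding w_def d_def by auto
  have wc: "continuous_on UNIV (w n)" for n unfolding w_def[abs_def] d_def by (intro continuous_intros)
  have le: "\<bar>w n x * apply_bcontfun \<phi> x\<bar> \<le> norm \<phi>" for n x
    unfolding abs_mult using mult_mono[OF w01(2)[of n x] abs_apply_bcontfun_le[of \<phi> x]] w01[of n x] by simp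
  have "(\<lambda>x. w n x * apply_bcontfun \<phi> x) \<in> bcontfun" for n
    by (rule bcontfun_normI[where b="norm \<phi>"]) (use le in \<open>auto intro!: continuous_intros wc\<close>)
  then have ap: "apply_bcontfun (Bcontfun (\<lambda>x. w n x * apply_bcontfun \<phi> x)) x = w n x * apply_bcontfun \<phi> x" for n x
    by (simp add: Bcontfun_inverse)
  have wl: "(\<lambda>n. w n x) \<longlonglongrightarrow> indicator {-t..0} x" for x
  proof (cases "x \<in> {-t..0}")
    case True
    then have "w n x = 1" for n unfolding w_def d_def by (auto simp: max_def)
    then show ?thesis using True by simp
  next
    case False
    then have dp: "0 < d x" unfolding d_def by (auto simp: less_max_iff_disj)
    obtain N :: nat where N: "1 / d x < real N" using reals_Archimedean2 by blast
    have "\<forall>\<^sub>F n in sequentially. w n x = 0"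
      using eventually_ge_at_top[of N]
    proof eventually_elim
      case (elim n)
      have "1 \<le> real N * d x" using N dp by (simp add: field_simps)
      also have "\<dots> \<le> real n * d x" using elim dp by (intro mult_right_mono) auto
      finally show ?case unfolding w_def by simp
    qed
    then show ?thesis using False by (simp add: tendsto_eventually)
  qed
  show ?thesis unfolding truncated_integral_def
    by (rule signed_integral_diff_le_dual[OF \<mu> \<nu>, where f="\<lambda>n. Bcontfun (\<lambda>x. w n x * apply_bcontfun \<phi> x)"])
      (auto simp: ap intro!: norm_bound le tendsto_mult wl)
qed

lemma truncated_integral_linear:
  assumes \<mu>: "signed_measure_on T \<mu>"
  shows "truncated_integral t \<mu> (\<phi> + \<psi>) = truncated_integral t \<mu> \<phi> + truncated_integral t \<mu> \<psi>"
    and "truncated_integral t \<mu> (\<phi> - \<psi>) = truncated_integral t \<mu> \<phi> - truncated_integral t \<mu> \<psi>"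
    and "\<bar>truncated_integral t \<mu> \<phi>\<bar> \<le> total_variation \<mu> * norm \<phi>"
proof -
  have m: "(\<lambda>x. indicator {-t..0} x * apply_bcontfun \<phi> x) \<in> borel_measurable borel" for \<phi> :: path
    by measurable
  have b: "\<bar>indicator {-t..0} x * apply_bcontfun \<phi> x\<bar> \<le> norm \<phi>" for \<phi> :: path and x
    using abs_apply_bcontfun_le[of \<phi> x] by (simp add: indicator_def)
  show "truncated_integral t \<mu> (\<phi> + \<psi>) = truncated_integral t \<mu> \<phi> + truncated_integral t \<mu> \<psi>"
    unfolding truncated_integral_def using signed_integral_add[OF \<mu> m b m b, of \<phi> \<psi>]
    by (simp add: distrib_left)
  show "truncated_integral t \<mu> (\<phi> - \<psi>) = truncated_integral t \<mu> \<phi> - truncated_integral t \<mu> \<psi>"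
    unfolding truncated_integral_def using signed_integral_diff[OF \<mu> m b m b, of \<phi> \<psi>]
    by (simp add: right_diff_distrib)
  show "\<bar>truncated_integral t \<mu> \<phi>\<bar> \<le> total_variation \<mu> * norm \<phi>"
    unfolding truncated_integral_def by (rule signed_integral_abs_le[OF \<mu> m b])
qed

lemma forward_quotient_truncated:
  assumes "signed_measure_on T \<mu>" "0 \<le> T" "\<eta> \<in> C_space T" "0 < \<epsilon>"
  shows "forward_quotient t (remove_atom0 \<mu>) \<eta> \<epsilon> = truncated_integral t \<mu> (diff_path \<epsilon> \<eta>)"
  unfolding truncated_integral_def apply_diff_path by (rule forward_quotient_remove_atom0[OF assms])

context smooth_functional
begin

text \<open>For a fixed step, changing the measure costs its dual distance times
  \<open>2 * norm \<gamma> / \<epsilon>\<close>, and changing the path costs the total variation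
  times \<open>2 / \<epsilon>\<close>. This makes the sets in the Baire argument closed.\<close>

lemma quotient_cont:
  assumes t: "t \<in> {0..<T}" and \<epsilon>: "0 < \<epsilon>"
  shows "continuous_on (C_space T) (\<lambda>\<eta>. truncated_integral t (Du t \<eta>) (diff_path \<epsilon> \<eta>))"
  unfolding continuous_on_def
proof
  fix \<eta> assume \<eta>: "\<eta> \<in> C_space T"
  have ident: "((\<lambda>\<gamma>::path. \<gamma>) \<longlongrightarrow> \<eta>) (at \<eta> within C_space T)" by (rule tendsto_ident_at)
  have "continuous_on (C_space T) (\<lambda>\<gamma>. dual_of (Du t \<gamma>))"
    using Du_deriv[OF t] by (meson continuous_on_eq_continuous_within has_derivative_continuous)
  then have dl: "((\<lambda>\<gamma>. dual_of (Du t \<gamma>)) \<longlongrightarrow> dual_of (Du t \<eta>)) (at \<eta> within C_space T)"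
    using \<eta> unfolding continuous_on_def by blast
  have "((\<lambda>\<gamma>. norm (dual_of (Du t \<gamma>) - dual_of (Du t \<eta>)) * (2 * norm \<gamma> / \<epsilon>) + total_variation (Du t \<eta>) * (2 * norm (\<gamma> - \<eta>) / \<epsilon>))
      \<longlongrightarrow> norm (dual_of (Du t \<eta>) - dual_of (Du t \<eta>)) * (2 * norm \<eta> / \<epsilon>) + total_variation (Du t \<eta>) * (2 * norm (\<eta> - \<eta>) / \<epsilon>)) (at \<eta> within C_space T)"
    by (intro tendsto_intros dl ident) (use \<epsilon> in auto)
  then have lim: "((\<lambda>\<gamma>. norm (dual_of (Du t \<gamma>) - dual_of (Du t \<eta>)) * (2 * norm \<gamma> / \<epsilon>) + total_variation (Du t \<eta>) * (2 * norm (\<gamma> - \<eta>) / \<epsilon>))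
      \<longlongrightarrow> 0) (at \<eta> within C_space T)" by simp
  have "\<forall>\<^sub>F \<gamma> in at \<eta> within C_space T. norm (truncated_integral t (Du t \<gamma>) (diff_path \<epsilon> \<gamma>) - truncated_integral t (Du t \<eta>) (diff_path \<epsilon> \<eta>))
      \<le> norm (dual_of (Du t \<gamma>) - dual_of (Du t \<eta>)) * (2 * norm \<gamma> / \<epsilon>) + total_variation (Du t \<eta>) * (2 * norm (\<gamma> - \<eta>) / \<epsilon>)"
    unfolding eventually_at_topological
  proof (intro exI[of _ UNIV] conjI ballI impI open_UNIV UNIV_I)
    fix \<gamma> assume \<gamma>: "\<gamma> \<in> C_space T"
    note s\<gamma> = Du_signed[OF t \<gamma>] and s\<eta> = Du_signed[OF t \<eta>]
    have t0: "0 \<le> t" using t by simp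
    have "\<bar>truncated_integral t (Du t \<gamma>) (diff_path \<epsilon> \<gamma>) - truncated_integral t (Du t \<eta>) (diff_path \<epsilon> \<gamma>)\<bar>
        \<le> norm (dual_of (Du t \<gamma>) - dual_of (Du t \<eta>)) * (2 * norm \<gamma> / \<epsilon>)"
      by (rule order_trans[OF truncated_integral_diff_le[OF s\<gamma> s\<eta> t0]])
        (intro mult_left_mono norm_diff_path_le \<epsilon> norm_ge_zero)
    moreover have "\<bar>truncated_integral t (Du t \<eta>) (diff_path \<epsilon> \<gamma>) - truncated_integral t (Du t \<eta>) (diff_path \<epsilon> \<eta>)\<bar>
        \<le> total_variation (Du t \<eta>) * (2 * norm (\<gamma> - \<eta>) / \<epsilon>)"
    proof -
      have "0 \<le> total_variation (Du t \<eta>)"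
        unfolding total_variation_def using pos_variation_nonneg[OF s\<eta>]
          pos_variation_nonneg[OF signed_measure_uminus[OF s\<eta>]] by (intro add_nonneg_nonneg)
      then show ?thesis
        unfolding truncated_integral_linear(2)[OF s\<eta>, symmetric] diff_path_diff[symmetric]
        by (intro order_trans[OF truncated_integral_linear(3)[OF s\<eta>]] mult_left_mono norm_diff_path_le \<epsilon>)
    qed
    ultimately show "norm (truncated_integral t (Du t \<gamma>) (diff_path \<epsilon> \<gamma>) - truncated_integral t (Du t \<eta>) (diff_path \<epsilon> \<eta>))
      \<le> norm (dual_of (Du t \<gamma>) - dual_of (Du t \<eta>)) * (2 * norm \<gamma> / \<epsilon>) + total_variation (Du t \<eta>) * (2 * norm (\<gamma> - \<eta>) / \<epsilon>)"
      unfolding real_norm_def by linarith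
  qed
  from Lim_null_comparison[OF this lim]
  show "((\<lambda>\<gamma>. truncated_integral t (Du t \<gamma>) (diff_path \<epsilon> \<gamma>)) \<longlongrightarrow> truncated_integral t (Du t \<eta>) (diff_path \<epsilon> \<eta>)) (at \<eta> within C_space T)"
    by (simp add: LIM_zero_iff)
qed

text \<open>By Baire's theorem, the convergence of the forward quotients is uniform up to \<open>\<delta>\<close> on some
  ball inside any given one.\<close>

lemma quotient_uniform_on_ball:
  assumes t: "t \<in> {0..<T}"
    and ex: "\<And>\<eta>. \<eta> \<in> C_space T \<Longrightarrow> forward_integral_exists t (remove_atom0 (Du t \<eta>)) \<eta>"
    and J: "continuous_on (C_space T) (\<lambda>\<eta>. forward_integral t (remove_atom0 (Du t \<eta>)) \<eta>)"
    and \<eta>0: "\<eta>0 \<in> C_space T" and \<rho>: "0 < \<rho>" and \<delta>: "0 < \<delta>"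
  shows "\<exists>\<eta>1\<in>C_space T. \<exists>r>0. \<exists>e>0. \<forall>\<eta>\<in>C_space T. dist \<eta> \<eta>1 < r \<longrightarrow> dist \<eta> \<eta>0 \<le> \<rho> \<and>
    (\<forall>\<epsilon>. 0 < \<epsilon> \<and> \<epsilon> \<le> e \<longrightarrow> \<bar>truncated_integral t (Du t \<eta>) (diff_path \<epsilon> \<eta>)
      - forward_integral t (remove_atom0 (Du t \<eta>)) \<eta>\<bar> \<le> \<delta>)"
proof -
  define C where "C = C_space T"
  define q where "q \<epsilon> \<eta> = truncated_integral t (Du t \<eta>) (diff_path \<epsilon> \<eta>)" for \<epsilon> \<eta>
  define Jf where "Jf \<eta> = forward_integral t (remove_atom0 (Du t \<eta>)) \<eta>" for \<eta>
  \<comment> \<open>The paths of the closed ball whose quotients have come within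
    \<open>\<delta>\<close> of their limit for all steps up to \<open>1 / Suc m\<close>. Pointwise
    convergence means that these sets cover the open ball, so one of them has interior points
    relative to \<open>C\<close>.\<close>
  define F where "F m = {\<eta> \<in> C. dist \<eta> \<eta>0 \<le> \<rho>} \<inter> (\<Inter>\<epsilon>\<in>{\<epsilon>. 0 < \<epsilon> \<and> \<epsilon> \<le> 1 / real (Suc m)}. {\<eta> \<in> C. \<bar>q \<epsilon> \<eta> - Jf \<eta>\<bar> \<le> \<delta>})" for m
  have cC: "closed C" unfolding C_def by (rule closed_C_space)
  have qc: "continuous_on C (q \<epsilon>)" if "0 < \<epsilon>" for \<epsilon>
    unfolding C_def q_def[abs_def] by (rule quotient_cont[OF t that])
  have Jc: "continuous_on C Jf" using J unfolding C_def Jf_def[abs_def] .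
  have clF: "closed (F m)" for m
    unfolding F_def
    by (intro closed_Int closed_INT ballI continuous_on_closed_Collect_le continuous_intros cC qc Jc) auto
  have lim: "((\<lambda>\<epsilon>. q \<epsilon> \<eta>) \<longlongrightarrow> Jf \<eta>) (at_right 0)" if \<eta>: "\<eta> \<in> C" for \<eta>
  proof -
    obtain l where l: "(forward_quotient t (remove_atom0 (Du t \<eta>)) \<eta> \<longlongrightarrow> l) (at_right 0)"
      using ex \<eta> unfolding C_def forward_integral_exists_def by blast
    then have "Jf \<eta> = l" unfolding Jf_def forward_integral_def by (intro tendsto_Lim) auto
    moreover have "\<forall>\<^sub>F \<epsilon> in at_right 0. forward_quotient t (remove_atom0 (Du t \<eta>)) \<eta> \<epsilon> = q \<epsilon> \<eta>"
      unfolding eventually_at_right_field q_def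
      using forward_quotient_truncated[OF Du_signed[OF t] _ _ ] \<eta> T unfolding C_def by (intro exI[of _ 1]) auto
    ultimately show ?thesis using Lim_transform_eventually[OF l] by simp
  qed
  have cover: "{\<eta> \<in> C. dist \<eta> \<eta>0 < \<rho>} \<subseteq> (\<Union>m. F m)"
  proof
    fix \<eta> assume "\<eta> \<in> {\<eta> \<in> C. dist \<eta> \<eta>0 < \<rho>}"
    then have \<eta>: "\<eta> \<in> C" "dist \<eta> \<eta>0 < \<rho>" by auto
    obtain b where b: "0 < b" "\<And>\<epsilon>. 0 < \<epsilon> \<Longrightarrow> \<epsilon> < b \<Longrightarrow> dist (q \<epsilon> \<eta>) (Jf \<eta>) < \<delta>"
      using tendstoD[OF lim[OF \<eta>(1)] \<delta>] unfolding eventually_at_right_field by auto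
    obtain m where m: "1 / real (Suc m) < b" using b(1) by (meson nat_approx_posE)
    have "\<eta> \<in> F m" unfolding F_def using \<eta> b(2) m by (auto simp: dist_real_def intro!: less_imp_le)
    then show "\<eta> \<in> (\<Union>m. F m)" by blast
  qed
  have "\<exists>m. top_of_set C interior_of F m \<noteq> {}"
  proof (rule ccontr)
    assume "\<nexists>m. top_of_set C interior_of F m \<noteq> {}"
    then have "top_of_set C interior_of \<Union>(range F) = {}"
    proof (intro Baire_category_alt conjI)
      show "completely_metrizable_space (top_of_set C) \<or> locally_compact_space (top_of_set C) \<and> regular_space (top_of_set C)"
        using completely_metrizable_space_closedin[OF completely_metrizable_space_euclidean, of C] cC by simp
      fix S assume "S \<in> range F"
      then obtain m where S: "S = F m" by blast
      show "closedin (top_of_set C) S"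
        unfolding S by (rule closed_subset[OF _ clF]) (auto simp: F_def)
      show "top_of_set C interior_of S = {}" unfolding S using \<open>\<nexists>m. top_of_set C interior_of F m \<noteq> {}\<close> by blast
    qed simp
    moreover have "{\<eta> \<in> C. dist \<eta> \<eta>0 < \<rho>} \<subseteq> top_of_set C interior_of \<Union>(range F)"
    proof (rule interior_of_maximal[OF cover])
      have "{\<eta> \<in> C. dist \<eta> \<eta>0 < \<rho>} = C \<inter> ball \<eta>0 \<rho>" by (auto simp: dist_commute)
      then show "openin (top_of_set C) {\<eta> \<in> C. dist \<eta> \<eta>0 < \<rho>}" by (simp add: openin_open_Int)
    qed
    ultimately show False using \<eta>0 \<rho> unfolding C_def by auto
  qed
  then obtain m \<eta>1 where m: "\<eta>1 \<in> top_of_set C interior_of F m" by blast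
  then obtain V where V: "openin (top_of_set C) V" "\<eta>1 \<in> V" "V \<subseteq> F m" unfolding interior_of_def by auto
  then obtain r where r: "0 < r" "ball \<eta>1 r \<inter> C \<subseteq> V" unfolding openin_contains_ball by blast
  have "\<eta>1 \<in> C" using V unfolding F_def by auto
  have mF: "\<eta> \<in> F m" if "\<eta> \<in> C_space T" "dist \<eta> \<eta>1 < r" for \<eta>
    using that r V unfolding C_def by (auto simp: dist_commute)
  have "dist \<eta> \<eta>0 \<le> \<rho>" if "\<eta> \<in> F m" for \<eta> using that unfolding F_def by auto
  moreover have "\<bar>truncated_integral t (Du t \<eta>) (diff_path \<epsilon> \<eta>) - forward_integral t (remove_atom0 (Du t \<eta>)) \<eta>\<bar> \<le> \<delta>"
    if "\<eta> \<in> F m" "0 < \<epsilon> \<and> \<epsilon> \<le> 1 / real (Suc m)" for \<eta> \<epsilon>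
    using that unfolding F_def q_def Jf_def by auto
  moreover have "0 < 1 / real (Suc m)" by simp
  ultimately show ?thesis using mF r(1) \<open>\<eta>1 \<in> C\<close> unfolding C_def by blast
qed

text \<open>Second differences of the forward quotient in the direction of a path oscillating at scale
  \<open>\<epsilon>\<close> with amplitude \<open>sqrt \<epsilon>\<close> tend to twice the diagonal integral, whereas those of the (continuous)
  forward integral tend to \<open>0\<close>.\<close>

lemma weighted_diagonal_zero:
  assumes t: "0 < t" "t < T"
    and ex: "\<And>\<eta>. \<eta> \<in> C_space T \<Longrightarrow> forward_integral_exists t (remove_atom0 (Du t \<eta>)) \<eta>"
    and J: "continuous_on (C_space T) (\<lambda>\<eta>. forward_integral t (remove_atom0 (Du t \<eta>)) \<eta>)"
    and c: "\<And>x. 0 \<le> c x" "\<And>x. c x \<le> (1::real)" and k: "\<And>x y. \<bar>c x - c y\<bar> \<le> k * \<bar>x - y\<bar>"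
    and cm: "continuous_on UNIV c" and a: "0 < a"
    and supp: "\<And>x. x \<le> - t + a \<Longrightarrow> c x = 0" "\<And>x. - a \<le> x \<Longrightarrow> c x = 0"
    and \<eta>0: "\<eta>0 \<in> C_space T"
  shows "(LINT x:{-T..0}|lborel. chi_g4 (D2chi t \<eta>0) x * (c x)\<^sup>2) = 0"
proof -
  have tT: "t \<in> {0..<T}" and T0: "0 \<le> T" using t by auto
  define E where "E n = 1 / real (Suc n)" for n
  have E: "0 < E n" "E \<longlonglongrightarrow> 0" for n unfolding E_def[abs_def] using LIMSEQ_inverse_real_of_nat by (auto simp: inverse_eq_divide)
  \<comment> \<open>The amplitude is balanced: \<open>\<phi> n\<close> tends to 0 uniformly, its
    forward quotient \<open>\<psi> n\<close> is of size \<open>1 / sqrt (E n)\<close>, and their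
    product stays of order one.\<close>
  define \<phi> where "\<phi> n = Bcontfun (\<lambda>x. sqrt (E n) * c x * sin (pi * (x / E n)))" for n
  define \<psi> where "\<psi> n = diff_path (E n) (\<phi> n)" for n
  have \<phi>b: "\<bar>sqrt (E n) * c x * sin (pi * (x / E n))\<bar> \<le> sqrt (E n)" for n x
  proof -
    have "\<bar>c x\<bar> * \<bar>sin (pi * (x / E n))\<bar> \<le> 1" using c[of x] by (intro mult_le_one) auto
    then show ?thesis using E(1)[of n] by (simp add: abs_mult mult.assoc mult_left_le)
  qed
  have "(\<lambda>x. sqrt (E n) * c x * sin (pi * (x / E n))) \<in> bcontfun" for n
    by (rule bcontfun_normI[where b="sqrt (E n)"])
      (use \<phi>b[of n] E(1)[of n] in \<open>auto intro!: continuous_intros continuous_on_subset[OF cm]\<close>)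
  then have \<phi>: "apply_bcontfun (\<phi> n) x = sqrt (E n) * c x * sin (pi * (x / E n))" for n x
    unfolding \<phi>_def by (simp add: Bcontfun_inverse)
  have \<phi>n: "norm (\<phi> n) \<le> sqrt (E n)" for n by (rule norm_bound) (simp add: \<phi> \<phi>b[simplified])
  have \<phi>C: "\<phi> n \<in> C_space T" for n
  proof -
    have "c (max (- T) (min 0 x)) = c x \<and> (x \<noteq> max (- T) (min 0 x) \<longrightarrow> c x = 0)" for x
      using supp(1)[of x] supp(2)[of x] supp(1)[of "-T"] supp(2)[of 0] t a T0
      by (cases "x < - T"; cases "0 < x") (auto simp: max_def min_def)
    then have "apply_bcontfun (\<phi> n) x = apply_bcontfun (\<phi> n) (max (- T) (min 0 x))" for x
      unfolding \<phi> by (metis mult_zero_left mult_zero_right)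
    then show ?thesis unfolding C_space_def using clamp_real_def[of "-T" 0] T0 by simp
  qed
  have \<psi>: "apply_bcontfun (\<psi> n) x = - (c (x + E n) + c x) * sin (pi * (x / E n)) / sqrt (E n)" for n x
  proof -
    \<comment> \<open>The step \<open>E n\<close> is half a period of the sine, so the forward
      difference adds the two values of \<open>c\<close> instead of subtracting them.\<close>
    have "pi * ((x + E n) / E n) = pi * (x / E n) + pi" using E(1)[of n] by (simp add: field_simps)
    then have s: "sin (pi * ((x + E n) / E n)) = - sin (pi * (x / E n))" by simp
    have alg: "(Q * p * (- w) - Q * p' * w) / e = - (p + p') * w / Q" if "0 < Q" "Q * Q = e" for Q p p' w e :: real
      using that by (auto simp: field_simps)
    show ?thesis unfolding \<psi>_def apply_diff_path \<phi> s
      by (rule alg) (use E(1)[of n] in auto)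
  qed
  have \<psi>n: "norm (\<psi> n) \<le> 2 / sqrt (E n)" for n
  proof (rule norm_bound)
    fix x
    have "\<bar>c (x + E n) + c x\<bar> * \<bar>sin (pi * (x / E n))\<bar> \<le> 2 * 1"
      using c[of x] c[of "x + E n"] by (intro mult_mono) auto
    then show "norm (apply_bcontfun (\<psi> n) x) \<le> 2 / sqrt (E n)"
      unfolding \<psi> real_norm_def abs_divide abs_mult abs_minus_cancel using E(1)[of n] by (simp add: divide_right_mono)
  qed
  have z: "apply_bcontfun (\<phi> n) 0 = 0" "apply_bcontfun (\<psi> n) 0 = 0" for n unfolding \<phi> \<psi> by simp_all
  have w\<phi>: "path_weight T (\<phi> n) \<le> sqrt T * sqrt (E n)" for n
    unfolding path_weight_def z using L2_norm_on_path_le[OF T0, of "\<phi> n"] mult_left_mono[OF \<phi>n[of n], of "sqrt T"] T0 by simp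
  have w\<psi>: "path_weight T (\<psi> n) \<le> sqrt T * (2 / sqrt (E n))" for n
    unfolding path_weight_def z using L2_norm_on_path_le[OF T0, of "\<psi> n"] mult_left_mono[OF \<psi>n[of n], of "sqrt T"] T0 by simp
  have ww: "path_weight T (\<phi> n) * path_weight T (\<psi> n) \<le> 2 * T" for n
  proof -
    have "path_weight T (\<phi> n) * path_weight T (\<psi> n) \<le> (sqrt T * sqrt (E n)) * (sqrt T * (2 / sqrt (E n)))"
      by (intro mult_mono w\<phi> w\<psi> path_weight_nonneg mult_nonneg_nonneg) (use T0 E(1)[of n] in auto)
    also have "\<dots> = 2 * T" using E(1)[of n] T0 by simp
    finally show ?thesis .
  qed
  have close_form: "\<bar>chi_form T (D2chi t \<eta>) (\<phi> n) (\<psi> n) - chi_form T (D2chi t \<gamma>) (\<phi> n) (\<psi> n)\<bar> \<le> e * (2 * T)"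
    if "chi_close e (t, \<eta>) (t, \<gamma>)" "0 \<le> e" for e \<eta> \<gamma> n
  proof -
    have "\<bar>chi_form T (D2chi t \<eta>) (\<phi> n) (\<psi> n) - chi_form T (D2chi t \<gamma>) (\<phi> n) (\<psi> n)\<bar> \<le> e * (path_weight T (\<phi> n) * path_weight T (\<psi> n))"
      using that(1) unfolding chi_close_def by (simp add: mult.assoc)
    also have "\<dots> \<le> e * (2 * T)" by (intro mult_left_mono ww that(2))
    finally show ?thesis .
  qed
  define D where "D \<eta> = (LINT x:{-T..0}|lborel. chi_g4 (D2chi t \<eta>) x * (c x)\<^sup>2)" for \<eta>
  have form_lim: "(\<lambda>n. chi_form T (D2chi t \<eta>) (\<phi> n) (\<psi> n)) \<longlonglongrightarrow> - D \<eta>" if "\<eta> \<in> C_space T" for \<eta>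
    unfolding D_def by (rule chi_form_oscillation[OF T0 D2chi_space[OF tT that] E c k cm \<phi> \<psi>])
  have nbhd: "\<exists>d>0. \<forall>\<gamma>\<in>C_space T. \<forall>\<gamma>'\<in>C_space T. dist \<gamma> \<eta> < d \<longrightarrow> dist \<gamma>' \<eta> < d \<longrightarrow> chi_close e (t, \<gamma>) (t, \<gamma>')"
    if h: "\<eta> \<in> C_space T" "0 < e" for \<eta> e
  proof -
    have "(t, \<eta>) \<in> dom" using h(1) tT by simp
    from chi_close_nbhd[OF this h(2)] obtain d where d: "0 < d" "\<forall>q\<in>ball (t, \<eta>) d. \<forall>r\<in>ball (t, \<eta>) d. q \<in> dom \<longrightarrow> r \<in> dom \<longrightarrow> chi_close e q r"
      by blast
    have "(t, \<gamma>) \<in> ball (t, \<eta>) d" if "dist \<gamma> \<eta> < d" for \<gamma> using that by (simp add: dist_Pair_Pair dist_commute)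
    then show ?thesis using d tT by (intro exI[of _ d]) auto
  qed
  have sqrtE: "(\<lambda>n. sqrt (E n)) \<longlonglongrightarrow> 0" using tendsto_real_sqrt[OF E(2)] by simp
  have \<phi>0: "\<phi> \<longlonglongrightarrow> 0"
    by (rule Lim_null_comparison[OF always_eventually sqrtE]) (use \<phi>n in blast)
  have main: "\<bar>D \<eta>\<bar> \<le> 2 * \<delta>"
    if \<eta>: "\<eta> \<in> C_space T" and L: "0 \<le> L" "\<And>x y. \<bar>apply_bcontfun \<eta> x - apply_bcontfun \<eta> y\<bar> \<le> L * \<bar>x - y\<bar>"
      and r: "0 < r" and e: "0 < e"
      and unif: "\<And>\<gamma> \<epsilon>. \<gamma> \<in> C_space T \<Longrightarrow> dist \<gamma> \<eta> < r \<Longrightarrow> 0 < \<epsilon> \<Longrightarrow> \<epsilon> \<le> e \<Longrightarrow>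
        \<bar>truncated_integral t (Du t \<gamma>) (diff_path \<epsilon> \<gamma>) - forward_integral t (remove_atom0 (Du t \<gamma>)) \<gamma>\<bar> \<le> \<delta>"
    for \<eta> L r e \<delta>
  proof -
    define Jf where "Jf \<gamma> = forward_integral t (remove_atom0 (Du t \<gamma>)) \<gamma>" for \<gamma>
    define q where "q n \<gamma> = truncated_integral t (Du t \<gamma>) (diff_path (E n) \<gamma>)" for n \<gamma>
    have mem: "\<eta> + \<phi> n \<in> C_space T" "\<eta> - \<phi> n \<in> C_space T" for n
      by (intro C_space_add C_space_diff \<eta> \<phi>C)+
    have pm: "(\<lambda>n. \<eta> + \<phi> n) \<longlonglongrightarrow> \<eta>" "(\<lambda>n. \<eta> - \<phi> n) \<longlonglongrightarrow> \<eta>"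
      using tendsto_add[OF tendsto_const \<phi>0, of \<eta>] tendsto_diff[OF tendsto_const \<phi>0, of \<eta>] by simp_all
    have Jl: "(\<lambda>n. Jf (\<eta> + \<phi> n) + Jf (\<eta> - \<phi> n) - 2 * Jf \<eta>) \<longlonglongrightarrow> Jf \<eta> + Jf \<eta> - 2 * Jf \<eta>"
      unfolding Jf_def
      by (intro tendsto_intros continuous_on_tendsto_compose[OF J] pm \<eta> always_eventually allI mem)
    have dcont: "continuous_on (C_space T) (\<lambda>\<gamma>. dual_of (Du t \<gamma>))"
      using Du_deriv[OF tT] by (meson continuous_on_eq_continuous_within has_derivative_continuous)
    define B where "B n = L * (norm (dual_of (Du t (\<eta> + \<phi> n)) - dual_of (Du t \<eta>)) + norm (dual_of (Du t (\<eta> - \<phi> n)) - dual_of (Du t \<eta>)))" for n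
    have "B \<longlonglongrightarrow> L * (norm (dual_of (Du t \<eta>) - dual_of (Du t \<eta>)) + norm (dual_of (Du t \<eta>) - dual_of (Du t \<eta>)))"
      unfolding B_def[abs_def]
      by (intro tendsto_intros continuous_on_tendsto_compose[OF dcont] pm \<eta> always_eventually allI mem)
    then have B0: "B \<longlonglongrightarrow> 0" by simp
    have nL: "norm (diff_path (E n) \<eta>) \<le> L" for n
    proof (rule norm_bound)
      fix x show "norm (apply_bcontfun (diff_path (E n) \<eta>) x) \<le> L"
        using L(2)[of "x + E n" x] E(1)[of n] unfolding apply_diff_path by (simp add: abs_divide divide_le_eq)
    qed
    \<comment> \<open>the second difference splits into a negligible part and an increment of \<open>Du\<close> paired with \<open>\<psi> n\<close>\<close>
    have split: "\<bar>(q n (\<eta> + \<phi> n) + q n (\<eta> - \<phi> n) - 2 * q n \<eta>)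
        - (blinfun_apply (dual_of (Du t (\<eta> + \<phi> n))) (\<psi> n) - blinfun_apply (dual_of (Du t (\<eta> - \<phi> n))) (\<psi> n))\<bar> \<le> B n"
      if n: "E n \<le> a" for n
    proof -
      \<comment> \<open>The margin \<open>a\<close> at both ends of \<open>[-t,0]\<close> leaves
        room for a shift by \<open>E n\<close>, so the truncation does not touch
        \<open>\<psi> n\<close>.\<close>
      have ind: "indicator {-t..0} x * apply_bcontfun (\<psi> n) x = apply_bcontfun (\<psi> n) x" for x
      proof (cases "x \<in> {-t..0}")
        case False
        then have "c x = 0" "c (x + E n) = 0"
          using supp(1)[of x] supp(2)[of x] supp(1)[of "x + E n"] supp(2)[of "x + E n"] a n E(1)[of n] by (auto simp: not_le)
        then show ?thesis unfolding \<psi> by simp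
      qed simp
      have \<psi>i: "truncated_integral t (Du t \<gamma>) (\<psi> n) = blinfun_apply (dual_of (Du t \<gamma>)) (\<psi> n)" if "\<gamma> \<in> C_space T" for \<gamma>
        unfolding truncated_integral_def ind dual_of_apply[OF Du_signed[OF tT that]] ..
      have q1: "q n (\<eta> + \<phi> n) = truncated_integral t (Du t (\<eta> + \<phi> n)) (diff_path (E n) \<eta>) + blinfun_apply (dual_of (Du t (\<eta> + \<phi> n))) (\<psi> n)"
        unfolding q_def diff_path_add truncated_integral_linear(1)[OF Du_signed[OF tT mem(1)]] \<psi>i[OF mem(1), unfolded \<psi>_def] \<psi>_def ..
      have q2: "q n (\<eta> - \<phi> n) = truncated_integral t (Du t (\<eta> - \<phi> n)) (diff_path (E n) \<eta>) - blinfun_apply (dual_of (Du t (\<eta> - \<phi> n))) (\<psi> n)"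
        unfolding q_def diff_path_diff truncated_integral_linear(2)[OF Du_signed[OF tT mem(2)]] \<psi>i[OF mem(2), unfolded \<psi>_def] \<psi>_def ..
      have le: "\<bar>truncated_integral t (Du t \<gamma>) (diff_path (E n) \<eta>) - q n \<eta>\<bar> \<le> L * norm (dual_of (Du t \<gamma>) - dual_of (Du t \<eta>))"
        if "\<gamma> \<in> C_space T" for \<gamma>
      proof -
        have "\<bar>truncated_integral t (Du t \<gamma>) (diff_path (E n) \<eta>) - q n \<eta>\<bar> \<le> norm (dual_of (Du t \<gamma>) - dual_of (Du t \<eta>)) * norm (diff_path (E n) \<eta>)"
          unfolding q_def by (rule truncated_integral_diff_le[OF Du_signed[OF tT that] Du_signed[OF tT \<eta>]]) (use t in simp)
        also have "\<dots> \<le> norm (dual_of (Du t \<gamma>) - dual_of (Du t \<eta>)) * L" by (intro mult_left_mono nL) simp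
        finally show ?thesis by (simp add: mult.commute)
      qed
      show ?thesis using le[OF mem(1), of n] le[OF mem(2), of n] unfolding q1 q2 B_def distrib_left by linarith
    qed
    \<comment> \<open>The mean value theorem is applied from \<open>\<eta> - \<phi> n\<close> to
      \<open>\<eta> + \<phi> n\<close>, a parameter interval of length 2; this is the factor in
      front of \<open>D \<eta>\<close>. The intermediate form is then moved to \<open>\<eta>\<close>
      by closeness.\<close>
    have pair_lim: "(\<lambda>n. blinfun_apply (dual_of (Du t (\<eta> + \<phi> n))) (\<psi> n) - blinfun_apply (dual_of (Du t (\<eta> - \<phi> n))) (\<psi> n)) \<longlonglongrightarrow> - 2 * D \<eta>"
    proof (rule LIMSEQ_I)
      fix \<zeta> :: real assume \<zeta>: "0 < \<zeta>"
      define e' where "e' = \<zeta> / (8 * (T + 1))"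
      have e': "0 < e'" "e' * (2 * T) \<le> \<zeta> / 4" unfolding e'_def using \<zeta> T0 by (auto simp: field_simps)
      obtain d where d: "0 < d" "\<And>\<gamma> \<gamma>'. \<gamma> \<in> C_space T \<Longrightarrow> \<gamma>' \<in> C_space T \<Longrightarrow> dist \<gamma> \<eta> < d \<Longrightarrow> dist \<gamma>' \<eta> < d \<Longrightarrow> chi_close e' (t, \<gamma>) (t, \<gamma>')"
        using nbhd[OF \<eta> e'(1)] by auto
      obtain N1 where N1: "\<And>n. n \<ge> N1 \<Longrightarrow> norm (\<phi> n) < d" using LIMSEQ_D[OF \<phi>0 d(1)] by auto
      obtain N2 where N2: "\<And>n. n \<ge> N2 \<Longrightarrow> \<bar>chi_form T (D2chi t \<eta>) (\<phi> n) (\<psi> n) - (- D \<eta>)\<bar> < \<zeta> / 4"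
        using LIMSEQ_D[OF form_lim[OF \<eta>], of "\<zeta> / 4"] \<zeta> by auto
      have "norm (blinfun_apply (dual_of (Du t (\<eta> + \<phi> n))) (\<psi> n) - blinfun_apply (dual_of (Du t (\<eta> - \<phi> n))) (\<psi> n) - (- 2 * D \<eta>)) < \<zeta>"
        if n: "max N1 N2 \<le> n" for n
      proof -
        obtain \<theta> where \<theta>: "-1 < \<theta>" "\<theta> < 1"
          and eq: "blinfun_apply (dual_of (Du t (\<eta> + \<phi> n))) (\<psi> n) - blinfun_apply (dual_of (Du t (\<eta> - \<phi> n))) (\<psi> n)
            = 2 * chi_form T (D2chi t (\<eta> + \<theta> *\<^sub>R \<phi> n)) (\<phi> n) (\<psi> n)"
          using segment_mvt[OF tT \<eta> \<phi>C[of n], of "-1" 1 "\<psi> n"] by auto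
        have "norm (\<theta> *\<^sub>R \<phi> n) \<le> 1 * norm (\<phi> n)" unfolding norm_scaleR using \<theta> by (intro mult_right_mono) auto
        then have "dist (\<eta> + \<theta> *\<^sub>R \<phi> n) \<eta> < d" using N1[of n] n by (simp add: dist_norm)
        then have "chi_close e' (t, \<eta> + \<theta> *\<^sub>R \<phi> n) (t, \<eta>)"
          by (intro d(2) C_space_add C_space_scaleR \<eta> \<phi>C) (use d(1) in simp_all)
        from close_form[OF this, of n] e'
        have "\<bar>chi_form T (D2chi t (\<eta> + \<theta> *\<^sub>R \<phi> n)) (\<phi> n) (\<psi> n) - chi_form T (D2chi t \<eta>) (\<phi> n) (\<psi> n)\<bar> \<le> \<zeta> / 4" by simp
        then show ?thesis unfolding eq real_norm_def using N2[of n] n by (simp add: abs_if split: if_splits)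
      qed
      then show "\<exists>no. \<forall>n\<ge>no. norm (blinfun_apply (dual_of (Du t (\<eta> + \<phi> n))) (\<psi> n) - blinfun_apply (dual_of (Du t (\<eta> - \<phi> n))) (\<psi> n) - (- 2 * D \<eta>)) < \<zeta>" by blast
    qed
    have "\<forall>\<^sub>F n in sequentially. \<bar>blinfun_apply (dual_of (Du t (\<eta> + \<phi> n))) (\<psi> n) - blinfun_apply (dual_of (Du t (\<eta> - \<phi> n))) (\<psi> n)\<bar>
        \<le> 4 * \<delta> + \<bar>Jf (\<eta> + \<phi> n) + Jf (\<eta> - \<phi> n) - 2 * Jf \<eta>\<bar> + B n"
      using order_tendstoD(2)[OF E(2), of a, OF a] order_tendstoD(2)[OF E(2), of e, OF e] tendstoD[OF \<phi>0 r]
    proof eventually_elim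
      case (elim n)
      have "dist (\<eta> + \<phi> n) \<eta> < r" "dist (\<eta> - \<phi> n) \<eta> < r" using elim(3) by (simp_all add: dist_norm)
      then have "\<bar>q n (\<eta> + \<phi> n) - Jf (\<eta> + \<phi> n)\<bar> \<le> \<delta>" "\<bar>q n (\<eta> - \<phi> n) - Jf (\<eta> - \<phi> n)\<bar> \<le> \<delta>" "\<bar>q n \<eta> - Jf \<eta>\<bar> \<le> \<delta>"
        unfolding q_def Jf_def using unif[OF mem(1) _ E(1)] unif[OF mem(2) _ E(1)] unif[OF \<eta> _ E(1)] r elim(2) by auto
      then show ?case using split[of n] elim(1) by linarith
    qed
    \<comment> \<open>In the limit \<open>2 * \<bar>D \<eta>\<bar> \<le> 4 * \<delta>\<close>: the
      second difference takes the two outer values once and the middle one twice, each with error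
      \<open>\<delta>\<close>.\<close>
    from tendsto_le[OF sequentially_bot tendsto_add[OF tendsto_add[OF tendsto_const tendsto_rabs[OF Jl]] B0]
        tendsto_rabs[OF pair_lim] this]
    show ?thesis by (simp add: abs_mult)
  qed
  \<comment> \<open>Baire's theorem gives a ball of uniform convergence near \<open>\<eta>0\<close>,
    not around it. A Lipschitz path inside that ball serves as the centre for \<open>main\<close>,
    and the closeness of the forms carries the estimate to \<open>\<eta>0\<close> in the
    limit.\<close>
  have "\<bar>D \<eta>0\<bar> \<le> \<zeta>" if \<zeta>: "0 < \<zeta>" for \<zeta>
  proof -
    define e' where "e' = \<zeta> / (4 * (T + 1))"
    have e': "0 < e'" "e' * (2 * T) \<le> \<zeta> / 2" unfolding e'_def using \<zeta> T0 by (auto simp: field_simps)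
    obtain d where d: "0 < d" "\<And>\<gamma> \<gamma>'. \<gamma> \<in> C_space T \<Longrightarrow> \<gamma>' \<in> C_space T \<Longrightarrow> dist \<gamma> \<eta>0 < d \<Longrightarrow> dist \<gamma>' \<eta>0 < d \<Longrightarrow> chi_close e' (t, \<gamma>) (t, \<gamma>')"
      using nbhd[OF \<eta>0 e'(1)] by auto
    have "0 < d / 2" "0 < \<zeta> / 4" using d(1) \<zeta> by auto
    from quotient_uniform_on_ball[OF tT ex J \<eta>0 this]
    obtain \<eta>1 r e where 1: "\<eta>1 \<in> C_space T" "0 < r" "0 < e"
      and near: "\<And>\<gamma>. \<gamma> \<in> C_space T \<Longrightarrow> dist \<gamma> \<eta>1 < r \<Longrightarrow> dist \<gamma> \<eta>0 \<le> d / 2"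
      and unif: "\<And>\<gamma> \<epsilon>. \<gamma> \<in> C_space T \<Longrightarrow> dist \<gamma> \<eta>1 < r \<Longrightarrow> 0 < \<epsilon> \<Longrightarrow> \<epsilon> \<le> e \<Longrightarrow>
        \<bar>truncated_integral t (Du t \<gamma>) (diff_path \<epsilon> \<gamma>) - forward_integral t (remove_atom0 (Du t \<gamma>)) \<gamma>\<bar> \<le> \<zeta> / 4"
      by blast
    have "0 < r / 2" using 1 by simp
    from lipschitz_paths_dense[OF T0 1(1) this]
    obtain \<eta> L where \<eta>: "\<eta> \<in> C_space T" "dist \<eta> \<eta>1 < r / 2" and L: "0 \<le> L" "\<And>x y. \<bar>apply_bcontfun \<eta> x - apply_bcontfun \<eta> y\<bar> \<le> L * \<bar>x - y\<bar>"
      by blast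
    have "\<bar>D \<eta>\<bar> \<le> 2 * (\<zeta> / 4)"
    proof (rule main[OF \<eta>(1) L \<open>0 < r / 2\<close> 1(3)])
      fix \<gamma> \<epsilon> assume *: "\<gamma> \<in> C_space T" "dist \<gamma> \<eta> < r / 2" "0 < \<epsilon>" "\<epsilon> \<le> e"
      have "dist \<gamma> \<eta>1 < r" using *(2) \<eta>(2) dist_triangle[of \<gamma> \<eta>1 \<eta>] by linarith
      from unif[OF *(1) this *(3,4)]
      show "\<bar>truncated_integral t (Du t \<gamma>) (diff_path \<epsilon> \<gamma>) - forward_integral t (remove_atom0 (Du t \<gamma>)) \<gamma>\<bar> \<le> \<zeta> / 4" .
    qed
    moreover have "\<bar>- D \<eta> - (- D \<eta>0)\<bar> \<le> \<zeta> / 2"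
    proof -
      have "dist \<eta> \<eta>0 < d" using near[OF \<eta>(1)] \<eta>(2) 1(2) d(1) by simp
      then have cl: "chi_close e' (t, \<eta>) (t, \<eta>0)" using d \<eta>(1) \<eta>0 by (intro d(2)) auto
      have "\<bar>chi_form T (D2chi t \<eta>) (\<phi> n) (\<psi> n) - chi_form T (D2chi t \<eta>0) (\<phi> n) (\<psi> n)\<bar> \<le> \<zeta> / 2" for n
        using close_form[OF cl, of n] e' by simp
      moreover have "(\<lambda>n. \<bar>chi_form T (D2chi t \<eta>) (\<phi> n) (\<psi> n) - chi_form T (D2chi t \<eta>0) (\<phi> n) (\<psi> n)\<bar>) \<longlonglongrightarrow> \<bar>- D \<eta> - (- D \<eta>0)\<bar>"
        by (intro tendsto_rabs tendsto_diff form_lim \<eta>(1) \<eta>0)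
      ultimately show ?thesis by (intro LIMSEQ_le_const2) auto
    qed
    ultimately show ?thesis by linarith
  qed
  then have "D \<eta>0 = 0" by (metis abs_ge_zero abs_zero dense_ge order_antisym abs_le_zero_iff)
  then show ?thesis unfolding D_def .
qed

text \<open>\<open>weighted_diagonal_zero\<close> makes the integral of \<open>g\<^sub>4\<close>
  vanish against squares of cut-off functions compactly supported in the interior of
  \<open>[-t,0]\<close>; these converge to 1 there, and dominated convergence gives the full
  integral. For \<open>t = 0\<close> the interval is a point.\<close>

lemma chi_diagonal_eq_lambda:
  assumes t: "t \<in> {0..<T}"
    and ex: "\<And>\<eta>. \<eta> \<in> C_space T \<Longrightarrow> forward_integral_exists t (remove_atom0 (Du t \<eta>)) \<eta>"
    and J: "continuous_on (C_space T) (\<lambda>\<eta>. forward_integral t (remove_atom0 (Du t \<eta>)) \<eta>)"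
    and \<eta>: "\<eta> \<in> C_space T"
  shows "chi_diagonal t (D2chi t \<eta>) = chi_lambda (D2chi t \<eta>)"
proof (cases "t = 0")
  case True
  then show ?thesis unfolding chi_diagonal_def by (simp add: zero_ereal_def)
next
  case False
  then have t': "0 < t" "t < T" and T0: "0 \<le> T" using t by auto
  define g where "g = chi_g4 (D2chi t \<eta>)"
  have g4: "essentially_bounded_on {-T..0} g" using D2chi_space[OF t \<eta>] unfolding chi_space_def g_def by auto
  \<comment> \<open>In terms of the distance to the nearer end of \<open>[-t,0]\<close>: 0 up to
    \<open>1 / Suc n\<close>, 1 from \<open>2 / Suc n\<close> on, and linear with slope
    \<open>Suc n\<close> in between.\<close>
  define c where "c n x = max 0 (min 1 (real (Suc n) * min (x + t) (- x) - 1))" for n x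
  have c01: "0 \<le> c n x" "c n x \<le> 1" for n x unfolding c_def by auto
  have cc: "continuous_on UNIV (c n)" for n unfolding c_def[abs_def] by (intro continuous_intros)
  have "(LINT x:{-T..0}|lborel. g x * (c n x)\<^sup>2) = 0" for n
    unfolding g_def
  proof (rule weighted_diagonal_zero[OF t' ex J c01 _ cc _ _ _ \<eta>])
    show "\<bar>c n x - c n y\<bar> \<le> real (Suc n) * \<bar>x - y\<bar>" for x y
    proof -
      have "\<bar>c n x - c n y\<bar> \<le> \<bar>real (Suc n) * min (x + t) (- x) - real (Suc n) * min (y + t) (- y)\<bar>"
        unfolding c_def by (auto simp: max_def min_def)
      also have "\<dots> = real (Suc n) * \<bar>min (x + t) (- x) - min (y + t) (- y)\<bar>"
        unfolding right_diff_distrib[symmetric] abs_mult by simp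
      also have "\<dots> \<le> real (Suc n) * \<bar>x - y\<bar>" by (intro mult_left_mono) auto
      finally show ?thesis .
    qed
    show "0 < 1 / real (Suc n)" by simp
    have small: "real (Suc n) * m - 1 \<le> 0" if "m \<le> 1 / real (Suc n)" for m
      using mult_left_mono[OF that, of "real (Suc n)"] by simp
    show "c n x = 0" if "x \<le> - t + 1 / real (Suc n)" for x
    proof -
      have "min (x + t) (- x) \<le> 1 / real (Suc n)" using that by linarith
      from small[OF this] show ?thesis unfolding c_def by (rule max_absorb1[OF min.coboundedI2])
    qed
    show "c n x = 0" if "- (1 / real (Suc n)) \<le> x" for x
    proof -
      have "min (x + t) (- x) \<le> 1 / real (Suc n)" using that by linarith
      from small[OF this] show ?thesis unfolding c_def by (rule max_absorb1[OF min.coboundedI2])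
    qed
  qed
  then have zero: "(LINT x|lborel. indicator {-T..0} x * (g x * (c n x)\<^sup>2)) = 0" for n
    unfolding set_lebesgue_integral_def by simp
  have one: "set_integrable lborel {-T..0} (\<lambda>x. g x * 1)"
    by (rule Linf_integral_le(1)[OF g4]) (auto simp: set_integrable_def emeasure_lborel_Icc_eq)
  have "(\<lambda>n. LINT x|lborel. indicator {-T..0} x * (g x * (c n x)\<^sup>2)) \<longlonglongrightarrow> (LINT x|lborel. indicator {-t..0} x * g x)"
  proof (rule integral_dominated_convergence[where w="\<lambda>x. \<bar>indicator {-T..0} x * g x\<bar>"])
    have gm: "(\<lambda>x. indicator {-T..0} x * g x) \<in> borel_measurable lborel"
      using one unfolding set_integrable_def by (simp add: borel_measurable_integrable)
    have "(\<lambda>x. (indicator {-T..0} x * g x) * (c n x)\<^sup>2) \<in> borel_measurable lborel" for n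
      by (rule borel_measurable_times[OF gm]) (use borel_measurable_continuous_onI[OF cc[of n]] in simp)
    then show "(\<lambda>x. indicator {-T..0} x * (g x * (c n x)\<^sup>2)) \<in> borel_measurable lborel" for n by (simp add: mult.assoc)
    have "(\<lambda>x. indicator {-t..0} x * (indicator {-T..0} x * g x)) \<in> borel_measurable lborel"
      by (rule borel_measurable_times[OF _ gm]) simp
    moreover have "indicator {-t..0} x * (indicator {-T..0} x * g x) = indicator {-t..0} x * g x" for x
      using t' by (auto simp: indicator_def)
    ultimately show "(\<lambda>x. indicator {-t..0} x * g x) \<in> borel_measurable lborel" by simp
    show "integrable lborel (\<lambda>x. \<bar>indicator {-T..0} x * g x\<bar>)"
      using one unfolding set_integrable_def by (intro integrable_abs) simp
    show "AE x in lborel. norm (indicator {-T..0} x * (g x * (c n x)\<^sup>2)) \<le> \<bar>indicator {-T..0} x * g x\<bar>" for n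
    proof (rule AE_I2)
      fix x
      have "(c n x)\<^sup>2 \<le> 1" using c01[of n x] by (simp add: power_le_one)
      then show "norm (indicator {-T..0} x * (g x * (c n x)\<^sup>2)) \<le> \<bar>indicator {-T..0} x * g x\<bar>"
        using mult_left_mono[of "(c n x)\<^sup>2" 1 "\<bar>indicator {-T..0} x * g x\<bar>"] by (simp add: abs_mult mult_ac)
    qed
    show "AE x in lborel. (\<lambda>n. indicator {-T..0} x * (g x * (c n x)\<^sup>2)) \<longlonglongrightarrow> indicator {-t..0} x * g x"
      using AE_lborel_singleton[of 0] AE_lborel_singleton[of "-t"]
    proof eventually_elim
      case (elim x)
      show ?case
      proof (cases "x \<in> {-t..0}")
        case True
        define m where "m = min (x + t) (- x)"
        have m: "0 < m" using True elim unfolding m_def by auto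
        obtain N :: nat where N: "2 / m < real N" using reals_Archimedean2 by blast
        have "\<forall>\<^sub>F n in sequentially. c n x = 1"
          using eventually_ge_at_top[of N]
        proof eventually_elim
          case (elim n)
          have "2 \<le> real N * m" using N m by (simp add: field_simps)
          also have "\<dots> \<le> real (Suc n) * m" using elim m by (intro mult_right_mono) auto
          finally show ?case unfolding c_def m_def[symmetric] by simp
        qed
        then have "(\<lambda>n. c n x) \<longlonglongrightarrow> 1" by (rule tendsto_eventually)
        then have "(\<lambda>n. indicator {-T..0} x * (g x * (c n x)\<^sup>2)) \<longlonglongrightarrow> indicator {-T..0} x * (g x * 1\<^sup>2)"
          by (intro tendsto_intros)
        then show ?thesis using True t' by simp
      next
        case False
        then have "min (x + t) (- x) < 0" by auto
        then have "real (Suc n) * min (x + t) (- x) \<le> 0" for n by (intro mult_nonneg_nonpos) auto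
        then have "c n x = 0" for n unfolding c_def by (smt (verit) max_absorb1 min_le_iff_disj)
        then show ?thesis using False by simp
      qed
    qed
  qed
  then have "(LINT x|lborel. indicator {-t..0} x * g x) = 0" unfolding zero by (simp add: LIMSEQ_const_iff)
  moreover have "(LBINT x=-t..0. g x) = (LINT x:{-t..0}|lborel. g x)"
    using interval_integral_Icc[of "-t" 0 g] t' by (simp add: zero_ereal_def)
  ultimately show ?thesis unfolding chi_diagonal_def g_def[symmetric] set_lebesgue_integral_def by simp
qed

end

section \<open>The change of variables formula along a sequence\<close>

lemma integral_partition:
  fixes g :: "real \<Rightarrow> real"
  assumes t: "0 \<le> t" and g: "continuous_on {0..t} g" and m: "0 < m"
  shows "integral {0..t} g = (\<Sum>j<m. integral {t * real j / real m..t * real (Suc j) / real m} g)"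
proof -
  have "integral {0..t * real k / real m} g = (\<Sum>j<k. integral {t * real j / real m..t * real (Suc j) / real m} g)" if "k \<le> m" for k
    using that
  proof (induction k)
    case (Suc k)
    have le: "t * real k / real m \<le> t * real (Suc k) / real m" "0 \<le> t * real k / real m"
      using t by (auto intro!: divide_right_mono mult_left_mono)
    have "t * real (Suc k) / real m \<le> t"
      using Suc.prems t m by (simp add: divide_le_eq mult_left_mono)
    then have "integral {0..t * real k / real m} g + integral {t * real k / real m..t * real (Suc k) / real m} g
        = integral {0..t * real (Suc k) / real m} g"
      using le by (intro Henstock_Kurzweil_Integration.integral_combine integrable_continuous_real continuous_on_subset[OF g]) auto
    then show ?case using Suc by simp
  qed simp
  from this[of m] show ?thesis using m by simp
qed

lemma LINT_indicator_eq_integral: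
  fixes f :: "real \<Rightarrow> real"
  assumes "continuous_on {a..b} f"
  shows "(LINT s|lborel. indicator {a..b} s * f s) = integral {a..b} f"
  using set_borel_integral_eq_integral(2)[OF borel_integrable_atLeastAtMost'[OF assms]]
  by (simp add: set_lebesgue_integral_def)

lemma integral_le_LINT:
  fixes f :: "real \<Rightarrow> real"
  assumes f: "continuous_on UNIV f" "integrable lborel f" "\<And>s. 0 \<le> f s"
  shows "integral {a..b} f \<le> (LINT s|lborel. f s)"
proof -
  have "integral {a..b} f = (LINT s|lborel. indicator {a..b} s * f s)"
    by (rule LINT_indicator_eq_integral[symmetric], rule continuous_on_subset[OF f(1)]) simp
  also have "\<dots> \<le> (LINT s|lborel. f s)"
  proof (rule integral_mono[OF _ f(2)])
    show "integrable lborel (\<lambda>s. indicator {a..b} s * f s)"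
      using borel_integrable_atLeastAtMost'[OF continuous_on_subset[OF f(1)], of a b] unfolding set_integrable_def by simp
    show "indicator {a..b} s * f s \<le> f s" for s using f(3)[of s] by (simp add: indicator_def)
  qed
  finally show ?thesis .
qed

lemma LINT_swap:
  fixes g :: "real \<Rightarrow> real" and H :: "real \<Rightarrow> real \<Rightarrow> real"
  assumes g: "integrable lborel g" and H: "(\<lambda>(x, s). H x s) \<in> borel_measurable (lborel \<Otimes>\<^sub>M lborel)"
    and C: "\<And>x s. \<bar>H x s\<bar> \<le> C"
  shows "(LINT x|lborel. g x * (LINT s|lborel. indicator {a..b} s * H x s))
    = (LINT s|lborel. indicator {a..b} s * (LINT x|lborel. g x * H x s))"
proof -
  have i1: "integrable (lborel \<Otimes>\<^sub>M lborel) (\<lambda>(x, s). g x * indicat_real {a..b} s)"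
  proof (rule lborel_pair.Fubini_integrable)
    show "(\<lambda>(x, s). g x * indicat_real {a..b} s) \<in> borel_measurable (lborel \<Otimes>\<^sub>M lborel)"
      using borel_measurable_integrable[OF g] by measurable
    have "integrable lborel (\<lambda>x. \<bar>g x\<bar> * measure lborel {a..b})"
      by (intro integrable_mult_left integrable_abs g)
    then show "integrable lborel (\<lambda>x. LINT s|lborel. norm (case (x, s) of (x, s) \<Rightarrow> g x * indicat_real {a..b} s))"
      by (simp add: abs_mult)
    show "AE x in lborel. integrable lborel (\<lambda>s. case (x, s) of (x, s) \<Rightarrow> g x * indicat_real {a..b} s)"
      by (auto intro!: AE_I2 integrable_mult_right integrable_real_indicator simp: emeasure_lborel_Icc_eq)
  qed
  have "integrable (lborel \<Otimes>\<^sub>M lborel) (\<lambda>z. (case z of (x, s) \<Rightarrow> g x * indicat_real {a..b} s) * (case z of (x, s) \<Rightarrow> H x s))"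
    by (rule integrable_mult_bounded[OF i1 H]) (use C in auto)
  then have i: "integrable (lborel \<Otimes>\<^sub>M lborel) (\<lambda>(x, s). g x * indicat_real {a..b} s * H x s)"
    by (simp add: case_prod_unfold)
  from lborel_pair.Fubini_integral[OF i]
  have "(LINT s|lborel. LINT x|lborel. g x * indicat_real {a..b} s * H x s) = (LINT x|lborel. LINT s|lborel. g x * indicat_real {a..b} s * H x s)" .
  moreover have "(LINT x|lborel. g x * indicat_real {a..b} s * H x s) = indicator {a..b} s * (LINT x|lborel. g x * H x s)" for s
    unfolding integral_mult_right_zero[symmetric] by (simp add: mult_ac)
  moreover have "(LINT s|lborel. g x * indicat_real {a..b} s * H x s) = g x * (LINT s|lborel. indicator {a..b} s * H x s)" for x
    unfolding integral_mult_right_zero[symmetric] by (simp add: mult_ac)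
  ultimately show ?thesis by simp
qed

text \<open>\<open>f\<close> is the nonlinear term evaluated along \<open>u\<close> and the atom of
  \<open>Du\<close>, hence a known function of time and path. Its continuity is asked only before
  \<open>T\<close>, where the atom is defined.\<close>

locale pde_solution = smooth_functional +
  fixes f :: "real \<Rightarrow> path \<Rightarrow> real"
  assumes u_cont: "continuous_on ({0..T} \<times> C_space T) (\<lambda>(t, \<eta>). u t \<eta>)"
    and f_cont: "continuous_on ({0..<T} \<times> C_space T) (\<lambda>(t, \<eta>). f t \<eta>)"
    and exists: "\<And>t \<eta>. t \<in> {0..<T} \<Longrightarrow> \<eta> \<in> C_space T \<Longrightarrow> forward_integral_exists t (remove_atom0 (Du t \<eta>)) \<eta>"
    and pde: "\<And>t \<eta>. t \<in> {0..<T} \<Longrightarrow> \<eta> \<in> C_space T \<Longrightarrow> L_operator dtu Du D2chi t \<eta> + f t \<eta> = 0"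
begin

section \<open>Consequences of the equation\<close>

lemma slice_cont:
  assumes "continuous_on dom (\<lambda>(t, \<eta>). g t \<eta>)" "t \<in> {0..<T}"
  shows "continuous_on (C_space T) (g t)"
proof -
  have "continuous_on (C_space T) (\<lambda>\<eta>. (\<lambda>(t, \<eta>). g t \<eta>) (t, \<eta>))"
    by (rule continuous_on_compose2[OF assms(1)]) (use assms(2) in \<open>auto intro!: continuous_intros\<close>)
  then show ?thesis by simp
qed

text \<open>The diagonal integral is dominated by the chi norm: the essential bound of
  \<open>g\<^sub>4\<close> times the length of \<open>[-t,0]\<close>, plus
  \<open>\<lambda>\<close>.\<close>

lemma diagonal_cont:
  assumes t: "t \<in> {0..<T}"
  shows "continuous_on (C_space T) (\<lambda>\<eta>. chi_diagonal t (D2chi t \<eta>))"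
proof -
  have T0: "0 \<le> T" and t0: "0 \<le> t" "t \<le> T" using t by auto
  have I: "(LBINT x=-t..0. g x) = (LINT x:{-t..0}|lborel. g x)" for g :: "real \<Rightarrow> real"
    using interval_integral_Icc[of "-t" 0 g] t0 by (simp add: zero_ereal_def)
  have one: "set_integrable lborel {-T..0} (\<lambda>x. indicat_real {-t..0} x)"
    unfolding set_integrable_def
    by (intro integrable_mult_indicator integrable_real_indicator) (auto simp: emeasure_lborel_Icc_eq)
  have eq: "(LINT x:{-t..0}|lborel. g x) = (LINT x:{-T..0}|lborel. g x * indicator {-t..0} x)" for g :: "real \<Rightarrow> real"
    unfolding set_lebesgue_integral_def
    by (rule Bochner_Integration.integral_cong) (use t0 in \<open>auto simp: indicator_def\<close>)
  have g4: "essentially_bounded_on {-T..0} (chi_g4 (D2chi t \<eta>))" if "\<eta> \<in> C_space T" for \<eta>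
    using D2chi_space[OF t that] unfolding chi_space_def by auto
  have le: "\<bar>chi_diagonal t (D2chi t \<gamma>) - chi_diagonal t (D2chi t \<eta>)\<bar> \<le> (1 + T) * chi_norm T (chi_diff (D2chi t \<gamma>) (D2chi t \<eta>))"
    if \<gamma>: "\<gamma> \<in> C_space T" and \<eta>: "\<eta> \<in> C_space T" for \<gamma> \<eta>
  proof -
    define n where "n = chi_norm T (chi_diff (D2chi t \<gamma>) (D2chi t \<eta>))"
    have b: "essentially_bounded_on {-T..0} (chi_g4 (chi_diff (D2chi t \<gamma>) (D2chi t \<eta>)))"
      using chi_diff_in_chi_space[OF D2chi_space[OF t \<gamma>] D2chi_space[OF t \<eta>]] unfolding chi_space_def by auto
    have n0: "0 \<le> n" using chi_components_le(2)[of "chi_diff (D2chi t \<gamma>) (D2chi t \<eta>)" T] unfolding n_def by linarith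
    have "(LINT x:{-T..0}|lborel. chi_g4 (D2chi t \<gamma>) x * indicator {-t..0} x) - (LINT x:{-T..0}|lborel. chi_g4 (D2chi t \<eta>) x * indicator {-t..0} x)
      = (LINT x:{-T..0}|lborel. chi_g4 (D2chi t \<gamma>) x * indicator {-t..0} x - chi_g4 (D2chi t \<eta>) x * indicator {-t..0} x)"
      by (rule set_integral_diff(2)[symmetric, OF Linf_integral_le(1)[OF g4[OF \<gamma>] _ one] Linf_integral_le(1)[OF g4[OF \<eta>] _ one]]) simp_all
    also have "\<dots> = (LINT x:{-T..0}|lborel. chi_g4 (chi_diff (D2chi t \<gamma>) (D2chi t \<eta>)) x * indicator {-t..0} x)"
      by (simp add: chi_diff_def left_diff_distrib)
    finally have "\<bar>(LINT x:{-T..0}|lborel. chi_g4 (D2chi t \<gamma>) x * indicator {-t..0} x) - (LINT x:{-T..0}|lborel. chi_g4 (D2chi t \<eta>) x * indicator {-t..0} x)\<bar>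
      \<le> \<bar>Linf_norm_on {-T..0} (chi_g4 (chi_diff (D2chi t \<gamma>) (D2chi t \<eta>)))\<bar> * (LINT x:{-T..0}|lborel. \<bar>indicat_real {-t..0} x\<bar>)"
      using Linf_integral_le(2)[OF b _ one] by simp
    also have "\<dots> \<le> n * T"
    proof (rule mult_mono)
      have "(LINT x:{-T..0}|lborel. \<bar>indicat_real {-t..0} x\<bar>) = (LINT x:{-t..0}|lborel. 1)"
        unfolding eq[of "\<lambda>_. 1"] by simp
      then show "(LINT x:{-T..0}|lborel. \<bar>indicat_real {-t..0} x\<bar>) \<le> T"
        unfolding set_lebesgue_integral_def using t0 by simp
    qed (use chi_components_le(5)[of T "chi_diff (D2chi t \<gamma>) (D2chi t \<eta>)"] n0 in \<open>auto simp: n_def set_lebesgue_integral_def\<close>)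
    finally have "\<bar>(LINT x:{-T..0}|lborel. chi_g4 (D2chi t \<gamma>) x * indicator {-t..0} x) - (LINT x:{-T..0}|lborel. chi_g4 (D2chi t \<eta>) x * indicator {-t..0} x)\<bar> \<le> n * T" .
    moreover have "\<bar>chi_lambda (D2chi t \<gamma>) - chi_lambda (D2chi t \<eta>)\<bar> \<le> n"
      using chi_components_le(2)[of "chi_diff (D2chi t \<gamma>) (D2chi t \<eta>)" T] unfolding n_def by (simp add: chi_diff_def)
    ultimately show ?thesis unfolding chi_diagonal_def I eq n_def[symmetric] distrib_right by (simp add: mult.commute)
  qed
  show ?thesis
    unfolding continuous_on_def
  proof
    fix \<eta> assume \<eta>: "\<eta> \<in> C_space T"
    have "((\<lambda>(s, \<gamma>). chi_norm T (chi_diff (D2chi s \<gamma>) (D2chi t \<eta>))) \<longlongrightarrow> 0) (at (t, \<eta>) within dom)"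
      using chi \<eta> t unfolding continuous_into_chi_def by blast
    moreover have "filterlim (\<lambda>\<gamma>. (t, \<gamma>)) (at (t, \<eta>) within dom) (at \<eta> within C_space T)"
      unfolding filterlim_at using t by (auto intro!: tendsto_intros eventually_at_topological[THEN iffD2] exI[of _ UNIV])
    ultimately have "((\<lambda>\<gamma>. (\<lambda>(s, \<gamma>). chi_norm T (chi_diff (D2chi s \<gamma>) (D2chi t \<eta>))) (t, \<gamma>)) \<longlongrightarrow> 0) (at \<eta> within C_space T)"
      by (rule filterlim_compose)
    from tendsto_mult_right_zero[OF this, of "1 + T"]
    have l: "((\<lambda>\<gamma>. (1 + T) * chi_norm T (chi_diff (D2chi t \<gamma>) (D2chi t \<eta>))) \<longlongrightarrow> 0) (at \<eta> within C_space T)" by simp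
    have "\<forall>\<^sub>F \<gamma> in at \<eta> within C_space T. norm (chi_diagonal t (D2chi t \<gamma>) - chi_diagonal t (D2chi t \<eta>)) \<le> (1 + T) * chi_norm T (chi_diff (D2chi t \<gamma>) (D2chi t \<eta>))"
      unfolding eventually_at_topological using le \<eta> by (intro exI[of _ UNIV]) auto
    from Lim_null_comparison[OF this l]
    show "((\<lambda>\<gamma>. chi_diagonal t (D2chi t \<gamma>)) \<longlongrightarrow> chi_diagonal t (D2chi t \<eta>)) (at \<eta> within C_space T)" by (simp add: LIM_zero_iff)
  qed
qed

text \<open>The equation expresses the forward integral by terms continuous in the path. So it is
  itself continuous, which is the premise of \<open>chi_diagonal_eq_lambda\<close>, and that lemma
  in turn reduces the second-order term of the equation to \<open>\<lambda>\<close>.\<close>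

lemma drift_eq:
  assumes t: "t \<in> {0..<T}" and \<eta>: "\<eta> \<in> C_space T"
  shows "drift t \<eta> = - f t \<eta> - chi_lambda (D2chi t \<eta>) / 2"
proof -
  have fi: "forward_integral t (remove_atom0 (Du t \<gamma>)) \<gamma> = - dtu t \<gamma> - 1 / 2 * chi_diagonal t (D2chi t \<gamma>) - f t \<gamma>" if "\<gamma> \<in> C_space T" for \<gamma>
    using pde[OF t that] unfolding L_operator_def by linarith
  have "continuous_on (C_space T) (\<lambda>\<gamma>. - dtu t \<gamma> - 1 / 2 * chi_diagonal t (D2chi t \<gamma>) - f t \<gamma>)"
    by (intro continuous_intros diagonal_cont t slice_cont[OF dtu_cont] slice_cont[OF f_cont])
  then have "continuous_on (C_space T) (\<lambda>\<gamma>. forward_integral t (remove_atom0 (Du t \<gamma>)) \<gamma>)"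
    by (rule continuous_on_cong[THEN iffD1, rotated -1]) (use fi in auto)
  from chi_diagonal_eq_lambda[OF t exists[OF t] this \<eta>] show ?thesis
    unfolding drift_def fi[OF \<eta>] by simp
qed

lemma drift_cont: "continuous_on dom (\<lambda>(t, \<eta>). drift t \<eta>)"
proof -
  have "continuous_on dom (\<lambda>p. - (case p of (t, \<eta>) \<Rightarrow> f t \<eta>) - (case p of (t, \<eta>) \<Rightarrow> chi_lambda (D2chi t \<eta>)) / 2)"
    by (intro continuous_intros f_cont lambda_cont) auto
  then show ?thesis
    by (rule continuous_on_cong[THEN iffD1, rotated -1]) (auto simp: drift_eq)
qed

end

locale pde_along_path = pde_solution + driving_path T x for x

text \<open>The purely deterministic situation that remains once a trajectory and a subsequence of
  steps are fixed. The squared increments are required to converge at all \<open>t * i / m\<close>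
  because the partition used later depends on the trajectory.\<close>

locale pde_along_sequence = pde_along_path +
  fixes E :: "nat \<Rightarrow> real" and K t :: real
  assumes E_pos: "\<And>n. 0 < E n" and E_le: "\<And>n. E n \<le> T" and E_lim: "E \<longlonglongrightarrow> 0"
    and energy_bound: "\<And>n p. p \<in> {0..1} \<Longrightarrow> energy (E n * p) \<le> K * E n"
    and t: "0 \<le> t" "t < T"
    and quadratic: "\<And>i m. 0 < m \<Longrightarrow> i \<le> m \<Longrightarrow>
      (\<lambda>n. integral {0..t * real i / real m} (\<lambda>s. (incr (E n) s)\<^sup>2) / E n) \<longlonglongrightarrow> t * real i / real m"
begin

definition osn :: "nat \<Rightarrow> real" where "osn n = osc (E n)"
definition Xp :: "real \<Rightarrow> path" where "Xp s = path_of T x s"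
definition Yp :: "nat \<Rightarrow> real \<Rightarrow> path" where "Yp n s = path_of T (smooth (E n)) s"
definition w :: "nat \<Rightarrow> real \<Rightarrow> real" where "w n s = incr (E n) s / E n"
definition g :: "nat \<Rightarrow> real \<Rightarrow> real" where "g n s = gap (E n) s"
definition bound :: real where "bound = (SOME B. \<forall>r. \<bar>x r\<bar> \<le> B)"
text \<open>The constant of \<open>gap_energy\<close> after the oscillation has been bounded by
  \<open>2 * bound\<close>.\<close>

definition C1 :: real where "C1 = 144 * (2 * bound)\<^sup>2 + K"

lemma T0: "0 \<le> T" using t by simp

lemma bound: "\<bar>x r\<bar> \<le> bound"
proof -
  have "\<exists>B. \<forall>r. \<bar>x r\<bar> \<le> B" using x_bounded by blast
  from someI_ex[OF this] show ?thesis unfolding bound_def by blast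
qed

lemma bound_nonneg: "0 \<le> bound" using bound[of 0] by linarith

lemma osn_nonneg: "0 \<le> osn n" unfolding osn_def using osc_nonneg E_pos by (simp add: less_imp_le)

lemma osn_le: "osn n \<le> 2 * bound"
  unfolding osn_def osc_def
proof (rule cSUP_least)
  have "(0, 0) \<in> {(r, s). \<bar>r - s\<bar> \<le> E n}" using E_pos[of n] by simp
  then show "{(r, s). \<bar>r - s\<bar> \<le> E n} \<noteq> {}" by blast
  show "\<bar>x (fst p) - x (snd p)\<bar> \<le> 2 * bound" for p using bound[of "fst p"] bound[of "snd p"] by linarith
qed

lemma osn_lim: "osn \<longlonglongrightarrow> 0"
  unfolding osn_def[abs_def]
proof (rule filterlim_compose[OF osc_tendsto])
  show "filterlim E (at_right 0) sequentially"
    using E_lim E_pos by (intro tendsto_imp_filterlim_at_right) auto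
qed

lemma K_nonneg: "0 \<le> K"
proof -
  have "0 \<le> K * E 0" using energy_bound[of 0 0] energy_nonneg[of 0] by simp
  then show ?thesis using E_pos[of 0] by (simp add: zero_le_mult_iff)
qed

lemma C1_nonneg: "0 \<le> C1" unfolding C1_def using K_nonneg by simp

lemma g_cont: "continuous_on S (g n)" unfolding g_def[abs_def] by (rule gap_cont[OF E_pos])
lemma w_cont: "continuous_on S (w n)" unfolding w_def[abs_def] using E_pos[of n] by (intro continuous_intros) auto

lemma g_square:
  shows "integrable lborel (\<lambda>r. (g n r)\<^sup>2)" and "(LINT r|lborel. (g n r)\<^sup>2) \<le> C1 * E n"
proof -
  show "integrable lborel (\<lambda>r. (g n r)\<^sup>2)"
    unfolding g_def by (rule gap_energy(1)[OF E_pos E_le energy_bound])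
  have "(LINT r|lborel. (g n r)\<^sup>2) \<le> 144 * (osn n)\<^sup>2 * E n + K * E n"
    unfolding g_def osn_def by (rule gap_energy(2)[OF E_pos E_le energy_bound])
  also have "\<dots> \<le> 144 * (2 * bound)\<^sup>2 * E n + K * E n"
    using osn_le[of n] osn_nonneg[of n] E_pos[of n] by (intro add_mono mult_right_mono mult_left_mono power_mono) auto
  finally show "(LINT r|lborel. (g n r)\<^sup>2) \<le> C1 * E n" unfolding C1_def by (simp add: distrib_right)
qed

lemma incr_square: "integral {a..b} (\<lambda>s. (incr (E n) s)\<^sup>2) \<le> K * E n"
proof -
  have "integral {a..b} (\<lambda>s. (incr (E n) s)\<^sup>2) \<le> (LINT s|lborel. (incr (E n) s)\<^sup>2)"
  proof (rule integral_le_LINT)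
    show "continuous_on UNIV (\<lambda>s. (incr (E n) s)\<^sup>2)" by (intro continuous_intros)
    show "integrable lborel (\<lambda>s. (incr (E n) s)\<^sup>2)" using integrable_increment[of "E n" 0] by (simp add: incr_def)
  qed simp
  also have "\<dots> \<le> K * E n" using energy_bound[of 1 n] unfolding energy_def incr_def by simp
  finally show ?thesis .
qed

lemma g_square_integral: "integral {a..b} (\<lambda>s. (g n (s + y))\<^sup>2) \<le> C1 * E n"
proof -
  have "integral {a..b} (\<lambda>s. (g n (s + y))\<^sup>2) \<le> (LINT s|lborel. (g n (s + y))\<^sup>2)"
    using lborel_integrable_real_affine[OF g_square(1)[of n], of 1 y]
    by (intro integral_le_LINT) (auto intro!: continuous_intros continuous_on_compose2[OF g_cont[of UNIV]] simp: add.commute)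
  also have "\<dots> = (LINT s|lborel. (g n s)\<^sup>2)"
    using lborel_integral_real_affine[of 1 "\<lambda>s. (g n s)\<^sup>2" y] by (simp add: add.commute)
  finally show ?thesis using g_square(2)[of n] by simp
qed

text \<open>The weight \<open>1 / E n\<close> is shared equally: squares of the gap and of the
  increments both have integrals of order \<open>E n\<close>, so the product has integrals of order
  one.\<close>

lemma young: "\<bar>a * w n s\<bar> \<le> (a\<^sup>2 + (incr (E n) s)\<^sup>2) / (2 * E n)"
proof -
  have "0 \<le> (\<bar>a\<bar> - \<bar>incr (E n) s\<bar>)\<^sup>2" by simp
  then have "2 * (\<bar>a\<bar> * \<bar>incr (E n) s\<bar>) \<le> a\<^sup>2 + (incr (E n) s)\<^sup>2" by (simp add: power2_diff algebra_simps)
  then show ?thesis unfolding w_def using E_pos[of n] by (simp add: abs_mult abs_divide field_simps)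
qed

lemma Xp_C: "Xp s \<in> C_space T" unfolding Xp_def by (rule path_of_in_C_space[OF x_cont T0])
lemma Yp_C: "Yp n s \<in> C_space T" unfolding Yp_def by (rule path_of_in_C_space[OF smooth_cont[OF E_pos] T0])

lemma Xp_cont: "continuous_on {a..b} Xp" unfolding Xp_def[abs_def] by (rule path_of_time_cont[OF x_cont T0])
lemma Yp_cont: "continuous_on {a..b} (Yp n)" unfolding Yp_def[abs_def] by (rule path_of_time_cont[OF smooth_cont[OF E_pos] T0])

lemma Yp_diff: "norm (Yp n s - Xp s) \<le> 12 * osn n"
  unfolding Yp_def Xp_def osn_def
  by (rule norm_path_of_diff_le[OF smooth_cont[OF E_pos] x_cont T0]) (use gap_le[OF E_pos] in \<open>simp add: gap_def\<close>)

lemma Yp_apply: "y \<in> {-T..0} \<Longrightarrow> apply_bcontfun (Yp n s - Xp s) y = g n (s + y)"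
  unfolding Yp_def Xp_def g_def gap_def
  by (simp add: apply_path_of[OF smooth_cont[OF E_pos] T0] apply_path_of[OF x_cont T0] clamp_real_def T0)

lemma gap_path_L2: "L2_norm_on {-T..0} (apply_bcontfun (Yp n s - Xp s)) \<le> sqrt (C1 * E n)"
proof -
  have "(LINT y:{-T..0}|lborel. (apply_bcontfun (Yp n s - Xp s) y)\<^sup>2) = (LINT y|lborel. indicator {-T..0} y * (g n (y + s))\<^sup>2)"
    unfolding set_lebesgue_integral_def
    by (rule Bochner_Integration.integral_cong) (auto simp: indicator_def Yp_apply add.commute simp del: minus_bcontfun.rep_eq)
  also have "\<dots> = integral {-T..0} (\<lambda>y. (g n (y + s))\<^sup>2)"
    by (intro LINT_indicator_eq_integral continuous_intros continuous_on_compose2[OF g_cont[of UNIV]]) auto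
  also have "\<dots> \<le> C1 * E n" by (rule g_square_integral)
  finally show ?thesis unfolding L2_norm_on_def by (rule real_sqrt_le_mono)
qed

definition K_graph :: "(real \<times> path) set" where "K_graph = (\<lambda>s. (s, Xp s)) ` {0..t}"

lemma graph_cont: "continuous_on {0..t} (\<lambda>s. (s, Xp s))"
  by (intro continuous_intros Xp_cont)

lemma K_graph: "compact K_graph" "K_graph \<subseteq> dom"
  unfolding K_graph_def using t Xp_C by (auto intro!: compact_continuous_image graph_cont)

lemma graph_pair: "s \<in> {0..t} \<Longrightarrow> (s, Xp s) \<in> K_graph" "s \<in> {0..t} \<Longrightarrow> (s, Xp s) \<in> dom" "s \<in> {0..t} \<Longrightarrow> (s, Yp n s) \<in> dom"
  unfolding K_graph_def using t Xp_C Yp_C by auto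

lemma along_cont:
  assumes h: "continuous_on dom (\<lambda>(t, \<eta>). h t \<eta>)"
  shows "continuous_on {0..t} (\<lambda>s. h s (Xp s))" and "continuous_on {0..t} (\<lambda>s. h s (Yp n s))"
proof -
  have "continuous_on {0..t} (\<lambda>s. (\<lambda>(t, \<eta>). h t \<eta>) (s, Xp s))"
    by (rule continuous_on_compose2[OF h]) (use graph_pair in \<open>auto intro!: graph_cont\<close>)
  then show "continuous_on {0..t} (\<lambda>s. h s (Xp s))" by simp
  have "continuous_on {0..t} (\<lambda>s. (\<lambda>(t, \<eta>). h t \<eta>) (s, Yp n s))"
    by (rule continuous_on_compose2[OF h]) (use graph_pair in \<open>auto intro!: continuous_intros Yp_cont\<close>)
  then show "continuous_on {0..t} (\<lambda>s. h s (Yp n s))" by simp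
qed

lemma uniform_along:
  fixes h :: "real \<Rightarrow> path \<Rightarrow> real"
  assumes h: "continuous_on dom (\<lambda>(t, \<eta>). h t \<eta>)" and e: "0 < e"
  shows "\<forall>\<^sub>F n in sequentially. \<forall>s\<in>{0..t}. \<bar>h s (Yp n s) - h s (Xp s)\<bar> < e"
proof -
  obtain d where d: "0 < d" "\<And>p q. p \<in> K_graph \<Longrightarrow> q \<in> dom \<Longrightarrow> dist p q < d \<Longrightarrow> dist ((\<lambda>(t, \<eta>). h t \<eta>) q) ((\<lambda>(t, \<eta>). h t \<eta>) p) < e"
    using compact_uniform_continuity[OF K_graph h e] by blast
  have "(\<lambda>n. 12 * osn n) \<longlonglongrightarrow> 0" using tendsto_mult_right_zero[OF osn_lim, of 12] by simp
  from order_tendstoD(2)[OF this d(1)] show ?thesis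
  proof eventually_elim
    case (elim n)
    show ?case
    proof
      fix s assume s: "s \<in> {0..t}"
      have "dist (s, Xp s) (s, Yp n s) < d"
        using Yp_diff[of n s] elim by (simp add: dist_Pair_Pair dist_norm norm_minus_commute)
      from d(2)[OF graph_pair(1)[OF s] graph_pair(3)[OF s] this]
      show "\<bar>h s (Yp n s) - h s (Xp s)\<bar> < e" by (simp add: dist_real_def)
    qed
  qed
qed

lemma integral_along_lim:
  fixes h :: "real \<Rightarrow> path \<Rightarrow> real"
  assumes h: "continuous_on dom (\<lambda>(t, \<eta>). h t \<eta>)"
  shows "(\<lambda>n. integral {0..t} (\<lambda>s. h s (Yp n s))) \<longlonglongrightarrow> integral {0..t} (\<lambda>s. h s (Xp s))"
proof (rule tendstoI)
  fix e :: real assume e: "0 < e"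
  have "0 < e / (t + 1)" using e t by simp
  from uniform_along[OF h this]
  show "\<forall>\<^sub>F n in sequentially. dist (integral {0..t} (\<lambda>s. h s (Yp n s))) (integral {0..t} (\<lambda>s. h s (Xp s))) < e"
  proof eventually_elim
    case (elim n)
    have "integral {0..t} (\<lambda>s. h s (Yp n s)) - integral {0..t} (\<lambda>s. h s (Xp s)) = integral {0..t} (\<lambda>s. h s (Yp n s) - h s (Xp s))"
      by (intro Henstock_Kurzweil_Integration.integral_diff[symmetric] integrable_continuous_real along_cont h)
    also have "\<bar>\<dots>\<bar> \<le> e / (t + 1) * (t - 0)"
    proof (rule integral_abs_le_const)
      show "continuous_on {0..t} (\<lambda>s. h s (Yp n s) - h s (Xp s))"
        by (intro continuous_on_diff along_cont[OF h])
    qed (use t elim in \<open>auto intro!: less_imp_le\<close>)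
    also have "\<dots> < e" using e t by (simp add: field_simps)
    finally show ?case by (simp add: dist_real_def)
  qed
qed

text \<open>The ramp is of size \<open>osn n / E n\<close> but lives on an interval of length
  \<open>E n\<close>, so it contributes only a multiple of \<open>osn n\<close>.\<close>

lemma ramp_term_lim: "(\<lambda>n. integral {0..t} (\<lambda>s. atom s (Yp n s) * ramp (E n) s)) \<longlonglongrightarrow> 0"
proof -
  have "compact ((\<lambda>s. atom s (Xp s)) ` {0..t})"
    by (intro compact_continuous_image along_cont atom_cont) simp
  then obtain M where M: "\<And>s. s \<in> {0..t} \<Longrightarrow> \<bar>atom s (Xp s)\<bar> \<le> M"
    by (meson bounded_real compact_imp_bounded imageI)
  have M0: "0 \<le> M" using M[of 0] t by force
  have ev: "\<forall>\<^sub>F n in sequentially. norm (integral {0..t} (\<lambda>s. atom s (Yp n s) * ramp (E n) s)) \<le> (M + 1) * 10 * osn n"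
    using uniform_along[OF atom_cont, of 1, simplified]
  proof eventually_elim
    case (elim n)
    have "\<bar>integral {0..t} (\<lambda>s. atom s (Yp n s) * ramp (E n) s)\<bar> \<le> ((M + 1) * (10 * osn n / E n)) * E n"
    proof (rule integral_abs_le_const_prefix)
      show "continuous_on {0..t} (\<lambda>s. atom s (Yp n s) * ramp (E n) s)"
        by (intro continuous_intros along_cont atom_cont)
      show "\<bar>atom r (Yp n r) * ramp (E n) r\<bar> \<le> (M + 1) * (10 * osn n / E n)" if r: "0 \<le> r" "r \<le> E n" "r \<le> t" for r
      proof -
        have "\<bar>atom r (Yp n r)\<bar> \<le> M + 1" using elim M[of r] r by force
        then show ?thesis
          unfolding abs_mult using ramp_le[OF E_pos r(1), of n] M0 unfolding osn_def[symmetric] by (intro mult_mono) auto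
      qed
    qed (use t E_pos[of n] M0 osn_nonneg[of n] ramp_zero[OF E_pos] in auto)
    moreover have "((M + 1) * (10 * osn n / E n)) * E n = (M + 1) * 10 * osn n" using E_pos[of n] by simp
    ultimately show ?case by simp
  qed
  have "(\<lambda>n. (M + 1) * 10 * osn n) \<longlonglongrightarrow> 0" by (rule tendsto_mult_right_zero[OF osn_lim])
  from Lim_null_comparison[OF ev this] show ?thesis .
qed

section \<open>The terms of first order in the gap\<close>

lemma chi_row_diff:
  assumes "\<mu> \<in> chi_space T"
  shows "chi_row T \<mu> (\<phi> - \<psi>) = chi_row T \<mu> \<phi> - chi_row T \<mu> \<psi>"
proof -
  have "square_integrable_on {-T..0} (chi_g2 \<mu>)" using assms unfolding chi_space_def by auto
  note i = L2_Cauchy_Schwarz(1)[OF this square_integrable_on_path]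
  show ?thesis unfolding chi_row_def using set_integral_diff(2)[OF i i, of \<phi> \<psi>] by (simp add: right_diff_distrib)
qed

lemma row_along_cont:
  assumes \<mu>: "\<mu> \<in> chi_space T"
  shows "continuous_on {a..b} (\<lambda>s. chi_row T \<mu> (Yp n s - Xp s))"
proof -
  define c where "c = chi_norm T \<mu> * sqrt T"
  have lip: "\<bar>chi_row T \<mu> \<phi> - chi_row T \<mu> \<psi>\<bar> \<le> c * norm (\<phi> - \<psi>)" for \<phi> \<psi>
  proof -
    have "0 \<le> chi_norm T \<mu>" using chi_components_le(2)[of \<mu> T] by linarith
    then have "chi_norm T \<mu> * L2_norm_on {-T..0} (apply_bcontfun (\<phi> - \<psi>)) \<le> chi_norm T \<mu> * (sqrt T * norm (\<phi> - \<psi>))"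
      by (intro mult_left_mono L2_norm_on_path_le T0)
    then show ?thesis
      using chi_form_parts_le(2)[OF T0 \<mu>, of "\<phi> - \<psi>"] unfolding chi_row_diff[OF \<mu>] c_def mult.assoc by linarith
  qed
  have "continuous_on UNIV (chi_row T \<mu>)"
    unfolding continuous_on_def
  proof
    fix \<psi> :: path
    have l: "((\<lambda>\<phi>. c * norm (\<phi> - \<psi>)) \<longlongrightarrow> c * norm (\<psi> - \<psi>)) (at \<psi>)" by (intro tendsto_intros)
    have "((\<lambda>\<phi>. chi_row T \<mu> \<phi> - chi_row T \<mu> \<psi>) \<longlongrightarrow> 0) (at \<psi>)"
      by (rule Lim_null_comparison[OF always_eventually]) (use lip l in auto)
    then show "(chi_row T \<mu> \<longlongrightarrow> chi_row T \<mu> \<psi>) (at \<psi>)" by (simp add: LIM_zero_iff)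
  qed
  then show ?thesis by (rule continuous_on_compose2) (auto intro!: continuous_intros Xp_cont Yp_cont)
qed

lemma w_le: "\<bar>w n s\<bar> \<le> osn n / E n"
  unfolding w_def incr_def osn_def abs_divide using E_pos[of n] osc_bound[of "s + E n" s "E n"] by (simp add: divide_right_mono)

text \<open>Cauchy-Schwarz alone gives boundedness, not convergence to 0. By Fubini the integral is
  that of \<open>g\<^sub>2\<close> against the correlations \<open>k n y\<close> of the gap shifted
  by \<open>y\<close> with \<open>w n\<close>. These are bounded by \<open>young\<close>; their
  integrals over intervals vanish in the limit, since \<open>gap_integral_le\<close> gains a factor
  \<open>E n\<close> against \<open>w n\<close>. So \<open>weakly_null_integral\<close>
  applies.\<close>

lemma row_term_lim:
  assumes \<mu>: "\<mu> \<in> chi_space T" and ab: "a \<le> b"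
  shows "(\<lambda>n. integral {a..b} (\<lambda>s. chi_row T \<mu> (Yp n s - Xp s) * w n s)) \<longlonglongrightarrow> 0"
proof -
  define G where "G y = indicator {-T..0} y * chi_g2 \<mu> y" for y
  have g2: "square_integrable_on {-T..0} (chi_g2 \<mu>)" using \<mu> unfolding chi_space_def by auto
  have "square_integrable_on {-T..0::real} (\<lambda>_. 1)"
    by (rule square_integrable_on_bounded(1)[where C=1]) (auto simp: emeasure_lborel_Icc_eq)
  from L2_Cauchy_Schwarz(1)[OF g2 this] have g2i: "set_integrable lborel {-T..0} (chi_g2 \<mu>)" by simp
  have Gi: "integrable lborel G" using g2i unfolding set_integrable_def G_def[abs_def] by simp
  define k where "k n y = (LINT s|lborel. indicator {a..b} s * (g n (s + y) * w n s))" for n y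
  have gw_cont: "continuous_on S (\<lambda>s. g n (s + y) * w n s)" for S n y
    by (intro continuous_intros w_cont continuous_on_compose2[OF g_cont[of UNIV]]) auto
  have k_eq: "k n y = integral {a..b} (\<lambda>s. g n (s + y) * w n s)" for n y
    unfolding k_def by (rule LINT_indicator_eq_integral[OF gw_cont])
  have kb: "\<bar>k n y\<bar> \<le> (C1 + K) / 2" for n y
  proof -
    have W: "continuous_on {a..b} (\<lambda>s. ((g n (s + y))\<^sup>2 + (incr (E n) s)\<^sup>2) / (2 * E n))"
      using E_pos[of n] by (intro continuous_intros continuous_on_compose2[OF g_cont[of UNIV]]) auto
    have "norm (integral {a..b} (\<lambda>s. g n (s + y) * w n s)) \<le> integral {a..b} (\<lambda>s. ((g n (s + y))\<^sup>2 + (incr (E n) s)\<^sup>2) / (2 * E n))"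
      by (rule integral_norm_bound_integral) (use young in \<open>auto intro!: integrable_continuous_real gw_cont W\<close>)
    also have "\<dots> = (integral {a..b} (\<lambda>s. (g n (s + y))\<^sup>2) + integral {a..b} (\<lambda>s. (incr (E n) s)\<^sup>2)) / (2 * E n)"
    proof -
      have "integral {a..b} (\<lambda>s. (g n (s + y))\<^sup>2 + (incr (E n) s)\<^sup>2) = integral {a..b} (\<lambda>s. (g n (s + y))\<^sup>2) + integral {a..b} (\<lambda>s. (incr (E n) s)\<^sup>2)"
        by (intro Henstock_Kurzweil_Integration.integral_add integrable_continuous_real continuous_intros continuous_on_compose2[OF g_cont[of UNIV]]) auto
      then show ?thesis by simp
    qed
    also have "\<dots> \<le> (C1 * E n + K * E n) / (2 * E n)"
      using g_square_integral incr_square E_pos[of n] by (intro divide_right_mono add_mono) auto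
    also have "\<dots> = (C1 + K) / 2" using E_pos[of n] by (simp add: field_simps)
    finally show ?thesis unfolding k_eq by simp
  qed
  have gm[measurable]: "g n \<in> borel_measurable borel" for n by (rule borel_measurable_continuous_onI[OF g_cont])
  have wm[measurable]: "w n \<in> borel_measurable borel" for n by (rule borel_measurable_continuous_onI[OF w_cont])
  have Hm: "(\<lambda>(y, s). g n (s + y) * w n s) \<in> borel_measurable (lborel \<Otimes>\<^sub>M lborel)" for n by measurable
  \<comment> \<open>This bound may blow up with \<open>n\<close>; it only justifies exchanging the
    integrals for fixed \<open>n\<close>.\<close>
  have Hb: "\<bar>g n (s + y) * w n s\<bar> \<le> 12 * osn n * (osn n / E n)" for n s y
    unfolding abs_mult by (intro mult_mono w_le) (use gap_le[OF E_pos] osn_nonneg[of n] in \<open>auto simp: g_def osn_def\<close>)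
  have km: "k n \<in> borel_measurable borel" for n
  proof -
    have "(\<lambda>(y, s). indicator {a..b} s * (g n (s + y) * w n s)) \<in> borel_measurable (borel \<Otimes>\<^sub>M lborel)" by measurable
    from lborel.borel_measurable_lebesgue_integral[OF this] show ?thesis unfolding k_def[abs_def] by simp
  qed
  have knull: "(\<lambda>n. LINT y:{c..d}|lborel. k n y) \<longlonglongrightarrow> 0" if cd: "c \<le> d" for c d
  proof -
    have I: "integrable lborel (indicat_real {c..d})" by (auto intro!: integrable_real_indicator simp: emeasure_lborel_Icc_eq)
    have eq: "(LINT y:{c..d}|lborel. k n y) = (LINT s|lborel. indicator {a..b} s * (integral {c..d} (\<lambda>y. g n (s + y)) * w n s))" for n
    proof -
      have "(LINT y:{c..d}|lborel. k n y) = (LINT s|lborel. indicator {a..b} s * (LINT y|lborel. indicator {c..d} y * (g n (s + y) * w n s)))"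
        unfolding set_lebesgue_integral_def k_def real_scaleR_def by (rule LINT_swap[OF I Hm Hb])
      moreover have "(LINT y|lborel. indicator {c..d} y * (g n (s + y) * w n s)) = integral {c..d} (\<lambda>y. g n (s + y)) * w n s" for s
      proof -
        have "(LINT y|lborel. indicator {c..d} y * (g n (s + y) * w n s)) = integral {c..d} (\<lambda>y. g n (s + y) * w n s)"
          by (intro LINT_indicator_eq_integral continuous_intros continuous_on_compose2[OF g_cont[of UNIV]]) auto
        then show ?thesis by simp
      qed
      ultimately show ?thesis by simp
    qed
    have le: "\<bar>integral {c..d} (\<lambda>y. g n (s + y)) * w n s\<bar> \<le> (4 * bound + 22 * osn n) * osn n" for n s
    proof -
      have "integral {c..d} (\<lambda>y. g n (s + y)) = integral {c + s..d + s} (g n)"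
        
        using integral_shift[where f="g n" and a=c and b=d and c=s] g_cont by (simp add: add.commute o_def)
      then have "\<bar>integral {c..d} (\<lambda>y. g n (s + y))\<bar> \<le> (4 * bound + 22 * osn n) * E n"
        unfolding g_def osn_def using gap_integral_le[OF E_pos bound, of "c + s" "d + s" n] cd by simp
      then have "\<bar>integral {c..d} (\<lambda>y. g n (s + y))\<bar> * \<bar>w n s\<bar> \<le> ((4 * bound + 22 * osn n) * E n) * (osn n / E n)"
        by (intro mult_mono w_le) (use bound_nonneg osn_nonneg[of n] E_pos[of n] in auto)
      then show ?thesis unfolding abs_mult using E_pos[of n] by simp
    qed
    have nle: "norm (LINT y:{c..d}|lborel. k n y) \<le> (4 * bound + 22 * osn n) * osn n * (b - a)" for n
    proof -
      have i2: "integrable lborel (\<lambda>s. (4 * bound + 22 * osn n) * osn n * indicat_real {a..b} s)"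
        by (auto intro!: integrable_mult_right integrable_real_indicator simp: emeasure_lborel_Icc_eq)
      have "norm (LINT y:{c..d}|lborel. k n y) \<le> (LINT s|lborel. (4 * bound + 22 * osn n) * osn n * indicat_real {a..b} s)"
        unfolding eq
      proof (rule order_trans[OF integral_norm_bound integral_mono'[OF i2]])
        have "0 \<le> (4 * bound + 22 * osn n) * osn n"
          using bound_nonneg osn_nonneg[of n] by (intro mult_nonneg_nonneg) auto
        then show "0 \<le> (4 * bound + 22 * osn n) * osn n * indicat_real {a..b} s" for s by simp
        show "norm (indicator {a..b} s * (integral {c..d} (\<lambda>y. g n (s + y)) * w n s)) \<le> (4 * bound + 22 * osn n) * osn n * indicat_real {a..b} s" for s
          using le[of n s] by (simp add: indicator_def)
      qed
      then show ?thesis using ab by simp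
    qed
    have "(\<lambda>n. (4 * bound + 22 * osn n) * osn n * (b - a)) \<longlonglongrightarrow> (4 * bound + 22 * 0) * 0 * (b - a)"
      by (intro tendsto_intros osn_lim)
    then have l0: "(\<lambda>n. (4 * bound + 22 * osn n) * osn n * (b - a)) \<longlonglongrightarrow> 0" by simp
    show ?thesis by (rule Lim_null_comparison[OF always_eventually l0]) (use nle in blast)
  qed
  have "(\<lambda>n. LINT y:{-T..0}|lborel. chi_g2 \<mu> y * k n y) \<longlonglongrightarrow> 0"
    by (rule weakly_null_integral[OF km kb knull g2i])
  moreover have "(LINT y:{-T..0}|lborel. chi_g2 \<mu> y * k n y) = integral {a..b} (\<lambda>s. chi_row T \<mu> (Yp n s - Xp s) * w n s)" for n
  proof -
    have row: "chi_row T \<mu> (Yp n s - Xp s) = (LINT y|lborel. G y * g n (s + y))" for s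
      unfolding chi_row_def set_lebesgue_integral_def G_def
      by (rule Bochner_Integration.integral_cong) (auto simp: indicator_def Yp_apply simp del: minus_bcontfun.rep_eq)
    have "(LINT y:{-T..0}|lborel. chi_g2 \<mu> y * k n y) = (LINT y|lborel. G y * k n y)"
      unfolding set_lebesgue_integral_def G_def by (simp add: mult.assoc)
    also have "\<dots> = (LINT s|lborel. indicator {a..b} s * (LINT y|lborel. G y * (g n (s + y) * w n s)))"
      unfolding k_def by (rule LINT_swap[OF Gi Hm Hb])
    also have "\<dots> = (LINT s|lborel. indicator {a..b} s * (chi_row T \<mu> (Yp n s - Xp s) * w n s))"
      unfolding row integral_mult_left_zero[symmetric] mult.assoc ..
    also have "\<dots> = integral {a..b} (\<lambda>s. chi_row T \<mu> (Yp n s - Xp s) * w n s)"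
      by (intro LINT_indicator_eq_integral continuous_intros row_along_cont \<mu> w_cont)
    finally show ?thesis .
  qed
  ultimately show ?thesis by simp
qed

lemma gap_term_lim:
  assumes m: "0 < m" "i \<le> m"
  shows "(\<lambda>n. integral {0..t * real i / real m} (\<lambda>s. g n s * w n s)) \<longlonglongrightarrow> t * real i / real m / 2"
proof -
  define \<tau> where "\<tau> = t * real i / real m"
  have \<tau>: "0 \<le> \<tau>" unfolding \<tau>_def using t by simp
  have le: "norm (integral {0..\<tau>} (\<lambda>s. g n s * w n s) - integral {0..\<tau>} (\<lambda>s. (incr (E n) s)\<^sup>2) / E n / 2)
      \<le> 2 * bound * osn n + 11 * (osn n)\<^sup>2" for n
    using gap_incr_integral[OF E_pos bound \<tau>, of n] unfolding g_def w_def osn_def by (simp add: mult.commute)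
  have l0: "(\<lambda>n. 2 * bound * osn n + 11 * (osn n)\<^sup>2) \<longlonglongrightarrow> 2 * bound * 0 + 11 * 0\<^sup>2"
    by (intro tendsto_intros osn_lim)
  have "(\<lambda>n. integral {0..\<tau>} (\<lambda>s. g n s * w n s) - integral {0..\<tau>} (\<lambda>s. (incr (E n) s)\<^sup>2) / E n / 2) \<longlonglongrightarrow> 0"
    by (rule Lim_null_comparison[OF always_eventually]) (use le l0 in auto)
  from tendsto_add[OF this tendsto_divide[OF quadratic[OF m] tendsto_const[of 2]]]
  show ?thesis unfolding \<tau>_def by simp
qed

text \<open>Freezing the second derivative on a fine partition reduces this to the two previous limits;
  the error is controlled by the energy of the increments.\<close>

lemma correction_term_lim:
  "(\<lambda>n. integral {0..t} (\<lambda>s. (atom s (Yp n s) - atom s (Xp s)) * w n s))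
    \<longlonglongrightarrow> integral {0..t} (\<lambda>s. chi_lambda (D2chi s (Xp s))) / 2"
proof (rule LIMSEQ_I)
  fix \<zeta> :: real assume \<zeta>: "0 < \<zeta>"
  define L where "L s = chi_lambda (D2chi s (Xp s))" for s
  define h where "h n s = atom s (Yp n s) - atom s (Xp s)" for n s
  have L_cont: "continuous_on {0..t} L" unfolding L_def by (rule along_cont(1)[OF lambda_cont])
  have h_cont: "continuous_on {0..t} (h n)" for n
    unfolding h_def[abs_def] by (intro continuous_intros along_cont atom_cont)
  \<comment> \<open>A bound, independent of \<open>n\<close> and of the partition, for the integral
    of the dominating function \<open>W\<close> below.\<close>
  define C2 where "C2 = (C1 + 2 * K + C1 * t) / 2"
  have C2: "0 \<le> C2" unfolding C2_def using C1_nonneg K_nonneg t by simp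
  define e where "e = \<zeta> / (4 * (C2 + t + 1))"
  have e: "0 < e" unfolding e_def using \<zeta> C2 t by simp
  have e_le: "e * C2 \<le> \<zeta> / 4" "e * t \<le> \<zeta> / 4"
  proof -
    have "e * (C2 + t + 1) = \<zeta> / 4" unfolding e_def using C2 t by (simp add: field_simps)
    moreover have "e * C2 \<le> e * (C2 + t + 1)" "e * t \<le> e * (C2 + t + 1)" using e C2 t by (auto intro!: mult_left_mono)
    ultimately show "e * C2 \<le> \<zeta> / 4" "e * t \<le> \<zeta> / 4" by simp_all
  qed
  have "\<exists>d>0. \<forall>p\<in>K_graph. \<forall>q r. dist p q < d \<longrightarrow> dist p r < d \<longrightarrow> (q \<in> dom \<longrightarrow> r \<in> dom \<longrightarrow> chi_close e q r)"
    by (rule compact_uniform_neighbourhood[OF K_graph(1)]) (use chi_close_nbhd[OF _ e] K_graph(2) in blast)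
  then obtain d where d: "0 < d" "\<And>p q r. p \<in> K_graph \<Longrightarrow> dist p q < d \<Longrightarrow> dist p r < d \<Longrightarrow> q \<in> dom \<Longrightarrow> r \<in> dom \<Longrightarrow> chi_close e q r"
    by blast
  have "uniformly_continuous_on {0..t} (\<lambda>s. (s, Xp s))" by (intro compact_uniformly_continuous graph_cont) simp
  then obtain d' where d': "0 < d'" "\<And>s r. s \<in> {0..t} \<Longrightarrow> r \<in> {0..t} \<Longrightarrow> dist r s < d' \<Longrightarrow> dist (r, Xp r) (s, Xp s) < d"
    unfolding uniformly_continuous_on_def using d(1) by blast
  obtain k :: nat where k: "t / d' < real k" using reals_Archimedean2 by blast
  define m where "m = Suc k"
  have m: "0 < m" "t / real m < d'" unfolding m_def using k d'(1) t
    by (auto simp: field_simps intro: order_less_trans)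
  define \<tau> where "\<tau> j = t * real j / real m" for j
  have \<tau>: "0 \<le> \<tau> j" "\<tau> j \<le> \<tau> (Suc j)" "\<tau> (Suc j) - \<tau> j = t / real m" for j
    unfolding \<tau>_def using t m by (auto simp: field_simps)
  have \<tau>t: "\<tau> j \<le> t" if "j \<le> m" for j unfolding \<tau>_def using that t m(1) by (simp add: divide_le_eq mult_left_mono)
  have sub: "{\<tau> j..\<tau> (Suc j)} \<subseteq> {0..t}" if "j < m" for j using \<tau>(1)[of j] \<tau>t[of "Suc j"] that by auto
  have near: "dist (s, Xp s) (\<tau> j, Xp (\<tau> j)) < d" if "j < m" "s \<in> {\<tau> j..\<tau> (Suc j)}" for j s
    using sub[OF that(1)] that m(2) \<tau>(2,3)[of j] by (intro d'(2)) (auto simp: dist_real_def)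
  define \<mu> where "\<mu> j = D2chi (\<tau> j) (Xp (\<tau> j))" for j
  have \<mu>: "\<mu> j \<in> chi_space T" if "j \<le> m" for j
    unfolding \<mu>_def using \<tau>(1)[of j] \<tau>t[OF that] t by (intro D2chi_space Xp_C) auto
  \<comment> \<open>The first-order expansion of the atom difference with the second derivative
    frozen at the grid point \<open>\<tau> j\<close>, times the forward quotient of
    \<open>x\<close>.\<close>
  define R where "R n j s = (L (\<tau> j) * g n s + chi_row T (\<mu> j) (Yp n s - Xp s)) * w n s" for n j s
  have R_cont: "continuous_on {a..b} (R n j)" if "j \<le> m" for n j a b
    unfolding R_def[abs_def] by (intro continuous_intros g_cont row_along_cont \<mu> that w_cont)
  define A where "A n = (\<Sum>j<m. integral {\<tau> j..\<tau> (Suc j)} (R n j))" for n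
  have A_lim: "A \<longlonglongrightarrow> (\<Sum>j<m. L (\<tau> j) * (t / real m) / 2)"
    unfolding A_def[abs_def]
  proof (rule tendsto_sum)
    fix j assume "j \<in> {..<m}"
    then have j: "j < m" "j \<le> m" "Suc j \<le> m" by auto
    have gw: "continuous_on S (\<lambda>s. g n s * w n s)" for S n by (intro continuous_intros g_cont w_cont)
    have rw: "continuous_on {a..b} (\<lambda>s. chi_row T (\<mu> j) (Yp n s - Xp s) * w n s)" for a b n
      by (intro continuous_intros row_along_cont \<mu> j w_cont)
    have eq: "integral {\<tau> j..\<tau> (Suc j)} (R n j) = L (\<tau> j) * (integral {0..\<tau> (Suc j)} (\<lambda>s. g n s * w n s) - integral {0..\<tau> j} (\<lambda>s. g n s * w n s))
        + integral {\<tau> j..\<tau> (Suc j)} (\<lambda>s. chi_row T (\<mu> j) (Yp n s - Xp s) * w n s)" for n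
    proof -
      have "integral {\<tau> j..\<tau> (Suc j)} (R n j) = integral {\<tau> j..\<tau> (Suc j)} (\<lambda>s. L (\<tau> j) * (g n s * w n s) + chi_row T (\<mu> j) (Yp n s - Xp s) * w n s)"
        unfolding R_def by (simp add: distrib_right mult.assoc)
      also have "\<dots> = integral {\<tau> j..\<tau> (Suc j)} (\<lambda>s. L (\<tau> j) * (g n s * w n s)) + integral {\<tau> j..\<tau> (Suc j)} (\<lambda>s. chi_row T (\<mu> j) (Yp n s - Xp s) * w n s)"
        by (rule Henstock_Kurzweil_Integration.integral_add)
          (auto intro!: integrable_continuous_real rw continuous_on_mult[OF continuous_on_const gw])
      also have "integral {\<tau> j..\<tau> (Suc j)} (\<lambda>s. L (\<tau> j) * (g n s * w n s)) = L (\<tau> j) * integral {\<tau> j..\<tau> (Suc j)} (\<lambda>s. g n s * w n s)"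
        by simp
      also have "integral {\<tau> j..\<tau> (Suc j)} (\<lambda>s. g n s * w n s) = integral {0..\<tau> (Suc j)} (\<lambda>s. g n s * w n s) - integral {0..\<tau> j} (\<lambda>s. g n s * w n s)"
        using Henstock_Kurzweil_Integration.integral_combine[OF \<tau>(1,2) integrable_continuous_real[OF gw], of j n] by simp
      finally show ?thesis .
    qed
    have "(\<lambda>n. integral {\<tau> j..\<tau> (Suc j)} (R n j)) \<longlonglongrightarrow> L (\<tau> j) * (\<tau> (Suc j) / 2 - \<tau> j / 2) + 0"
      unfolding eq
      by (intro tendsto_intros gap_term_lim[OF m(1) j(3), folded \<tau>_def] gap_term_lim[OF m(1) j(2), folded \<tau>_def]
          row_term_lim \<mu> j \<tau>)
    then show "(\<lambda>n. integral {\<tau> j..\<tau> (Suc j)} (R n j)) \<longlonglongrightarrow> L (\<tau> j) * (t / real m) / 2"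
      unfolding diff_divide_distrib[symmetric] \<tau>(3) by simp
  qed
  have L_sum: "\<bar>(\<Sum>j<m. L (\<tau> j) * (t / real m) / 2) - integral {0..t} L / 2\<bar> \<le> e * t / 2"
  proof -
    have one: "\<bar>L (\<tau> j) * (t / real m) - integral {\<tau> j..\<tau> (Suc j)} L\<bar> \<le> e * (t / real m)" if j: "j < m" for j
    proof -
      have Lj: "continuous_on {\<tau> j..\<tau> (Suc j)} L" by (rule continuous_on_subset[OF L_cont sub[OF j]])
      have "integral {\<tau> j..\<tau> (Suc j)} (\<lambda>s. L (\<tau> j) - L s) = integral {\<tau> j..\<tau> (Suc j)} (\<lambda>s. L (\<tau> j)) - integral {\<tau> j..\<tau> (Suc j)} L"
        by (intro Henstock_Kurzweil_Integration.integral_diff integrable_continuous_real Lj continuous_intros)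
      also have "integral {\<tau> j..\<tau> (Suc j)} (\<lambda>s. L (\<tau> j)) = L (\<tau> j) * (t / real m)"
        using \<tau>(2,3)[of j] by simp
      finally have eq: "L (\<tau> j) * (t / real m) - integral {\<tau> j..\<tau> (Suc j)} L = integral {\<tau> j..\<tau> (Suc j)} (\<lambda>s. L (\<tau> j) - L s)" by simp
      have "\<bar>integral {\<tau> j..\<tau> (Suc j)} (\<lambda>s. L (\<tau> j) - L s)\<bar> \<le> e * (\<tau> (Suc j) - \<tau> j)"
      proof (rule integral_abs_le_const[OF \<tau>(2)])
        show "continuous_on {\<tau> j..\<tau> (Suc j)} (\<lambda>s. L (\<tau> j) - L s)" by (intro continuous_intros Lj)
        fix s assume s: "\<tau> j \<le> s" "s \<le> \<tau> (Suc j)"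
        have st: "s \<in> {0..t}" "\<tau> j \<in> {0..t}" using sub[OF j] s \<tau>(2)[of j] by auto
        have "chi_close e (\<tau> j, Xp (\<tau> j)) (s, Xp s)"
          by (rule d(2)[OF graph_pair(1)[OF st(1)]]) (use near[OF j, of s] s d(1) graph_pair(2) st in auto)
        then show "\<bar>L (\<tau> j) - L s\<bar> \<le> e" unfolding chi_close_def L_def by simp
      qed
      then show ?thesis unfolding eq \<tau>(3) .
    qed
    have "\<bar>(\<Sum>j<m. L (\<tau> j) * (t / real m)) - integral {0..t} L\<bar> = \<bar>\<Sum>j<m. L (\<tau> j) * (t / real m) - integral {\<tau> j..\<tau> (Suc j)} L\<bar>"
      unfolding integral_partition[OF t(1) L_cont m(1), folded \<tau>_def] sum_subtractf ..
    also have "\<dots> \<le> (\<Sum>j<m. \<bar>L (\<tau> j) * (t / real m) - integral {\<tau> j..\<tau> (Suc j)} L\<bar>)" by (rule sum_abs)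
    also have "\<dots> \<le> (\<Sum>j<m. e * (t / real m))" by (intro sum_mono one) simp
    also have "\<dots> = e * t" using m(1) by simp
    finally show ?thesis by (simp add: sum_divide_distrib[symmetric] diff_divide_distrib[symmetric] abs_divide del: times_divide_eq_right)
  qed
  have close: "\<bar>integral {0..t} (\<lambda>s. h n s * w n s) - A n\<bar> \<le> e * C2" if small: "12 * osn n < d" for n
  proof -
    \<comment> \<open>It dominates the path weight of the perturbation times
      \<open>\<bar>w n s\<bar>\<close>: \<open>young\<close> is applied once to its value
      \<open>g n s\<close> at 0 and once to the bound \<open>sqrt (C1 * E n)\<close> of its L2
      norm.\<close>
    define W where "W s = ((g n s)\<^sup>2 + (incr (E n) s)\<^sup>2) / (2 * E n) + (C1 * E n + (incr (E n) s)\<^sup>2) / (2 * E n)" for s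
    have W_cont: "continuous_on S W" for S
      unfolding W_def[abs_def] using E_pos[of n] by (intro continuous_intros g_cont) auto
    have hw: "continuous_on {0..t} (\<lambda>s. h n s * w n s)" by (intro continuous_intros h_cont w_cont)
    have pt: "\<bar>h n s * w n s - R n j s\<bar> \<le> e * W s" if j: "j < m" and s: "s \<in> {\<tau> j..\<tau> (Suc j)}" for j s
    proof -
      define \<phi> where "\<phi> = Yp n s - Xp s"
      have st: "s \<in> {0..t}" "\<tau> j \<in> {0..t}" and sT: "s \<in> {0..<T}" using sub[OF j] s \<tau>(2)[of j] t by auto
      have \<phi>C: "\<phi> \<in> C_space T" unfolding \<phi>_def by (intro C_space_diff Yp_C Xp_C)
      have \<phi>n: "norm \<phi> \<le> 12 * osn n" unfolding \<phi>_def by (rule Yp_diff)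
      have \<phi>0: "apply_bcontfun \<phi> 0 = g n s" unfolding \<phi>_def using Yp_apply[of 0 n s] T0 by simp
      have "chi_close e (s, Xp s + \<theta> *\<^sub>R \<phi>) (\<tau> j, Xp (\<tau> j))" if \<theta>: "0 < \<theta>" "\<theta> < 1" for \<theta>
      proof (rule d(2)[OF graph_pair(1)[OF st(1)]])
        have "norm (\<theta> *\<^sub>R \<phi>) \<le> 1 * norm \<phi>" unfolding norm_scaleR using \<theta> by (intro mult_right_mono) auto
        then show "dist (s, Xp s) (s, Xp s + \<theta> *\<^sub>R \<phi>) < d"
          using \<phi>n small by (simp add: dist_Pair_Pair dist_norm)
        show "dist (s, Xp s) (\<tau> j, Xp (\<tau> j)) < d" by (rule near[OF j s])
        show "(s, Xp s + \<theta> *\<^sub>R \<phi>) \<in> dom" using sT by (auto intro!: C_space_add C_space_scaleR Xp_C \<phi>C)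
        show "(\<tau> j, Xp (\<tau> j)) \<in> dom" by (rule graph_pair(2)[OF st(2)])
      qed
      from atom_expansion[OF sT Xp_C \<phi>C this graph_pair(2)[OF st(2)]]
      have "\<bar>h n s - (L (\<tau> j) * g n s + chi_row T (\<mu> j) \<phi>)\<bar> \<le> e * path_weight T \<phi>"
        unfolding h_def L_def \<mu>_def \<phi>0 by (simp add: \<phi>_def)
      then have "\<bar>h n s - (L (\<tau> j) * g n s + chi_row T (\<mu> j) \<phi>)\<bar> * \<bar>w n s\<bar> \<le> e * path_weight T \<phi> * \<bar>w n s\<bar>"
        by (rule mult_right_mono) simp
      then have "\<bar>h n s * w n s - R n j s\<bar> \<le> e * (path_weight T \<phi> * \<bar>w n s\<bar>)"
        unfolding R_def \<phi>_def[symmetric] left_diff_distrib[symmetric] abs_mult by (simp add: mult.assoc)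
      also have "\<dots> \<le> e * W s"
      proof (rule mult_left_mono)
        have "path_weight T \<phi> * \<bar>w n s\<bar> \<le> (\<bar>g n s\<bar> + sqrt (C1 * E n)) * \<bar>w n s\<bar>"
          unfolding path_weight_def \<phi>0 using gap_path_L2[of n s] by (intro mult_right_mono) (auto simp: \<phi>_def)
        also have "\<dots> = \<bar>g n s * w n s\<bar> + \<bar>sqrt (C1 * E n) * w n s\<bar>"
          using C1_nonneg E_pos[of n] by (simp add: abs_mult distrib_right)
        also have "\<dots> \<le> W s"
          unfolding W_def using young[of "g n s" n s] young[of "sqrt (C1 * E n)" n s] C1_nonneg E_pos[of n] by simp
        finally show "path_weight T \<phi> * \<bar>w n s\<bar> \<le> W s" .
      qed (use e in simp)
      finally show ?thesis .
    qed
    have one: "\<bar>integral {\<tau> j..\<tau> (Suc j)} (\<lambda>s. h n s * w n s) - integral {\<tau> j..\<tau> (Suc j)} (R n j)\<bar> \<le> e * integral {\<tau> j..\<tau> (Suc j)} W"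
      if j: "j < m" for j
    proof -
      have c1: "continuous_on {\<tau> j..\<tau> (Suc j)} (\<lambda>s. h n s * w n s)" by (rule continuous_on_subset[OF hw sub[OF j]])
      have c2: "continuous_on {\<tau> j..\<tau> (Suc j)} (R n j)" by (rule R_cont) (use j in simp)
      have "integral {\<tau> j..\<tau> (Suc j)} (\<lambda>s. h n s * w n s) - integral {\<tau> j..\<tau> (Suc j)} (R n j)
          = integral {\<tau> j..\<tau> (Suc j)} (\<lambda>s. h n s * w n s - R n j s)"
        by (intro Henstock_Kurzweil_Integration.integral_diff[symmetric] integrable_continuous_real c1 c2)
      moreover have "norm (integral {\<tau> j..\<tau> (Suc j)} (\<lambda>s. h n s * w n s - R n j s)) \<le> integral {\<tau> j..\<tau> (Suc j)} (\<lambda>s. e * W s)"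
        by (rule integral_norm_bound_integral)
          (use pt[OF j] in \<open>auto intro!: integrable_continuous_real continuous_on_diff c1 c2 continuous_on_mult continuous_on_const W_cont\<close>)
      ultimately show ?thesis by simp
    qed
    have "\<bar>integral {0..t} (\<lambda>s. h n s * w n s) - A n\<bar>
        = \<bar>\<Sum>j<m. integral {\<tau> j..\<tau> (Suc j)} (\<lambda>s. h n s * w n s) - integral {\<tau> j..\<tau> (Suc j)} (R n j)\<bar>"
      unfolding A_def integral_partition[OF t(1) hw m(1), folded \<tau>_def] sum_subtractf ..
    also have "\<dots> \<le> (\<Sum>j<m. \<bar>integral {\<tau> j..\<tau> (Suc j)} (\<lambda>s. h n s * w n s) - integral {\<tau> j..\<tau> (Suc j)} (R n j)\<bar>)" by (rule sum_abs)
    also have "\<dots> \<le> (\<Sum>j<m. e * integral {\<tau> j..\<tau> (Suc j)} W)" by (intro sum_mono one) simp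
    also have "\<dots> = e * integral {0..t} W"
      unfolding sum_distrib_left[symmetric] integral_partition[OF t(1) W_cont m(1), folded \<tau>_def] ..
    also have "integral {0..t} W \<le> C2"
    proof -
      define P Q where "P = integral {0..t} (\<lambda>s. (g n s)\<^sup>2)" and "Q = integral {0..t} (\<lambda>s. (incr (E n) s)\<^sup>2)"
      have "W = (\<lambda>s. ((g n s)\<^sup>2 + 2 * (incr (E n) s)\<^sup>2 + C1 * E n) / (2 * E n))"
        unfolding W_def[abs_def] add_divide_distrib[symmetric] by (simp add: algebra_simps)
      then have "integral {0..t} W = integral {0..t} (\<lambda>s. (g n s)\<^sup>2 + 2 * (incr (E n) s)\<^sup>2 + C1 * E n) / (2 * E n)" by simp
      also have "integral {0..t} (\<lambda>s. (g n s)\<^sup>2 + 2 * (incr (E n) s)\<^sup>2 + C1 * E n)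
          = integral {0..t} (\<lambda>s. (g n s)\<^sup>2 + 2 * (incr (E n) s)\<^sup>2) + integral {0..t} (\<lambda>s. C1 * E n)"
        by (intro Henstock_Kurzweil_Integration.integral_add integrable_continuous_real continuous_intros g_cont)
      also have "integral {0..t} (\<lambda>s. (g n s)\<^sup>2 + 2 * (incr (E n) s)\<^sup>2) = P + integral {0..t} (\<lambda>s. 2 * (incr (E n) s)\<^sup>2)"
        unfolding P_def by (intro Henstock_Kurzweil_Integration.integral_add integrable_continuous_real continuous_intros g_cont)
      also have "integral {0..t} (\<lambda>s. 2 * (incr (E n) s)\<^sup>2) = 2 * Q" unfolding Q_def by simp
      also have "integral {0..t} (\<lambda>s. C1 * E n) = C1 * E n * t" using t by simp
      finally have eq: "integral {0..t} W = (P + 2 * Q + C1 * E n * t) / (2 * E n)" .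
      have "P \<le> C1 * E n" unfolding P_def using g_square_integral[of 0 t n 0] by simp
      moreover have "Q \<le> K * E n" unfolding Q_def by (rule incr_square)
      ultimately have "integral {0..t} W \<le> (C1 * E n + 2 * (K * E n) + C1 * E n * t) / (2 * E n)"
        unfolding eq using E_pos[of n] by (intro divide_right_mono) auto
      also have "\<dots> = C2" unfolding C2_def using E_pos[of n] by (simp add: field_simps)
      finally show ?thesis .
    qed
    finally show ?thesis using e by (simp add: mult_left_mono)
  qed
  obtain N1 where N1: "\<And>n. n \<ge> N1 \<Longrightarrow> \<bar>A n - (\<Sum>j<m. L (\<tau> j) * (t / real m) / 2)\<bar> < \<zeta> / 4"
    using LIMSEQ_D[OF A_lim, of "\<zeta> / 4"] \<zeta> by auto
  obtain N2 where N2: "\<And>n. n \<ge> N2 \<Longrightarrow> 12 * osn n < d"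
  proof -
    have "0 < d / 12" using d(1) by simp
    from order_tendstoD(2)[OF osn_lim this] show ?thesis
      using that by (force simp: eventually_sequentially)
  qed
  have "norm (integral {0..t} (\<lambda>s. h n s * w n s) - integral {0..t} L / 2) < \<zeta>" if "max N1 N2 \<le> n" for n
  proof -
    have "\<bar>integral {0..t} (\<lambda>s. h n s * w n s) - A n\<bar> \<le> \<zeta> / 4" using close[OF N2, of n] that e_le(1) by simp
    moreover have "\<bar>A n - (\<Sum>j<m. L (\<tau> j) * (t / real m) / 2)\<bar> < \<zeta> / 4" using N1 that by simp
    moreover have "\<bar>(\<Sum>j<m. L (\<tau> j) * (t / real m) / 2) - integral {0..t} L / 2\<bar> \<le> \<zeta> / 4" using L_sum e_le(2) \<zeta> by linarith
    ultimately show ?thesis unfolding real_norm_def using \<zeta> by linarith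
  qed
  then show "\<exists>no. \<forall>n\<ge>no. norm (integral {0..t} (\<lambda>s. (atom s (Yp n s) - atom s (Xp s)) * w n s) - integral {0..t} (\<lambda>s. chi_lambda (D2chi s (Xp s))) / 2) < \<zeta>"
    unfolding h_def L_def[abs_def] by blast
qed

lemma u_endpoint_lim:
  assumes "s \<in> {0..t}"
  shows "(\<lambda>n. u s (Yp n s)) \<longlonglongrightarrow> u s (Xp s)"
proof -
  have "(\<lambda>n. 12 * osn n) \<longlonglongrightarrow> 0" using tendsto_mult_right_zero[OF osn_lim, of 12] by simp
  then have "(\<lambda>n. Yp n s - Xp s) \<longlonglongrightarrow> 0"
    by (rule Lim_null_comparison[OF always_eventually, rotated]) (use Yp_diff in auto)
  then have l: "(\<lambda>n. Yp n s) \<longlonglongrightarrow> Xp s" by (simp add: LIM_zero_iff)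
  have c: "continuous_on (C_space T) (\<lambda>\<eta>. (\<lambda>(t, \<eta>). u t \<eta>) (s, \<eta>))"
    by (rule continuous_on_compose2[OF u_cont]) (use assms t in \<open>auto intro!: continuous_intros\<close>)
  from continuous_on_tendsto_compose[OF c l Xp_C] Yp_C show ?thesis by simp
qed

text \<open>The chain rule along the smoothed windows is solved for the integral at the true
  windows. In the limit the drift brings half the integral of \<open>\<lambda>\<close> with one sign
  and the correction term with the other; what is left involves only \<open>u\<close> and
  \<open>f\<close>.\<close>

theorem forward_sums_lim:
  "(\<lambda>n. integral {0..t} (\<lambda>s. atom s (path_of T x s) * (incr (E n) s / E n)))
    \<longlonglongrightarrow> u t (path_of T x t) - u 0 (path_of T x 0) + integral {0..t} (\<lambda>s. f s (path_of T x s))"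
proof -
  define h where "h n s = atom s (Yp n s) - atom s (Xp s)" for n s
  have cont: "continuous_on {0..t} (\<lambda>s. atom s (Xp s))" "continuous_on {0..t} (\<lambda>s. atom s (Yp n s))"
    "continuous_on {0..t} (\<lambda>s. drift s (Yp n s))" "continuous_on {0..t} (h n)" for n
    unfolding h_def[abs_def] by (intro continuous_intros along_cont atom_cont drift_cont)+
  have eq: "integral {0..t} (\<lambda>s. atom s (Xp s) * w n s) = u t (Yp n t) - u 0 (Yp n 0) - integral {0..t} (\<lambda>s. drift s (Yp n s))
      - integral {0..t} (\<lambda>s. atom s (Yp n s) * ramp (E n) s) - integral {0..t} (\<lambda>s. h n s * w n s)" for n
  proof -
    have "u t (Yp n t) - u 0 (Yp n 0) = integral {0..t} (\<lambda>s. drift s (Yp n s) + atom s (Yp n s) * speed (E n) s)"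
      unfolding Yp_def by (rule u_along_C1_path[OF smooth_deriv[OF E_pos] speed_cont speed_left[OF E_pos] t])
    \<comment> \<open>The speed is \<open>w n\<close> plus the ramp, and in the product with
      \<open>w n\<close> the atom at the smoothed window is replaced by the atom at the true one
      plus \<open>h n\<close>.\<close>
    also have "\<dots> = integral {0..t} (\<lambda>s. (drift s (Yp n s) + atom s (Yp n s) * ramp (E n) s) + (atom s (Xp s) * w n s + h n s * w n s))"
      by (rule integral_cong) (auto simp: speed_def w_def h_def max_absorb1 algebra_simps)
    also have "\<dots> = integral {0..t} (\<lambda>s. drift s (Yp n s) + atom s (Yp n s) * ramp (E n) s) + integral {0..t} (\<lambda>s. atom s (Xp s) * w n s + h n s * w n s)"
      by (intro Henstock_Kurzweil_Integration.integral_add integrable_continuous_real continuous_intros cont w_cont)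
    also have "integral {0..t} (\<lambda>s. drift s (Yp n s) + atom s (Yp n s) * ramp (E n) s) = integral {0..t} (\<lambda>s. drift s (Yp n s)) + integral {0..t} (\<lambda>s. atom s (Yp n s) * ramp (E n) s)"
      by (intro Henstock_Kurzweil_Integration.integral_add integrable_continuous_real continuous_intros cont)
    also have "integral {0..t} (\<lambda>s. atom s (Xp s) * w n s + h n s * w n s) = integral {0..t} (\<lambda>s. atom s (Xp s) * w n s) + integral {0..t} (\<lambda>s. h n s * w n s)"
      by (intro Henstock_Kurzweil_Integration.integral_add integrable_continuous_real continuous_intros cont w_cont)
    finally show ?thesis by simp
  qed
  have t_mem: "t \<in> {0..t}" "0 \<in> {0..t}" using t by auto
  have "(\<lambda>n. integral {0..t} (\<lambda>s. atom s (Xp s) * w n s)) \<longlonglongrightarrow> u t (Xp t) - u 0 (Xp 0) - integral {0..t} (\<lambda>s. drift s (Xp s))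
      - 0 - integral {0..t} (\<lambda>s. chi_lambda (D2chi s (Xp s))) / 2"
    unfolding eq unfolding h_def
    by (intro tendsto_diff u_endpoint_lim t_mem integral_along_lim drift_cont ramp_term_lim correction_term_lim)
  moreover have "integral {0..t} (\<lambda>s. drift s (Xp s)) = - integral {0..t} (\<lambda>s. f s (Xp s)) - integral {0..t} (\<lambda>s. chi_lambda (D2chi s (Xp s))) / 2"
  proof -
    have "integral {0..t} (\<lambda>s. drift s (Xp s)) = integral {0..t} (\<lambda>s. - f s (Xp s) - chi_lambda (D2chi s (Xp s)) / 2)"
      by (rule integral_cong) (use drift_eq Xp_C t in auto)
    also have "\<dots> = integral {0..t} (\<lambda>s. - f s (Xp s)) - integral {0..t} (\<lambda>s. chi_lambda (D2chi s (Xp s)) / 2)"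
      by (intro Henstock_Kurzweil_Integration.integral_diff integrable_continuous_real continuous_intros along_cont f_cont lambda_cont) auto
    finally show ?thesis by simp
  qed
  ultimately show ?thesis unfolding Xp_def w_def by (simp add: algebra_simps)
qed

end

section \<open>Measurability of functionals of continuous processes\<close>

lemma floor_scaled_bound:
  fixes a :: real
  shows "\<bar>of_int \<lfloor>real (Suc n) * a\<rfloor> / real (Suc n) - a\<bar> \<le> 1 / real (Suc n)"
proof -
  have p: "0 < real (Suc n)" by simp
  have "of_int \<lfloor>real (Suc n) * a\<rfloor> / real (Suc n) - a = (of_int \<lfloor>real (Suc n) * a\<rfloor> - real (Suc n) * a) / real (Suc n)"
    by (simp add: field_simps)
  moreover have "\<bar>of_int \<lfloor>real (Suc n) * a\<rfloor> - real (Suc n) * a\<bar> \<le> 1"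
    using of_int_floor_le[of "real (Suc n) * a"] floor_correct[of "real (Suc n) * a"] by linarith
  ultimately show ?thesis using p by (simp add: divide_right_mono)
qed

lemma floor_scaled_tendsto: "(\<lambda>n. of_int \<lfloor>real (Suc n) * a\<rfloor> / real (Suc n)) \<longlonglongrightarrow> (a::real)"
proof -
  have "(\<lambda>n. of_int \<lfloor>real (Suc n) * a\<rfloor> / real (Suc n) - a) \<longlonglongrightarrow> 0"
    by (rule Lim_null_comparison[OF always_eventually LIMSEQ_inverse_real_of_nat])
      (use floor_scaled_bound[of _ a] in \<open>auto simp: inverse_eq_divide\<close>)
  then show ?thesis by (simp only: LIM_zero_iff)
qed

text \<open>Rounding time to a grid leaves countably many time values, each giving a measurable map;
  continuity of the paths recovers the process as the grid is refined.\<close>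

lemma continuous_process_jointly_measurable:
  fixes f :: "real \<Rightarrow> 'w \<Rightarrow> real"
  assumes meas: "\<And>t. f t \<in> borel_measurable M"
    and cont: "\<And>\<omega>. \<omega> \<in> space M \<Longrightarrow> continuous_on UNIV (\<lambda>t. f t \<omega>)"
  shows "(\<lambda>z. f (fst z) (snd z)) \<in> borel_measurable (borel \<Otimes>\<^sub>M M)"
proof (rule borel_measurable_LIMSEQ_real)
  fix z :: "real \<times> 'w" assume "z \<in> space (borel \<Otimes>\<^sub>M M)"
  then have "snd z \<in> space M" by (auto simp: space_pair_measure)
  from continuous_on_tendsto_compose[OF cont[OF this] floor_scaled_tendsto]
  show "(\<lambda>n. f (of_int \<lfloor>real (Suc n) * fst z\<rfloor> / real (Suc n)) (snd z)) \<longlonglongrightarrow> f (fst z) (snd z)" by simp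
next
  fix n
  show "(\<lambda>z. f (of_int \<lfloor>real (Suc n) * fst z\<rfloor> / real (Suc n)) (snd z)) \<in> borel_measurable (borel \<Otimes>\<^sub>M M)"
  proof (rule measurable_compose_countable[where f="\<lambda>(i::int) z. f (of_int i / real (Suc n)) (snd z)"])
    show "(\<lambda>z. f (of_int i / real (Suc n)) (snd z)) \<in> borel_measurable (borel \<Otimes>\<^sub>M M)" for i :: int
      by (rule measurable_compose[OF measurable_snd meas])
    show "(\<lambda>z. \<lfloor>real (Suc n) * fst z\<rfloor>) \<in> measurable (borel \<Otimes>\<^sub>M M) (count_space UNIV)"
      by measurable
  qed
qed

lemma interval_integral_eq_integral_continuous:
  fixes f :: "real \<Rightarrow> real"
  assumes "0 \<le> t" "continuous_on {0..t} f"
  shows "(LBINT s=0..t. f s) = integral {0..t} f"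
  using interval_integral_Icc[OF assms(1), of f] set_borel_integral_eq_integral(2)[OF borel_integrable_atLeastAtMost'[OF assms(2)]]
  by (simp add: zero_ereal_def)

lemma measurable_time_integral:
  fixes g :: "real \<Rightarrow> 'w \<Rightarrow> real"
  assumes t: "0 \<le> t" and meas: "\<And>s. s \<in> {0..t} \<Longrightarrow> g s \<in> borel_measurable M"
    and cont: "\<And>\<omega>. \<omega> \<in> space M \<Longrightarrow> continuous_on {0..t} (\<lambda>s. g s \<omega>)"
  shows "(\<lambda>\<omega>. integral {0..t} (\<lambda>s. g s \<omega>)) \<in> borel_measurable M"
proof -
  \<comment> \<open>Clamping the time to \<open>[0,t]\<close> yields a process on the whole line, to
    which joint measurability applies.\<close>
  have cl: "max 0 (min t s) \<in> {0..t}" for s using t by auto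
  have [measurable]: "(\<lambda>z. g (max 0 (min t (fst z))) (snd z)) \<in> borel_measurable (borel \<Otimes>\<^sub>M M)"
  proof (rule continuous_process_jointly_measurable)
    show "g (max 0 (min t s)) \<in> borel_measurable M" for s by (rule meas[OF cl])
    show "continuous_on UNIV (\<lambda>s. g (max 0 (min t s)) \<omega>)" if "\<omega> \<in> space M" for \<omega>
      by (rule continuous_on_compose2[OF cont[OF that]]) (use cl in \<open>auto intro!: continuous_intros\<close>)
  qed
  have "(\<lambda>z. g (max 0 (min t (fst z))) (snd z)) \<circ> (\<lambda>p. (snd p, fst p)) \<in> borel_measurable (M \<Otimes>\<^sub>M borel)"
    by (rule measurable_comp[OF _ \<open>(\<lambda>z. g (max 0 (min t (fst z))) (snd z)) \<in> borel_measurable (borel \<Otimes>\<^sub>M M)\<close>]) measurable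
  then have [measurable]: "(\<lambda>p. g (max 0 (min t (snd p))) (fst p)) \<in> borel_measurable (M \<Otimes>\<^sub>M borel)"
    by (simp add: comp_def)
  have "(\<lambda>p. indicator {0..t} (snd p) * g (max 0 (min t (snd p))) (fst p)) \<in> borel_measurable (M \<Otimes>\<^sub>M borel)"
    by (intro borel_measurable_times \<open>(\<lambda>p. g (max 0 (min t (snd p))) (fst p)) \<in> borel_measurable (M \<Otimes>\<^sub>M borel)\<close>) measurable
  then have "(\<lambda>p. indicator {0..t} (snd p) * g (max 0 (min t (snd p))) (fst p)) \<in> borel_measurable (M \<Otimes>\<^sub>M lborel)"
    by (simp cong: measurable_cong_sets add: measurable_lborel1 sets_pair_measure_cong[OF refl sets_lborel])
  then have m: "(\<lambda>\<omega>. LINT s|lborel. indicator {0..t} s * g (max 0 (min t s)) \<omega>) \<in> borel_measurable M"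
    by (intro lborel.borel_measurable_lebesgue_integral) (simp add: case_prod_unfold)
  show ?thesis
  proof (rule measurable_cong[THEN iffD1, OF _ m])
    fix \<omega> assume \<omega>: "\<omega> \<in> space M"
    have "(LINT s|lborel. indicator {0..t} s * g (max 0 (min t s)) \<omega>) = (LINT s|lborel. indicator {0..t} s * g s \<omega>)"
      by (rule Bochner_Integration.integral_cong) (auto simp: indicator_def)
    also have "\<dots> = integral {0..t} (\<lambda>s. g s \<omega>)" by (rule LINT_indicator_eq_integral[OF cont[OF \<omega>]])
    finally show "(LINT s|lborel. indicator {0..t} s * g (max 0 (min t s)) \<omega>) = integral {0..t} (\<lambda>s. g s \<omega>)" .
  qed
qed

text \<open>Two paths with the same rounded values on a grid, both of which oscillate little between
  neighbouring grid points, are close; one representative of each class gives a dense sequence.\<close>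

lemma C_space_separable:
  assumes T: "0 < T"
  shows "\<exists>d :: nat \<Rightarrow> path. (\<forall>k. d k \<in> C_space T) \<and> (\<forall>\<eta>\<in>C_space T. \<forall>e>0. \<exists>k. norm (\<eta> - d k) \<le> e)"
proof -
  define node where "node N i = - T + T * real i / real (Suc N)" for N i
  define Q where "Q m N ks \<eta> \<longleftrightarrow> \<eta> \<in> C_space T \<and>
     (\<forall>r s. \<bar>r - s\<bar> \<le> T / real (Suc N) \<longrightarrow> \<bar>apply_bcontfun \<eta> r - apply_bcontfun \<eta> s\<bar> \<le> 1 / real (Suc m)) \<and>
     ks = map (\<lambda>i. \<lfloor>real (Suc m) * apply_bcontfun \<eta> (node N i)\<rfloor>) [0..<Suc (Suc N)]"
    for m N and ks :: "int list" and \<eta> :: path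
  define c where "c z = (case z of (m, N, ks) \<Rightarrow> if \<exists>\<eta>. Q m N ks \<eta> then SOME \<eta>. Q m N ks \<eta> else 0)" for z
  have z0: "(0::path) \<in> C_space T" by (simp add: C_space_def)
  have cQ: "Q m N ks (c (m, N, ks))" if "Q m N ks \<eta>" for m N ks \<eta>
    unfolding c_def using someI[of "Q m N ks", OF that] that by auto
  have cC: "c z \<in> C_space T" for z
  proof (cases z)
    case (fields m N ks)
    show ?thesis
    proof (cases "\<exists>\<eta>. Q m N ks \<eta>")
      case True
      then show ?thesis using cQ Q_def unfolding fields by blast
    next
      case False
      then have "c (m, N, ks) = 0" unfolding c_def prod.case by (rule if_not_P)
      then show ?thesis using z0 unfolding fields by simp
    qed
  qed
  show ?thesis
  proof (rule exI[of _ "\<lambda>k. c (from_nat k)"], intro conjI allI ballI impI)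
    show "c (from_nat k) \<in> C_space T" for k by (rule cC)
    fix \<eta> :: path and e :: real assume \<eta>: "\<eta> \<in> C_space T" and e: "0 < e"
    \<comment> \<open>Four errors occur at each point: the oscillation of either path up to the
      nearest grid point, and the rounding of either value there.\<close>
    obtain m where m: "1 / real (Suc m) < e / 4" using nat_approx_posE[of "e / 4"] e by auto
    have "uniformly_continuous_on {-T..0} (apply_bcontfun \<eta>)"
      by (rule compact_uniformly_continuous) (auto intro!: continuous_intros)
    then obtain \<delta> where \<delta>: "0 < \<delta>" "\<And>r s. r \<in> {-T..0} \<Longrightarrow> s \<in> {-T..0} \<Longrightarrow> \<bar>s - r\<bar> < \<delta> \<Longrightarrow>
        \<bar>apply_bcontfun \<eta> s - apply_bcontfun \<eta> r\<bar> < 1 / real (Suc m)"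
      unfolding uniformly_continuous_on_def dist_real_def by (metis of_nat_0_less_iff zero_less_Suc zero_less_divide_1_iff)
    obtain N where N: "1 / real (Suc N) < \<delta> / T" using nat_approx_posE[of "\<delta> / T"] \<delta>(1) T by auto
    have N': "T / real (Suc N) < \<delta>" using N T by (simp add: field_simps)
    have clampe: "apply_bcontfun \<gamma> r = apply_bcontfun \<gamma> (max (-T) (min 0 r))" if "\<gamma> \<in> C_space T" for \<gamma> r
      using that T unfolding C_space_def by (simp add: clamp_real_def)
    define ks where "ks = map (\<lambda>i. \<lfloor>real (Suc m) * apply_bcontfun \<eta> (node N i)\<rfloor>) [0..<Suc (Suc N)]"
    have Q: "Q m N ks \<eta>"
      unfolding Q_def
    proof (intro conjI allI impI)
      fix r s :: real assume rs: "\<bar>r - s\<bar> \<le> T / real (Suc N)"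
      show "\<bar>apply_bcontfun \<eta> r - apply_bcontfun \<eta> s\<bar> \<le> 1 / real (Suc m)"
        unfolding clampe[OF \<eta>, of r] clampe[OF \<eta>, of s]
        by (rule less_imp_le, rule \<delta>(2)) (use rs N' T in \<open>auto simp: max_def min_def abs_if split: if_splits\<close>)
    qed (use \<eta> ks_def in auto)
    define \<gamma> where "\<gamma> = c (m, N, ks)"
    have Q': "Q m N ks \<gamma>" unfolding \<gamma>_def by (rule cQ[OF Q])
    then have \<gamma>: "\<gamma> \<in> C_space T" by (simp add: Q_def)
    have fl: "\<lfloor>real (Suc m) * apply_bcontfun \<gamma> (node N i)\<rfloor> = \<lfloor>real (Suc m) * apply_bcontfun \<eta> (node N i)\<rfloor>" if "i \<le> Suc N" for i
    proof -
      have "map (\<lambda>i. \<lfloor>real (Suc m) * apply_bcontfun \<gamma> (node N i)\<rfloor>) [0..<Suc (Suc N)] = ks" using Q' unfolding Q_def by metis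
      then have "\<forall>i\<in>set [0..<Suc (Suc N)]. \<lfloor>real (Suc m) * apply_bcontfun \<gamma> (node N i)\<rfloor> = \<lfloor>real (Suc m) * apply_bcontfun \<eta> (node N i)\<rfloor>"
        unfolding ks_def by (simp only: map_eq_conv)
      moreover have "i \<in> set [0..<Suc (Suc N)]" using that by (auto simp: less_Suc_eq_le simp del: upt_Suc)
      ultimately show ?thesis by (rule bspec)
    qed
    have grid: "\<exists>i\<le>Suc N. \<bar>r - node N i\<bar> \<le> T / real (Suc N)" if r: "r \<in> {-T..0}" for r
    proof -
      define y where "y = (r + T) * real (Suc N) / T"
      have y: "0 \<le> y" "y \<le> real (Suc N)" unfolding y_def using r T
        by (auto simp del: of_nat_Suc simp: pos_le_divide_eq pos_divide_le_eq mult_left_mono mult.commute)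
      have ry: "r = - T + T * y / real (Suc N)" unfolding y_def using T by (simp del: of_nat_Suc)
      have "\<bar>y - real (nat \<lfloor>y\<rfloor>)\<bar> \<le> 1" using y(1) floor_correct[of y] by linarith
      moreover have "r - node N (nat \<lfloor>y\<rfloor>) = T / real (Suc N) * (y - real (nat \<lfloor>y\<rfloor>))"
        unfolding node_def ry by (simp add: right_diff_distrib del: of_nat_Suc)
      ultimately have "\<bar>r - node N (nat \<lfloor>y\<rfloor>)\<bar> \<le> T / real (Suc N)"
        using mult_left_mono[of "\<bar>y - real (nat \<lfloor>y\<rfloor>)\<bar>" 1 "T / real (Suc N)"] T by (simp add: abs_mult)
      moreover have "nat \<lfloor>y\<rfloor> \<le> Suc N" using y(2) by linarith
      ultimately show ?thesis by blast
    qed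
    have pt: "\<bar>apply_bcontfun \<eta> r - apply_bcontfun \<gamma> r\<bar> \<le> e" if r: "r \<in> {-T..0}" for r
    proof -
      obtain i where i: "i \<le> Suc N" "\<bar>r - node N i\<bar> \<le> T / real (Suc N)" using grid[OF r] by blast
      have "\<bar>apply_bcontfun \<eta> r - apply_bcontfun \<eta> (node N i)\<bar> \<le> 1 / real (Suc m)"
        "\<bar>apply_bcontfun \<gamma> r - apply_bcontfun \<gamma> (node N i)\<bar> \<le> 1 / real (Suc m)"
        using Q Q' i(2) unfolding Q_def by auto
      moreover have "\<bar>of_int \<lfloor>real (Suc m) * apply_bcontfun \<eta> (node N i)\<rfloor> / real (Suc m) - apply_bcontfun \<eta> (node N i)\<bar> \<le> 1 / real (Suc m)"
        by (rule floor_scaled_bound)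
      moreover have "\<bar>of_int \<lfloor>real (Suc m) * apply_bcontfun \<eta> (node N i)\<rfloor> / real (Suc m) - apply_bcontfun \<gamma> (node N i)\<bar> \<le> 1 / real (Suc m)"
        unfolding fl[OF i(1), symmetric] by (rule floor_scaled_bound)
      ultimately show ?thesis using m by linarith
    qed
    have "norm (\<eta> - \<gamma>) \<le> e"
    proof (rule norm_bound)
      fix r
      show "norm (apply_bcontfun (\<eta> - \<gamma>) r) \<le> e"
        unfolding minus_bcontfun.rep_eq real_norm_def clampe[OF \<eta>, of r] clampe[OF \<gamma>, of r]
        by (rule pt) (use T in auto)
    qed
    then show "\<exists>k. norm (\<eta> - c (from_nat k)) \<le> e"
      unfolding \<gamma>_def by (metis from_nat_to_nat)
  qed
qed

text \<open>Membership in a closed ball becomes countably many conditions on coordinates, and is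
  therefore measurable if the coordinates are.\<close>

lemma norm_path_le_iff_rational:
  "norm (\<eta>::path) \<le> e \<longleftrightarrow> (\<forall>(i::int) n. \<bar>apply_bcontfun \<eta> (of_int i / real (Suc n))\<bar> \<le> e)"
proof
  assume q: "\<forall>(i::int) n. \<bar>apply_bcontfun \<eta> (of_int i / real (Suc n))\<bar> \<le> e"
  show "norm \<eta> \<le> e"
  proof (rule norm_bound)
    fix r
    have "(\<lambda>n. apply_bcontfun \<eta> (of_int \<lfloor>real (Suc n) * r\<rfloor> / real (Suc n))) \<longlonglongrightarrow> apply_bcontfun \<eta> r"
      by (rule continuous_on_tendsto_compose[OF continuous_on_apply_bcontfun[of UNIV] floor_scaled_tendsto]) auto
    from tendsto_norm[OF this] show "norm (apply_bcontfun \<eta> r) \<le> e"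
      by (rule LIMSEQ_le_const2) (use q in auto)
  qed
next
  assume "norm \<eta> \<le> e"
  then show "\<forall>(i::int) n. \<bar>apply_bcontfun \<eta> (of_int i / real (Suc n))\<bar> \<le> e" using abs_apply_bcontfun_le order_trans by blast
qed

text \<open>The path space is separable, so a path-valued map with measurable coordinates is a limit of
  measurable maps with countably many values.\<close>

lemma measurable_continuous_functional:
  fixes W :: "'w \<Rightarrow> path"
  assumes T: "0 < T" and W: "\<And>\<omega>. \<omega> \<in> space M \<Longrightarrow> W \<omega> \<in> C_space T"
    and coord: "\<And>r. (\<lambda>\<omega>. apply_bcontfun (W \<omega>) r) \<in> borel_measurable M"
    and g: "continuous_on (C_space T) (g :: path \<Rightarrow> real)"
  shows "(\<lambda>\<omega>. g (W \<omega>)) \<in> borel_measurable M"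
proof -
  define dense where "dense d \<longleftrightarrow> (\<forall>k. d k \<in> C_space T) \<and> (\<forall>\<eta>\<in>C_space T. \<forall>e>0. \<exists>k. norm (\<eta> - d k) \<le> e)"
    for d :: "nat \<Rightarrow> path"
  obtain d where "dense d" using C_space_separable[OF T, folded dense_def] by blast
  then have d: "\<And>k. d k \<in> C_space T" "\<And>\<eta> e. \<eta> \<in> C_space T \<Longrightarrow> 0 < e \<Longrightarrow> \<exists>k. norm (\<eta> - d k) \<le> e"
    unfolding dense_def by auto
  define k where "k m \<omega> = (LEAST k. norm (W \<omega> - d k) \<le> 1 / real (Suc m))" for m \<omega>
  have near: "norm (W \<omega> - d (k m \<omega>)) \<le> 1 / real (Suc m)" if "\<omega> \<in> space M" for \<omega> m
    unfolding k_def by (rule LeastI_ex, rule d(2)[OF W[OF that]]) simp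
  show ?thesis
  proof (rule borel_measurable_LIMSEQ_real)
    fix \<omega> assume \<omega>: "\<omega> \<in> space M"
    have "(\<lambda>m. d (k m \<omega>) - W \<omega>) \<longlonglongrightarrow> 0"
      by (rule Lim_null_comparison[OF always_eventually LIMSEQ_inverse_real_of_nat])
        (use near[OF \<omega>] in \<open>auto simp: inverse_eq_divide norm_minus_commute\<close>)
    then have "(\<lambda>m. d (k m \<omega>)) \<longlonglongrightarrow> W \<omega>" by (simp only: LIM_zero_iff)
    from continuous_on_tendsto_compose[OF g this W[OF \<omega>]] d(1)
    show "(\<lambda>m. g (d (k m \<omega>))) \<longlonglongrightarrow> g (W \<omega>)" by simp
  next
    fix m
    show "(\<lambda>\<omega>. g (d (k m \<omega>))) \<in> borel_measurable M"
    proof (rule measurable_compose_countable[where f="\<lambda>k \<omega>. g (d k)"])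
      note coord[measurable]
      show "k m \<in> measurable M (count_space UNIV)"
        unfolding k_def norm_path_le_iff_rational minus_bcontfun.rep_eq by measurable
    qed simp
  qed
qed

section \<open>Convergence in probability and subsequences\<close>

lemma tendsto_in_probability_cong:
  assumes "\<And>i \<omega>. \<omega> \<in> space M \<Longrightarrow> Z i \<omega> = Z' i \<omega>"
  shows "tendsto_in_probability M Z Z0 F \<longleftrightarrow> tendsto_in_probability M Z' Z0 F"
proof -
  have "Z i \<in> borel_measurable M \<longleftrightarrow> Z' i \<in> borel_measurable M" for i
    by (rule measurable_cong) (rule assms)
  moreover have "{\<omega> \<in> space M. \<delta> < \<bar>Z i \<omega> - Z0 \<omega>\<bar>} = {\<omega> \<in> space M. \<delta> < \<bar>Z' i \<omega> - Z0 \<omega>\<bar>}" for i \<delta>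
    using assms by auto
  ultimately show ?thesis unfolding tendsto_in_probability_def by simp
qed

context prob_space
begin

lemma integrable_unit_range:
  assumes "f \<in> borel_measurable M" "\<And>\<omega>. 0 \<le> f \<omega>" "\<And>\<omega>. f \<omega> \<le> (1::real)"
  shows "integrable M f"
  by (rule integrable_const_bound[of _ 1]) (use assms in auto)

text \<open>The truncated means turn convergence in probability into convergence of integrals, which
  can be averaged over shifts by Fubini and summed with weights over countably many
  conditions.\<close>

lemma tendsto_in_probability_truncated:
  assumes "tendsto_in_probability M Z Z0 F"
  shows "((\<lambda>i. \<integral>\<omega>. min 1 \<bar>Z i \<omega> - Z0 \<omega>\<bar> \<partial>M) \<longlongrightarrow> 0) F"
proof (rule tendstoI)
  fix e :: real assume e: "0 < e"
  have m0[measurable]: "Z0 \<in> borel_measurable M" using assms unfolding tendsto_in_probability_def by simp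
  have "\<forall>\<^sub>F i in F. Z i \<in> borel_measurable M" using assms unfolding tendsto_in_probability_def by simp
  moreover have "\<forall>\<^sub>F i in F. measure M {\<omega> \<in> space M. e / 2 < \<bar>Z i \<omega> - Z0 \<omega>\<bar>} < e / 2"
  proof (rule order_tendstoD(2))
    have "\<forall>\<delta>>0. ((\<lambda>i. measure M {\<omega> \<in> space M. \<delta> < \<bar>Z i \<omega> - Z0 \<omega>\<bar>}) \<longlongrightarrow> 0) F"
      using assms unfolding tendsto_in_probability_def by simp
    moreover have e2: "0 < e / 2" using e by simp
    ultimately show "((\<lambda>i. measure M {\<omega> \<in> space M. e / 2 < \<bar>Z i \<omega> - Z0 \<omega>\<bar>}) \<longlongrightarrow> 0) F" by blast
    show "0 < e / 2" by (rule e2)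
  qed
  ultimately show "\<forall>\<^sub>F i in F. dist (\<integral>\<omega>. min 1 \<bar>Z i \<omega> - Z0 \<omega>\<bar> \<partial>M) 0 < e"
  proof eventually_elim
    case (elim i)
    note elim(1)[measurable]
    define A where "A = {\<omega> \<in> space M. e / 2 < \<bar>Z i \<omega> - Z0 \<omega>\<bar>}"
    have A[measurable]: "A \<in> sets M" unfolding A_def by measurable
    have "(\<integral>\<omega>. min 1 \<bar>Z i \<omega> - Z0 \<omega>\<bar> \<partial>M) \<le> (\<integral>\<omega>. e / 2 + indicator A \<omega> \<partial>M)"
    proof (rule integral_mono)
      show "integrable M (\<lambda>\<omega>. min 1 \<bar>Z i \<omega> - Z0 \<omega>\<bar>)" by (rule integrable_unit_range) auto
      show "integrable M (\<lambda>\<omega>. e / 2 + indicat_real A \<omega>)"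
        by (intro Bochner_Integration.integrable_add integrable_const integrable_real_indicator)
          (auto simp: emeasure_eq_measure)
      show "min 1 \<bar>Z i \<omega> - Z0 \<omega>\<bar> \<le> e / 2 + indicat_real A \<omega>" if "\<omega> \<in> space M" for \<omega>
        using e that unfolding A_def by (auto simp: indicator_def min_def)
    qed
    also have "\<dots> = (\<integral>\<omega>. e / 2 \<partial>M) + (\<integral>\<omega>. indicator A \<omega> \<partial>M)"
      by (rule Bochner_Integration.integral_add) (auto simp: emeasure_eq_measure intro!: integrable_real_indicator)
    also have "\<dots> = e / 2 + measure M A" using A by (simp add: prob_space sets.Int_space_eq2)
    also have "\<dots> < e" using elim(2) unfolding A_def by simp
    finally have "(\<integral>\<omega>. min 1 \<bar>Z i \<omega> - Z0 \<omega>\<bar> \<partial>M) < e" .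
    moreover have "0 \<le> (\<integral>\<omega>. min 1 \<bar>Z i \<omega> - Z0 \<omega>\<bar> \<partial>M)" by (rule Bochner_Integration.integral_nonneg) simp
    ultimately show ?case by simp
  qed
qed

text \<open>A weighted sum reduces countably many sequences to a single one, so no diagonal argument is
  needed.\<close>

lemma AE_common_subsequence:
  fixes V :: "nat \<Rightarrow> nat \<Rightarrow> 'a \<Rightarrow> real"
  assumes meas: "\<And>k n. V k n \<in> borel_measurable M"
    and range: "\<And>k n \<omega>. 0 \<le> V k n \<omega>" "\<And>k n \<omega>. V k n \<omega> \<le> 1"
    and lim: "\<And>k. (\<lambda>n. \<integral>\<omega>. V k n \<omega> \<partial>M) \<longlonglongrightarrow> 0"
  shows "\<exists>r. strict_mono r \<and> (AE \<omega> in M. \<forall>k. (\<lambda>n. V k (r n) \<omega>) \<longlonglongrightarrow> 0)"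
proof -
  define S where "S n \<omega> = (\<Sum>k. (1 / 2) ^ k * V k n \<omega>)" for n \<omega>
  have geo: "summable (\<lambda>k. (1 / 2 :: real) ^ k)" by (rule summable_geometric) simp
  have le: "(1 / 2) ^ k * V k n \<omega> \<le> (1 / 2) ^ k" for k n \<omega>
    using mult_left_mono[OF range(2), of "(1 / 2) ^ k"] by simp
  have sm: "summable (\<lambda>k. (1 / 2) ^ k * V k n \<omega>)" for n \<omega>
    by (rule summable_comparison_test[OF _ geo]) (use le range in \<open>auto simp: abs_mult\<close>)
  have int: "integrable M (\<lambda>\<omega>. (1 / 2) ^ k * V k n \<omega>)" for k n
    by (intro integrable_mult_right integrable_unit_range meas range)
  have V_int: "0 \<le> (\<integral>\<omega>. V k n \<omega> \<partial>M)" "(\<integral>\<omega>. V k n \<omega> \<partial>M) \<le> 1" for k n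
  proof -
    show "0 \<le> (\<integral>\<omega>. V k n \<omega> \<partial>M)" by (rule Bochner_Integration.integral_nonneg) (rule range)
    have "(\<integral>\<omega>. V k n \<omega> \<partial>M) \<le> (\<integral>\<omega>. 1 \<partial>M)"
      by (rule integral_mono) (auto intro: integrable_unit_range meas range)
    then show "(\<integral>\<omega>. V k n \<omega> \<partial>M) \<le> 1" by (simp add: prob_space)
  qed
  have abs_int: "(\<integral>\<omega>. norm ((1 / 2) ^ k * V k n \<omega>) \<partial>M) = (1 / 2) ^ k * (\<integral>\<omega>. V k n \<omega> \<partial>M)" for k n
    using range by (simp add: abs_mult)
  have le': "(1 / 2) ^ k * (\<integral>\<omega>. V k n \<omega> \<partial>M) \<le> (1 / 2) ^ k" for k n
    using mult_left_mono[OF V_int(2), of "(1 / 2) ^ k"] by simp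
  have sm': "summable (\<lambda>k. \<integral>\<omega>. norm ((1 / 2) ^ k * V k n \<omega>) \<partial>M)" for n
    unfolding abs_int by (rule summable_comparison_test[OF _ geo]) (use le' V_int(1) in \<open>auto simp: abs_mult\<close>)
  have sn: "AE \<omega> in M. summable (\<lambda>k. norm ((1 / 2) ^ k * V k n \<omega>))" for n
    using sm[of n] range by (simp add: abs_mult)
  have S_int: "integrable M (S n)" for n
    unfolding S_def[abs_def] by (rule integrable_suminf[OF int sn sm'])
  have "(\<lambda>n. \<Sum>k. (1 / 2) ^ k * (\<integral>\<omega>. V k n \<omega> \<partial>M)) \<longlonglongrightarrow> (\<Sum>k. 0)"
  proof -
    have ev: "\<forall>\<^sub>F (k, n) in at_top \<times>\<^sub>F sequentially. norm ((1 / 2) ^ k * (\<integral>\<omega>. V k n \<omega> \<partial>M)) \<le> (1 / 2 :: real) ^ k"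
      using le' V_int(1) by (intro always_eventually) (auto simp: abs_mult)
    have l: "(\<lambda>n. (1 / 2) ^ k * (\<integral>\<omega>. V k n \<omega> \<partial>M)) \<longlonglongrightarrow> 0" for k by (rule tendsto_mult_right_zero[OF lim])
    from tannerys_theorem[OF l ev geo] show ?thesis by simp
  qed
  moreover have "(\<integral>\<omega>. norm (S n \<omega>) \<partial>M) = (\<Sum>k. (1 / 2) ^ k * (\<integral>\<omega>. V k n \<omega> \<partial>M))" for n
  proof -
    have "0 \<le> S n \<omega>" for \<omega> unfolding S_def by (rule suminf_nonneg[OF sm]) (use range in simp)
    then have "(\<integral>\<omega>. norm (S n \<omega>) \<partial>M) = (\<integral>\<omega>. S n \<omega> \<partial>M)" by simp
    also have "\<dots> = (\<Sum>k. \<integral>\<omega>. (1 / 2) ^ k * V k n \<omega> \<partial>M)"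
      unfolding S_def by (rule integral_suminf[OF int sn sm'])
    finally show ?thesis by simp
  qed
  ultimately have "(\<lambda>n. \<integral>\<omega>. norm (S n \<omega>) \<partial>M) \<longlonglongrightarrow> 0" by simp
  from tendsto_L1_AE_subseq[OF S_int this]
  obtain r where r: "strict_mono r" "AE \<omega> in M. (\<lambda>n. S (r n) \<omega>) \<longlonglongrightarrow> 0" by blast
  have "AE \<omega> in M. \<forall>k. (\<lambda>n. V k (r n) \<omega>) \<longlonglongrightarrow> 0"
    using r(2)
  proof eventually_elim
    case (elim \<omega>)
    show ?case
    proof
      fix k
      have "norm (V k (r n) \<omega>) \<le> 2 ^ k * S (r n) \<omega>" for n
      proof -
        have "(1 / 2) ^ k * V k (r n) \<omega> \<le> S (r n) \<omega>"
          unfolding S_def using sum_le_suminf[OF sm, of "{k}" "r n" \<omega>] range by simp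
        from mult_left_mono[OF this, of "2 ^ k"] show ?thesis
          using range by (simp add: power_one_over)
      qed
      then show "(\<lambda>n. V k (r n) \<omega>) \<longlonglongrightarrow> 0"
        by (intro Lim_null_comparison[OF always_eventually tendsto_mult_right_zero[OF elim]]) blast
    qed
  qed
  then show ?thesis using r(1) by blast
qed

lemma measure_tendsto_of_AE:
  assumes meas: "\<And>n. Z n \<in> borel_measurable M" "Z0 \<in> borel_measurable M"
    and lim: "AE \<omega> in M. (\<lambda>n. Z n \<omega>) \<longlonglongrightarrow> (Z0 \<omega> :: real)" and \<delta>: "0 < \<delta>"
  shows "(\<lambda>n. measure M {\<omega> \<in> space M. \<delta> < \<bar>Z n \<omega> - Z0 \<omega>\<bar>}) \<longlonglongrightarrow> 0"
proof -
  note meas[measurable]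
  define A where "A n = {\<omega> \<in> space M. \<delta> < \<bar>Z n \<omega> - Z0 \<omega>\<bar>}" for n
  have A[measurable]: "A n \<in> sets M" for n unfolding A_def by measurable
  have "(\<lambda>n. \<integral>\<omega>. indicat_real (A n) \<omega> \<partial>M) \<longlonglongrightarrow> (\<integral>\<omega>. 0 \<partial>M)"
  proof (rule integral_dominated_convergence[where w="\<lambda>_. 1"])
    show "AE \<omega> in M. (\<lambda>n. indicat_real (A n) \<omega>) \<longlonglongrightarrow> 0"
      using lim
    proof eventually_elim
      case (elim \<omega>)
      from LIMSEQ_D[OF elim \<delta>] have "\<forall>\<^sub>F n in sequentially. \<bar>Z n \<omega> - Z0 \<omega>\<bar> < \<delta>"
        unfolding eventually_sequentially real_norm_def .
      then have "\<forall>\<^sub>F n in sequentially. indicat_real (A n) \<omega> = 0"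
        by eventually_elim (auto simp: A_def)
      then show ?case by (rule tendsto_eventually)
    qed
  qed auto
  then show ?thesis unfolding A_def[symmetric] by (simp add: sets.Int_space_eq2)
qed

text \<open>If some deviation probability did not tend to 0, it would stay above a positive level
  along a sequence of steps; an almost surely convergent subsequence of that sequence contradicts
  this.\<close>

lemma tendsto_in_probability_at_rightI:
  fixes Z :: "real \<Rightarrow> 'a \<Rightarrow> real"
  assumes meas: "\<And>\<epsilon>. 0 < \<epsilon> \<Longrightarrow> Z \<epsilon> \<in> borel_measurable M" "Z0 \<in> borel_measurable M"
    and sub: "\<And>E. (\<And>n. 0 < E n) \<Longrightarrow> E \<longlonglongrightarrow> 0 \<Longrightarrow>
      \<exists>r. strict_mono r \<and> (AE \<omega> in M. (\<lambda>n. Z (E (r n)) \<omega>) \<longlonglongrightarrow> Z0 \<omega>)"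
  shows "tendsto_in_probability M Z Z0 (at_right 0)"
  unfolding tendsto_in_probability_def
proof (intro conjI allI impI)
  show "\<forall>\<^sub>F \<epsilon> in at_right 0. Z \<epsilon> \<in> borel_measurable M"
    using eventually_at_right_less by eventually_elim (rule meas(1))
  fix \<delta> :: real assume \<delta>: "0 < \<delta>"
  define P where "P \<epsilon> = measure M {\<omega> \<in> space M. \<delta> < \<bar>Z \<epsilon> \<omega> - Z0 \<omega>\<bar>}" for \<epsilon>
  have "\<forall>\<^sub>F \<epsilon> in at_right 0. P \<epsilon> < e" if e: "0 < e" for e
  proof (rule sequentially_imp_eventually_at_right[of 0 1])
    fix E :: "nat \<Rightarrow> real" assume E: "\<And>n. 0 < E n" "E \<longlonglongrightarrow> 0"
    show "\<forall>\<^sub>F n in sequentially. P (E n) < e"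
    proof (rule ccontr)
      assume "\<not> (\<forall>\<^sub>F n in sequentially. P (E n) < e)"
      then have "infinite {n. \<not> P (E n) < e}"
        by (simp add: eventually_cofinite flip: cofinite_eq_sequentially)
      from infinite_enumerate[OF this]
      obtain s :: "nat \<Rightarrow> nat" where s: "strict_mono s" "\<forall>n. s n \<in> {n. \<not> P (E n) < e}" by blast
      have "(\<lambda>n. E (s n)) \<longlonglongrightarrow> 0" using LIMSEQ_subseq_LIMSEQ[OF E(2) s(1)] by (simp add: comp_def)
      from sub[of "\<lambda>n. E (s n)", OF E(1) this]
      obtain r where r: "AE \<omega> in M. (\<lambda>n. Z (E (s (r n))) \<omega>) \<longlonglongrightarrow> Z0 \<omega>" by blast
      have "(\<lambda>n. P (E (s (r n)))) \<longlonglongrightarrow> 0"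
        unfolding P_def by (rule measure_tendsto_of_AE[OF meas(1) meas(2) r \<delta>]) (rule E(1))
      from order_tendstoD(2)[OF this e] have "\<exists>n. P (E (s (r n))) < e"
        by (auto simp: eventually_sequentially)
      then show False using s(2) by blast
    qed
  qed simp
  moreover have "0 \<le> P \<epsilon>" for \<epsilon> unfolding P_def by simp
  ultimately have "(P \<longlongrightarrow> 0) (at_right 0)"
    by (auto intro: tendstoI)
  then show "((\<lambda>\<epsilon>. measure M {\<omega> \<in> space M. \<delta> < \<bar>Z \<epsilon> \<omega> - Z0 \<omega>\<bar>}) \<longlongrightarrow> 0) (at_right 0)"
    unfolding P_def .
qed (rule meas(2))

end

section \<open>Processes with quadratic variation \<open>[X]\<^sub>t = t\<close>\<close>

text \<open>By Markov's inequality the shifts whose ratio is off by at least 1 form a set of measure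
  below 1/4. All others have energy at most \<open>(T + 2) * \<epsilon>\<close>:
  \<open>T + 1\<close> from the ratio and 1 from the part before time 0. \<open>energy_le\<close>
  extends this to every shift at the price of a factor 4.\<close>

lemma (in driving_path) energy_bound_of_mean:
  assumes \<epsilon>: "0 < \<epsilon>" "osc \<epsilon> \<le> 1" and p: "p \<in> {0..1}"
    and meas: "(\<lambda>p. integral {0..T} (\<lambda>s. (incr (\<epsilon> * p) s)\<^sup>2) / (\<epsilon> * p)) \<in> borel_measurable borel"
    and mean: "(LINT p|lborel. indicator {0..1} p * min 1 \<bar>integral {0..T} (\<lambda>s. (incr (\<epsilon> * p) s)\<^sup>2) / (\<epsilon> * p) - T\<bar>) < 1 / 4"
  shows "energy (\<epsilon> * p) \<le> 4 * (T + 2) * \<epsilon>"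
proof -
  define q where "q r = integral {0..T} (\<lambda>s. (incr r s)\<^sup>2)" for r
  define \<rho> where "\<rho> p = min 1 \<bar>q (\<epsilon> * p) / (\<epsilon> * p) - T\<bar>" for p
  have \<rho>m[measurable]: "\<rho> \<in> borel_measurable borel"
    unfolding \<rho>_def[abs_def] q_def using meas by measurable
  define B where "B = {p \<in> {0..1}. 1 \<le> \<rho> p}"
  have Bm[measurable]: "B \<in> sets borel"
  proof -
    have "B = {0..1} \<inter> {p \<in> space borel. 1 \<le> \<rho> p}" unfolding B_def by auto
    also have "\<dots> \<in> sets borel" by measurable
    finally show ?thesis .
  qed
  have B1: "B \<subseteq> {0..1}" unfolding B_def by blast
  have ind: "integrable lborel (indicat_real {0..1::real})" by (rule integrable_real_indicator) auto
  have "measure lborel B = (LINT p|lborel. indicator B p)" by simp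
  also have "\<dots> \<le> (LINT p|lborel. indicator {0..1} p * \<rho> p)"
  proof (rule integral_mono)
    show "integrable lborel (indicat_real B)"
      by (rule Bochner_Integration.integrable_bound[OF ind _ AE_I2]) (use B1 Bm in \<open>auto simp: indicator_def\<close>)
    show "integrable lborel (\<lambda>p. indicator {0..1} p * \<rho> p)"
    proof (rule Bochner_Integration.integrable_bound[OF ind _ AE_I2])
      show "(\<lambda>p. indicator {0..1} p * \<rho> p) \<in> borel_measurable lborel" by measurable
    qed (auto simp: indicator_def \<rho>_def)
    show "indicat_real B p \<le> indicator {0..1} p * \<rho> p" for p
      unfolding B_def by (auto simp: indicator_def \<rho>_def)
  qed
  also have "\<dots> < 1 / 4" using mean unfolding \<rho>_def q_def .
  finally have B4: "measure lborel B < 1 / 4" .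
  \<comment> \<open>The energy also counts starting times in \<open>[-r,0]\<close>, which
    \<open>q\<close> omits; there the increments are at most 1 because
    \<open>osc \<epsilon> \<le> 1\<close>.\<close>
  have en: "energy r \<le> \<epsilon> + q r" if r: "0 \<le> r" "r \<le> \<epsilon>" for r
  proof -
    have xc: "continuous_on S (\<lambda>s. (x (s + r) - x s)\<^sup>2)" for S
      by (rule continuous_on_power) (rule incr_cont[of S r, unfolded incr_def[abs_def]])
    have ir: "integrable lborel (indicat_real {-r..0::real})"
      by (rule integrable_real_indicator) (use r in simp_all)
    have "energy r \<le> (LINT s|lborel. indicator {-r..0} s * 1 + indicator {0..T} s * (x (s + r) - x s)\<^sup>2)"
      unfolding energy_def
    proof (rule integral_mono)
      show "integrable lborel (\<lambda>s. (x (s + r) - x s)\<^sup>2)" using integrable_increment[of r 0] by simp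
      have "integrable lborel (\<lambda>s. indicator {0..T} s *\<^sub>R (x (s + r) - x s)\<^sup>2)"
        by (rule borel_integrable_compact[OF compact_Icc xc])
      moreover have "integrable lborel (\<lambda>s. indicator {-r..0} s * (1::real))"
        by (intro integrable_mult_left ir)
      ultimately show "integrable lborel (\<lambda>s. indicator {-r..0} s * 1 + indicator {0..T} s * (x (s + r) - x s)\<^sup>2)"
        by (intro Bochner_Integration.integrable_add) auto
      fix s
      consider "s < - r" | "- r \<le> s" "s \<le> 0" | "0 < s" "s \<le> T" | "T < s" by linarith
      then show "(x (s + r) - x s)\<^sup>2 \<le> indicator {-r..0} s * 1 + indicator {0..T} s * (x (s + r) - x s)\<^sup>2"
      proof cases
        case 1
        then show ?thesis using x_left[of s] x_left[of "s + r"] r by simp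
      next
        case 2
        have "\<bar>x (s + r) - x s\<bar> \<le> osc \<epsilon>" by (rule osc_bound) (use r in simp)
        then have "(x (s + r) - x s)\<^sup>2 \<le> 1\<^sup>2" using \<epsilon>(2) by (intro power2_le_iff_abs_le[THEN iffD2]) auto
        then have "(x (s + r) - x s)\<^sup>2 \<le> 1" by simp
        moreover have "0 \<le> indicator {0..T} s * (x (s + r) - x s)\<^sup>2" by simp
        ultimately show ?thesis using 2 by (simp add: indicator_def)
      next
        case 3
        then show ?thesis by (simp add: indicator_def)
      next
        case 4
        then show ?thesis using x_right[of s] x_right[of "s + r"] r by simp
      qed
    qed
    also have "\<dots> = (LINT s|lborel. indicator {-r..0} s * (1::real)) + (LINT s|lborel. indicator {0..T} s * (x (s + r) - x s)\<^sup>2)"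
    proof (rule Bochner_Integration.integral_add)
      show "integrable lborel (\<lambda>s. indicator {-r..0} s * (1::real))"
        by (intro integrable_mult_left ir)
      have "integrable lborel (\<lambda>s. indicator {0..T} s *\<^sub>R (x (s + r) - x s)\<^sup>2)"
        by (rule borel_integrable_compact[OF compact_Icc xc])
      then show "integrable lborel (\<lambda>s. indicator {0..T} s * (x (s + r) - x s)\<^sup>2)" by simp
    qed
    also have "(LINT s|lborel. indicator {-r..0} s * (1::real)) = r" using r by simp
    also have "(LINT s|lborel. indicator {0..T} s * (x (s + r) - x s)\<^sup>2) = q r"
      unfolding q_def incr_def by (rule LINT_indicator_eq_integral[OF xc])
    finally show ?thesis using r by simp
  qed
  have "energy (\<epsilon> * p) \<le> 4 * ((T + 2) * \<epsilon>)"
  proof (rule energy_le[OF Bm B4 B1 _ less_imp_le[OF \<epsilon>(1)] p])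
    fix r :: real assume r: "r \<in> {0..1}" "r \<notin> B"
    have er: "0 \<le> \<epsilon> * r" "\<epsilon> * r \<le> \<epsilon>" using r(1) \<epsilon>(1) by (auto simp: mult_left_le)
    have "q (\<epsilon> * r) \<le> (T + 1) * \<epsilon>"
    \<comment> \<open>At \<open>r = 0\<close> the quotient in \<open>\<rho>\<close> is 0 by the
      convention for division and gives no information, but \<open>q\<close> itself
      vanishes.\<close>
    proof (cases "r = 0")
      case True
      then show ?thesis using \<epsilon>(1) T by (simp add: q_def incr_def)
    next
      case False
      then have pos: "0 < \<epsilon> * r" using r(1) \<epsilon>(1) by auto
      have "\<rho> r < 1" using r unfolding B_def by auto
      then have "q (\<epsilon> * r) / (\<epsilon> * r) \<le> T + 1" unfolding \<rho>_def by (simp add: min_def abs_if split: if_splits)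
      then have "q (\<epsilon> * r) \<le> (T + 1) * (\<epsilon> * r)" using pos by (simp add: pos_divide_le_eq)
      also have "\<dots> \<le> (T + 1) * \<epsilon>" using er(2) T by (intro mult_left_mono) auto
      finally show ?thesis .
    qed
    then show "energy (\<epsilon> * r) \<le> (T + 2) * \<epsilon>" using en[OF er] by (simp add: algebra_simps)
  qed
  then show ?thesis by (simp add: algebra_simps)
qed

locale unit_variation_process = prob_space M for M :: "'w measure" +
  fixes T :: real and X :: "real \<Rightarrow> 'w \<Rightarrow> real"
  assumes T: "0 < T" and X: "continuous_process M T X"
    and X0: "\<And>\<omega>. \<omega> \<in> space M \<Longrightarrow> X 0 \<omega> = 0"
    and qv: "has_quadratic_variation M T X (\<lambda>t \<omega>. t)"
begin

definition traj :: "'w \<Rightarrow> real \<Rightarrow> real" where "traj \<omega> r = extend_process T X r \<omega>"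

definition ratio :: "real \<Rightarrow> real \<Rightarrow> 'w \<Rightarrow> real" where
  "ratio \<tau> \<epsilon> \<omega> = integral {0..\<tau>} (\<lambda>s. (traj \<omega> (s + \<epsilon>) - traj \<omega> s)\<^sup>2) / \<epsilon>"

lemma traj_eq: "traj \<omega> r = X (max 0 (min T r)) \<omega>"
  unfolding traj_def extend_process_def using T by (simp add: clamp_real_def)

lemma window_eq: "window T X t \<omega> = path_of T (traj \<omega>) t"
  unfolding window_def path_of_def traj_def ..

lemma driving_traj:
  assumes "\<omega> \<in> space M"
  shows "driving_path T (traj \<omega>)"
proof
  have "continuous_on {0..T} (\<lambda>t. X t \<omega>)" using X assms unfolding continuous_process_def by simp
  then show "continuous_on UNIV (traj \<omega>)"
    unfolding traj_eq[abs_def]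
    by (rule continuous_on_compose2) (use T in \<open>auto intro!: continuous_intros\<close>)
  show "traj \<omega> r = 0" if "r \<le> 0" for r
    unfolding traj_eq using X0[OF assms] that T by (simp add: min_def max_def)
  show "traj \<omega> r = traj \<omega> T" if "T \<le> r" for r
    unfolding traj_eq using that T by simp
qed (rule T)

lemma traj_cont: "\<omega> \<in> space M \<Longrightarrow> continuous_on S (traj \<omega>)"
  using driving_path.x_cont'[OF driving_traj] .

lemma traj_meas: "(\<lambda>\<omega>. traj \<omega> r) \<in> borel_measurable M"
  unfolding traj_eq using X T unfolding continuous_process_def by simp

lemma traj_joint: "(\<lambda>z. traj (snd z) (fst z)) \<in> borel_measurable (borel \<Otimes>\<^sub>M M)"
  by (rule continuous_process_jointly_measurable[where f="\<lambda>r \<omega>. traj \<omega> r"]) (rule traj_meas, rule traj_cont)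

lemma sq_incr_cont: "\<omega> \<in> space M \<Longrightarrow> continuous_on S (\<lambda>s. (traj \<omega> (s + \<epsilon>) - traj \<omega> s)\<^sup>2)"
  by (intro continuous_intros traj_cont continuous_on_compose2[OF traj_cont[where S=UNIV]]) auto

lemma ratio_joint: "(\<lambda>z. ratio T (fst z) (snd z)) \<in> borel_measurable (borel \<Otimes>\<^sub>M M)"
proof -
  have m1: "(\<lambda>p. traj (snd (fst p)) (snd p + fst (fst p))) \<in> borel_measurable ((borel \<Otimes>\<^sub>M M) \<Otimes>\<^sub>M lborel)"
    using measurable_compose[OF _ traj_joint, of "\<lambda>p. (snd p + fst (fst p), snd (fst p))" "(borel \<Otimes>\<^sub>M M) \<Otimes>\<^sub>M lborel"] by simp
  have m2: "(\<lambda>p. traj (snd (fst p)) (snd p)) \<in> borel_measurable ((borel \<Otimes>\<^sub>M M) \<Otimes>\<^sub>M lborel)"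
    using measurable_compose[OF _ traj_joint, of "\<lambda>p. (snd p, snd (fst p))" "(borel \<Otimes>\<^sub>M M) \<Otimes>\<^sub>M lborel"] by simp
  have "(\<lambda>p. indicator {0..T} (snd p) * (traj (snd (fst p)) (snd p + fst (fst p)) - traj (snd (fst p)) (snd p))\<^sup>2)
      \<in> borel_measurable ((borel \<Otimes>\<^sub>M M) \<Otimes>\<^sub>M lborel)"
    using m1 m2 by measurable
  then have "(\<lambda>z. LINT s|lborel. indicator {0..T} s * (traj (snd z) (s + fst z) - traj (snd z) s)\<^sup>2) \<in> borel_measurable (borel \<Otimes>\<^sub>M M)"
    by (intro lborel.borel_measurable_lebesgue_integral) (simp add: case_prod_unfold)
  then have m: "(\<lambda>z. (LINT s|lborel. indicator {0..T} s * (traj (snd z) (s + fst z) - traj (snd z) s)\<^sup>2) / fst z) \<in> borel_measurable (borel \<Otimes>\<^sub>M M)"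
    by measurable
  show ?thesis
  proof (rule measurable_cong[THEN iffD1, OF _ m])
    fix z :: "real \<times> 'w" assume "z \<in> space (borel \<Otimes>\<^sub>M M)"
    then have "snd z \<in> space M" by (auto simp: space_pair_measure)
    from LINT_indicator_eq_integral[OF sq_incr_cont[OF this], of 0 T "fst z"]
    show "(LINT s|lborel. indicator {0..T} s * (traj (snd z) (s + fst z) - traj (snd z) s)\<^sup>2) / fst z = ratio T (fst z) (snd z)"
      unfolding ratio_def by simp
  qed
qed

lemma ratio_meas: "0 \<le> \<tau> \<Longrightarrow> ratio \<tau> \<epsilon> \<in> borel_measurable M"
  unfolding ratio_def[abs_def]
  using traj_meas
  by (intro borel_measurable_divide measurable_time_integral sq_incr_cont borel_measurable_power borel_measurable_diff borel_measurable_const) auto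

lemma ratio_prob:
  assumes "\<tau> \<in> {0..T}"
  shows "((\<lambda>\<epsilon>. \<integral>\<omega>. min 1 \<bar>ratio \<tau> \<epsilon> \<omega> - \<tau>\<bar> \<partial>M) \<longlongrightarrow> 0) (at_right 0)"
proof (rule tendsto_in_probability_truncated)
  have "tendsto_in_probability M (\<lambda>\<epsilon> \<omega>. (1 / \<epsilon>) * (LBINT s=0..\<tau>. (extend_process T X (s + \<epsilon>) \<omega> - extend_process T X s \<omega>)\<^sup>2)) (\<lambda>\<omega>. \<tau>) (at_right 0)"
    using qv assms unfolding has_quadratic_variation_def by simp
  moreover have "(1 / \<epsilon>) * (LBINT s=0..\<tau>. (extend_process T X (s + \<epsilon>) \<omega> - extend_process T X s \<omega>)\<^sup>2) = ratio \<tau> \<epsilon> \<omega>"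
    if "\<omega> \<in> space M" for \<epsilon> \<omega>
    using interval_integral_eq_integral_continuous[OF _ sq_incr_cont[OF that], of \<tau> \<epsilon>] assms
    unfolding ratio_def traj_def by simp
  ultimately show "tendsto_in_probability M (ratio \<tau>) (\<lambda>\<omega>. \<tau>) (at_right 0)"
    by (subst (asm) tendsto_in_probability_cong) auto
qed

text \<open>A single random variable that watches all shifts \<open>\<epsilon> * p\<close> at once.
  Almost sure convergence along a subsequence could otherwise be had for countably many shifts only,
  whereas a small mean controls all but a small set of them.\<close>

definition mean_gap :: "real \<Rightarrow> 'w \<Rightarrow> real" where
  "mean_gap \<epsilon> \<omega> = (LINT p|lborel. indicator {0..1} p * min 1 \<bar>ratio T (\<epsilon> * p) \<omega> - T\<bar>)"

lemma mean_gap_joint: "(\<lambda>z. indicator {0..1} (fst z) * min 1 \<bar>ratio T (\<epsilon> * fst z) (snd z) - T\<bar>) \<in> borel_measurable (lborel \<Otimes>\<^sub>M M)"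
proof -
  have "(\<lambda>z. ratio T (\<epsilon> * fst z) (snd z)) \<in> borel_measurable (lborel \<Otimes>\<^sub>M M)"
    using measurable_compose[OF _ ratio_joint, of "\<lambda>z. (\<epsilon> * fst z, snd z)" "lborel \<Otimes>\<^sub>M M"] by simp
  then show ?thesis by measurable
qed

lemma mean_gap_meas: "mean_gap \<epsilon> \<in> borel_measurable M"
proof -
  have "(\<lambda>z. indicator {0..1} (fst z) * min 1 \<bar>ratio T (\<epsilon> * fst z) (snd z) - T\<bar>) \<circ> (\<lambda>p. (snd p, fst p)) \<in> borel_measurable (M \<Otimes>\<^sub>M lborel)"
    by (rule measurable_comp[OF _ mean_gap_joint]) measurable
  then show ?thesis
    unfolding mean_gap_def[abs_def] by (intro lborel.borel_measurable_lebesgue_integral) (simp add: case_prod_unfold comp_def)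
qed

lemma ind_int: "integrable lborel (indicat_real {0..1::real})"
  by (rule integrable_real_indicator) auto

lemma mean_gap_range: 
  assumes "\<omega> \<in> space M"
  shows "0 \<le> mean_gap \<epsilon> \<omega>" "mean_gap \<epsilon> \<omega> \<le> 1"
proof -
  show "0 \<le> mean_gap \<epsilon> \<omega>" unfolding mean_gap_def by (rule Bochner_Integration.integral_nonneg) simp
  have m: "(\<lambda>p. indicator {0..1} p * min 1 \<bar>ratio T (\<epsilon> * p) \<omega> - T\<bar>) \<in> borel_measurable lborel"
    using measurable_compose[OF measurable_Pair2'[OF assms] mean_gap_joint[of \<epsilon>]] by simp
  have "mean_gap \<epsilon> \<omega> \<le> (LINT p|lborel. indicat_real {0..1::real} p)"
    unfolding mean_gap_def
  proof (rule integral_mono[OF _ ind_int])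
    show "integrable lborel (\<lambda>p. indicator {0..1} p * min 1 \<bar>ratio T (\<epsilon> * p) \<omega> - T\<bar>)"
      by (rule Bochner_Integration.integrable_bound[OF ind_int m]) (auto simp: indicator_def)
  qed (auto simp: indicator_def)
  then show "mean_gap \<epsilon> \<omega> \<le> 1" by simp
qed

text \<open>By Fubini the expectation is an average over \<open>p\<close> of truncated deviations at
  step \<open>E n * p\<close>. For each \<open>p > 0\<close> these steps tend to 0 from the right,
  so every such deviation vanishes in the limit, and they are bounded by 1.\<close>

lemma mean_gap_lim:
  assumes E: "\<And>n. 0 < E n" "E \<longlonglongrightarrow> 0"
  shows "(\<lambda>n. \<integral>\<omega>. mean_gap (E n) \<omega> \<partial>M) \<longlonglongrightarrow> 0"
proof -
  interpret pair: pair_sigma_finite lborel M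
    by (intro pair_sigma_finite.intro lborel.sigma_finite_measure_axioms sigma_finite_measure_axioms)
  define \<Phi> where "\<Phi> \<epsilon> = (\<integral>\<omega>. min 1 \<bar>ratio T \<epsilon> \<omega> - T\<bar> \<partial>M)" for \<epsilon>
  have \<Phi>01: "0 \<le> \<Phi> \<epsilon>" "\<Phi> \<epsilon> \<le> 1" for \<epsilon>
  proof -
    note ratio_meas[OF less_imp_le[OF T], of \<epsilon>, measurable]
    show "0 \<le> \<Phi> \<epsilon>" unfolding \<Phi>_def by (rule Bochner_Integration.integral_nonneg) simp
    have "\<Phi> \<epsilon> \<le> (\<integral>\<omega>. 1 \<partial>M)" unfolding \<Phi>_def by (rule integral_mono) (auto intro!: integrable_unit_range)
    then show "\<Phi> \<epsilon> \<le> 1" by (simp add: prob_space)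
  qed
  have fub: "(\<integral>\<omega>. mean_gap (E n) \<omega> \<partial>M) = (LINT p|lborel. indicator {0..1} p * \<Phi> (E n * p))"
    and \<Phi>m: "(\<lambda>p. indicator {0..1} p * \<Phi> (E n * p)) \<in> borel_measurable lborel" for n
  proof -
    let ?f = "\<lambda>z. indicator {0..1} (fst z) * min 1 \<bar>ratio T (E n * fst z) (snd z) - T\<bar>"
    have ii: "integrable (lborel \<Otimes>\<^sub>M M) ?f"
    proof (rule Bochner_Integration.integrable_bound[OF _ mean_gap_joint])
      have "emeasure (lborel \<Otimes>\<^sub>M M) ({0..1::real} \<times> space M) = 1"
        by (subst emeasure_pair_measure_Times) (auto simp: emeasure_space_1)
      then show "integrable (lborel \<Otimes>\<^sub>M M) (indicat_real ({0..1::real} \<times> space M))"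
        by (intro integrable_real_indicator pair_measureI) simp_all
      show "AE z in lborel \<Otimes>\<^sub>M M. norm (?f z) \<le> norm (indicat_real ({0..1} \<times> space M) z)"
        by (rule AE_I2) (auto simp: space_pair_measure indicator_def)
    qed
    have "(\<integral>\<omega>. mean_gap (E n) \<omega> \<partial>M) = (LINT p|lborel. \<integral>\<omega>. indicator {0..1} p * min 1 \<bar>ratio T (E n * p) \<omega> - T\<bar> \<partial>M)"
      unfolding mean_gap_def using ii by (intro pair.Fubini_integral) (simp add: case_prod_unfold)
    then show "(\<integral>\<omega>. mean_gap (E n) \<omega> \<partial>M) = (LINT p|lborel. indicator {0..1} p * \<Phi> (E n * p))"
      unfolding \<Phi>_def by simp
    have "(\<lambda>p. \<integral>\<omega>. ?f (p, \<omega>) \<partial>M) \<in> borel_measurable lborel"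
      by (rule borel_measurable_lebesgue_integral) (use mean_gap_joint[of "E n"] in \<open>simp add: case_prod_unfold\<close>)
    then show "(\<lambda>p. indicator {0..1} p * \<Phi> (E n * p)) \<in> borel_measurable lborel"
      unfolding \<Phi>_def by simp
  qed
  have "(\<lambda>n. LINT p|lborel. indicator {0..1} p * \<Phi> (E n * p)) \<longlonglongrightarrow> (LINT p|(lborel::real measure). 0)"
  proof (rule integral_dominated_convergence[OF _ \<Phi>m ind_int])
    show "AE p in lborel. (\<lambda>n. indicator {0..1} p * \<Phi> (E n * p)) \<longlonglongrightarrow> 0"
      using AE_lborel_singleton[of "0::real"]
    proof eventually_elim
      case (elim p)
      show ?case
      proof (cases "p \<in> {0..1}")
        case True
        then have p: "0 < p" using elim by simp
        have "filterlim (\<lambda>n. E n * p) (at_right 0) sequentially"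
          unfolding filterlim_at
          using tendsto_mult_left_zero[OF E(2), of p] E(1) less_imp_neq[OF E(1)] p by (auto intro!: always_eventually)
        from tendsto_mult_right_zero[OF filterlim_compose[OF ratio_prob this], of T] T
        show ?thesis unfolding \<Phi>_def by simp
      qed simp
    qed
    show "AE p in lborel. norm (indicator {0..1} p * \<Phi> (E n * p)) \<le> indicator {0..1} p" for n
      using \<Phi>01 by (intro AE_I2) (auto simp: indicator_def)
  qed simp
  then show ?thesis unfolding fub by simp
qed

text \<open>There are only countably many conditions, namely \<open>mean_gap\<close> and the ratios
  at the fractions of \<open>t\<close>, so one subsequence serves them all.\<close>

theorem good_subsequence:
  assumes E: "\<And>n. 0 < E n" "E \<longlonglongrightarrow> 0" and t: "0 \<le> t" "t \<le> T"
  shows "\<exists>r. strict_mono r \<and> (AE \<omega> in M. (\<lambda>n. mean_gap (E (r n)) \<omega>) \<longlonglongrightarrow> 0 \<and>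
    (\<forall>i m. 0 < m \<longrightarrow> i \<le> m \<longrightarrow> (\<lambda>n. ratio (t * real i / real m) (E (r n)) \<omega>) \<longlonglongrightarrow> t * real i / real m))"
proof -
  \<comment> \<open>An enumeration of the fractions through coded pairs; codes of inadmissible pairs
    are sent to the harmless time 0.\<close>
  define \<tau> where "\<tau> k = (case prod_decode k of (i, m) \<Rightarrow> if 0 < m \<and> i \<le> m then t * real i / real m else 0)" for k
  have \<tau>: "\<tau> k \<in> {0..T}" for k
  proof (cases "prod_decode k")
    case (Pair i m)
    show ?thesis
    proof (cases "0 < m \<and> i \<le> m")
      case True
      then have "t * (real i / real m) \<le> t * 1" using t by (intro mult_left_mono) auto
      then show ?thesis using True t unfolding \<tau>_def Pair by simp
    next
      case False
      then show ?thesis using T unfolding \<tau>_def Pair by auto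
    qed
  qed
  define V where "V k n \<omega> = (case k of 0 \<Rightarrow> min 1 \<bar>mean_gap (E n) \<omega>\<bar> | Suc k \<Rightarrow> min 1 \<bar>ratio (\<tau> k) (E n) \<omega> - \<tau> k\<bar>)" for k n \<omega>
  have Er: "filterlim E (at_right 0) sequentially"
    unfolding filterlim_at using E(2) less_imp_neq[OF E(1)] E(1) by (auto intro!: always_eventually)
  have "\<exists>r. strict_mono r \<and> (AE \<omega> in M. \<forall>k. (\<lambda>n. V k (r n) \<omega>) \<longlonglongrightarrow> 0)"
  proof (rule AE_common_subsequence)
    show "V k n \<in> borel_measurable M" for k n
      using mean_gap_meas[of "E n"] ratio_meas[of "\<tau> (k - 1)" "E n"] \<tau>[of "k - 1"]
      unfolding V_def[abs_def] by (cases k) simp_all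
    show "0 \<le> V k n \<omega>" "V k n \<omega> \<le> 1" for k n \<omega> unfolding V_def by (simp_all split: nat.split)
    show "(\<lambda>n. \<integral>\<omega>. V k n \<omega> \<partial>M) \<longlonglongrightarrow> 0" for k
    proof (cases k)
      case 0
      have "(\<integral>\<omega>. V 0 n \<omega> \<partial>M) = (\<integral>\<omega>. mean_gap (E n) \<omega> \<partial>M)" for n
        unfolding V_def by (rule Bochner_Integration.integral_cong) (use mean_gap_range[of _ "E n"] in auto)
      then show ?thesis using mean_gap_lim[OF E] 0 by simp
    next
      case (Suc j)
      show ?thesis unfolding Suc V_def nat.case by (rule filterlim_compose[OF ratio_prob[OF \<tau>] Er])
    qed
  qed
  then obtain r where r: "strict_mono r" "AE \<omega> in M. \<forall>k. (\<lambda>n. V k (r n) \<omega>) \<longlonglongrightarrow> 0" by blast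
  have trunc: "a \<longlonglongrightarrow> 0" if "(\<lambda>n. min 1 \<bar>a n\<bar>) \<longlonglongrightarrow> 0" for a :: "nat \<Rightarrow> real"
  proof (rule tendstoI)
    fix e :: real assume "0 < e"
    then have "0 < min 1 e" by simp
    from order_tendstoD(2)[OF that this] show "\<forall>\<^sub>F n in sequentially. dist (a n) 0 < e"
      by eventually_elim (auto simp: min_def split: if_splits)
  qed
  have "AE \<omega> in M. (\<lambda>n. mean_gap (E (r n)) \<omega>) \<longlonglongrightarrow> 0 \<and>
    (\<forall>i m. 0 < m \<longrightarrow> i \<le> m \<longrightarrow> (\<lambda>n. ratio (t * real i / real m) (E (r n)) \<omega>) \<longlonglongrightarrow> t * real i / real m)"
    using r(2)
  proof eventually_elim
    case (elim \<omega>)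
    have "(\<lambda>n. mean_gap (E (r n)) \<omega>) \<longlonglongrightarrow> 0" by (rule trunc) (use elim[rule_format, of 0] in \<open>simp add: V_def\<close>)
    moreover have "(\<lambda>n. ratio (t * real i / real m) (E (r n)) \<omega>) \<longlonglongrightarrow> t * real i / real m" if "0 < m" "i \<le> m" for i m
    proof -
      define k where "k = prod_encode (i, m)"
      have k: "\<tau> k = t * real i / real m" unfolding \<tau>_def k_def using that by simp
      have "(\<lambda>n. ratio (\<tau> k) (E (r n)) \<omega> - \<tau> k) \<longlonglongrightarrow> 0"
        by (rule trunc) (use elim[rule_format, of "Suc k"] in \<open>simp add: V_def\<close>)
      then show ?thesis unfolding k LIM_zero_iff .
    qed
    ultimately show ?case by blast
  qed
  then show ?thesis using r(1) by blast
qed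

end

section \<open>The improper forward integral\<close>

locale kolmogorov_process = unit_variation_process M T X + pde_solution T u dtu Du D2u D2chi f
  for M :: "'w measure" and T X u dtu Du D2u D2chi f
begin

abbreviation win :: "'w \<Rightarrow> real \<Rightarrow> path" where
  "win \<omega> \<equiv> path_of T (traj \<omega>)"

lemma win_C: "\<omega> \<in> space M \<Longrightarrow> win \<omega> s \<in> C_space T"
  using T by (intro path_of_in_C_space traj_cont) auto

lemma functional_meas:
  assumes "continuous_on (C_space T) (g :: path \<Rightarrow> real)"
  shows "(\<lambda>\<omega>. g (win \<omega> s)) \<in> borel_measurable M"
proof (rule measurable_continuous_functional[OF T _ _ assms])
  show "(\<lambda>\<omega>. apply_bcontfun (win \<omega> s) r) \<in> borel_measurable M" for r
  proof (rule measurable_cong[THEN iffD2])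
    show "apply_bcontfun (win \<omega> s) r = traj \<omega> (s + clamp (- T) 0 r)" if "\<omega> \<in> space M" for \<omega>
      using T by (intro apply_path_of traj_cont that) auto
    show "(\<lambda>\<omega>. traj \<omega> (s + clamp (- T) 0 r)) \<in> borel_measurable M" by (rule traj_meas)
  qed
qed (rule win_C)

lemma graph_win_cont: "\<omega> \<in> space M \<Longrightarrow> continuous_on {a..b} (\<lambda>s. (s, win \<omega> s))"
  using T by (intro continuous_on_Pair continuous_on_id path_of_time_cont traj_cont) auto

lemma along_win_cont:
  assumes g: "continuous_on dom (\<lambda>(t, \<eta>). g t \<eta> :: real)" and t: "t < T" and \<omega>: "\<omega> \<in> space M"
  shows "continuous_on {0..t} (\<lambda>s. g s (win \<omega> s))"
  using continuous_on_compose2[OF g graph_win_cont[OF \<omega>]] win_C[OF \<omega>] t by force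

lemma u_win_cont:
  assumes \<omega>: "\<omega> \<in> space M"
  shows "continuous_on {0..T} (\<lambda>s. u s (win \<omega> s))"
  using continuous_on_compose2[OF u_cont graph_win_cont[OF \<omega>]] win_C[OF \<omega>] by force

lemma u_meas: "t \<in> {0..T} \<Longrightarrow> (\<lambda>\<omega>. u t (win \<omega> s)) \<in> borel_measurable M"
  by (rule functional_meas, rule continuous_on_compose2[OF u_cont, of _ "\<lambda>\<eta>. (t, \<eta>)", simplified])
    (auto intro!: continuous_intros)

text \<open>The value that the formula forces upon the forward integral up to \<open>t\<close>. It
  is free of the atom, so it has a meaning up to \<open>T\<close>.\<close>

definition value_gap :: "real \<Rightarrow> 'w \<Rightarrow> real" where
  "value_gap t \<omega> = u t (win \<omega> t) - u 0 (win \<omega> 0) + integral {0..t} (\<lambda>s. f s (win \<omega> s))"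

lemma value_gap_meas:
  assumes "0 \<le> t" "t < T"
  shows "value_gap t \<in> borel_measurable M"
  unfolding value_gap_def[abs_def]
proof (intro borel_measurable_add borel_measurable_diff u_meas measurable_time_integral along_win_cont f_cont)
  show "(\<lambda>\<omega>. f s (win \<omega> s)) \<in> borel_measurable M" if "s \<in> {0..t}" for s
    by (rule functional_meas, rule slice_cont[OF f_cont]) (use that assms in auto)
qed (use assms in auto)

lemma incr_traj_cont:
  assumes "\<omega> \<in> space M"
  shows "continuous_on S (\<lambda>s. traj \<omega> (s + \<epsilon>) - traj \<omega> s)"
  using driving_path.incr_cont[OF driving_traj[OF assms]]
  unfolding driving_path.incr_def[OF driving_traj[OF assms]] .

text \<open>Any sequence of steps has a subsequence along which almost every trajectory satisfies
  the deterministic theorem. The limit \<open>A\<close> need agree with \<open>value_gap t\<close>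
  only almost surely, since a version continuous on all of the sample space is used later.\<close>

lemma forward_sums_in_probability:
  assumes t: "0 \<le> t" "t < T" and A: "A \<in> borel_measurable M" "AE \<omega> in M. A \<omega> = value_gap t \<omega>"
  shows "tendsto_in_probability M
    (\<lambda>\<epsilon> \<omega>. integral {0..t} (\<lambda>s. atom s (win \<omega> s) * ((traj \<omega> (s + \<epsilon>) - traj \<omega> s) / \<epsilon>))) A (at_right 0)"
proof (rule tendsto_in_probability_at_rightI[OF _ A(1)])
  show "(\<lambda>\<omega>. integral {0..t} (\<lambda>s. atom s (win \<omega> s) * ((traj \<omega> (s + \<epsilon>) - traj \<omega> s) / \<epsilon>))) \<in> borel_measurable M"
    if "0 < \<epsilon>" for \<epsilon>
  proof (rule measurable_time_integral[OF t(1)])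
    show "(\<lambda>\<omega>. atom s (win \<omega> s) * ((traj \<omega> (s + \<epsilon>) - traj \<omega> s) / \<epsilon>)) \<in> borel_measurable M" if "s \<in> {0..t}" for s
    proof -
      have "(\<lambda>\<omega>. atom s (win \<omega> s)) \<in> borel_measurable M"
        by (rule functional_meas, rule slice_cont[OF atom_cont]) (use that t in auto)
      then show ?thesis
        by (intro borel_measurable_times borel_measurable_divide borel_measurable_diff traj_meas borel_measurable_const)
    qed
    show "continuous_on {0..t} (\<lambda>s. atom s (win \<omega> s) * ((traj \<omega> (s + \<epsilon>) - traj \<omega> s) / \<epsilon>))" if \<omega>: "\<omega> \<in> space M" for \<omega>
      using \<open>0 < \<epsilon>\<close>
      by (intro continuous_on_mult continuous_on_divide incr_traj_cont along_win_cont atom_cont continuous_on_const t \<omega>) auto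
  qed
  fix E :: "nat \<Rightarrow> real" assume E: "\<And>n. 0 < E n" "E \<longlonglongrightarrow> 0"
  from good_subsequence[OF E t(1) less_imp_le[OF t(2)]]
  obtain r where r: "strict_mono r" and good: "AE \<omega> in M. (\<lambda>n. mean_gap (E (r n)) \<omega>) \<longlonglongrightarrow> 0 \<and>
    (\<forall>i m. 0 < m \<longrightarrow> i \<le> m \<longrightarrow> (\<lambda>n. ratio (t * real i / real m) (E (r n)) \<omega>) \<longlonglongrightarrow> t * real i / real m)"
    by blast
  have Er: "(\<lambda>n. E (r n)) \<longlonglongrightarrow> 0" using LIMSEQ_subseq_LIMSEQ[OF E(2) r] by (simp add: comp_def)
  have "AE \<omega> in M. (\<lambda>n. integral {0..t} (\<lambda>s. atom s (win \<omega> s) * ((traj \<omega> (s + E (r n)) - traj \<omega> s) / E (r n)))) \<longlonglongrightarrow> A \<omega>"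
    using good A(2) AE_space
  proof eventually_elim
    case (elim \<omega>)
    interpret P: driving_path T "traj \<omega>" by (rule driving_traj[OF elim(3)])
    have "filterlim (\<lambda>n. E (r n)) (at_right 0) sequentially"
      unfolding filterlim_at using Er E(1) less_imp_neq[OF E(1)] by (auto intro!: always_eventually)
    from filterlim_compose[OF P.osc_tendsto this] have osc: "(\<lambda>n. P.osc (E (r n))) \<longlonglongrightarrow> 0" .
    have "\<forall>\<^sub>F n in sequentially. P.osc (E (r n)) < 1 \<and> mean_gap (E (r n)) \<omega> < 1 / 4 \<and> E (r n) < T"
      using order_tendstoD(2)[OF osc, of 1] order_tendstoD(2)[OF conjunct1[OF elim(1)], of "1 / 4"] order_tendstoD(2)[OF Er T]
      by (auto intro!: eventually_conj)
    \<comment> \<open>The bounds hold eventually, whereas \<open>pde_along_sequence\<close> asks for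
      them at every index; so the sequence is started at \<open>N\<close>.\<close>
    then obtain N where N: "\<And>n. N \<le> n \<Longrightarrow> P.osc (E (r n)) < 1 \<and> mean_gap (E (r n)) \<omega> < 1 / 4 \<and> E (r n) < T"
      unfolding eventually_sequentially by blast
    have ratio_eq: "ratio \<tau> \<epsilon> \<omega> = integral {0..\<tau>} (\<lambda>s. (P.incr \<epsilon> s)\<^sup>2) / \<epsilon>" for \<tau> \<epsilon>
      unfolding ratio_def P.incr_def ..
    interpret Q: pde_along_sequence T u dtu Du D2u D2chi f "traj \<omega>" "\<lambda>n. E (r (n + N))" "4 * (T + 2)" t
    proof
      show "0 < E (r (n + N))" "E (r (n + N)) \<le> T" for n using E(1) N[of "n + N"] by auto
      show "(\<lambda>n. E (r (n + N))) \<longlonglongrightarrow> 0" by (rule LIMSEQ_ignore_initial_segment[OF Er])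
      show "0 \<le> t" "t < T" by (rule t)+
      show "(\<lambda>n. integral {0..t * real i / real m} (\<lambda>s. (P.incr (E (r (n + N))) s)\<^sup>2) / E (r (n + N))) \<longlonglongrightarrow> t * real i / real m"
        if "0 < m" "i \<le> m" for i m
        using LIMSEQ_ignore_initial_segment[OF conjunct2[OF elim(1), rule_format, OF that], of N] unfolding ratio_eq .
      show "P.energy (E (r (n + N)) * p) \<le> 4 * (T + 2) * E (r (n + N))" if "p \<in> {0..1}" for n p
      proof (rule P.energy_bound_of_mean[OF E(1) _ that])
        show "P.osc (E (r (n + N))) \<le> 1" using N[of "n + N"] by simp
        show "(\<lambda>p. integral {0..T} (\<lambda>s. (P.incr (E (r (n + N)) * p) s)\<^sup>2) / (E (r (n + N)) * p)) \<in> borel_measurable borel"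
          unfolding ratio_eq[symmetric]
          by (rule measurable_compose[OF _ ratio_joint, of "\<lambda>p. (E (r (n + N)) * p, \<omega>)", simplified]) (use elim(3) in simp)
        show "(LINT p|lborel. indicator {0..1} p * min 1 \<bar>integral {0..T} (\<lambda>s. (P.incr (E (r (n + N)) * p) s)\<^sup>2) / (E (r (n + N)) * p) - T\<bar>) < 1 / 4"
          unfolding ratio_eq[symmetric] mean_gap_def[symmetric] using N[of "n + N"] by simp
      qed
    qed
    from Q.forward_sums_lim show ?case
      unfolding P.incr_def value_gap_def[symmetric] elim(2)[symmetric] by (rule LIMSEQ_offset)
  qed
  then show "\<exists>r. strict_mono r \<and> (AE \<omega> in M. (\<lambda>n. integral {0..t} (\<lambda>s. atom s (win \<omega> s) * ((traj \<omega> (s + E (r n)) - traj \<omega> s) / E (r n)))) \<longlonglongrightarrow> A \<omega>)"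
    using r by blast
qed

lemma set_integrable_of_interval:
  assumes "interval_lebesgue_integrable lborel 0 T (g :: real \<Rightarrow> real)"
  shows "set_integrable lborel {0..T} g"
proof -
  have "set_integrable lborel {0<..<T} g"
    using assms T by (simp add: interval_lebesgue_integrable_def zero_ereal_def einterval_eq)
  then show ?thesis
    by (subst set_integrable_discrete_difference[where X="{0, T}" and B="{0<..<T}"]) (use T in auto)
qed

text \<open>Before \<open>T\<close> the forward integral is \<open>value_gap\<close>, which has a
  limit at \<open>T\<close> because \<open>u\<close> is continuous on the closed time interval and
  \<open>f\<close> is integrable along the windows. This yields the improper integral even if the
  atom blows up at \<open>T\<close>.\<close>

theorem improper_integral_exists:
  assumes Z_int: "AE \<omega> in M. interval_lebesgue_integrable lborel 0 T (\<lambda>s. atom s (win \<omega> s))"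
    and f_int: "AE \<omega> in M. interval_lebesgue_integrable lborel 0 T (\<lambda>s. f s (win \<omega> s))"
  shows "\<exists>I. has_improper_forward_integral M T (\<lambda>s \<omega>. atom s (win \<omega> s)) X I \<and>
    (AE \<omega> in M. I \<omega> = u T (win \<omega> T) - u 0 (win \<omega> 0) + (LBINT s=0..T. f s (win \<omega> s)))"
proof -
  have T0: "0 \<le> T" using T by simp
  from f_int obtain N where N: "{\<omega> \<in> space M. \<not> interval_lebesgue_integrable lborel 0 T (\<lambda>s. f s (win \<omega> s))} \<subseteq> N"
      "N \<in> sets M" "emeasure M N = 0"
    by (rule AE_E)
  have AN: "AE \<omega> in M. \<omega> \<notin> N" using N(2,3) by (intro AE_not_in) (simp add: null_sets_def)
  \<comment> \<open>On the null set where integrability of \<open>f\<close> may fail the process is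
    set to 0, because \<open>continuous_process\<close> demands continuity for every sample
    point.\<close>
  define A where "A t \<omega> = (if \<omega> \<in> N then 0 else value_gap t \<omega>)" for t \<omega>
  have A_AE: "AE \<omega> in M. A t \<omega> = value_gap t \<omega>" for t
    using AN by eventually_elim (simp add: A_def)
  have int: "set_integrable lborel {0..T} (\<lambda>s. f s (win \<omega> s))" if "\<omega> \<in> space M" "\<omega> \<notin> N" for \<omega>
    using N(1) that by (intro set_integrable_of_interval) auto
  have A_cont: "continuous_on {0..T} (\<lambda>t. A t \<omega>)" if \<omega>: "\<omega> \<in> space M" for \<omega>
  proof (cases "\<omega> \<in> N")
    case True
    then show ?thesis by (simp add: A_def)
  next
    case False
    have "continuous_on {0..T} (\<lambda>t. value_gap t \<omega>)"
      unfolding value_gap_def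
      by (intro continuous_on_add continuous_on_diff continuous_on_const u_win_cont \<omega> indefinite_integral_continuous_1
          set_borel_integral_eq_integral(1) int False)
    then show ?thesis using False unfolding A_def by simp
  qed
  have A_meas: "A t \<in> borel_measurable M" if "0 \<le> t" "t < T" for t
    unfolding A_def[abs_def] using N(2) value_gap_meas[OF that] by (intro measurable_If_set) auto
  \<comment> \<open>\<open>value_gap_meas\<close> covers only times before \<open>T\<close>; at
    \<open>T\<close> measurability comes from a sequence of times increasing to \<open>T\<close> and
    the continuity of the paths of \<open>A\<close>.\<close>
  have A_meas_T: "A T \<in> borel_measurable M"
  proof (rule borel_measurable_LIMSEQ_real)
    define \<tau> where "\<tau> n = T * (1 - inverse (real (Suc n)))" for n
    have \<tau>: "\<tau> n \<in> {0..T}" "\<tau> n < T" for n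
    proof -
      have "0 < inverse (real (Suc n))" "inverse (real (Suc n)) \<le> 1"
        by (auto simp: inverse_eq_divide)
      then show "\<tau> n \<in> {0..T}" "\<tau> n < T" unfolding \<tau>_def using T
        by (auto simp: mult_le_cancel_left1 mult_less_cancel_left1 simp del: of_nat_Suc)
    qed
    have "(\<lambda>n. T * (1 - inverse (real (Suc n)))) \<longlonglongrightarrow> T * (1 - 0)"
      by (intro tendsto_intros LIMSEQ_inverse_real_of_nat)
    then have lim: "\<tau> \<longlonglongrightarrow> T" unfolding \<tau>_def[abs_def] by simp
    show "A (\<tau> n) \<in> borel_measurable M" for n by (rule A_meas) (use \<tau>[of n] in auto)
    show "(\<lambda>n. A (\<tau> n) \<omega>) \<longlonglongrightarrow> A T \<omega>" if "\<omega> \<in> space M" for \<omega>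
      by (rule continuous_on_tendsto_compose[OF A_cont[OF that] lim]) (use \<tau> T in auto)
  qed
  have "is_forward_integral_process M T (\<lambda>s \<omega>. atom s (win \<omega> s)) X A"
    unfolding is_forward_integral_process_def
  proof (intro conjI ballI Z_int)
    show "(\<lambda>\<omega>. atom t (win \<omega> t)) \<in> borel_measurable M" if "t \<in> {0..<T}" for t
      by (rule functional_meas, rule slice_cont[OF atom_cont that])
    show "continuous_process M T A"
      unfolding continuous_process_def using A_meas A_meas_T A_cont by (auto simp: le_less)
    fix t assume t: "t \<in> {0..<T}"
    have "tendsto_in_probability M
      (\<lambda>\<epsilon> \<omega>. integral {0..t} (\<lambda>s. atom s (win \<omega> s) * ((traj \<omega> (s + \<epsilon>) - traj \<omega> s) / \<epsilon>))) (A t) (at_right 0)"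
      by (rule forward_sums_in_probability[OF _ _ A_meas A_AE]) (use t in auto)
    moreover have "(LBINT s=0..t. atom s (win \<omega> s) * ((extend_process T X (s + \<epsilon>) \<omega> - extend_process T X s \<omega>) / \<epsilon>))
        = integral {0..t} (\<lambda>s. atom s (win \<omega> s) * ((traj \<omega> (s + \<epsilon>) - traj \<omega> s) / \<epsilon>))" if \<omega>: "\<omega> \<in> space M" for \<epsilon> \<omega>
    proof (cases "\<epsilon> = 0")
      case True
      then show ?thesis using t by (simp add: interval_integral_eq_integral_continuous)
    next
      case False
      then show ?thesis
        unfolding traj_def[symmetric] using t
        by (intro interval_integral_eq_integral_continuous continuous_on_mult continuous_on_divide incr_traj_cont
            along_win_cont atom_cont continuous_on_const \<omega>) auto
    qed
    ultimately show "tendsto_in_probability M (\<lambda>\<epsilon> \<omega>. LBINT s=0..t. atom s (win \<omega> s) *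
        ((extend_process T X (s + \<epsilon>) \<omega> - extend_process T X s \<omega>) / \<epsilon>)) (A t) (at_right 0)"
      by (subst tendsto_in_probability_cong) auto
  qed
  moreover have "AE \<omega> in M. ((\<lambda>t. A t \<omega>) \<longlongrightarrow> A T \<omega>) (at_left T)"
  proof (rule AE_I2)
    fix \<omega> assume "\<omega> \<in> space M"
    then have "((\<lambda>t. A t \<omega>) \<longlongrightarrow> A T \<omega>) (at T within {0..T})"
      using A_cont T unfolding continuous_on_def by simp
    then show "((\<lambda>t. A t \<omega>) \<longlongrightarrow> A T \<omega>) (at_left T)" using T by (simp add: at_within_Icc_at_left)
  qed
  moreover have "AE \<omega> in M. A T \<omega> = u T (win \<omega> T) - u 0 (win \<omega> 0) + (LBINT s=0..T. f s (win \<omega> s))"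
    using A_AE[of T] AN AE_space
  proof eventually_elim
    case (elim \<omega>)
    have "(LBINT s=0..T. f s (win \<omega> s)) = integral {0..T} (\<lambda>s. f s (win \<omega> s))"
      using interval_integral_Icc[OF T0, of "\<lambda>s. f s (win \<omega> s)"] set_borel_integral_eq_integral(2)[OF int[OF elim(3,2)]]
      by (simp add: zero_ereal_def)
    then show ?case using elim(1) unfolding value_gap_def by simp
  qed
  ultimately show ?thesis unfolding has_improper_forward_integral_def by blast
qed

end

theorem proposition4p1:
  fixes M :: "'w measure" and T :: real
    and X Z :: "real \<Rightarrow> 'w \<Rightarrow> real" and h Y0 :: "'w \<Rightarrow> real"
    and G :: "path \<Rightarrow> real" and F :: "real \<Rightarrow> path \<Rightarrow> real \<Rightarrow> real \<Rightarrow> real"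
    and u dtu v :: "real \<Rightarrow> path \<Rightarrow> real" and Du :: "real \<Rightarrow> path \<Rightarrow> real set \<Rightarrow> real"
    and D2u :: "real \<Rightarrow> path \<Rightarrow> path \<Rightarrow>\<^sub>L path \<Rightarrow>\<^sub>L real" and D2chi :: "real \<Rightarrow> path \<Rightarrow> chi"
  assumes "prob_space M" and "0 < T"
    and "continuous_process M T X"
    and "\<forall>\<omega>\<in>space M. \<forall>t\<in>{0..T}. window T X t \<omega> \<in> V2 T"
    and "has_quadratic_variation M T X (\<lambda>t \<omega>. t)"
    and "\<forall>\<omega>\<in>space M. X 0 \<omega> = 0"
    and "continuous_on (C_space T) G"
    and "continuous_on ({0..T} \<times> C_space T \<times> UNIV \<times> UNIV) (\<lambda>(t, \<eta>, y, z). F t \<eta> y z)"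
    and "C12 T u dtu Du D2u"
    and "continuous_on ({0..T} \<times> C_space T) (\<lambda>(t, \<eta>). u t \<eta>)"
    and "strongly_exists T (V2 T) (\<lambda>t \<eta>. remove_atom0 (Du t \<eta>))"
    and "continuous_into_chi T D2u D2chi"
    and "solves_kolmogorov T F G u dtu Du D2chi"
    and h: "\<forall>\<omega>. h \<omega> = G (window T X T \<omega>)"
    and v: "\<forall>t \<eta>. v t \<eta> = Du t \<eta> {0}"
    and Y0: "\<forall>\<omega>. Y0 \<omega> = u 0 (window T X 0 \<omega>)"
    and Z: "\<forall>s \<omega>. Z s \<omega> = Du s (window T X s \<omega>) {0}"
    \<comment> \<open>the two integrals over \<open>[0,T]\<close> in the conclusion are meaningful; \<open>v\<close> may blow up at \<open>T\<close>\<close>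
    and "AE \<omega> in M. interval_lebesgue_integrable lborel 0 T (\<lambda>s. Z s \<omega>)"
    and "AE \<omega> in M. interval_lebesgue_integrable lborel 0 T
           (\<lambda>s. F s (window T X s \<omega>) (u s (window T X s \<omega>)) (v s (window T X s \<omega>)))"
  shows "\<exists>I. has_improper_forward_integral M T Z X I \<and>
           (AE \<omega> in M. h \<omega> = Y0 \<omega>
              - (LBINT s=0..T. F s (window T X s \<omega>) (u s (window T X s \<omega>)) (v s (window T X s \<omega>)))
              + I \<omega>)"
proof -
  define f where "f t \<eta> = F t \<eta> (u t \<eta>) (Du t \<eta> {0})" for t \<eta>
  interpret process: unit_variation_process M T X
    by (intro unit_variation_process.intro unit_variation_process_axioms.intro assms(1,2,3,5) assms(6)[rule_format])
  interpret smooth: smooth_functional T u dtu Du D2u D2chi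
    by (intro smooth_functional.intro assms(2,9,12))
  interpret kolmogorov_process M T X u dtu Du D2u D2chi f
  proof
    show "continuous_on ({0..T} \<times> C_space T) (\<lambda>(t, \<eta>). u t \<eta>)" by (rule assms(10))
    have "continuous_on ({0..<T} \<times> C_space T) (\<lambda>p. (\<lambda>(t, \<eta>, y, z). F t \<eta> y z)
        (fst p, snd p, (\<lambda>(t, \<eta>). u t \<eta>) p, (\<lambda>(t, \<eta>). Du t \<eta> {0}) p))"
      by (rule continuous_on_compose2[OF assms(8)])
        (auto intro!: continuous_on_Pair continuous_on_fst continuous_on_snd continuous_on_id smooth.atom_cont
          continuous_on_subset[OF assms(10)])
    then show "continuous_on ({0..<T} \<times> C_space T) (\<lambda>(t, \<eta>). f t \<eta>)"
      unfolding f_def by (simp add: case_prod_unfold)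
    fix t \<eta> assume "t \<in> {0..<T}" "\<eta> \<in> C_space T"
    then show "forward_integral_exists t (remove_atom0 (Du t \<eta>)) \<eta>" "L_operator dtu Du D2chi t \<eta> + f t \<eta> = 0"
      using assms(13) unfolding solves_kolmogorov_def f_def by auto
  qed
  have Z_eq: "Z = (\<lambda>s \<omega>. Du s (win \<omega> s) {0})"
    using Z by (intro ext) (simp add: process.window_eq)
  have f_eq: "F s (window T X s \<omega>) (u s (window T X s \<omega>)) (v s (window T X s \<omega>)) = f s (win \<omega> s)" for s \<omega>
    using v by (simp add: f_def process.window_eq)
  have Zi: "AE \<omega> in M. interval_lebesgue_integrable lborel 0 T (\<lambda>s. Du s (win \<omega> s) {0})"
    using assms(18) unfolding Z_eq .
  have fi: "AE \<omega> in M. interval_lebesgue_integrable lborel 0 T (\<lambda>s. f s (win \<omega> s))"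
    using assms(19) unfolding f_eq .
  from improper_integral_exists[OF Zi fi] obtain I where I: "has_improper_forward_integral M T Z X I"
    "AE \<omega> in M. I \<omega> = u T (win \<omega> T) - u 0 (win \<omega> 0) + (LBINT s=0..T. f s (win \<omega> s))"
    unfolding Z_eq by blast
  have "AE \<omega> in M. h \<omega> = Y0 \<omega> - (LBINT s=0..T. f s (win \<omega> s)) + I \<omega>"
    using I(2) AE_space
  proof eventually_elim
    case (elim \<omega>)
    have "u T (win \<omega> T) = G (win \<omega> T)"
      using assms(13) win_C[OF elim(2)] unfolding solves_kolmogorov_def by blast
    then show ?case using elim(1) h Y0 by (simp add: process.window_eq)
  qed
  then show ?thesis unfolding f_eq using I(1) by blast
qed

end
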